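(* Let $(\mathbb{X}, \mathbb{T}, \mathcal{D}, \ast, \iota)$ be a Cartesian reverse tangent category. Then the category $\mathsf{DO}_{\text{sd}}$ of self-dual differential objects (and all maps of $\mathbb{X}$ between them) is a Cartesian reverse differential category, where the reverse differential combinator $\mathsf{R}$ is defined on a map $f: A \to B$ as the composite $$\mathsf{R}[f] := \Big( A \times B \;\cong\; A \times_{B} \mathsf{T}^\ast(B) \xrightarrow{\ \mathsf{T}^\ast(f)\ } \mathsf{T}^\ast(A) \;\cong\; A \times A \xrightarrow{\ \pi_1\ } A \Big).$$
   Context: Composition is written diagrammatically: $fg$ means first $f$, then $g$. **Tangent category.** A tangent structure $\mathbb{T}=(\mathsf{T},\mathsf{p},\mathsf{s},\mathsf{z},\ell,\mathsf{c})$ on a category $\mathbb{X}$ consists of an endofunctor $\mathsf{T}$ and natural transformations $\mathsf{p}_A:\mathsf{T}(A)\to A$, $\mathsf{s}_A:\mathsf{T}_2(A)\to\mathsf{T}(A)$, $\mathsf{z}_A:A\to\mathsf{T}(A)$, $\ell_A:\mathsf{T}(A)\to\mathsf{T}^2(A)$, $\mathsf{c}_A:\mathsf{T}^2(A)\to\mathsf{T}^2(A)$, where for each $n$ the $n$-fold pullback $\mathsf{T}_n(A)$ of $\mathsf{p}_A$ (projections $\rho_j$) exists and is preserved by all $\mathsf{T}^m$, such that: (1) $(\mathsf{p}_A,\mathsf{s}_A,\mathsf{z}_A)$ is a commutative monoid in $\mathbb{X}/A$; (2) $\ell_A\mathsf{T}(\mathsf{p}_A)=\mathsf{p}_A\mathsf{z}_A$,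 $\mathsf{s}_A\ell_A=\langle\rho_0\ell_A,\rho_1\ell_A\rangle\mathsf{T}(\mathsf{s}_A)$, $\mathsf{z}_A\ell_A=\mathsf{z}_A\mathsf{T}(\mathsf{z}_A)$; (3) $\mathsf{c}_A\mathsf{p}_{\mathsf{T}(A)}=\mathsf{T}(\mathsf{p}_A)$, $\mathsf{T}(\mathsf{s}_A)\mathsf{c}_A=\langle\mathsf{T}(\rho_0)\mathsf{c}_A,\mathsf{T}(\rho_1)\mathsf{c}_A\rangle\mathsf{s}_{\mathsf{T}(A)}$, $\mathsf{T}(\mathsf{z}_A)\mathsf{c}_A=\mathsf{z}_{\mathsf{T}(A)}$; (4) $\mathsf{c}_A\mathsf{c}_A=1$, $\ell_A\mathsf{c}_A=\ell_A$, $\ell_A\mathsf{T}(\ell_A)=\ell_A\ell_{\mathsf{T}(A)}$, $\mathsf{T}(\mathsf{c}_A)\mathsf{c}_{\mathsf{T}(A)}\mathsf{T}(\mathsf{c}_A)=\mathsf{c}_{\mathsf{T}(A)}\mathsf{T}(\mathsf{c}_A)\mathsf{c}_{\mathsf{T}(A)}$, $\ell_{\mathsf{T}(A)}\mathsf{T}(\mathsf{c}_A)\mathsf{c}_{\mathsf{T}(A)}=\mathsf{c}_A\mathsf{T}(\ell_A)$; (5) with $v_A=\langle\rho_0\ell_A,\rho_1\mathsf{z}_{\mathsf{T}(A)}\rangle\mathsf{T}(\mathsf{s}_A)$, the square $v_A\mathsf{T}(\mathsf{p}_A)=(\rho_0\mathsf{p}_A)\mathsf{z}_A$ exhibits $\mathsf{T}_2(A)$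 as the pullback of $\mathsf{T}(\mathsf{p}_A)$ along $\mathsf{z}_A$, preserved by all $\mathsf{T}^m$. A tangent category is a category with a tangent structure. It is Cartesian if $\mathbb{X}$ has finite products and $\mathsf{T}$ preserves them. **Differential bundles.** A differential bundle over $A$ is $\mathcal{E}=(\mathsf{q}:E\to A,\sigma:E_2\to E,\zeta:A\to E,\lambda:E\to\mathsf{T}(E))$ where the $n$-fold pullbacks $E_n$ of $\mathsf{q}$ (projections $\pi_j$) exist and are preserved by all $\mathsf{T}^m$; $(\mathsf{q},\sigma,\zeta)$ is a commutative monoid in $\mathbb{X}/A$; $\lambda\mathsf{T}(\mathsf{q})=\mathsf{q}\mathsf{z}_A$, $\sigma\lambda=\langle\pi_0\lambda,\pi_1\lambda\rangle\mathsf{T}(\sigma)$, $\zeta\lambda=\mathsf{z}_A\mathsf{T}(\zeta)$; $\lambda\mathsf{p}_E=\mathsf{q}\zeta$, $\sigma\lambda=\langle\pi_0\lambda,\pi_1\lambda\rangle\mathsf{s}_E$, $\zeta\lambda=\zeta\mathsf{z}_E$; $\lambda\ell_E=\lambda\mathsf{T}(\lambda)$; and with $\mu=\langle\pi_0\lambda,\pi_1\mathsf{z}_E\rangle\mathsf{T}(\sigma):E_2\to\mathsf{T}(E)$ the square $\mu\mathsf{T}(\mathsf{q})=(\pi_0\mathsf{q})\mathsf{z}_A$ exhibits $E_2$ as the pullback of $\mathsf{T}(\mathsf{q})$ along $\mathsf{z}_A$, preserved by all $\mathsf{T}^m$. A linear differential bundle morphism $(f,g):\mathcal{E}\to\mathcal{E}'$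 is a pair $f:A\to A'$, $g:E\to E'$ with $g\mathsf{q}'=\mathsf{q}f$ and $g\lambda'=\lambda\mathsf{T}(g)$; it is a linear $A$-differential bundle morphism if $A=A'$ and $f=1_A$. The tangent bundle of $A$ is the differential bundle $\mathcal{T}(A)=(\mathsf{p}_A,\mathsf{s}_A,\mathsf{z}_A,\ell_A)$, and $\mathcal{T}(f)=(f,\mathsf{T}(f))$. The tangent bundle of $\mathcal{E}$ is $\overline{\mathsf{T}}(\mathcal{E})=(\mathsf{T}(\mathsf{q}),\mathsf{T}(\sigma),\mathsf{T}(\zeta),\mathsf{T}(\lambda)\mathsf{c}_E)$, and $\overline{\mathsf{T}}(f,g)=(\mathsf{T}(f),\mathsf{T}(g))$. For $f:X\to A$, if the pullbacks $X\times_A E_n$ exist and are preserved by all $\mathsf{T}^m$, the pullback bundle is $X\times_A\mathcal{E}=(\pi_0:X\times_A E\to X,\,1_X\times_A\sigma,\,\langle 1_X,f\zeta\rangle,\,\mathsf{z}_X\times_A\lambda)$. **System of differential bundles.** A collection $\mathcal{D}$ of differential bundles such that $\mathcal{T}(A)\in\mathcal{D}$ for all $A$; $\mathcal{E}\in\mathcal{D}$ implies $\overline{\mathsf{T}}(\mathcal{E})\in\mathcal{D}$; and for every $\mathcal{E}\in\mathcal{D}$ over $A$ and $f:X\to A$, the pullback bundle $X\times_A\mathcal{E}$ exists (i.e. for every $n$ the pullback $X\times_A E_n$ of $E_n\to A$ along $f$ exists and is preserved by all $\mathsf{T}^m$) and lies in $\mathcal{D}$. $\mathsf{DBun}_\mathcal{D}[(\mathbb{X},\mathbb{T})]$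 is the category of bundles in $\mathcal{D}$ and linear differential bundle morphisms; it is fibred over $\mathbb{X}$ by sending a bundle to its base, with fibre over $A$ the category $\mathsf{DBun}_\mathcal{D}[A]$ of bundles over $A$ in $\mathcal{D}$ and linear $A$-differential bundle morphisms. **Dual fibration.** $\mathsf{DBun}^\circ_\mathcal{D}[(\mathbb{X},\mathbb{T})]$ has the same objects; a map $(f,g):\mathcal{E}\to\mathcal{E}'$ is $f:A\to A'$ together with a linear $A$-differential bundle morphism $g:A\times_{A'}\mathcal{E}'\to\mathcal{E}$ (pullback along $f$); identities are $(1_A,\pi_1)$; the composite of $(f,g)$ and $(h,k)$ is $(fh,\langle\pi_0,(f\times 1)k\rangle g)$. It is fibred over $\mathbb{X}$ by $(f,g)\mapsto f$, with fibre over $A$ equal to $\mathsf{DBun}_\mathcal{D}[A]^{op}$. The functor $\overline{\mathsf{T}}^\circ$ on it acts as $\overline{\mathsf{T}}$ on objects and sends $(f,g)$ to $(\mathsf{T}(f),\mathsf{T}(g))$, using $\mathsf{T}(A)\times_{\mathsf{T}(A')}\mathsf{T}(E')\cong\mathsf{T}(A\times_{A'}E')$. **Reverse tangent category.** $(\mathbb{X},\mathbb{T},\mathcal{D},\ast,\iota)$: a tangent category with a system of differential bundles $\mathcal{D}$ and a linear involution $(\ast,\iota)$, i.e. a morphism of fibrations over $\mathbb{X}$ (preserving Cartesian maps) $(-)^\ast:\mathsf{DBun}_\mathcal{D}[(\mathbb{X},\mathbb{T})]\to\mathsf{DBun}^\circ_\mathcal{D}[(\mathbb{X},\mathbb{T})]$,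 written $\mathcal{E}\mapsto\mathcal{E}^\ast=(\mathsf{q}^\ast:E^\ast\to A,\sigma^\ast,\zeta^\ast,\lambda^\ast)$ and $(f,g)\mapsto(f,g^\ast)$ with $g^\ast:A\times_{A'}{E'}^\ast\to E^\ast$, together with a natural isomorphism $\iota_\mathcal{E}:\mathcal{E}\to\mathcal{E}^{\ast\ast}$ (where $(-)^{\ast\ast}$ is $(-)^\ast$ followed by the functor $\mathsf{DBun}_\mathcal{D}^\circ\to\mathsf{DBun}_\mathcal{D}^{\circ\circ}\cong\mathsf{DBun}_\mathcal{D}$ induced by $(-)^\ast$ on dual fibrations), such that $(-)^\ast$ followed by $\overline{\mathsf{T}}^\circ$ equals $\overline{\mathsf{T}}$ followed by $(-)^\ast$. On fibres this gives functors $(-)^\ast:\mathsf{DBun}_\mathcal{D}[A]^{op}\to\mathsf{DBun}_\mathcal{D}[A]$. The reverse tangent bundle of $A$ is the total space $\mathsf{T}^\ast(A)$ of $\mathcal{T}^\ast(A):=\mathcal{T}(A)^\ast$, with projection $\mathsf{p}_A^\ast$; for $f:A\to B$, $\mathsf{T}^\ast(f):A\times_B\mathsf{T}^\ast(B)\to\mathsf{T}^\ast(A)$ is the second component of $(f,\mathsf{T}(f))^\ast$. **Cartesian reverse tangent category.** A reverse tangent category with $(\mathbb{X},\mathbb{T})$ Cartesian, $\mathcal{D}$ closed under products of bundles (the product of $E\to A$ and $E'\to A'$ being $E\times E'\to A\times A'$), and such that for each $A$ the functor $(-)^\ast:\mathsf{DBun}_\mathcal{D}[A]^{op}\to\mathsf{DBun}_\mathcal{D}[A]$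 preserves the biproduct structure (the biproduct in $\mathsf{DBun}_\mathcal{D}[A]$ is the fibre product over $A$). **Self-dual differential objects.** A differential object is a differential bundle over the terminal object $\mathsf{1}$, identified with its total space $A$. A self-dual differential object is a differential object $A$ in $\mathcal{D}$ equipped with a linear isomorphism $A\cong A^\ast$ (a linear $\mathsf{1}$-differential bundle isomorphism). $\mathsf{DO}_{\text{sd}}$ is the full subcategory of these objects and all maps of $\mathbb{X}$ between them. The sum of maps $f,g:A\to B$ is $\langle f,g\rangle\sigma_B$ and the zero map is $A\to\mathsf{1}\xrightarrow{\zeta_B}B$. **The isomorphisms in $\mathsf{R}[f]$.** For a differential object $A$ with structure $(\sigma,\zeta,\lambda)$, $\nu_A=\langle\pi_1\lambda,\pi_0\mathsf{z}_A\rangle\mathsf{T}(\sigma):A\times A\to\mathsf{T}(A)$ is a linear $A$-differential bundle isomorphism, where $\pi_0:A\times A\to A$ is the pullback bundle of $A\to\mathsf{1}$ along $A\to\mathsf{1}$ (so the first factor is the base point, the second the tangent vector). Since $(-)^\ast$ preserves Cartesian maps, the dual of the bundle $\pi_0:A\times A\to A$ is identified with $\pi_0:A\times A^\ast\to A$; dualizing $\nu_A$ then gives $\mathsf{T}^\ast(A)\cong A\times A^\ast$ over $A$, and using $A^\ast\cong A$ one gets $\mathsf{T}^\ast(A)\cong A\times A$ over $A$ (with $\mathsf{p}^\ast_A$ corresponding to $\pi_0$). For $f:A\to B$ one has accordingly $A\times_B\mathsf{T}^\ast(B)\cong A\times_B(B\times B)\cong A\times B$. **Cartesian reverse differential category.**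 A Cartesian left additive category is a category with finite products whose homsets are commutative monoids with $f(g+h)=fg+fh$, $f0=0$, and whose projections satisfy $(f+g)\pi_j=f\pi_j+g\pi_j$, $0\pi_j=0$. A Cartesian reverse differential category is a Cartesian left additive category with an operator $\mathsf{R}$ sending $f:A\to B$ to $\mathsf{R}[f]:A\times B\to A$ such that: [RD.1] $\mathsf{R}[f+g]=\mathsf{R}[f]+\mathsf{R}[g]$, $\mathsf{R}[0]=0$; [RD.2] $\langle a,b+c\rangle\mathsf{R}[f]=\langle a,b\rangle\mathsf{R}[f]+\langle a,c\rangle\mathsf{R}[f]$, $\langle a,0\rangle\mathsf{R}[f]=0$; [RD.3] $\mathsf{R}[1]=\pi_1$, $\mathsf{R}[\pi_0]=\pi_1\langle 1,0\rangle$, $\mathsf{R}[\pi_1]=\pi_1\langle 0,1\rangle$; [RD.4] $\mathsf{R}[\langle f,g\rangle]=(1\times\pi_0)\mathsf{R}[f]+(1\times\pi_1)\mathsf{R}[g]$, and $\mathsf{R}[A\to\mathsf{1}]=0$; [RD.5] $\mathsf{R}[fg]=\langle\pi_0,(f\times 1)\mathsf{R}[g]\rangle\mathsf{R}[f]$; and, writing $\mathsf{D}[f]:=(\langle 1,0\rangle\times 1)\mathsf{R}[\mathsf{R}[f]]\pi_1:A\times A\to B$, [RD.6] $\langle 1\times\pi_0,0\times\pi_1\rangle\mathsf{D}[\mathsf{R}[f]]=(1\times\pi_1)\mathsf{R}[f]$ as maps $A\times(B\times B)\to A$; [RD.7] $\mathsf{ex}\,\mathsf{D}[\mathsf{D}[f]]=\mathsf{D}[\mathsf{D}[f]]$,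 where $\mathsf{ex}=\langle\pi_0\times\pi_0,\pi_1\times\pi_1\rangle:(A\times A)\times(A\times A)\to(A\times A)\times(A\times A)$.
   Formalization: Self-dual objects are required to have a linear isomorphism α: A ≅ A* compatible with the involution, α = ι_A followed by α* (for arbitrary α, RD.6 fails, e.g. for non-symmetric bilinear forms on k^2); the natural isomorphism ι is taken to lie over identities of the base. *)

theory Defs
  imports Main
begin

section \<open>Categories\<close>

text \<open>Composition is diagrammatic: \<open>f \<cdot> g\<close> is first \<open>f\<close>, then \<open>g\<close>.  All equations below are only
  imposed on arrows in \<^term>\<open>Arr\<close> that compose.\<close>

record ('o, 'a) cat =
  Obj :: "'o set"
  Arr :: "'a set"
  Dom :: "'a \<Rightarrow> 'o"
  Cod :: "'a \<Rightarrow> 'o"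
  Comp :: "'a \<Rightarrow> 'a \<Rightarrow> 'a" (infixl "\<cdot>\<index>" 70)
  Idn :: "'o \<Rightarrow> 'a"

context
  fixes C :: "('o, 'a, 'm) cat_scheme" (structure)
begin

definition Hom :: "'o \<Rightarrow> 'o \<Rightarrow> 'a set" where
  "Hom A B = {f \<in> Arr C. Dom C f = A \<and> Cod C f = B}"

definition category :: bool where
  "category \<longleftrightarrow>
     (\<forall>f \<in> Arr C. Dom C f \<in> Obj C \<and> Cod C f \<in> Obj C) \<and>
     (\<forall>A \<in> Obj C. Idn C A \<in> Hom A A) \<and>
     (\<forall>f \<in> Arr C. \<forall>g \<in> Arr C. Cod C f = Dom C g \<longrightarrow> f \<cdot> g \<in> Hom (Dom C f) (Cod C g)) \<and>
     (\<forall>f \<in> Arr C. Idn C (Dom C f) \<cdot> f = f \<and> f \<cdot> Idn C (Cod C f) = f) \<and>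
     (\<forall>f \<in> Arr C. \<forall>g \<in> Arr C. \<forall>h \<in> Arr C.
        Cod C f = Dom C g \<longrightarrow> Cod C g = Dom C h \<longrightarrow> (f \<cdot> g) \<cdot> h = f \<cdot> (g \<cdot> h))"

definition inverse_pair :: "'a \<Rightarrow> 'a \<Rightarrow> bool" where
  "inverse_pair f g \<longleftrightarrow> f \<in> Arr C \<and> g \<in> Hom (Cod C f) (Dom C f) \<and>
     f \<cdot> g = Idn C (Dom C f) \<and> g \<cdot> f = Idn C (Cod C f)"

definition is_iso :: "'a \<Rightarrow> bool" where
  "is_iso f \<longleftrightarrow> (\<exists>g. inverse_pair f g)"

definition inv_arr :: "'a \<Rightarrow> 'a" where
  "inv_arr f = (THE g. inverse_pair f g)"

definition is_terminal :: "'o \<Rightarrow> bool" where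
  "is_terminal I \<longleftrightarrow> I \<in> Obj C \<and> (\<forall>A \<in> Obj C. \<exists>!f. f \<in> Hom A I)"

text \<open>A binary cone is the pair of its projections; its apex is their common domain.\<close>

definition apex :: "'a \<times> 'a \<Rightarrow> 'o" where
  "apex c = Dom C (fst c)"

definition mediates :: "'a \<times> 'a \<Rightarrow> 'a \<Rightarrow> 'a \<Rightarrow> 'a \<Rightarrow> bool" where
  "mediates c a b h \<longleftrightarrow> h \<in> Hom (Dom C a) (apex c) \<and> h \<cdot> fst c = a \<and> h \<cdot> snd c = b"

text \<open>The pairing \<open>\<langle>a, b\<rangle>\<close> into the limit cone \<open>c\<close>.  The cone is an explicit argument, so that
  pairings into \<open>T(E\<^sub>2)\<close>, with projections \<open>T(\<pi>\<^sub>0)\<close> and \<open>T(\<pi>\<^sub>1)\<close>, need no separate notion.\<close>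

definition tup :: "'a \<times> 'a \<Rightarrow> 'a \<Rightarrow> 'a \<Rightarrow> 'a" where
  "tup c a b = (THE h. mediates c a b h)"

definition is_product :: "'o \<Rightarrow> 'o \<Rightarrow> 'a \<times> 'a \<Rightarrow> bool" where
  "is_product A B c \<longleftrightarrow>
     fst c \<in> Hom (apex c) A \<and> snd c \<in> Hom (apex c) B \<and>
     (\<forall>Y. \<forall>a \<in> Hom Y A. \<forall>b \<in> Hom Y B. \<exists>!h. mediates c a b h)"

definition is_pullback :: "'a \<Rightarrow> 'a \<Rightarrow> 'a \<times> 'a \<Rightarrow> bool" where
  "is_pullback f g c \<longleftrightarrow>
     f \<in> Arr C \<and> g \<in> Arr C \<and> Cod C f = Cod C g \<and>
     fst c \<in> Hom (apex c) (Dom C f) \<and> snd c \<in> Hom (apex c) (Dom C g) \<and>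
     fst c \<cdot> f = snd c \<cdot> g \<and>
     (\<forall>Y. \<forall>a \<in> Hom Y (Dom C f). \<forall>b \<in> Hom Y (Dom C g). a \<cdot> f = b \<cdot> g \<longrightarrow>
        (\<exists>!h. mediates c a b h))"

text \<open>The \<open>n\<close>-fold pullback of \<open>q : E \<rightarrow> A\<close>, i.e. the \<open>n\<close>-fold power of \<open>q\<close> in the slice over \<open>A\<close>:
  \<open>r : E\<^sub>n \<rightarrow> A\<close> with projections \<open>\<pi> 0, \<dots>, \<pi> (n - 1)\<close>.  For \<open>n = 0\<close> this is \<open>A\<close> itself.\<close>

definition is_nfold_pullback :: "'a \<Rightarrow> nat \<Rightarrow> 'a \<Rightarrow> (nat \<Rightarrow> 'a) \<Rightarrow> bool" where
  "is_nfold_pullback q n r \<pi> \<longleftrightarrow>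
     q \<in> Arr C \<and> r \<in> Hom (Dom C r) (Cod C q) \<and>
     (\<forall>j<n. \<pi> j \<in> Hom (Dom C r) (Dom C q) \<and> \<pi> j \<cdot> q = r) \<and>
     (\<forall>Y. \<forall>r' \<in> Hom Y (Cod C q). \<forall>a.
        (\<forall>j<n. a j \<in> Hom Y (Dom C q) \<and> a j \<cdot> q = r') \<longrightarrow>
        (\<exists>!h. h \<in> Hom Y (Dom C r) \<and> h \<cdot> r = r' \<and> (\<forall>j<n. h \<cdot> \<pi> j = a j)))"

definition has_finite_products :: bool where
  "has_finite_products \<longleftrightarrow>
     (\<exists>I. is_terminal I) \<and> (\<forall>A \<in> Obj C. \<forall>B \<in> Obj C. \<exists>c. is_product A B c)"

text \<open>A fixed choice of terminal object, binary products and pullbacks.\<close>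

definition one :: "'o" where
  "one = (SOME I. is_terminal I)"

definition prd :: "'o \<Rightarrow> 'o \<Rightarrow> 'a \<times> 'a" where
  "prd A B = (SOME c. is_product A B c)"

definition pb :: "'a \<Rightarrow> 'a \<Rightarrow> 'a \<times> 'a" where
  "pb f g = (SOME c. is_pullback f g c)"

end

definition is_functor ::
  "('o, 'a, 'm) cat_scheme \<Rightarrow> ('o2, 'a2, 'm2) cat_scheme \<Rightarrow> ('o \<Rightarrow> 'o2) \<Rightarrow> ('a \<Rightarrow> 'a2) \<Rightarrow> bool" where
  "is_functor C C' FO FA \<longleftrightarrow>
     (\<forall>A \<in> Obj C. FO A \<in> Obj C') \<and>
     (\<forall>f \<in> Arr C. FA f \<in> Hom C' (FO (Dom C f)) (FO (Cod C f))) \<and>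
     (\<forall>A \<in> Obj C. FA (Idn C A) = Idn C' (FO A)) \<and>
     (\<forall>f \<in> Arr C. \<forall>g \<in> Arr C. Cod C f = Dom C g \<longrightarrow>
        FA (f \<cdot>\<^bsub>C\<^esub> g) = FA f \<cdot>\<^bsub>C'\<^esub> FA g)"

text \<open>The arrow \<open>\<phi>\<close> of \<open>C\<close> is Cartesian for the functor \<open>(PO, PA)\<close> from \<open>C\<close> to \<open>B\<close>.\<close>

definition is_cartesian_arrow ::
  "('o, 'a, 'm) cat_scheme \<Rightarrow> ('o2, 'a2, 'm2) cat_scheme \<Rightarrow> ('o \<Rightarrow> 'o2) \<Rightarrow> ('a \<Rightarrow> 'a2) \<Rightarrow> 'a \<Rightarrow> bool" where
  "is_cartesian_arrow C B PO PA \<phi> \<longleftrightarrow> \<phi> \<in> Arr C \<and>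
     (\<forall>Y \<in> Obj C. \<forall>\<psi> \<in> Hom C Y (Cod C \<phi>). \<forall>h \<in> Hom B (PO Y) (PO (Dom C \<phi>)).
        h \<cdot>\<^bsub>B\<^esub> PA \<phi> = PA \<psi> \<longrightarrow>
        (\<exists>!\<chi>. \<chi> \<in> Hom C Y (Dom C \<phi>) \<and> PA \<chi> = h \<and> \<chi> \<cdot>\<^bsub>C\<^esub> \<phi> = \<psi>))"


section \<open>Tangent categories\<close>

record ('o, 'a) tangent_cat = "('o, 'a) cat" +
  To :: "'o \<Rightarrow> 'o"
  Tm :: "'a \<Rightarrow> 'a"
  tp :: "'o \<Rightarrow> 'a"
  ts :: "'o \<Rightarrow> 'a"
  tz :: "'o \<Rightarrow> 'a"
  tl :: "'o \<Rightarrow> 'a"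
  tc :: "'o \<Rightarrow> 'a"

text \<open>A bundle \<open>(q, \<sigma>, \<zeta>, \<lambda>)\<close>.\<close>

record 'a bdl =
  bq :: 'a
  bs :: 'a
  bz :: 'a
  bl :: 'a

text \<open>A pair \<open>(f, g)\<close> of an arrow between bases and an arrow between total spaces, together with
  its source and target bundles.\<close>

record 'a bmor =
  bdom :: "'a bdl"
  bcod :: "'a bdl"
  base :: 'a
  total :: 'a

context
  fixes X :: "('o, 'a, 'm) tangent_cat_scheme" (structure)
begin

definition Tcone :: "'a \<times> 'a \<Rightarrow> 'a \<times> 'a" where
  "Tcone c = (Tm X (fst c), Tm X (snd c))"

text \<open>A pullback that is preserved by all powers \<open>T\<^sup>m\<close> (the case \<open>m = 0\<close> is the pullback itself).\<close>

definition is_Tpullback :: "'a \<Rightarrow> 'a \<Rightarrow> 'a \<times> 'a \<Rightarrow> bool" where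
  "is_Tpullback f g c \<longleftrightarrow>
     (\<forall>m. is_pullback X ((Tm X ^^ m) f) ((Tm X ^^ m) g) ((Tcone ^^ m) c))"

definition has_nfold_Tpullbacks :: "'a \<Rightarrow> bool" where
  "has_nfold_Tpullbacks q \<longleftrightarrow>
     (\<forall>n. \<exists>r \<pi>. \<forall>m. is_nfold_pullback X ((Tm X ^^ m) q) n ((Tm X ^^ m) r) (\<lambda>j. (Tm X ^^ m) (\<pi> j)))"

text \<open>\<open>(q, \<sigma>, \<zeta>)\<close> is a commutative monoid in the slice over the codomain of \<open>q\<close>; associativity is
  written for an arbitrary triple of arrows \<open>Y \<rightarrow> E\<close> over the base.\<close>

definition comm_monoid_over :: "'a \<Rightarrow> 'a \<Rightarrow> 'a \<Rightarrow> bool" where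
  "comm_monoid_over q \<sigma> \<zeta> \<longleftrightarrow>
     (let E = Dom X q; A = Cod X q; E2 = pb X q q in
      q \<in> Arr X \<and> \<sigma> \<in> Hom X (apex X E2) E \<and> \<zeta> \<in> Hom X A E \<and>
      \<sigma> \<cdot> q = fst E2 \<cdot> q \<and> \<zeta> \<cdot> q = Idn X A \<and>
      tup X E2 (Idn X E) (q \<cdot> \<zeta>) \<cdot> \<sigma> = Idn X E \<and>
      tup X E2 (snd E2) (fst E2) \<cdot> \<sigma> = \<sigma> \<and>
      (\<forall>Y. \<forall>a \<in> Hom X Y E. \<forall>b \<in> Hom X Y E. \<forall>d \<in> Hom X Y E. a \<cdot> q = b \<cdot> q \<longrightarrow> b \<cdot> q = d \<cdot> q \<longrightarrow>
         tup X E2 (tup X E2 a b \<cdot> \<sigma>) d \<cdot> \<sigma> = tup X E2 a (tup X E2 b d \<cdot> \<sigma>) \<cdot> \<sigma>))"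

definition T2 :: "'o \<Rightarrow> 'a \<times> 'a" where
  "T2 A = pb X (tp X A) (tp X A)"

definition tangent_category :: bool where
  "tangent_category \<longleftrightarrow>
     category X \<and> is_functor X X (To X) (Tm X) \<and>
     (\<forall>A \<in> Obj X. let T = To X; \<rho>0 = fst (T2 A); \<rho>1 = snd (T2 A) in
        tp X A \<in> Hom X (T A) A \<and>
        ts X A \<in> Hom X (apex X (T2 A)) (T A) \<and>
        tz X A \<in> Hom X A (T A) \<and>
        tl X A \<in> Hom X (T A) (T (T A)) \<and>
        tc X A \<in> Hom X (T (T A)) (T (T A)) \<and>
        has_nfold_Tpullbacks (tp X A) \<and>
        comm_monoid_over (tp X A) (ts X A) (tz X A) \<and>

        tl X A \<cdot> Tm X (tp X A) = tp X A \<cdot> tz X A \<and>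
        ts X A \<cdot> tl X A = tup X (Tcone (T2 A)) (\<rho>0 \<cdot> tl X A) (\<rho>1 \<cdot> tl X A) \<cdot> Tm X (ts X A) \<and>
        tz X A \<cdot> tl X A = tz X A \<cdot> Tm X (tz X A) \<and>

        tc X A \<cdot> tp X (T A) = Tm X (tp X A) \<and>
        Tm X (ts X A) \<cdot> tc X A =
          tup X (T2 (T A)) (Tm X \<rho>0 \<cdot> tc X A) (Tm X \<rho>1 \<cdot> tc X A) \<cdot> ts X (T A) \<and>
        Tm X (tz X A) \<cdot> tc X A = tz X (T A) \<and>

        tc X A \<cdot> tc X A = Idn X (T (T A)) \<and>
        tl X A \<cdot> tc X A = tl X A \<and>
        tl X A \<cdot> Tm X (tl X A) = tl X A \<cdot> tl X (T A) \<and>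
        Tm X (tc X A) \<cdot> tc X (T A) \<cdot> Tm X (tc X A) = tc X (T A) \<cdot> Tm X (tc X A) \<cdot> tc X (T A) \<and>
        tl X (T A) \<cdot> Tm X (tc X A) \<cdot> tc X (T A) = tc X A \<cdot> Tm X (tl X A) \<and>

        is_Tpullback (Tm X (tp X A)) (tz X A)
          (tup X (Tcone (T2 A)) (\<rho>0 \<cdot> tl X A) (\<rho>1 \<cdot> tz X (T A)) \<cdot> Tm X (ts X A), \<rho>0 \<cdot> tp X A)) \<and>
     (\<forall>f \<in> Arr X. let A = Dom X f; B = Cod X f in
        Tm X f \<cdot> tp X B = tp X A \<cdot> f \<and>
        tup X (T2 B) (fst (T2 A) \<cdot> Tm X f) (snd (T2 A) \<cdot> Tm X f) \<cdot> ts X B = ts X A \<cdot> Tm X f \<and>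
        f \<cdot> tz X B = tz X A \<cdot> Tm X f \<and>
        Tm X f \<cdot> tl X B = tl X A \<cdot> Tm X (Tm X f) \<and>
        Tm X (Tm X f) \<cdot> tc X B = tc X A \<cdot> Tm X (Tm X f))"

definition cartesian_tangent_category :: bool where
  "cartesian_tangent_category \<longleftrightarrow>
     tangent_category \<and> has_finite_products X \<and>
     (\<forall>I. is_terminal X I \<longrightarrow> is_terminal X (To X I)) \<and>
     (\<forall>A \<in> Obj X. \<forall>B \<in> Obj X. \<forall>c. is_product X A B c \<longrightarrow> is_product X (To X A) (To X B) (Tcone c))"


section \<open>Differential bundles\<close>

definition tot :: "'a bdl \<Rightarrow> 'o" where
  "tot E = Dom X (bq E)"

definition bas :: "'a bdl \<Rightarrow> 'o" where
  "bas E = Cod X (bq E)"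

definition bpair :: "'a bdl \<Rightarrow> 'a \<times> 'a" where
  "bpair E = pb X (bq E) (bq E)"

definition differential_bundle :: "'a bdl \<Rightarrow> bool" where
  "differential_bundle E \<longleftrightarrow>
     (let q = bq E; \<sigma> = bs E; \<zeta> = bz E; l = bl E;
          E2 = bpair E; \<pi>0 = fst (bpair E); \<pi>1 = snd (bpair E);
          A = bas E; Et = tot E in
      has_nfold_Tpullbacks q \<and> comm_monoid_over q \<sigma> \<zeta> \<and> l \<in> Hom X Et (To X Et) \<and>

      l \<cdot> Tm X q = q \<cdot> tz X A \<and>
      \<sigma> \<cdot> l = tup X (Tcone E2) (\<pi>0 \<cdot> l) (\<pi>1 \<cdot> l) \<cdot> Tm X \<sigma> \<and>
      \<zeta> \<cdot> l = tz X A \<cdot> Tm X \<zeta> \<and>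

      l \<cdot> tp X Et = q \<cdot> \<zeta> \<and>
      \<sigma> \<cdot> l = tup X (T2 Et) (\<pi>0 \<cdot> l) (\<pi>1 \<cdot> l) \<cdot> ts X Et \<and>
      \<zeta> \<cdot> l = \<zeta> \<cdot> tz X Et \<and>

      l \<cdot> tl X Et = l \<cdot> Tm X l \<and>

      is_Tpullback (Tm X q) (tz X A)
        (tup X (Tcone E2) (\<pi>0 \<cdot> l) (\<pi>1 \<cdot> tz X Et) \<cdot> Tm X \<sigma>, \<pi>0 \<cdot> q))"

definition linear_morphism :: "'a bdl \<Rightarrow> 'a bdl \<Rightarrow> 'a \<Rightarrow> 'a \<Rightarrow> bool" where
  "linear_morphism E E' f g \<longleftrightarrow>
     f \<in> Hom X (bas E) (bas E') \<and> g \<in> Hom X (tot E) (tot E') \<and>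
     g \<cdot> bq E' = bq E \<cdot> f \<and> g \<cdot> bl E' = bl E \<cdot> Tm X g"

definition linear_over :: "'a bdl \<Rightarrow> 'a bdl \<Rightarrow> 'a \<Rightarrow> bool" where
  "linear_over E E' g \<longleftrightarrow> bas E = bas E' \<and> linear_morphism E E' (Idn X (bas E)) g"

definition tangent_bundle :: "'o \<Rightarrow> 'a bdl" where
  "tangent_bundle A = \<lparr>bq = tp X A, bs = ts X A, bz = tz X A, bl = tl X A\<rparr>"

text \<open>The bundle \<open>(T(q), T(\<sigma>), T(\<zeta>), T(\<lambda>) c)\<close>.  Its addition has to start at the chosen pullback of
  \<open>T(q)\<close> with itself, so \<open>T(\<sigma>)\<close> is preceded by the canonical isomorphism to \<open>T(E\<^sub>2)\<close>.\<close>

definition Tbar :: "'a bdl \<Rightarrow> 'a bdl" where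
  "Tbar E = (let P = pb X (Tm X (bq E)) (Tm X (bq E)) in
     \<lparr>bq = Tm X (bq E),
      bs = tup X (Tcone (bpair E)) (fst P) (snd P) \<cdot> Tm X (bs E),
      bz = Tm X (bz E),
      bl = Tm X (bl E) \<cdot> tc X (tot E)\<rparr>)"

definition Tbar_mor :: "'a bmor \<Rightarrow> 'a bmor" where
  "Tbar_mor m = \<lparr>bdom = Tbar (bdom m), bcod = Tbar (bcod m),
     base = Tm X (base m), total = Tm X (total m)\<rparr>"

text \<open>Pullback along \<open>f : Y \<rightarrow> A\<close>: the cone \<open>(\<pi>\<^sub>0 : Y \<times>\<^sub>A E \<rightarrow> Y, \<pi>\<^sub>1 : Y \<times>\<^sub>A E \<rightarrow> E)\<close> and the bundle
  \<open>(\<pi>\<^sub>0, 1 \<times> \<sigma>, \<langle>1, f \<zeta>\<rangle>, z \<times> \<lambda>)\<close>.  The last two products are read along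
  \<open>(Y \<times>\<^sub>A E)\<^sub>2 \<cong> Y \<times>\<^sub>A E\<^sub>2\<close> and \<open>T(Y) \<times>\<^bsub>T(A)\<^esub> T(E) \<cong> T(Y \<times>\<^sub>A E)\<close>.\<close>

definition pbcone :: "'a \<Rightarrow> 'a bdl \<Rightarrow> 'a \<times> 'a" where
  "pbcone f E = pb X f (bq E)"

definition pullback_bundle :: "'a \<Rightarrow> 'a bdl \<Rightarrow> 'a bdl" where
  "pullback_bundle f E =
     (let c = pbcone f E; \<pi>0 = fst c; \<pi>1 = snd c; d = pb X \<pi>0 \<pi>0; Y = Dom X f in
      \<lparr>bq = \<pi>0,
       bs = tup X c (fst d \<cdot> \<pi>0) (tup X (bpair E) (fst d \<cdot> \<pi>1) (snd d \<cdot> \<pi>1) \<cdot> bs E),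
       bz = tup X c (Idn X Y) (f \<cdot> bz E),
       bl = tup X (Tcone c) (\<pi>0 \<cdot> tz X Y) (\<pi>1 \<cdot> bl E)\<rparr>)"

definition pullback_bundle_exists :: "'a \<Rightarrow> 'a bdl \<Rightarrow> bool" where
  "pullback_bundle_exists f E \<longleftrightarrow>
     (\<forall>n r \<pi>. is_nfold_pullback X (bq E) n r \<pi> \<longrightarrow> (\<exists>c. is_Tpullback f r c))"

definition product_bundle :: "'a bdl \<Rightarrow> 'a bdl \<Rightarrow> 'a bdl" where
  "product_bundle E F =
     (let c = prd X (tot E) (tot F); b = prd X (bas E) (bas F);
          q = tup X b (fst c \<cdot> bq E) (snd c \<cdot> bq F); d = pb X q q in
      \<lparr>bq = q,
       bs = tup X c (tup X (bpair E) (fst d \<cdot> fst c) (snd d \<cdot> fst c) \<cdot> bs E)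
                    (tup X (bpair F) (fst d \<cdot> snd c) (snd d \<cdot> snd c) \<cdot> bs F),
       bz = tup X c (fst b \<cdot> bz E) (snd b \<cdot> bz F),
       bl = tup X (Tcone c) (fst c \<cdot> bl E) (snd c \<cdot> bl F)\<rparr>)"

definition system_of_bundles :: "'a bdl set \<Rightarrow> bool" where
  "system_of_bundles \<D> \<longleftrightarrow>
     (\<forall>E \<in> \<D>. differential_bundle E) \<and>
     (\<forall>A \<in> Obj X. tangent_bundle A \<in> \<D>) \<and>
     (\<forall>E \<in> \<D>. Tbar E \<in> \<D>) \<and>
     (\<forall>E \<in> \<D>. \<forall>f \<in> Arr X. Cod X f = bas E \<longrightarrow>
        pullback_bundle_exists f E \<and> pullback_bundle f E \<in> \<D>)"


section \<open>The fibration of differential bundles and its dual\<close>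

definition DBun :: "'a bdl set \<Rightarrow> ('a bdl, 'a bmor) cat" where
  "DBun \<D> =
     \<lparr>Obj = \<D>,
      Arr = {m. bdom m \<in> \<D> \<and> bcod m \<in> \<D> \<and>
                linear_morphism (bdom m) (bcod m) (base m) (total m)},
      Dom = bdom, Cod = bcod,
      Comp = (\<lambda>m n. \<lparr>bdom = bdom m, bcod = bcod n,
                base = base m \<cdot> base n, total = total m \<cdot> total n\<rparr>),
      Idn = (\<lambda>E. \<lparr>bdom = E, bcod = E, base = Idn X (bas E), total = Idn X (tot E)\<rparr>)\<rparr>"

text \<open>In the dual fibration the second component of an arrow from \<open>E\<close> to \<open>E'\<close> over \<open>f : A \<rightarrow> A'\<close> is a
  linear map \<open>A \<times>\<^bsub>A'\<^esub> E' \<rightarrow> E\<close> over \<open>A\<close>.\<close>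

definition DBun_dual :: "'a bdl set \<Rightarrow> ('a bdl, 'a bmor) cat" where
  "DBun_dual \<D> =
     \<lparr>Obj = \<D>,
      Arr = {m. bdom m \<in> \<D> \<and> bcod m \<in> \<D> \<and> base m \<in> Hom X (bas (bdom m)) (bas (bcod m)) \<and>
                linear_over (pullback_bundle (base m) (bcod m)) (bdom m) (total m)},
      Dom = bdom, Cod = bcod,
      Comp = (\<lambda>m n. let c = pbcone (base m \<cdot> base n) (bcod n) in
                \<lparr>bdom = bdom m, bcod = bcod n,
                 base = base m \<cdot> base n,
                 total = tup X (pbcone (base m) (bcod m)) (fst c)
                           (tup X (pbcone (base n) (bcod n)) (fst c \<cdot> base m) (snd c) \<cdot> total n)
                         \<cdot> total m\<rparr>),
      Idn = (\<lambda>E. \<lparr>bdom = E, bcod = E, base = Idn X (bas E),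
                  total = snd (pbcone (Idn X (bas E)) E)\<rparr>)\<rparr>"

definition Tbar_dual_mor :: "'a bmor \<Rightarrow> 'a bmor" where
  "Tbar_dual_mor m =
     (let c = pbcone (base m) (bcod m); d = pbcone (Tm X (base m)) (Tbar (bcod m)) in
      \<lparr>bdom = Tbar (bdom m), bcod = Tbar (bcod m),
       base = Tm X (base m), total = tup X (Tcone c) (fst d) (snd d) \<cdot> Tm X (total m)\<rparr>)"

text \<open>The Cartesian arrow \<open>(f, \<pi>\<^sub>1)\<close> from the pullback bundle to the bundle.\<close>

definition cart_lift :: "'a \<Rightarrow> 'a bdl \<Rightarrow> 'a bmor" where
  "cart_lift f E = \<lparr>bdom = pullback_bundle f E, bcod = E, base = f, total = snd (pbcone f E)\<rparr>"

definition vert :: "'a bdl \<Rightarrow> 'a bdl \<Rightarrow> 'a \<Rightarrow> 'a bmor" where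
  "vert E F g = \<lparr>bdom = E, bcod = F, base = Idn X (bas E), total = g\<rparr>"

end


section \<open>Reverse tangent categories\<close>

text \<open>The data of an involution: the functor \<open>(-)\<^sup>*\<close> on bundles and on arrows, and \<open>\<iota>\<close>.\<close>

record 'a involution =
  Star :: "'a bdl \<Rightarrow> 'a bdl"
  StarM :: "'a bmor \<Rightarrow> 'a bmor"
  Iota :: "'a bdl \<Rightarrow> 'a bmor"

context
  fixes X :: "('o, 'a, 'm) tangent_cat_scheme" (structure)
    and \<D> :: "'a bdl set"
    and V :: "'a involution"
begin

text \<open>The functor induced on the fibre over \<open>A\<close>: for \<open>g : E \<rightarrow> F\<close> linear over \<open>A\<close>, the map
  \<open>F\<^sup>* \<cong> A \<times>\<^sub>A F\<^sup>* \<rightarrow> E\<^sup>*\<close>.\<close>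

definition fib_dual :: "'a bdl \<Rightarrow> 'a bdl \<Rightarrow> 'a \<Rightarrow> 'a" where
  "fib_dual E F g =
     tup X (pbcone X (Idn X (bas X F)) (Star V F)) (bq (Star V F)) (Idn X (tot X (Star V F)))
       \<cdot> total (StarM V (vert X E F g))"

text \<open>The canonical isomorphism \<open>(A \<times>\<^bsub>A'\<^esub> E)\<^sup>* \<rightarrow> A \<times>\<^bsub>A'\<^esub> E\<^sup>*\<close> for \<open>f : A \<rightarrow> A'\<close>; its inverse is the
  dual of the Cartesian arrow \<open>(f, \<pi>\<^sub>1)\<close>.\<close>

definition dual_pullback :: "'a \<Rightarrow> 'a bdl \<Rightarrow> 'a" where
  "dual_pullback f E = inv_arr X (total (StarM V (cart_lift X f E)))"

text \<open>The functor \<open>(-)\<^sup>*\<^sup>*\<close> on an arrow \<open>(f, g)\<close> from \<open>E\<close> to \<open>F\<close>.  With \<open>g\<^sup>* : A \<times>\<^bsub>A'\<^esub> F\<^sup>* \<rightarrow> E\<^sup>*\<close>, the functor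
  induced on dual fibrations applies the fibre functor to \<open>g\<^sup>*\<close> and the canonical isomorphism above,
  \<open>E\<^sup>*\<^sup>* \<rightarrow> (A \<times>\<^bsub>A'\<^esub> F\<^sup>*)\<^sup>* \<cong> A \<times>\<^bsub>A'\<^esub> F\<^sup>*\<^sup>*\<close>; the identification of the double dual fibration with the
  original one composes this with the projection to \<open>F\<^sup>*\<^sup>*\<close>.\<close>

definition double_dual :: "'a bmor \<Rightarrow> 'a bmor" where
  "double_dual m =
     (let f = base m; E1 = Star V (bdom m); F1 = Star V (bcod m) in
      \<lparr>bdom = Star V E1, bcod = Star V F1, base = f,
       total = fib_dual (pullback_bundle X f F1) E1 (total (StarM V m))
                 \<cdot> dual_pullback f F1 \<cdot> snd (pbcone X f (Star V F1))\<rparr>)"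

text \<open>\<open>\<iota>\<close> is an isomorphism of functors fibred over \<open>X\<close>, so its components lie over identities.\<close>

definition linear_involution :: bool where
  "linear_involution \<longleftrightarrow>
     is_functor (DBun X \<D>) (DBun_dual X \<D>) (Star V) (StarM V) \<and>
     (\<forall>E \<in> \<D>. bas X (Star V E) = bas X E) \<and>
     (\<forall>m \<in> Arr (DBun X \<D>). base (StarM V m) = base m) \<and>
     (\<forall>m. is_cartesian_arrow (DBun X \<D>) X (bas X) base m \<longrightarrow>
          is_cartesian_arrow (DBun_dual X \<D>) X (bas X) base (StarM V m)) \<and>
     (\<forall>E \<in> \<D>. Iota V E \<in> Hom (DBun X \<D>) E (Star V (Star V E)) \<and>
          base (Iota V E) = Idn X (bas X E) \<and> is_iso (DBun X \<D>) (Iota V E)) \<and>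
     (\<forall>m \<in> Arr (DBun X \<D>).
          m \<cdot>\<^bsub>DBun X \<D>\<^esub> Iota V (bcod m) = Iota V (bdom m) \<cdot>\<^bsub>DBun X \<D>\<^esub> double_dual m)"

definition reverse_tangent_category :: bool where
  "reverse_tangent_category \<longleftrightarrow>
     tangent_category X \<and> system_of_bundles X \<D> \<and> linear_involution \<and>
     (\<forall>E \<in> \<D>. Tbar X (Star V E) = Star V (Tbar X E)) \<and>
     (\<forall>m \<in> Arr (DBun X \<D>). Tbar_dual_mor X (StarM V m) = StarM V (Tbar_mor X m))"

text \<open>A biproduct diagram in the fibre over \<open>A\<close>: \<open>P\<close> with projections \<open>p\<close> is the fibre product of \<open>E\<close> and
  \<open>F\<close> over \<open>A\<close>, and the injections are \<open>\<langle>1, 0\<rangle>\<close> and \<open>\<langle>0, 1\<rangle>\<close> for the zero maps \<open>q \<zeta>\<close>.\<close>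

definition fibre_biproduct ::
  "'a bdl \<Rightarrow> 'a bdl \<Rightarrow> 'a bdl \<Rightarrow> 'a \<times> 'a \<Rightarrow> 'a \<times> 'a \<Rightarrow> bool" where
  "fibre_biproduct E F P p i \<longleftrightarrow>
     E \<in> \<D> \<and> F \<in> \<D> \<and> P \<in> \<D> \<and>
     linear_over X P E (fst p) \<and> linear_over X P F (snd p) \<and>
     linear_over X E P (fst i) \<and> linear_over X F P (snd i) \<and>
     is_pullback X (bq E) (bq F) p \<and>
     fst i \<cdot> fst p = Idn X (tot X E) \<and> fst i \<cdot> snd p = bq E \<cdot> bz F \<and>
     snd i \<cdot> fst p = bq F \<cdot> bz E \<and> snd i \<cdot> snd p = Idn X (tot X F)"

text \<open>A zero object of the fibre over \<open>A\<close> (the empty biproduct): its projection to \<open>A\<close> is invertible.\<close>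

definition fibre_zero :: "'a bdl \<Rightarrow> bool" where
  "fibre_zero E \<longleftrightarrow> E \<in> \<D> \<and> is_iso X (bq E)"

definition preserves_biproducts :: bool where
  "preserves_biproducts \<longleftrightarrow>
     (\<forall>E. fibre_zero E \<longrightarrow> fibre_zero (Star V E)) \<and>
     (\<forall>E F P p i. fibre_biproduct E F P p i \<longrightarrow>
        fibre_biproduct (Star V E) (Star V F) (Star V P)
          (fib_dual E P (fst i), fib_dual F P (snd i))
          (fib_dual P E (fst p), fib_dual P F (snd p)))"

definition cartesian_reverse_tangent_category :: bool where
  "cartesian_reverse_tangent_category \<longleftrightarrow>
     reverse_tangent_category \<and> cartesian_tangent_category X \<and>
     (\<forall>E \<in> \<D>. \<forall>F \<in> \<D>. product_bundle X E F \<in> \<D>) \<and>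
     preserves_biproducts"

end


section \<open>Cartesian reverse differential categories\<close>

context
  fixes C :: "('o, 'a, 'm) cat_scheme" (structure)
    and I :: 'o
    and pr :: "'o \<Rightarrow> 'o \<Rightarrow> 'a \<times> 'a"
    and add :: "'a \<Rightarrow> 'a \<Rightarrow> 'a"  (infixl "\<^bold>+" 65)
    and zero :: "'o \<Rightarrow> 'o \<Rightarrow> 'a"
begin

text \<open>The terminal object \<open>I\<close> and the product cones \<open>pr A B\<close> are part of the structure; \<open>\<^bold>+\<close> is the
  addition of parallel arrows and \<open>zero A B\<close> the zero arrow from \<open>A\<close> to \<open>B\<close>.\<close>

definition cartesian_left_additive_category :: bool where
  "cartesian_left_additive_category \<longleftrightarrow>
     category C \<and> is_terminal C I \<and>
     (\<forall>A \<in> Obj C. \<forall>B \<in> Obj C. is_product C A B (pr A B)) \<and>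
     (\<forall>A \<in> Obj C. \<forall>B \<in> Obj C.
        zero A B \<in> Hom C A B \<and>
        (\<forall>f \<in> Hom C A B. zero A B \<^bold>+ f = f) \<and>
        (\<forall>f \<in> Hom C A B. \<forall>g \<in> Hom C A B. f \<^bold>+ g \<in> Hom C A B \<and> f \<^bold>+ g = g \<^bold>+ f) \<and>
        (\<forall>f \<in> Hom C A B. \<forall>g \<in> Hom C A B. \<forall>h \<in> Hom C A B. (f \<^bold>+ g) \<^bold>+ h = f \<^bold>+ (g \<^bold>+ h))) \<and>
     (\<forall>Y \<in> Obj C. \<forall>A \<in> Obj C. \<forall>B \<in> Obj C. \<forall>f \<in> Hom C Y A.
        f \<cdot> zero A B = zero Y B \<and>
        (\<forall>g \<in> Hom C A B. \<forall>h \<in> Hom C A B. f \<cdot> (g \<^bold>+ h) = f \<cdot> g \<^bold>+ f \<cdot> h)) \<and>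
     (\<forall>Y \<in> Obj C. \<forall>A \<in> Obj C. \<forall>B \<in> Obj C. let c = pr A B; P = apex C c in
        zero Y P \<cdot> fst c = zero Y A \<and> zero Y P \<cdot> snd c = zero Y B \<and>
        (\<forall>f \<in> Hom C Y P. \<forall>g \<in> Hom C Y P.
           (f \<^bold>+ g) \<cdot> fst c = f \<cdot> fst c \<^bold>+ g \<cdot> fst c \<and> (f \<^bold>+ g) \<cdot> snd c = f \<cdot> snd c \<^bold>+ g \<cdot> snd c))"

definition prod_obj :: "'o \<Rightarrow> 'o \<Rightarrow> 'o"  (infixr "\<times>\<times>" 80) where
  "A \<times>\<times> B = apex C (pr A B)"

definition pi0 :: "'o \<Rightarrow> 'o \<Rightarrow> 'a" where
  "pi0 A B = fst (pr A B)"

definition pi1 :: "'o \<Rightarrow> 'o \<Rightarrow> 'a" where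
  "pi1 A B = snd (pr A B)"

definition pairing :: "'a \<Rightarrow> 'a \<Rightarrow> 'a"  ("\<llangle>_, _\<rrangle>") where
  "\<llangle>f, g\<rrangle> = tup C (pr (Cod C f) (Cod C g)) f g"

definition cross :: "'a \<Rightarrow> 'a \<Rightarrow> 'a"  (infixr "\<otimes>" 75) where
  "f \<otimes> g = \<llangle>pi0 (Dom C f) (Dom C g) \<cdot> f, pi1 (Dom C f) (Dom C g) \<cdot> g\<rrangle>"

definition fwd_deriv :: "('a \<Rightarrow> 'a) \<Rightarrow> 'a \<Rightarrow> 'a" where
  "fwd_deriv R f = (let A = Dom C f; B = Cod C f in
     (\<llangle>Idn C A, zero A B\<rrangle> \<otimes> Idn C A) \<cdot> R (R f) \<cdot> pi1 A B)"

definition cartesian_reverse_differential_category :: "('a \<Rightarrow> 'a) \<Rightarrow> bool" where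
  "cartesian_reverse_differential_category R \<longleftrightarrow>
     cartesian_left_additive_category \<and>
     (\<forall>A \<in> Obj C. \<forall>B \<in> Obj C. \<forall>f \<in> Hom C A B. R f \<in> Hom C (A \<times>\<times> B) A) \<and>
     \<comment> \<open>RD.1\<close>
     (\<forall>A \<in> Obj C. \<forall>B \<in> Obj C.
        R (zero A B) = zero (A \<times>\<times> B) A \<and>
        (\<forall>f \<in> Hom C A B. \<forall>g \<in> Hom C A B. R (f \<^bold>+ g) = R f \<^bold>+ R g)) \<and>
     \<comment> \<open>RD.2\<close>
     (\<forall>Y \<in> Obj C. \<forall>A \<in> Obj C. \<forall>B \<in> Obj C. \<forall>f \<in> Hom C A B. \<forall>a \<in> Hom C Y A.
        \<llangle>a, zero Y B\<rrangle> \<cdot> R f = zero Y A \<and>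
        (\<forall>b \<in> Hom C Y B. \<forall>d \<in> Hom C Y B. \<llangle>a, b \<^bold>+ d\<rrangle> \<cdot> R f = \<llangle>a, b\<rrangle> \<cdot> R f \<^bold>+ \<llangle>a, d\<rrangle> \<cdot> R f)) \<and>
     \<comment> \<open>RD.3\<close>
     (\<forall>A \<in> Obj C. R (Idn C A) = pi1 A A) \<and>
     (\<forall>A \<in> Obj C. \<forall>B \<in> Obj C.
        R (pi0 A B) = pi1 (A \<times>\<times> B) A \<cdot> \<llangle>Idn C A, zero A B\<rrangle> \<and>
        R (pi1 A B) = pi1 (A \<times>\<times> B) B \<cdot> \<llangle>zero B A, Idn C B\<rrangle>) \<and>
     \<comment> \<open>RD.4\<close>
     (\<forall>A \<in> Obj C. \<forall>B \<in> Obj C. \<forall>D \<in> Obj C. \<forall>f \<in> Hom C A B. \<forall>g \<in> Hom C A D.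
        R \<llangle>f, g\<rrangle> = (Idn C A \<otimes> pi0 B D) \<cdot> R f \<^bold>+ (Idn C A \<otimes> pi1 B D) \<cdot> R g) \<and>
     (\<forall>A \<in> Obj C. \<forall>t \<in> Hom C A I. R t = zero (A \<times>\<times> I) A) \<and>
     \<comment> \<open>RD.5\<close>
     (\<forall>A \<in> Obj C. \<forall>B \<in> Obj C. \<forall>D \<in> Obj C. \<forall>f \<in> Hom C A B. \<forall>g \<in> Hom C B D.
        R (f \<cdot> g) = \<llangle>pi0 A D, (f \<otimes> Idn C D) \<cdot> R g\<rrangle> \<cdot> R f) \<and>
     \<comment> \<open>RD.6\<close>
     (\<forall>A \<in> Obj C. \<forall>B \<in> Obj C. \<forall>f \<in> Hom C A B.
        \<llangle>Idn C A \<otimes> pi0 B B, zero A A \<otimes> pi1 B B\<rrangle> \<cdot> fwd_deriv R (R f) = (Idn C A \<otimes> pi1 B B) \<cdot> R f) \<and>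
     \<comment> \<open>RD.7\<close>
     (\<forall>A \<in> Obj C. \<forall>B \<in> Obj C. \<forall>f \<in> Hom C A B.
        \<llangle>pi0 A A \<otimes> pi0 A A, pi1 A A \<otimes> pi1 A A\<rrangle> \<cdot> fwd_deriv R (fwd_deriv R f)
          = fwd_deriv R (fwd_deriv R f))"

end


section \<open>Self-dual differential objects\<close>

record 'a sdobj =
  sbun :: "'a bdl"
  sdual :: 'a

record 'a sdmor =
  sdom :: "'a sdobj"
  scod :: "'a sdobj"
  sarr :: 'a

context
  fixes X :: "('o, 'a, 'm) tangent_cat_scheme" (structure)
    and \<D> :: "'a bdl set"
    and V :: "'a involution"
begin

text \<open>A bundle in \<open>\<D>\<close> over the terminal object with a linear isomorphism \<open>\<alpha> : A \<rightarrow> A\<^sup>*\<close>.\<close>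

definition linear_self_duality :: "'a sdobj \<Rightarrow> bool" where
  "linear_self_duality S \<longleftrightarrow>
     sbun S \<in> \<D> \<and> bas X (sbun S) = one X \<and>
     vert X (sbun S) (Star V (sbun S)) (sdual S) \<in> Arr (DBun X \<D>) \<and>
     is_iso (DBun X \<D>) (vert X (sbun S) (Star V (sbun S)) (sdual S))"

text \<open>Compatibility of \<open>\<alpha>\<close> with the involution: \<open>\<alpha>\<close> equals \<open>A \<cong> A\<^sup>*\<^sup>* \<rightarrow> A\<^sup>*\<close>, the composite of \<open>\<iota>\<close> and
  \<open>\<alpha>\<^sup>*\<close>.  Without it, transposing twice along the dualities is not the identity and RD.6 can fail: for
  linear \<open>f : A \<rightarrow> B\<close> between spaces with dualities given by invertible matrices \<open>M\<close>, the map
  \<open>fwd_deriv R f\<close> sends \<open>(a, v)\<close> to \<open>N\<^sub>B f N\<^sub>A\<^sup>-\<^sup>1 v\<close> with \<open>N = M\<^sup>-\<^sup>1 M\<^sup>T\<close>.\<close>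

definition symmetric_duality :: "'a sdobj \<Rightarrow> bool" where
  "symmetric_duality S \<longleftrightarrow>
     total (Iota V (sbun S)) \<cdot> fib_dual X V (sbun S) (Star V (sbun S)) (sdual S) = sdual S"

definition stot :: "'a sdobj \<Rightarrow> 'o" where
  "stot S = tot X (sbun S)"

definition DOsd :: "('a sdobj, 'a sdmor) cat" where
  "DOsd =
     \<lparr>Obj = {S. linear_self_duality S \<and> symmetric_duality S},
      Arr = {m. linear_self_duality (sdom m) \<and> symmetric_duality (sdom m) \<and>
                linear_self_duality (scod m) \<and> symmetric_duality (scod m) \<and>
                sarr m \<in> Hom X (stot (sdom m)) (stot (scod m))},
      Dom = sdom, Cod = scod,
      Comp = (\<lambda>m n. \<lparr>sdom = sdom m, scod = scod n, sarr = sarr m \<cdot> sarr n\<rparr>),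
      Idn = (\<lambda>S. \<lparr>sdom = S, scod = S, sarr = Idn X (stot S)\<rparr>)\<rparr>"

definition sd_add :: "'a sdmor \<Rightarrow> 'a sdmor \<Rightarrow> 'a sdmor" where
  "sd_add m n = \<lparr>sdom = sdom m, scod = scod m,
     sarr = tup X (bpair X (sbun (scod m))) (sarr m) (sarr n) \<cdot> bs (sbun (scod m))\<rparr>"

definition sd_zero :: "'a sdobj \<Rightarrow> 'a sdobj \<Rightarrow> 'a sdmor" where
  "sd_zero S S' = \<lparr>sdom = S, scod = S', sarr = bq (sbun S) \<cdot> bz (sbun S')\<rparr>"

text \<open>\<open>P\<close> with projections \<open>c\<close> is the product of the self-dual objects \<open>S\<close> and \<open>S'\<close>: its bundle is the
  product bundle over the terminal object, and its duality is
  \<open>A \<times> B \<rightarrow> A\<^sup>* \<times> B\<^sup>* \<cong> (A \<times> B)\<^sup>*\<close>, where the canonical isomorphism \<open>(A \<times> B)\<^sup>* \<cong> A\<^sup>* \<times> B\<^sup>*\<close> is given by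
  the duals of the two injections.\<close>

definition sd_product :: "'a sdobj \<Rightarrow> 'a sdobj \<Rightarrow> 'a sdmor \<times> 'a sdmor \<Rightarrow> bool" where
  "sd_product S S' c \<longleftrightarrow>
     (\<exists>P \<in> Obj DOsd. fst c \<in> Hom DOsd P S \<and> snd c \<in> Hom DOsd P S' \<and>
        (\<exists>i. fibre_biproduct X \<D> (sbun S) (sbun S') (sbun P) (sarr (fst c), sarr (snd c)) i \<and>
             sdual P \<cdot> fib_dual X V (sbun S) (sbun P) (fst i) = sarr (fst c) \<cdot> sdual S \<and>
             sdual P \<cdot> fib_dual X V (sbun S') (sbun P) (snd i) = sarr (snd c) \<cdot> sdual S'))"

definition sd_product_structure ::
  "'a sdobj \<Rightarrow> ('a sdobj \<Rightarrow> 'a sdobj \<Rightarrow> 'a sdmor \<times> 'a sdmor) \<Rightarrow> bool" where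
  "sd_product_structure I pr \<longleftrightarrow>
     is_terminal DOsd I \<and> (\<forall>S \<in> Obj DOsd. \<forall>S' \<in> Obj DOsd. sd_product S S' (pr S S'))"

text \<open>The bundle \<open>\<pi>\<^sub>0 : A \<times> A \<rightarrow> A\<close> obtained by pulling back the differential object \<open>E\<close> along its
  projection \<open>A \<rightarrow> 1\<close>, and the isomorphism \<open>\<nu> = \<langle>\<pi>\<^sub>1 \<lambda>, \<pi>\<^sub>0 z\<rangle> T(\<sigma>)\<close> from it to the tangent bundle.\<close>

definition nu :: "'a bdl \<Rightarrow> 'a" where
  "nu E = (let c = pbcone X (bq E) E in
     tup X (Tcone X (bpair X E)) (snd c \<cdot> bl E) (fst c \<cdot> tz X (tot X E)) \<cdot> Tm X (bs E))"

definition cotangent_bundle :: "'o \<Rightarrow> 'a bdl" where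
  "cotangent_bundle A = Star V (tangent_bundle X A)"

text \<open>For \<open>f : A \<rightarrow> B\<close>, the second component \<open>A \<times>\<^sub>B T\<^sup>*(B) \<rightarrow> T\<^sup>*(A)\<close> of the dual of \<open>(f, T(f))\<close>.\<close>

definition cotangent_map :: "'a \<Rightarrow> 'a" where
  "cotangent_map f = total (StarM V
     \<lparr>bdom = tangent_bundle X (Dom X f), bcod = tangent_bundle X (Cod X f),
      base = f, total = Tm X f\<rparr>)"

context
  fixes pr :: "'a sdobj \<Rightarrow> 'a sdobj \<Rightarrow> 'a sdmor \<times> 'a sdmor"
begin

definition xcone :: "'a sdobj \<Rightarrow> 'a sdobj \<Rightarrow> 'a \<times> 'a" where
  "xcone S S' = (sarr (fst (pr S S')), sarr (snd (pr S S')))"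

text \<open>The isomorphism \<open>T\<^sup>*(A) \<cong> A \<times> A\<close>: first \<open>T\<^sup>*(A) \<rightarrow> (A \<times> A)\<^sup>* \<cong> A \<times> A\<^sup>*\<close> by dualizing \<open>\<nu>\<close>, where
  \<open>A \<times> A\<^sup>*\<close> is the pullback bundle of \<open>A\<^sup>*\<close> along \<open>A \<rightarrow> 1\<close>, then \<open>1 \<times> \<alpha>\<^sup>-\<^sup>1\<close>.\<close>

definition cotangent_iso :: "'a sdobj \<Rightarrow> 'a" where
  "cotangent_iso S =
     (let E = sbun S; c = pbcone X (bq E) (Star V E) in
      fib_dual X V (pullback_bundle X (bq E) E) (tangent_bundle X (tot X E)) (nu E)
        \<cdot> dual_pullback X V (bq E) E
        \<cdot> tup X (xcone S S) (fst c) (snd c \<cdot> inv_arr X (sdual S)))"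

text \<open>The isomorphism \<open>A \<times> B \<cong> A \<times>\<^sub>B (B \<times> B) \<cong> A \<times>\<^sub>B T\<^sup>*(B)\<close>, for \<open>f : A \<rightarrow> B\<close>.\<close>

definition cotangent_pullback_iso :: "'a sdmor \<Rightarrow> 'a" where
  "cotangent_pullback_iso m =
     (let S = sdom m; S' = scod m; f = sarr m; c = xcone S S' in
      tup X (pbcone X f (cotangent_bundle (stot S'))) (fst c)
        (tup X (xcone S' S') (fst c \<cdot> f) (snd c) \<cdot> inv_arr X (cotangent_iso S')))"

definition rev_deriv :: "'a sdmor \<Rightarrow> 'a sdmor" where
  "rev_deriv m =
     \<lparr>sdom = sdom (fst (pr (sdom m) (scod m))), scod = sdom m,
      sarr = cotangent_pullback_iso m \<cdot> cotangent_map (sarr m)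
               \<cdot> cotangent_iso (sdom m) \<cdot> snd (xcone (sdom m) (sdom m))\<rparr>"

end

end

end

theory Submission
  imports Defs
begin

text \<open>For differential objects \<open>E\<close> and \<open>F\<close>, a linear map over \<open>A\<close> between the trivial bundles \<open>A \<times> E\<close> and \<open>A \<times> F\<close> amounts to an
  arrow \<open>h : A \<times> E \<rightarrow> F\<close> that is linear in its second argument.  The involution and the isomorphism
  \<open>(A \<times> E)\<^sup>* \<cong> A \<times> E\<^sup>*\<close> turn \<open>h\<close> into a transpose \<open>h\<^sup>\<dagger> : A \<times> F\<^sup>* \<rightarrow> E\<^sup>*\<close>.  Functoriality gives
  \<open>(\<langle>\<pi>\<^sub>0 f, e\<rangle> h)\<^sup>\<dagger>(a, w) = e\<^sup>\<dagger>(a, h\<^sup>\<dagger>(a f, w))\<close>, naturality of \<open>\<iota>\<close> makes \<open>\<dagger>\<close> involutive, and preservation of biproducts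
  determines it on pairings and zero maps.  Since \<open>\<nu> : A \<times> A \<cong> T(A)\<close>, every \<open>f : A \<rightarrow> B\<close> has a derivative
  \<open>D[f] : A \<times> A \<rightarrow> B\<close>, linear in the second argument, and \<open>R[f](a, y) = D[f]\<^sup>\<dagger>(a, y \<alpha>) \<alpha>\<^sup>-\<^sup>1\<close>.  This gives RD.1 to RD.5
  from the chain rule and from additivity of linear maps.  A map that is linear in its second argument is its own
  partial derivative there, so symmetry of the dualities and the involution law identify the forward derivative
  built from \<open>R\<close> with \<open>D\<close>.  Then RD.6 is linearity of \<open>R[f]\<close>, and RD.7 is the invariance of \<open>T\<^sup>2(f)\<close> under the flip.\<close>

section \<open>Product and pullback cones\<close>

text \<open>Three features of the definitions shape the proof. Pullbacks are arbitrary choices, so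
  pulling back along an identity gives an isomorphic bundle, not the same one; canonical
  isomorphisms are kept out of sight by evaluating at generalized elements, where they become
  pairings such as <a, w>. Linearity refers to \<lambda> alone, so additivity is derived: \<lambda>
  is monic and carries \<sigma> to the tangent addition, which is natural. Laws stated in X pass to
  their images under \<open>Tm\<close> by being taken at product projections, mapped, and
  precomposed with a pairing.

  The comparison of the double dual of A x E with A x (double dual of E) comes from naturality of
  \<iota> at the projection to E, whose transpose is again a projection. A sum is a pairing followed
  by \<sigma> and a zero map is an injection followed by the opposite projection, so both reduce to
  duals of biproduct diagrams. Symmetry of the dualities enters when a map is transposed twice, and
  again when the product duality is shown to be symmetric. Product bundles live over 1 x 1, so
  products of differential objects need a pullback along the diagonal of 1.\<close>

lemma in_Hom [simp]: "f \<in> Hom C A B \<longleftrightarrow> f \<in> Arr C \<and> Dom C f = A \<and> Cod C f = B"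
  by (simp add: Hom_def)

locale category_ctx =
  fixes C :: "('o, 'a, 'm) cat_scheme" (structure)
  assumes category_axiom: "category C"
begin

text \<open>The orientation of \<open>assoc\<close> makes simp normalize every composite to
  left-nested form. An equation f g = k then no longer matches inside a longer chain, so many later
  facts carry an extra arrow x in front.\<close>

lemma Dom_obj [simp]: "f \<in> Arr C \<Longrightarrow> Dom C f \<in> Obj C"
  and Cod_obj [simp]: "f \<in> Arr C \<Longrightarrow> Cod C f \<in> Obj C"
  and Idn_arr [simp]: "A \<in> Obj C \<Longrightarrow> Idn C A \<in> Arr C"
  and Dom_Idn [simp]: "A \<in> Obj C \<Longrightarrow> Dom C (Idn C A) = A"
  and Cod_Idn [simp]: "A \<in> Obj C \<Longrightarrow> Cod C (Idn C A) = A"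
  and comp_arr [simp]: "\<lbrakk>f \<in> Arr C; g \<in> Arr C; Cod C f = Dom C g\<rbrakk> \<Longrightarrow> f \<cdot> g \<in> Arr C"
  and Dom_comp [simp]: "\<lbrakk>f \<in> Arr C; g \<in> Arr C; Cod C f = Dom C g\<rbrakk> \<Longrightarrow> Dom C (f \<cdot> g) = Dom C f"
  and Cod_comp [simp]: "\<lbrakk>f \<in> Arr C; g \<in> Arr C; Cod C f = Dom C g\<rbrakk> \<Longrightarrow> Cod C (f \<cdot> g) = Cod C g"
  and Idn_left [simp]: "\<lbrakk>f \<in> Arr C; Dom C f = A\<rbrakk> \<Longrightarrow> Idn C A \<cdot> f = f"
  and Idn_right [simp]: "\<lbrakk>f \<in> Arr C; Cod C f = A\<rbrakk> \<Longrightarrow> f \<cdot> Idn C A = f"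
  and assoc [simp]: "\<lbrakk>f \<in> Arr C; g \<in> Arr C; h \<in> Arr C; Cod C f = Dom C g; Cod C g = Dom C h\<rbrakk>
    \<Longrightarrow> f \<cdot> (g \<cdot> h) = f \<cdot> g \<cdot> h"
  using category_axiom by (auto simp: category_def)

lemma terminal_arr_eq:
  "\<lbrakk>is_terminal C I; f \<in> Arr C; g \<in> Arr C; Dom C f = Dom C g; Cod C f = I; Cod C g = I\<rbrakk> \<Longrightarrow> f = g"
  unfolding is_terminal_def by (metis Dom_obj in_Hom)

lemma product_cone:
  assumes "is_product C A B c"
  shows "fst c \<in> Arr C" "snd c \<in> Arr C" "Dom C (snd c) = Dom C (fst c)"
    "Cod C (fst c) = A" "Cod C (snd c) = B"
  using assms by (auto simp: is_product_def apex_def)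

lemma product_mediates:
  assumes "is_product C A B c" "a \<in> Arr C" "b \<in> Arr C" "Dom C a = Dom C b" "Cod C a = A" "Cod C b = B"
  shows "mediates C c a b (tup C c a b)"
proof -
  have "\<exists>!h. mediates C c a b h"
    using assms by (auto simp: is_product_def)
  then show ?thesis unfolding tup_def by (rule theI')
qed

lemma product_tup:
  assumes "is_product C A B c" "a \<in> Arr C" "b \<in> Arr C" "Dom C a = Dom C b" "Cod C a = A" "Cod C b = B"
  shows "tup C c a b \<in> Arr C" "Dom C (tup C c a b) = Dom C b" "Cod C (tup C c a b) = Dom C (fst c)"
    "tup C c a b \<cdot> fst c = a" "tup C c a b \<cdot> snd c = b"
  using product_mediates[OF assms] assms by (auto simp: mediates_def apex_def)

lemma product_eqI:
  assumes "is_product C A B c" "h \<in> Arr C" "k \<in> Arr C" "Dom C h = Dom C k"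
    "Cod C h = Dom C (fst c)" "Cod C k = Dom C (fst c)"
    "h \<cdot> fst c = k \<cdot> fst c" "h \<cdot> snd c = k \<cdot> snd c"
  shows "h = k"
proof -
  note [simp] = product_cone[OF assms(1)]
  have "\<exists>!l. mediates C c (h \<cdot> fst c) (h \<cdot> snd c) l"
    using assms by (auto simp: is_product_def)
  moreover have "mediates C c (h \<cdot> fst c) (h \<cdot> snd c) h" "mediates C c (h \<cdot> fst c) (h \<cdot> snd c) k"
    using assms by (auto simp: mediates_def apex_def)
  ultimately show ?thesis by blast
qed

lemma product_comp_tup:
  assumes P: "is_product C A B c" and "a \<in> Arr C" "b \<in> Arr C" "Dom C a = Dom C b" "Cod C a = A" "Cod C b = B"
    "x \<in> Arr C" "Cod C x = Dom C b"
  shows "x \<cdot> tup C c a b = tup C c (x \<cdot> a) (x \<cdot> b)"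
proof -
  note [simp] = assms product_cone[OF P] product_tup[OF P]
  have "x \<cdot> tup C c a b \<cdot> fst c = x \<cdot> a"
    using assoc[of x "tup C c a b" "fst c"] by (simp del: assoc)
  moreover have "x \<cdot> tup C c a b \<cdot> snd c = x \<cdot> b"
    using assoc[of x "tup C c a b" "snd c"] by (simp del: assoc)
  ultimately show ?thesis by - (rule product_eqI[OF P], simp_all)
qed

lemma product_tup_eta:
  assumes P: "is_product C A B c" and "x \<in> Arr C" "Cod C x = Dom C (fst c)"
  shows "tup C c (x \<cdot> fst c) (x \<cdot> snd c) = x"
  using assms by - (rule product_eqI[OF P], (simp_all add: product_cone[OF P] product_tup[OF P]))

lemma product_tup_id:
  assumes P: "is_product C A B c"
  shows "tup C c (fst c) (snd c) = Idn C (Dom C (fst c))"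
  by (rule product_eqI[OF P]) (simp_all add: product_cone[OF P] product_tup[OF P])

lemmas product_simps = product_cone product_tup product_comp_tup product_tup_eta product_tup_id

lemma is_productI:
  assumes "fst c \<in> Arr C" "snd c \<in> Arr C" "Dom C (snd c) = Dom C (fst c)" "Cod C (fst c) = A" "Cod C (snd c) = B"
    "\<And>a b. \<lbrakk>a \<in> Arr C; b \<in> Arr C; Dom C a = Dom C b; Cod C a = A; Cod C b = B\<rbrakk> \<Longrightarrow>
      \<exists>h \<in> Arr C. Dom C h = Dom C b \<and> Cod C h = Dom C (fst c) \<and> h \<cdot> fst c = a \<and> h \<cdot> snd c = b"
    "\<And>h k. \<lbrakk>h \<in> Arr C; k \<in> Arr C; Dom C h = Dom C k; Cod C h = Dom C (fst c); Cod C k = Dom C (fst c);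
      h \<cdot> fst c = k \<cdot> fst c; h \<cdot> snd c = k \<cdot> snd c\<rbrakk> \<Longrightarrow> h = k"
  shows "is_product C A B c"
  unfolding is_product_def
proof (intro conjI allI ballI)
  fix Y a b assume "a \<in> Hom C Y A" "b \<in> Hom C Y B"
  then have ab: "a \<in> Arr C" "b \<in> Arr C" "Dom C a = Dom C b" "Cod C a = A" "Cod C b = B" by auto
  obtain h where "h \<in> Arr C" "Dom C h = Dom C b" "Cod C h = Dom C (fst c)" "h \<cdot> fst c = a" "h \<cdot> snd c = b"
    using assms(6)[OF ab] by blast
  then show "\<exists>!h. mediates C c a b h"
    using assms(7) ab by (intro ex1I[of _ h]) (auto simp: mediates_def apex_def)
qed (use assms in \<open>auto simp: apex_def\<close>)

lemma pullback_cone: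
  assumes "is_pullback C f g c"
  shows "f \<in> Arr C" "g \<in> Arr C" "Cod C f = Cod C g"
    "fst c \<in> Arr C" "snd c \<in> Arr C" "Dom C (snd c) = Dom C (fst c)"
    "Cod C (fst c) = Dom C f" "Cod C (snd c) = Dom C g" "fst c \<cdot> f = snd c \<cdot> g"
  using assms by (auto simp: is_pullback_def apex_def)

lemma pullback_mediates:
  assumes "is_pullback C f g c" "a \<in> Arr C" "b \<in> Arr C" "Dom C a = Dom C b" "Cod C a = Dom C f"
    "Cod C b = Dom C g" "a \<cdot> f = b \<cdot> g"
  shows "mediates C c a b (tup C c a b)"
proof -
  have "\<exists>!h. mediates C c a b h"
    using assms by (auto simp: is_pullback_def)
  then show ?thesis unfolding tup_def by (rule theI')
qed

lemma pullback_tup: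
  assumes "is_pullback C f g c" "a \<in> Arr C" "b \<in> Arr C" "Dom C a = Dom C b" "Cod C a = Dom C f"
    "Cod C b = Dom C g" "a \<cdot> f = b \<cdot> g"
  shows "tup C c a b \<in> Arr C" "Dom C (tup C c a b) = Dom C b" "Cod C (tup C c a b) = Dom C (fst c)"
    "tup C c a b \<cdot> fst c = a" "tup C c a b \<cdot> snd c = b"
  using pullback_mediates[OF assms] assms by (auto simp: mediates_def apex_def)

lemma pullback_eqI:
  assumes "is_pullback C f g c" "h \<in> Arr C" "k \<in> Arr C" "Dom C h = Dom C k"
    "Cod C h = Dom C (fst c)" "Cod C k = Dom C (fst c)"
    "h \<cdot> fst c = k \<cdot> fst c" "h \<cdot> snd c = k \<cdot> snd c"
  shows "h = k"
proof -
  note [simp] = pullback_cone(1,2,4-8)[OF assms(1)]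
  have eq: "h \<cdot> fst c \<cdot> f = h \<cdot> snd c \<cdot> g"
    using assms pullback_cone(9)[OF assms(1)] assoc[of h "fst c" f] assoc[of h "snd c" g] by simp
  have "\<exists>!l. mediates C c (h \<cdot> fst c) (h \<cdot> snd c) l"
    using assms eq unfolding is_pullback_def by (simp add: apex_def)
  moreover have "mediates C c (h \<cdot> fst c) (h \<cdot> snd c) h" "mediates C c (h \<cdot> fst c) (h \<cdot> snd c) k"
    using assms by (auto simp: mediates_def apex_def)
  ultimately show ?thesis by blast
qed

lemma pullback_comp_tup:
  assumes P: "is_pullback C f g c" and "a \<in> Arr C" "b \<in> Arr C" "Dom C a = Dom C b" "Cod C a = Dom C f"
    "Cod C b = Dom C g" "a \<cdot> f = b \<cdot> g" "x \<in> Arr C" "Cod C x = Dom C b"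
  shows "x \<cdot> tup C c a b = tup C c (x \<cdot> a) (x \<cdot> b)"
proof -
  note [simp] = assms(2-6,8-) pullback_cone(1,2,4-8)[OF P]
  note T [simp] = pullback_tup(1-3)[OF P _ _ _ _ _ assms(7)]
  note T45 = pullback_tup(4,5)[OF P _ _ _ _ _ assms(7)]
  have eq: "x \<cdot> a \<cdot> f = x \<cdot> b \<cdot> g" using assms(7) assoc[of x a f] assoc[of x b g] by simp
  note T' [simp] = pullback_tup[OF P _ _ _ _ _ eq]
  have "x \<cdot> tup C c a b \<cdot> fst c = x \<cdot> a"
    using assoc[of x "tup C c a b" "fst c"] by (simp del: assoc add: T45)
  moreover have "x \<cdot> tup C c a b \<cdot> snd c = x \<cdot> b"
    using assoc[of x "tup C c a b" "snd c"] by (simp del: assoc add: T45)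
  ultimately show ?thesis by - (rule pullback_eqI[OF P], simp_all)
qed

lemma pullback_tup_eta:
  assumes P: "is_pullback C f g c" and "x \<in> Arr C" "Cod C x = Dom C (fst c)"
  shows "tup C c (x \<cdot> fst c) (x \<cdot> snd c) = x"
proof -
  note [simp] = pullback_cone(1,2,4-8)[OF P]
  have "x \<cdot> fst c \<cdot> f = x \<cdot> snd c \<cdot> g"
    using assms pullback_cone(9)[OF P] assoc[of x "fst c" f] assoc[of x "snd c" g] by simp
  note [simp] = pullback_tup[OF P _ _ _ _ _ this]
  show ?thesis using assms by - (rule pullback_eqI[OF P], simp_all)
qed

text \<open>Any pullback at all makes the \<open>SOME\<close> in \<open>pb\<close> meaningful;
  existence will come from the bundle axioms.\<close>

lemma pb_is_pullback: "is_pullback C f g c \<Longrightarrow> is_pullback C f g (pb C f g)"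
  unfolding pb_def by (rule someI)

text \<open>Over a terminal object the two legs always agree, so the pullbacks attached to a
  differential object are ordinary products.\<close>

lemma pullback_over_terminal:
  assumes "is_pullback C f g c" "is_terminal C (Cod C f)"
  shows "is_product C (Dom C f) (Dom C g) c"
proof (rule is_productI)
  note [simp] = pullback_cone(1,2,4-8)[OF assms(1)]
  fix a b assume ab: "a \<in> Arr C" "b \<in> Arr C" "Dom C a = Dom C b" "Cod C a = Dom C f" "Cod C b = Dom C g"
  then have "a \<cdot> f = b \<cdot> g"
    using pullback_cone(3)[OF assms(1)] by - (rule terminal_arr_eq[OF assms(2)], simp_all)
  from pullback_tup[OF assms(1) ab this]
  show "\<exists>h \<in> Arr C. Dom C h = Dom C b \<and> Cod C h = Dom C (fst c) \<and> h \<cdot> fst c = a \<and> h \<cdot> snd c = b"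
    by (intro bexI[of _ "tup C c a b"] conjI)
next
  fix h k assume "h \<in> Arr C" "k \<in> Arr C" "Dom C h = Dom C k" "Cod C h = Dom C (fst c)" "Cod C k = Dom C (fst c)"
      "h \<cdot> fst c = k \<cdot> fst c" "h \<cdot> snd c = k \<cdot> snd c"
  then show "h = k" by (rule pullback_eqI[OF assms(1)])
qed (use pullback_cone[OF assms(1)] in auto)

lemma product_is_pullback:
  assumes "is_product C A B c" "is_terminal C I" "f \<in> Hom C A I" "g \<in> Hom C B I"
  shows "is_pullback C f g c"
  unfolding is_pullback_def
proof (intro conjI allI ballI impI)
  note [simp] = product_cone[OF assms(1)]
  show "fst c \<cdot> f = snd c \<cdot> g" using assms by - (rule terminal_arr_eq[OF assms(2)], auto)
  fix Y a b assume "a \<in> Hom C Y (Dom C f)" "b \<in> Hom C Y (Dom C g)"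
  then show "\<exists>!h. mediates C c a b h" using assms by (auto simp: is_product_def)
qed (use assms product_cone[OF assms(1)] in \<open>auto simp: apex_def\<close>)

lemma inverse_pair_unique:
  assumes "inverse_pair C f g" "inverse_pair C f g'"
  shows "g = g'"
proof -
  have g: "g \<in> Arr C" "Dom C g = Cod C f" "Cod C g = Dom C f" "g \<cdot> f = Idn C (Cod C f)"
    and g': "g' \<in> Arr C" "Dom C g' = Cod C f" "Cod C g' = Dom C f" "f \<cdot> g' = Idn C (Dom C f)"
    and f: "f \<in> Arr C"
    using assms by (simp_all add: inverse_pair_def)
  have "g \<cdot> (f \<cdot> g') = g" using g f by (simp add: g'(4) del: assoc)
  moreover have "g \<cdot> (f \<cdot> g') = g'" using g g'(1-3) f by simp
  ultimately show ?thesis by simp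
qed

lemma inv_arr_eq: "inverse_pair C f g \<Longrightarrow> inv_arr C f = g"
  unfolding inv_arr_def by (blast intro: the_equality inverse_pair_unique)

end

section \<open>Additions in a Cartesian tangent category\<close>

locale tangent_ctx = category_ctx X for X :: "('o, 'a, 'm) tangent_cat_scheme" (structure) +
  assumes cartesian_tangent: "cartesian_tangent_category X"
begin

lemma tangent: "tangent_category X"
  using cartesian_tangent by (simp add: cartesian_tangent_category_def)

lemmas tangent_obj = tangent[unfolded tangent_category_def Let_def, THEN conjunct2, THEN conjunct2, THEN conjunct1, THEN bspec]
lemmas tangent_arr = tangent[unfolded tangent_category_def Let_def, THEN conjunct2, THEN conjunct2, THEN conjunct2, THEN bspec]

lemma T_functor: "is_functor X X (To X) (Tm X)"
  using tangent by (simp add: tangent_category_def)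

lemma T_obj [simp]: "A \<in> Obj X \<Longrightarrow> To X A \<in> Obj X"
  and T_arr [simp]: "f \<in> Arr X \<Longrightarrow> Tm X f \<in> Arr X"
  and Dom_T [simp]: "f \<in> Arr X \<Longrightarrow> Dom X (Tm X f) = To X (Dom X f)"
  and Cod_T [simp]: "f \<in> Arr X \<Longrightarrow> Cod X (Tm X f) = To X (Cod X f)"
  and T_Idn [simp]: "A \<in> Obj X \<Longrightarrow> Tm X (Idn X A) = Idn X (To X A)"
  and T_comp [simp]: "\<lbrakk>f \<in> Arr X; g \<in> Arr X; Cod X f = Dom X g\<rbrakk> \<Longrightarrow> Tm X (f \<cdot> g) = Tm X f \<cdot> Tm X g"
  using T_functor by (auto simp: is_functor_def)

lemma tp_arr [simp]: "A \<in> Obj X \<Longrightarrow> tp X A \<in> Arr X" "A \<in> Obj X \<Longrightarrow> Dom X (tp X A) = To X A"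
    "A \<in> Obj X \<Longrightarrow> Cod X (tp X A) = A"
  and ts_arr [simp]: "A \<in> Obj X \<Longrightarrow> ts X A \<in> Arr X" "A \<in> Obj X \<Longrightarrow> Dom X (ts X A) = Dom X (fst (T2 X A))"
    "A \<in> Obj X \<Longrightarrow> Cod X (ts X A) = To X A"
  and tz_arr [simp]: "A \<in> Obj X \<Longrightarrow> tz X A \<in> Arr X" "A \<in> Obj X \<Longrightarrow> Dom X (tz X A) = A"
    "A \<in> Obj X \<Longrightarrow> Cod X (tz X A) = To X A"
  and tl_arr [simp]: "A \<in> Obj X \<Longrightarrow> tl X A \<in> Arr X" "A \<in> Obj X \<Longrightarrow> Dom X (tl X A) = To X A"
    "A \<in> Obj X \<Longrightarrow> Cod X (tl X A) = To X (To X A)"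
  and tc_arr [simp]: "A \<in> Obj X \<Longrightarrow> tc X A \<in> Arr X" "A \<in> Obj X \<Longrightarrow> Dom X (tc X A) = To X (To X A)"
    "A \<in> Obj X \<Longrightarrow> Cod X (tc X A) = To X (To X A)"
  using tangent_obj by (simp_all add: apex_def)

text \<open>The precomposed shape that left-nested normal forms require; naturality squares and
  bundle axioms are fed through it.\<close>

lemma comp_eq_precomp:
  assumes "f \<cdot> g = h \<cdot> k" "f \<in> Arr X" "g \<in> Arr X" "h \<in> Arr X" "k \<in> Arr X" "x \<in> Arr X"
    "Cod X x = Dom X f" "Cod X f = Dom X g" "Cod X x = Dom X h" "Cod X h = Dom X k"
  shows "x \<cdot> f \<cdot> g = x \<cdot> h \<cdot> k"
  using assms assoc[of x f g] assoc[of x h k] by (simp del: assoc)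

lemma comp_eq_precomp1:
  assumes "f \<cdot> g = k" "x \<in> Arr X" "f \<in> Arr X" "g \<in> Arr X" "Cod X x = Dom X f" "Cod X f = Dom X g"
  shows "x \<cdot> f \<cdot> g = x \<cdot> k"
  using assms(2-) by (simp add: assms(1)[symmetric])

section \<open>The tangent transformations at generalized elements\<close>

lemma tp_natural:
  assumes "x \<in> Arr X" "f \<in> Arr X" "Cod X x = To X (Dom X f)" "Cod X f = B"
  shows "x \<cdot> Tm X f \<cdot> tp X B = x \<cdot> tp X (Dom X f) \<cdot> f"
  by (rule comp_eq_precomp) (use assms Cod_obj[OF assms(2)] tangent_arr[of f] in simp_all)

lemma tz_natural:
  assumes "x \<in> Arr X" "f \<in> Arr X" "Cod X x = A" "Dom X f = A"
  shows "x \<cdot> tz X A \<cdot> Tm X f = x \<cdot> f \<cdot> tz X (Cod X f)"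
  by (rule comp_eq_precomp) (use assms Dom_obj[OF assms(2)] tangent_arr[of f] in simp_all)

lemma tl_natural:
  assumes "x \<in> Arr X" "f \<in> Arr X" "Cod X x = To X A" "Dom X f = A"
  shows "x \<cdot> tl X A \<cdot> Tm X (Tm X f) = x \<cdot> Tm X f \<cdot> tl X (Cod X f)"
  by (rule comp_eq_precomp) (use assms Dom_obj[OF assms(2)] tangent_arr[of f] in simp_all)

lemma tc_natural:
  assumes "x \<in> Arr X" "f \<in> Arr X" "Cod X x = To X (To X A)" "Dom X f = A"
  shows "x \<cdot> tc X A \<cdot> Tm X (Tm X f) = x \<cdot> Tm X (Tm X f) \<cdot> tc X (Cod X f)"
  by (rule comp_eq_precomp) (use assms Dom_obj[OF assms(2)] tangent_arr[of f] in simp_all)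

lemma tz_tc:
  assumes "x \<in> Arr X" "Cod X x = To X A" "A \<in> Obj X"
  shows "x \<cdot> Tm X (tz X A) \<cdot> tc X A = x \<cdot> tz X (To X A)"
  using assms tangent_obj[of A] assoc[of x "Tm X (tz X A)" "tc X A"] by (simp del: assoc)

text \<open>\<open>tz_tc\<close> followed by the flip, which is an involution.\<close>

lemma tz_T_tc:
  assumes "x \<in> Arr X" "Cod X x = To X A" "A \<in> Obj X"
  shows "x \<cdot> tz X (To X A) \<cdot> tc X A = x \<cdot> Tm X (tz X A)"
proof -
  have "x \<cdot> Tm X (tz X A) \<cdot> (tc X A \<cdot> tc X A) = x \<cdot> Tm X (tz X A)"
    using assms tangent_obj[of A] by (simp del: assoc)
  then show ?thesis using assms by (simp add: tz_tc)
qed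

lemma tl_tc:
  assumes "x \<in> Arr X" "Cod X x = To X A" "A \<in> Obj X"
  shows "x \<cdot> tl X A \<cdot> tc X A = x \<cdot> tl X A"
  using assms tangent_obj[of A] assoc[of x "tl X A" "tc X A"] by (simp del: assoc)

lemma tz_tl:
  assumes "x \<in> Arr X" "Cod X x = A" "A \<in> Obj X"
  shows "x \<cdot> tz X A \<cdot> tl X A = x \<cdot> tz X A \<cdot> Tm X (tz X A)"
  by (rule comp_eq_precomp) (use assms tangent_obj[of A] in simp_all)

lemma fst_Tcone [simp]: "fst (Tcone X c) = Tm X (fst c)"
  and snd_Tcone [simp]: "snd (Tcone X c) = Tm X (snd c)"
  by (simp_all add: Tcone_def)

lemma one_terminal: "is_terminal X (one X)"
proof -
  obtain I where "is_terminal X I"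
    using cartesian_tangent by (auto simp: cartesian_tangent_category_def has_finite_products_def)
  then show ?thesis unfolding one_def by (rule someI)
qed

lemma one_obj [simp]: "one X \<in> Obj X"
  using one_terminal by (simp add: is_terminal_def)

lemma T_terminal: "is_terminal X I \<Longrightarrow> is_terminal X (To X I)"
  using cartesian_tangent by (simp add: cartesian_tangent_category_def)

lemma prd_product: "A \<in> Obj X \<Longrightarrow> B \<in> Obj X \<Longrightarrow> is_product X A B (prd X A B)"
  using cartesian_tangent unfolding cartesian_tangent_category_def has_finite_products_def prd_def
  by (blast intro: someI_ex)

lemma T_product:
  assumes "is_product X A B c"
  shows "is_product X (To X A) (To X B) (Tcone X c)"
proof -
  have "A \<in> Obj X" "B \<in> Obj X"
    using product_cone[OF assms] Cod_obj by metis+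
  then show ?thesis using assms cartesian_tangent unfolding cartesian_tangent_category_def by blast
qed

lemmas T_product_tup = product_tup[OF T_product, unfolded fst_Tcone snd_Tcone]
  and T_product_comp_tup = product_comp_tup[OF T_product, unfolded fst_Tcone snd_Tcone]
  and T_product_eqI = product_eqI[OF T_product, unfolded fst_Tcone snd_Tcone]
  and TT_product_tup = product_tup[OF T_product[OF T_product], unfolded fst_Tcone snd_Tcone]
  and TT_product_eqI = product_eqI[OF T_product[OF T_product], unfolded fst_Tcone snd_Tcone]

lemma product_obj [simp]:
  assumes "is_product X A B c"
  shows "A \<in> Obj X" "B \<in> Obj X" "Dom X (fst c) \<in> Obj X"
  using product_cone[OF assms] Cod_obj Dom_obj by metis+

lemma T_tup:
  assumes P: "is_product X A B c" and "a \<in> Arr X" "b \<in> Arr X" "Dom X a = Dom X b" "Cod X a = A" "Cod X b = B"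
  shows "Tm X (tup X c a b) = tup X (Tcone X c) (Tm X a) (Tm X b)"
proof -
  note [simp] = product_cone[OF P]
  note ab = assms(2-)
  have "Tm X (tup X c a b) \<cdot> Tm X (fst c) = Tm X a"
    using T_comp[of "tup X c a b" "fst c"] product_tup[OF P ab] by (simp del: T_comp)
  moreover have "Tm X (tup X c a b) \<cdot> Tm X (snd c) = Tm X b"
    using T_comp[of "tup X c a b" "snd c"] product_tup[OF P ab] by (simp del: T_comp)
  ultimately show ?thesis
    using ab product_tup(1-3)[OF P ab]
    by - (rule T_product_eqI[OF P], simp_all add: T_product_tup[OF P])
qed

text \<open>Naturality at both projections makes the transformation act componentwise on a pairing.
  The same argument gives the versions for \<open>tp\<close>, \<open>tl\<close> and
  \<open>tc\<close>.\<close>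

lemma tz_tup:
  assumes P: "is_product X A B c" and "a \<in> Arr X" "b \<in> Arr X" "Dom X a = Dom X b" "Cod X a = A" "Cod X b = B"
    and "D = Dom X (fst c)"
  shows "tup X c a b \<cdot> tz X D = tup X (Tcone X c) (a \<cdot> tz X A) (b \<cdot> tz X B)"
  using assms(2-) product_obj[OF P]
  by - (rule T_product_eqI[OF P], simp_all add: product_simps[OF P] T_product_tup[OF P] tz_natural)

lemma tp_tup:
  assumes P: "is_product X A B c" and "a \<in> Arr X" "b \<in> Arr X" "Dom X a = Dom X b"
    "Cod X a = To X A" "Cod X b = To X B" and "D = Dom X (fst c)"
  shows "tup X (Tcone X c) a b \<cdot> tp X D = tup X c (a \<cdot> tp X A) (b \<cdot> tp X B)"
proof -
  note [simp] = assms(2-) product_obj[OF P] product_cone[OF P] product_tup[OF P] T_product_tup[OF P]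
  have "tup X (Tcone X c) a b \<cdot> tp X D \<cdot> fst c = a \<cdot> tp X A"
    "tup X (Tcone X c) a b \<cdot> tp X D \<cdot> snd c = b \<cdot> tp X B"
    using tp_natural[of "tup X (Tcone X c) a b" "fst c" A] tp_natural[of "tup X (Tcone X c) a b" "snd c" B] by simp_all
  then show ?thesis by - (rule product_eqI[OF P], simp_all)
qed

lemma tl_tup:
  assumes P: "is_product X A B c" and "a \<in> Arr X" "b \<in> Arr X" "Dom X a = Dom X b"
    "Cod X a = To X A" "Cod X b = To X B" and "D = Dom X (fst c)"
  shows "tup X (Tcone X c) a b \<cdot> tl X D = tup X (Tcone X (Tcone X c)) (a \<cdot> tl X A) (b \<cdot> tl X B)"
  using assms(2-) product_obj[OF P]
  by - (rule TT_product_eqI[OF P], simp_all add: product_cone[OF P]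
     T_product_tup[OF P] TT_product_tup[OF P] tl_natural)

lemma tc_tup:
  assumes P: "is_product X A B c" and "a \<in> Arr X" "b \<in> Arr X" "Dom X a = Dom X b"
    "Cod X a = To X (To X A)" "Cod X b = To X (To X B)" and "D = Dom X (fst c)"
  shows "tup X (Tcone X (Tcone X c)) a b \<cdot> tc X D = tup X (Tcone X (Tcone X c)) (a \<cdot> tc X A) (b \<cdot> tc X B)"
  using assms(2-) product_obj[OF P]
  by - (rule TT_product_eqI[OF P], simp_all add: product_cone[OF P]
     TT_product_tup[OF P] tc_natural)

text \<open>Arrows \<open>Y \<rightarrow> M\<close> serve as generalized elements of \<open>M\<close> throughout: equations are stated for the values \<open>\<langle>a, b\<rangle> \<sigma>\<close>
  and \<open>a f\<close>, so that composition associates to the left.\<close>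

definition madd :: "'a \<times> 'a \<Rightarrow> 'a \<Rightarrow> 'a \<Rightarrow> 'a \<Rightarrow> 'a" where
  "madd c \<sigma> a b = tup X c a b \<cdot> \<sigma>"

text \<open>An addition before any law is imposed. That \<open>tz\<close>, \<open>tp\<close>,
  \<open>tl\<close>, \<open>tc\<close> and T respect it is naturality or functoriality at \<sigma>,
  so these facts can be reused for all iterates of T.\<close>

definition magma :: "'o \<Rightarrow> 'a \<times> 'a \<Rightarrow> 'a \<Rightarrow> bool" where
  "magma M c \<sigma> \<longleftrightarrow> is_product X M M c \<and> \<sigma> \<in> Arr X \<and> Dom X \<sigma> = Dom X (fst c) \<and> Cod X \<sigma> = M"

lemma magma_facts:
  assumes "magma M c \<sigma>"
  shows "is_product X M M c" "\<sigma> \<in> Arr X" "Dom X \<sigma> = Dom X (fst c)" "Cod X \<sigma> = M" "M \<in> Obj X"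
  using assms by (auto simp: magma_def)

lemma magma_T: "magma M c \<sigma> \<Longrightarrow> magma (To X M) (Tcone X c) (Tm X \<sigma>)"
  using product_cone(1,2)[of M M c] by (simp add: magma_def T_product)

context
  fixes M c \<sigma> assumes mg: "magma M c \<sigma>"
begin

lemma madd_arr:
  assumes "a \<in> Arr X" "b \<in> Arr X" "Dom X a = Dom X b" "Cod X a = M" "Cod X b = M"
  shows "madd c \<sigma> a b \<in> Arr X" "Dom X (madd c \<sigma> a b) = Dom X b" "Cod X (madd c \<sigma> a b) = M"
  using magma_facts[OF mg] product_tup[OF magma_facts(1)[OF mg] assms] by (simp_all add: madd_def)

lemma comp_madd:
  assumes "x \<in> Arr X" "a \<in> Arr X" "b \<in> Arr X" "Dom X a = Dom X b" "Cod X a = M" "Cod X b = M" "Cod X x = Dom X b"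
  shows "x \<cdot> madd c \<sigma> a b = madd c \<sigma> (x \<cdot> a) (x \<cdot> b)"
  using assms magma_facts[OF mg] by (simp add: product_simps[OF magma_facts(1)[OF mg]] madd_def)

lemma T_madd:
  assumes "a \<in> Arr X" "b \<in> Arr X" "Dom X a = Dom X b" "Cod X a = M" "Cod X b = M"
  shows "Tm X (madd c \<sigma> a b) = madd (Tcone X c) (Tm X \<sigma>) (Tm X a) (Tm X b)"
  using assms magma_facts[OF mg] T_tup[OF magma_facts(1)[OF mg] assms]
  by (simp add: madd_def product_tup[OF magma_facts(1)[OF mg]])

lemma madd_tz:
  assumes "a \<in> Arr X" "b \<in> Arr X" "Dom X a = Dom X b" "Cod X a = M" "Cod X b = M"
  shows "madd c \<sigma> a b \<cdot> tz X M = madd (Tcone X c) (Tm X \<sigma>) (a \<cdot> tz X M) (b \<cdot> tz X M)"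
proof -
  note P = magma_facts(1)[OF mg]
  show ?thesis unfolding madd_def
    using assms magma_facts[OF mg] product_tup[OF P assms]
      tz_natural[of "tup X c a b" \<sigma> "Dom X (fst c)"] tz_tup[OF P assms]
    by simp
qed

lemma madd_tp:
  assumes "a \<in> Arr X" "b \<in> Arr X" "Dom X a = Dom X b" "Cod X a = To X M" "Cod X b = To X M"
  shows "madd (Tcone X c) (Tm X \<sigma>) a b \<cdot> tp X M = madd c \<sigma> (a \<cdot> tp X M) (b \<cdot> tp X M)"
proof -
  note P = magma_facts(1)[OF mg]
  show ?thesis unfolding madd_def
    using assms magma_facts[OF mg] product_cone[OF P] T_product_tup[OF P assms]
      tp_natural[of "tup X (Tcone X c) a b" \<sigma> M] tp_tup[OF P assms]
    by simp
qed

lemma madd_tl: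
  assumes "a \<in> Arr X" "b \<in> Arr X" "Dom X a = Dom X b" "Cod X a = To X M" "Cod X b = To X M"
  shows "madd (Tcone X c) (Tm X \<sigma>) a b \<cdot> tl X M
    = madd (Tcone X (Tcone X c)) (Tm X (Tm X \<sigma>)) (a \<cdot> tl X M) (b \<cdot> tl X M)"
proof -
  note P = magma_facts(1)[OF mg]
  show ?thesis unfolding madd_def
    using assms magma_facts[OF mg] product_cone[OF P] T_product_tup[OF P assms]
      tl_natural[of "tup X (Tcone X c) a b" \<sigma> "Dom X (fst c)"] tl_tup[OF P assms]
    by simp
qed

lemma madd_tc:
  assumes "a \<in> Arr X" "b \<in> Arr X" "Dom X a = Dom X b" "Cod X a = To X (To X M)" "Cod X b = To X (To X M)"
  shows "madd (Tcone X (Tcone X c)) (Tm X (Tm X \<sigma>)) a b \<cdot> tc X M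
    = madd (Tcone X (Tcone X c)) (Tm X (Tm X \<sigma>)) (a \<cdot> tc X M) (b \<cdot> tc X M)"
proof -
  note P = magma_facts(1)[OF mg]
  show ?thesis unfolding madd_def
    using assms magma_facts[OF mg] product_cone[OF P] TT_product_tup[OF P assms]
      tc_natural[of "tup X (Tcone X (Tcone X c)) a b" \<sigma> "Dom X (fst c)"] tc_tup[OF P assms]
    by simp
qed

lemma madd_hom:
  assumes "magma N d \<tau>" "g \<in> Arr X" "Dom X g = M" "Cod X g = N"
    "\<sigma> \<cdot> g = tup X d (fst c \<cdot> g) (snd c \<cdot> g) \<cdot> \<tau>"
    "a \<in> Arr X" "b \<in> Arr X" "Dom X a = Dom X b" "Cod X a = M" "Cod X b = M"
  shows "madd c \<sigma> a b \<cdot> g = madd d \<tau> (a \<cdot> g) (b \<cdot> g)"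
proof -
  note P = magma_facts(1)[OF mg] and Q = magma_facts(1)[OF assms(1)]
  note [simp] = assms(2-4,6-) magma_facts[OF mg] magma_facts[OF assms(1)] product_simps[OF P] product_simps[OF Q]
  have "tup X c a b \<cdot> \<sigma> \<cdot> g = tup X c a b \<cdot> tup X d (fst c \<cdot> g) (snd c \<cdot> g) \<cdot> \<tau>"
    by (rule comp_eq_precomp[OF assms(5)]) (simp_all del: product_comp_tup)
  then show ?thesis by (simp add: madd_def)
qed

end

text \<open>The unit is recorded by the constant endomorphism \<open>e\<close> of \<open>M\<close> rather than by a point \<open>1 \<rightarrow> M\<close>, so that
  the notion is visibly stable under \<open>T\<close>.\<close>

definition cmon :: "'o \<Rightarrow> 'a \<times> 'a \<Rightarrow> 'a \<Rightarrow> 'a \<Rightarrow> bool" where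
  "cmon M c \<sigma> e \<longleftrightarrow> magma M c \<sigma> \<and> e \<in> Hom X M M \<and>
     (\<forall>Y. \<forall>a \<in> Hom X Y M. \<forall>b \<in> Hom X Y M.
        madd c \<sigma> a b = madd c \<sigma> b a \<and> a \<cdot> e = b \<cdot> e \<and> madd c \<sigma> a (b \<cdot> e) = a \<and>
        (\<forall>d \<in> Hom X Y M. madd c \<sigma> (madd c \<sigma> a b) d = madd c \<sigma> a (madd c \<sigma> b d)))"

lemma cmonD:
  assumes "cmon M c \<sigma> e"
  shows "magma M c \<sigma>" "e \<in> Arr X" "Dom X e = M" "Cod X e = M"
  using assms by (simp_all add: cmon_def)

context
  fixes M c \<sigma> e assumes cm: "cmon M c \<sigma> e"
begin

lemma cmon_laws:
  assumes "a \<in> Arr X" "b \<in> Arr X" "Dom X a = Dom X b" "Cod X a = M" "Cod X b = M"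
  shows "madd c \<sigma> a b = madd c \<sigma> b a \<and> a \<cdot> e = b \<cdot> e \<and> madd c \<sigma> a (b \<cdot> e) = a \<and>
    (\<forall>d \<in> Hom X (Dom X b) M. madd c \<sigma> (madd c \<sigma> a b) d = madd c \<sigma> a (madd c \<sigma> b d))"
  by (rule cm[unfolded cmon_def, THEN conjunct2, THEN conjunct2, THEN spec, THEN bspec, THEN bspec])
    (use assms in simp_all)

lemma madd_comm:
  "\<lbrakk>a \<in> Arr X; b \<in> Arr X; Dom X a = Dom X b; Cod X a = M; Cod X b = M\<rbrakk> \<Longrightarrow> madd c \<sigma> a b = madd c \<sigma> b a"
  by (rule cmon_laws[THEN conjunct1])

lemma zero_eq:
  "\<lbrakk>a \<in> Arr X; b \<in> Arr X; Dom X a = Dom X b; Cod X a = M; Cod X b = M\<rbrakk> \<Longrightarrow> a \<cdot> e = b \<cdot> e"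
  by (rule cmon_laws[THEN conjunct2, THEN conjunct1])

lemma madd_zero:
  "\<lbrakk>a \<in> Arr X; b \<in> Arr X; Dom X a = Dom X b; Cod X a = M; Cod X b = M\<rbrakk> \<Longrightarrow> madd c \<sigma> a (b \<cdot> e) = a"
  by (rule cmon_laws[THEN conjunct2, THEN conjunct2, THEN conjunct1])

lemma madd_assoc:
  "\<lbrakk>a \<in> Arr X; b \<in> Arr X; d \<in> Arr X; Dom X a = Dom X d; Dom X b = Dom X d; Cod X a = M; Cod X b = M; Cod X d = M\<rbrakk>
    \<Longrightarrow> madd c \<sigma> (madd c \<sigma> a b) d = madd c \<sigma> a (madd c \<sigma> b d)"
  by (rule cmon_laws[THEN conjunct2, THEN conjunct2, THEN conjunct2, THEN bspec]) simp_all

lemma madd_interchange: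
  assumes "a \<in> Arr X" "b \<in> Arr X" "d \<in> Arr X" "f \<in> Arr X" "Dom X a = Dom X f" "Dom X b = Dom X f" "Dom X d = Dom X f"
    "Cod X a = M" "Cod X b = M" "Cod X d = M" "Cod X f = M"
  shows "madd c \<sigma> (madd c \<sigma> a b) (madd c \<sigma> d f) = madd c \<sigma> (madd c \<sigma> a d) (madd c \<sigma> b f)"
proof -
  note [simp] = assms madd_arr[OF cmonD(1)[OF cm]]
  have "madd c \<sigma> (madd c \<sigma> a b) (madd c \<sigma> d f) = madd c \<sigma> a (madd c \<sigma> (madd c \<sigma> b d) f)"
    by (simp add: madd_assoc)
  also have "madd c \<sigma> b d = madd c \<sigma> d b" by (simp add: madd_comm)
  also have "madd c \<sigma> a (madd c \<sigma> (madd c \<sigma> d b) f) = madd c \<sigma> (madd c \<sigma> a d) (madd c \<sigma> b f)"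
    by (simp add: madd_assoc)
  finally show ?thesis .
qed

text \<open>The laws quantify over elements of M, and T yields them only for images of such
  elements. They are therefore taken at universal elements, mapped by T, and precomposed with a
  pairing into the T-image of the product.\<close>

lemma cmon_T: "cmon (To X M) (Tcone X c) (Tm X \<sigma>) (Tm X e)"
proof -
  note mg = cmonD(1)[OF cm]
  note P = magma_facts(1)[OF mg]
  note [simp] = cmonD(2-)[OF cm] magma_facts(2-)[OF mg] product_cone[OF P]
    madd_arr[OF mg] madd_arr[OF magma_T[OF mg]] comp_madd[OF mg] comp_madd[OF magma_T[OF mg]] T_madd[OF mg]
  note [simp] = T_product_tup[OF P]
  \<comment> \<open>The product of the apex of c with M carries the universal triple that
    associativity needs.\<close>
  define C3 where "C3 = prd X (Dom X (fst c)) M"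
  have P3: "is_product X (Dom X (fst c)) M C3" unfolding C3_def by (rule prd_product) simp_all
  note [simp] = product_cone[OF P3] T_product_tup[OF P3]
  have comm: "madd (Tcone X c) (Tm X \<sigma>) (Tm X (fst c)) (Tm X (snd c)) = madd (Tcone X c) (Tm X \<sigma>) (Tm X (snd c)) (Tm X (fst c))"
    using arg_cong[OF madd_comm[of "fst c" "snd c"], of "Tm X"] by simp
  have zero: "Tm X (fst c) \<cdot> Tm X e = Tm X (snd c) \<cdot> Tm X e"
    using arg_cong[OF zero_eq[of "fst c" "snd c"], of "Tm X"] by simp
  have mzero: "madd (Tcone X c) (Tm X \<sigma>) (Tm X (fst c)) (Tm X (snd c) \<cdot> Tm X e) = Tm X (fst c)"
    using arg_cong[OF madd_zero[of "fst c" "snd c"], of "Tm X"] by simp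
  let ?a = "fst C3 \<cdot> fst c" and ?b = "fst C3 \<cdot> snd c" and ?d = "snd C3"
  have ass: "madd (Tcone X c) (Tm X \<sigma>) (madd (Tcone X c) (Tm X \<sigma>) (Tm X ?a) (Tm X ?b)) (Tm X ?d)
     = madd (Tcone X c) (Tm X \<sigma>) (Tm X ?a) (madd (Tcone X c) (Tm X \<sigma>) (Tm X ?b) (Tm X ?d))"
    using arg_cong[OF madd_assoc[of ?a ?b ?d], of "Tm X"] by simp
  show ?thesis unfolding cmon_def
  proof (intro conjI allI ballI)
    show "magma (To X M) (Tcone X c) (Tm X \<sigma>)" by (rule magma_T[OF mg])
    show "Tm X e \<in> Hom X (To X M) (To X M)" by simp
    fix Y a b assume "a \<in> Hom X Y (To X M)" "b \<in> Hom X Y (To X M)"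
    then have [simp]: "a \<in> Arr X" "b \<in> Arr X" "Dom X a = Y" "Dom X b = Y" "Cod X a = To X M" "Cod X b = To X M"
      by simp_all
    let ?g = "tup X (Tcone X c) a b"
    show "madd (Tcone X c) (Tm X \<sigma>) a b = madd (Tcone X c) (Tm X \<sigma>) b a"
      using arg_cong[OF comm, of "\<lambda>u. ?g \<cdot> u"] T_product_tup[OF P, of a b] by simp
    show "a \<cdot> Tm X e = b \<cdot> Tm X e"
      using arg_cong[OF zero, of "\<lambda>u. ?g \<cdot> u"] T_product_tup[OF P, of a b] by simp
    show "madd (Tcone X c) (Tm X \<sigma>) a (b \<cdot> Tm X e) = a"
      using arg_cong[OF mzero, of "\<lambda>u. ?g \<cdot> u"] T_product_tup[OF P, of a b] by simp
    fix d assume "d \<in> Hom X Y (To X M)"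
    then have [simp]: "d \<in> Arr X" "Dom X d = Y" "Cod X d = To X M" by simp_all
    let ?k = "tup X (Tcone X C3) ?g d"
    show "madd (Tcone X c) (Tm X \<sigma>) (madd (Tcone X c) (Tm X \<sigma>) a b) d = madd (Tcone X c) (Tm X \<sigma>) a (madd (Tcone X c) (Tm X \<sigma>) b d)"
      using arg_cong[OF ass, of "\<lambda>u. ?k \<cdot> u"] T_product_tup[OF P3, of ?g d]
        T_product_tup[OF P, of a b] by simp
  qed
qed

end

text \<open>Bundle axioms assert n-fold pullbacks whereas additions start at the binary
  \<open>pb\<close>; the case n = 2 translates between the two.\<close>

lemma nfold_two_pullback:
  assumes "is_nfold_pullback X q 2 r \<pi>"
  shows "is_pullback X q q (\<pi> 0, \<pi> 1)"
proof -
  have \<pi>: "\<pi> j \<in> Arr X" "Dom X (\<pi> j) = Dom X r" "Cod X (\<pi> j) = Dom X q" "\<pi> j \<cdot> q = r" if "j < 2" for j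
    using assms that by (auto simp: is_nfold_pullback_def)
  have q: "q \<in> Arr X" using assms by (simp add: is_nfold_pullback_def)
  have "\<exists>!h. mediates X (\<pi> 0, \<pi> 1) a b h"
    if ab: "a \<in> Hom X Y (Dom X q)" "b \<in> Hom X Y (Dom X q)" "a \<cdot> q = b \<cdot> q" for Y a b
  proof -
    define u where "u = (\<lambda>j::nat. if j = 0 then a else b)"
    have "a \<cdot> q \<in> Hom X Y (Cod X q)" "\<forall>j<2. u j \<in> Hom X Y (Dom X q) \<and> u j \<cdot> q = a \<cdot> q"
      using ab q by (auto simp: u_def)
    then have ex: "\<exists>!h. h \<in> Hom X Y (Dom X r) \<and> h \<cdot> r = a \<cdot> q \<and> (\<forall>j<2. h \<cdot> \<pi> j = u j)"
      using assms unfolding is_nfold_pullback_def by blast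
    have "mediates X (\<pi> 0, \<pi> 1) a b h \<longleftrightarrow> h \<in> Hom X Y (Dom X r) \<and> h \<cdot> r = a \<cdot> q \<and> (\<forall>j<2. h \<cdot> \<pi> j = u j)" for h
    proof -
      have "h \<cdot> r = a \<cdot> q" if "h \<in> Hom X Y (Dom X r)" "h \<cdot> \<pi> 0 = a"
        using that q \<pi>[of 0] assoc[of h "\<pi> 0" q] by (simp del: assoc)
      then show ?thesis using ab \<pi>[of 0] by (auto simp: mediates_def apex_def u_def less_2_cases_iff)
    qed
    then show ?thesis using ex by simp
  qed
  then show ?thesis using q \<pi>[of 0] \<pi>[of 1] by (simp add: is_pullback_def apex_def)
qed

text \<open>The case n = 1 in which \<open>pullback_bundle_exists\<close> will be instantiated: q is
  its own 1-fold power.\<close>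

lemma nfold_one_pullback:
  assumes "q \<in> Arr X"
  shows "is_nfold_pullback X q 1 q (\<lambda>_. Idn X (Dom X q))"
  unfolding is_nfold_pullback_def
proof (intro conjI allI ballI impI)
  fix Y r' a assume r': "r' \<in> Hom X Y (Cod X q)" and a: "\<forall>j<1::nat. a j \<in> Hom X Y (Dom X q) \<and> a j \<cdot> q = r'"
  then show "\<exists>!h. h \<in> Hom X Y (Dom X q) \<and> h \<cdot> q = r' \<and> (\<forall>j<1. h \<cdot> Idn X (Dom X q) = a j)"
    by (intro ex1I[of _ "a 0"]) auto
qed (use assms in simp_all)

lemma has_nfold_pullback:
  assumes "has_nfold_Tpullbacks X q"
  shows "is_pullback X q q (pb X q q)"
proof -
  obtain r \<pi> where "\<forall>m. is_nfold_pullback X ((Tm X ^^ m) q) 2 ((Tm X ^^ m) r) (\<lambda>j. (Tm X ^^ m) (\<pi> j))"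
    using assms unfolding has_nfold_Tpullbacks_def by blast
  from spec[OF this, of 0] have "is_nfold_pullback X q 2 r \<pi>" by simp
  then show ?thesis using nfold_two_pullback pb_is_pullback by blast
qed

lemma T2_pullback: "A \<in> Obj X \<Longrightarrow> is_pullback X (tp X A) (tp X A) (T2 X A)"
  using tangent_obj[of A] has_nfold_pullback unfolding T2_def by blast

text \<open>The naturality axiom is stated for the projections of \<open>T2\<close>; this is its
  value at two vectors with a common base point.\<close>

lemma ts_natural:
  assumes "u \<in> Arr X" "w \<in> Arr X" "Dom X u = Dom X w" "Cod X u = To X (Dom X f)" "Cod X w = To X (Dom X f)"
    "u \<cdot> tp X (Dom X f) = w \<cdot> tp X (Dom X f)" "f \<in> Arr X" "Cod X f = B" "Dom X f = A"
  shows "tup X (T2 X A) u w \<cdot> ts X A \<cdot> Tm X f = tup X (T2 X B) (u \<cdot> Tm X f) (w \<cdot> Tm X f) \<cdot> ts X B"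
proof -
  have [simp]: "A \<in> Obj X" "B \<in> Obj X" using assms Dom_obj Cod_obj by blast+
  note P = T2_pullback[of A] and Q = T2_pullback[of B]
  note [simp] = assms(1-5,7-) pullback_cone(4-8)[OF P] pullback_cone(4-8)[OF Q]
  have uw: "u \<cdot> tp X A = w \<cdot> tp X A" using assms by simp
  note [simp] = pullback_tup[OF P _ _ _ _ _ uw]
  have "fst (T2 X A) \<cdot> Tm X f \<cdot> tp X B = snd (T2 X A) \<cdot> Tm X f \<cdot> tp X B"
    using pullback_cone(9)[OF P] by (simp add: tp_natural)
  note Q' = pullback_tup[OF Q _ _ _ _ _ this] pullback_comp_tup[OF Q _ _ _ _ _ this]
  have "tup X (T2 X A) u w \<cdot> ts X A \<cdot> Tm X f
     = tup X (T2 X A) u w \<cdot> tup X (T2 X B) (fst (T2 X A) \<cdot> Tm X f) (snd (T2 X A) \<cdot> Tm X f) \<cdot> ts X B"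
    by (rule comp_eq_precomp) (use tangent_arr[of f] in \<open>simp_all add: Q'(1-5)\<close>)
  then show ?thesis by (simp add: Q')
qed

text \<open>Zero plus zero: the unit law of the tangent addition, evaluated at the zero vector over
  a.\<close>

lemma ts_zero:
  assumes "a \<in> Arr X" "Cod X a = A" "A \<in> Obj X"
  shows "tup X (T2 X A) (a \<cdot> tz X A) (a \<cdot> tz X A) \<cdot> ts X A = a \<cdot> tz X A"
proof -
  note P = T2_pullback[OF assms(3)]
  have cm: "comm_monoid_over X (tp X A) (ts X A) (tz X A)"
    using tangent_obj[OF assms(3)] by blast
  have zp: "tz X A \<cdot> tp X A = Idn X A"
    and un: "tup X (T2 X A) (Idn X (To X A)) (tp X A \<cdot> tz X A) \<cdot> ts X A = Idn X (To X A)"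
    using cm assms(3) by (simp_all add: comm_monoid_over_def Let_def T2_def)
  note [simp] = assms pullback_cone(4-8)[OF P]
  have "tp X A = tp X A \<cdot> tz X A \<cdot> tp X A" using zp assoc[of "tp X A" "tz X A" "tp X A"] by (simp del: assoc)
  then have eq: "Idn X (To X A) \<cdot> tp X A = tp X A \<cdot> tz X A \<cdot> tp X A" by simp
  note [simp] = pullback_tup(1-3)[OF P _ _ _ _ _ eq] pullback_comp_tup[OF P _ _ _ _ _ eq]
  have azp: "a \<cdot> tz X A \<cdot> tp X A = a" using zp assoc[of a "tz X A" "tp X A"] by (simp del: assoc)
  have "a \<cdot> tz X A \<cdot> (tup X (T2 X A) (Idn X (To X A)) (tp X A \<cdot> tz X A) \<cdot> ts X A) = a \<cdot> tz X A"
    unfolding un by simp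
  then show ?thesis by (simp add: azp)
qed

section \<open>Differential objects\<close>

lemma tz_tp:
  assumes "x \<in> Arr X" "Cod X x = A" "A \<in> Obj X"
  shows "x \<cdot> tz X A \<cdot> tp X A = x"
proof -
  have "tz X A \<cdot> tp X A = Idn X A"
    using tangent_obj[OF assms(3)] by (simp add: comm_monoid_over_def Let_def)
  then show ?thesis using assms assoc[of x "tz X A" "tp X A"] by (simp del: assoc)
qed

abbreviation U :: "'a bdl \<Rightarrow> 'o" where
  "U E \<equiv> Dom X (bq E)"

definition diff_obj :: "'a bdl \<Rightarrow> bool" where
  "diff_obj E \<longleftrightarrow> differential_bundle X E \<and> Cod X (bq E) = one X"

abbreviation ad :: "'a bdl \<Rightarrow> 'a \<Rightarrow> 'a \<Rightarrow> 'a" where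
  "ad E \<equiv> madd (bpair X E) (bs E)"
abbreviation Tad :: "'a bdl \<Rightarrow> 'a \<Rightarrow> 'a \<Rightarrow> 'a" where
  "Tad E \<equiv> madd (Tcone X (bpair X E)) (Tm X (bs E))"
abbreviation TTad :: "'a bdl \<Rightarrow> 'a \<Rightarrow> 'a \<Rightarrow> 'a" where
  "TTad E \<equiv> madd (Tcone X (Tcone X (bpair X E))) (Tm X (Tm X (bs E)))"

lemma one_eq: "\<lbrakk>f \<in> Arr X; g \<in> Arr X; Dom X f = Dom X g; Cod X f = one X; Cod X g = one X\<rbrakk> \<Longrightarrow> f = g"
  by (rule terminal_arr_eq[OF one_terminal])

context
  fixes E assumes dE: "diff_obj E"
begin

lemma diff_obj_axioms:
  "comm_monoid_over X (bq E) (bs E) (bz E)" "bl E \<in> Hom X (U E) (To X (U E))"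
  "bs E \<cdot> bl E = tup X (Tcone X (bpair X E)) (fst (bpair X E) \<cdot> bl E) (snd (bpair X E) \<cdot> bl E) \<cdot> Tm X (bs E)"
  "bz E \<cdot> bl E = tz X (one X) \<cdot> Tm X (bz E)"
  "bl E \<cdot> tp X (U E) = bq E \<cdot> bz E"
  "bs E \<cdot> bl E = tup X (T2 X (U E)) (fst (bpair X E) \<cdot> bl E) (snd (bpair X E) \<cdot> bl E) \<cdot> ts X (U E)"
  "bz E \<cdot> bl E = bz E \<cdot> tz X (U E)"
  "bl E \<cdot> tl X (U E) = bl E \<cdot> Tm X (bl E)"
  "is_Tpullback X (Tm X (bq E)) (tz X (one X))
        (tup X (Tcone X (bpair X E)) (fst (bpair X E) \<cdot> bl E) (snd (bpair X E) \<cdot> tz X (U E)) \<cdot> Tm X (bs E), fst (bpair X E) \<cdot> bq E)"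
  "has_nfold_Tpullbacks X (bq E)"
  using dE unfolding diff_obj_def differential_bundle_def Let_def bas_def tot_def by auto

lemma Cod_bq [simp]: "Cod X (bq E) = one X"
  using dE by (simp add: diff_obj_def)

lemma bpair_pullback: "is_pullback X (bq E) (bq E) (bpair X E)"
  unfolding bpair_def by (rule has_nfold_pullback[OF diff_obj_axioms(10)])

lemma bpair_product: "is_product X (U E) (U E) (bpair X E)"
  by (rule pullback_over_terminal[OF bpair_pullback]) (simp add: one_terminal)

lemma diff_obj_arr [simp]:
  "bq E \<in> Arr X" "bs E \<in> Arr X" "bz E \<in> Arr X" "bl E \<in> Arr X"
  "Dom X (bs E) = Dom X (fst (bpair X E))" "Cod X (bs E) = U E"
  "Dom X (bz E) = one X" "Cod X (bz E) = U E"
  "Dom X (bl E) = U E" "Cod X (bl E) = To X (U E)"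
  using diff_obj_axioms(1,2) by (simp_all add: comm_monoid_over_def Let_def apex_def bpair_def)

lemma bpair_arr [simp]:
  "fst (bpair X E) \<in> Arr X" "snd (bpair X E) \<in> Arr X" "Dom X (snd (bpair X E)) = Dom X (fst (bpair X E))"
  "Cod X (fst (bpair X E)) = U E" "Cod X (snd (bpair X E)) = U E"
  using product_cone[OF bpair_product] by simp_all

lemma diff_obj_magma: "magma (U E) (bpair X E) (bs E)"
  by (simp add: magma_def bpair_product)

text \<open>The condition that summands lie over the same base point is automatic over the terminal
  object, and all elements share the zero q \<zeta>.\<close>

lemma diff_obj_cmon: "cmon (U E) (bpair X E) (bs E) (bq E \<cdot> bz E)"
proof -
  note cm = diff_obj_axioms(1)[unfolded comm_monoid_over_def Let_def, folded bpair_def]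
  note P = bpair_product
  note [simp] = product_simps[OF P]
  have un: "tup X (bpair X E) (Idn X (U E)) (bq E \<cdot> bz E) \<cdot> bs E = Idn X (U E)"
    and co: "tup X (bpair X E) (snd (bpair X E)) (fst (bpair X E)) \<cdot> bs E = bs E"
    using cm by blast+
  show ?thesis unfolding cmon_def
  proof (intro conjI allI ballI)
    show "magma (U E) (bpair X E) (bs E)" by (rule diff_obj_magma)
    show "bq E \<cdot> bz E \<in> Hom X (U E) (U E)" by simp
    fix Y a b assume a: "a \<in> Hom X Y (U E)" and b: "b \<in> Hom X Y (U E)"
    then have ab [simp]: "a \<in> Arr X" "b \<in> Arr X" "Dom X a = Y" "Dom X b = Y" "Cod X a = U E" "Cod X b = U E"
      by simp_all
    note ab' = product_tup[OF P ab(1,2)]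
    have q: "a \<cdot> bq E = b \<cdot> bq E" by (rule one_eq) simp_all
    show ze: "a \<cdot> (bq E \<cdot> bz E) = b \<cdot> (bq E \<cdot> bz E)" using q by simp
    have "tup X (bpair X E) a b \<cdot> (tup X (bpair X E) (snd (bpair X E)) (fst (bpair X E)) \<cdot> bs E) = tup X (bpair X E) a b \<cdot> bs E"
      unfolding co ..
    then show "madd (bpair X E) (bs E) a b = madd (bpair X E) (bs E) b a" by (simp add: madd_def)
    have "a \<cdot> (tup X (bpair X E) (Idn X (U E)) (bq E \<cdot> bz E) \<cdot> bs E) = a"
      unfolding un by simp
    then have "madd (bpair X E) (bs E) a (a \<cdot> (bq E \<cdot> bz E)) = a" by (simp add: madd_def)
    then show "madd (bpair X E) (bs E) a (b \<cdot> (bq E \<cdot> bz E)) = a" unfolding ze .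
    fix d assume d: "d \<in> Hom X Y (U E)"
    have "b \<cdot> bq E = d \<cdot> bq E" using d by - (rule one_eq, simp_all)
    with cm a b d q show "madd (bpair X E) (bs E) (madd (bpair X E) (bs E) a b) d = madd (bpair X E) (bs E) a (madd (bpair X E) (bs E) b d)"
      unfolding madd_def by blast
  qed
qed

lemmas ad_arr [simp] = madd_arr[OF diff_obj_magma]
  and Tad_arr [simp] = madd_arr[OF magma_T[OF diff_obj_magma]]
  and TTad_arr [simp] = madd_arr[OF magma_T[OF magma_T[OF diff_obj_magma]]]
  and comp_ad [simp] = comp_madd[OF diff_obj_magma]
  and comp_Tad [simp] = comp_madd[OF magma_T[OF diff_obj_magma]]
  and comp_TTad [simp] = comp_madd[OF magma_T[OF magma_T[OF diff_obj_magma]]]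
  and T_ad [simp] = T_madd[OF diff_obj_magma]
  and T_Tad [simp] = T_madd[OF magma_T[OF diff_obj_magma]]
  and ad_tz = madd_tz[OF diff_obj_magma]
  and Tad_tp = madd_tp[OF diff_obj_magma]
  and Tad_tl = madd_tl[OF diff_obj_magma]
  and TTad_tc = madd_tc[OF diff_obj_magma]

lemma bl_ad:
  assumes "a \<in> Arr X" "b \<in> Arr X" "Dom X a = Dom X b" "Cod X a = U E" "Cod X b = U E"
  shows "ad E a b \<cdot> bl E = Tad E (a \<cdot> bl E) (b \<cdot> bl E)"
  by (rule madd_hom[OF diff_obj_magma magma_T[OF diff_obj_magma] _ _ _ diff_obj_axioms(3)]) (use assms in simp_all)

lemma bl_bz:
  assumes "x \<in> Arr X" "Cod X x = one X"
  shows "x \<cdot> bz E \<cdot> bl E = x \<cdot> tz X (one X) \<cdot> Tm X (bz E)"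
  by (rule comp_eq_precomp[OF diff_obj_axioms(4)]) (use assms in simp_all)

lemma bl_bz_tz:
  assumes "x \<in> Arr X" "Cod X x = one X"
  shows "x \<cdot> bz E \<cdot> bl E = x \<cdot> bz E \<cdot> tz X (U E)"
  by (rule comp_eq_precomp[OF diff_obj_axioms(7)]) (use assms in simp_all)

lemma bl_tp:
  assumes "x \<in> Arr X" "Cod X x = U E"
  shows "x \<cdot> bl E \<cdot> tp X (U E) = x \<cdot> bq E \<cdot> bz E"
  by (rule comp_eq_precomp[OF diff_obj_axioms(5)]) (use assms in simp_all)

lemma bl_tl:
  assumes "x \<in> Arr X" "Cod X x = U E"
  shows "x \<cdot> bl E \<cdot> tl X (U E) = x \<cdot> bl E \<cdot> Tm X (bl E)"
  by (rule comp_eq_precomp[OF diff_obj_axioms(8)]) (use assms in simp_all)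

text \<open>A bundle has two axioms for \<sigma> \<lambda>; this one computes it with the addition
  of tangent vectors. The first claim, that both lifts sit over the zero of E, is what allows them
  to be paired into \<open>T2\<close>.\<close>

lemma bl_ad_ts:
  assumes "a \<in> Arr X" "b \<in> Arr X" "Dom X a = Dom X b" "Cod X a = U E" "Cod X b = U E"
  shows "a \<cdot> bl E \<cdot> tp X (U E) = b \<cdot> bl E \<cdot> tp X (U E)"
    "tup X (T2 X (U E)) (a \<cdot> bl E) (b \<cdot> bl E) \<cdot> ts X (U E) = ad E a b \<cdot> bl E"
proof -
  let ?T = "T2 X (U E)"
  have eq: "a \<cdot> bq E = b \<cdot> bq E" by (rule one_eq) (use assms in simp_all)
  show "a \<cdot> bl E \<cdot> tp X (U E) = b \<cdot> bl E \<cdot> tp X (U E)"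
    using assms eq by (simp add: bl_tp)
  have "fst (bpair X E) \<cdot> bq E = snd (bpair X E) \<cdot> bq E" using pullback_cone(9)[OF bpair_pullback] .
  then have 1: "fst (bpair X E) \<cdot> bl E \<cdot> tp X (U E) = snd (bpair X E) \<cdot> bl E \<cdot> tp X (U E)"
    by (simp add: bl_tp)
  note P = bpair_product and Q = T2_pullback[OF Dom_obj[OF diff_obj_arr(1)]]
  note [simp] = assms product_tup[OF P] pullback_tup[OF Q _ _ _ _ _ 1] pullback_comp_tup[OF Q _ _ _ _ _ 1] pullback_cone(4-8)[OF Q]
  have "tup X (bpair X E) a b \<cdot> (bs E \<cdot> bl E) =
      tup X (bpair X E) a b \<cdot> (tup X ?T (fst (bpair X E) \<cdot> bl E) (snd (bpair X E) \<cdot> bl E) \<cdot> ts X (U E))"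
    unfolding diff_obj_axioms(6) ..
  then show "tup X ?T (a \<cdot> bl E) (b \<cdot> bl E) \<cdot> ts X (U E) = ad E a b \<cdot> bl E"
    by (simp add: madd_def)
qed

end

lemmas ad_comm = madd_comm[OF diff_obj_cmon]
  and ad_assoc = madd_assoc[OF diff_obj_cmon]
  and TTad_interchange = madd_interchange[OF cmon_T[OF cmon_T[OF diff_obj_cmon]]]

text \<open>The zero element is x \<zeta> with x any arrow to the terminal object, because simp
  reaches it through different but equal arrows x.\<close>

lemma ad_zero:
  assumes "diff_obj E" "a \<in> Arr X" "x \<in> Arr X" "Dom X a = Dom X x" "Cod X a = U E" "Cod X x = one X"
  shows "ad E a (x \<cdot> bz E) = a" "ad E (x \<cdot> bz E) a = a"
proof -
  have "a \<cdot> bq E = x" by (rule one_eq) (use assms in simp_all)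
  then show 1: "ad E a (x \<cdot> bz E) = a"
    using madd_zero[OF diff_obj_cmon, of E a a] assms by simp
  show "ad E (x \<cdot> bz E) a = a"
    using 1 assms ad_comm[of E a "x \<cdot> bz E"] by simp
qed

lemma Tad_zero:
  assumes "diff_obj E" "a \<in> Arr X" "x \<in> Arr X" "Dom X a = Dom X x" "Cod X a = To X (U E)" "Cod X x = To X (one X)"
  shows "Tad E a (x \<cdot> Tm X (bz E)) = a" "Tad E (x \<cdot> Tm X (bz E)) a = a"
proof -
  note c = cmon_T[OF diff_obj_cmon]
  have "a \<cdot> Tm X (bq E) = x" by (rule terminal_arr_eq[OF T_terminal[OF one_terminal]]) (use assms in simp_all)
  then show 1: "Tad E a (x \<cdot> Tm X (bz E)) = a"
    using madd_zero[OF c, of E a a] assms by simp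
  show "Tad E (x \<cdot> Tm X (bz E)) a = a"
    using 1 assms madd_comm[OF c, of E a "x \<cdot> Tm X (bz E)"] by simp
qed

section \<open>The isomorphism \<nu> and its inverse on elements\<close>

definition nu_el :: "'a bdl \<Rightarrow> 'a \<Rightarrow> 'a \<Rightarrow> 'a" where
  "nu_el E a v = Tad E (v \<cdot> bl E) (a \<cdot> tz X (U E))"

text \<open>The value of T(\<nu>) at two elements of T(E). Elements of the second tangent object are
  described by nesting it over \<open>nu_el\<close>.\<close>

definition T_nu_el :: "'a bdl \<Rightarrow> 'a \<Rightarrow> 'a \<Rightarrow> 'a" where
  "T_nu_el E a v = TTad E (v \<cdot> Tm X (bl E)) (a \<cdot> Tm X (tz X (U E)))"

context
  fixes E assumes dE: "diff_obj E"
begin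

lemmas [simp] = diff_obj_arr[OF dE] Cod_bq[OF dE] bpair_arr[OF dE]

lemma nu_el_arr [simp]:
  assumes "a \<in> Arr X" "v \<in> Arr X" "Dom X a = Dom X v" "Cod X a = U E" "Cod X v = U E"
  shows "nu_el E a v \<in> Arr X" "Dom X (nu_el E a v) = Dom X v" "Cod X (nu_el E a v) = To X (U E)"
  using assms dE by (simp_all add: nu_el_def)

lemma comp_nu_el [simp]:
  assumes "x \<in> Arr X" "Cod X x = Dom X v" "a \<in> Arr X" "v \<in> Arr X" "Dom X a = Dom X v" "Cod X a = U E" "Cod X v = U E"
  shows "x \<cdot> nu_el E a v = nu_el E (x \<cdot> a) (x \<cdot> v)"
  using assms dE by (simp add: nu_el_def)

lemma T_nu_el_arr [simp]:
  assumes "a \<in> Arr X" "v \<in> Arr X" "Dom X a = Dom X v" "Cod X a = To X (U E)" "Cod X v = To X (U E)"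
  shows "T_nu_el E a v \<in> Arr X" "Dom X (T_nu_el E a v) = Dom X v" "Cod X (T_nu_el E a v) = To X (To X (U E))"
  using assms dE by (simp_all add: T_nu_el_def)

lemma comp_T_nu_el [simp]:
  assumes "x \<in> Arr X" "Cod X x = Dom X v" "a \<in> Arr X" "v \<in> Arr X" "Dom X a = Dom X v"
    "Cod X a = To X (U E)" "Cod X v = To X (U E)"
  shows "x \<cdot> T_nu_el E a v = T_nu_el E (x \<cdot> a) (x \<cdot> v)"
  using assms dE by (simp add: T_nu_el_def)

lemma T_nu_el [simp]:
  assumes "a \<in> Arr X" "v \<in> Arr X" "Dom X a = Dom X v" "Cod X a = U E" "Cod X v = U E"
  shows "Tm X (nu_el E a v) = T_nu_el E (Tm X a) (Tm X v)"
  using assms dE by (simp add: nu_el_def T_nu_el_def)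

lemma nu_el_tp:
  assumes "a \<in> Arr X" "v \<in> Arr X" "Dom X a = Dom X v" "Cod X a = U E" "Cod X v = U E"
  shows "nu_el E a v \<cdot> tp X (U E) = a"
  using assms dE by (simp add: nu_el_def Tad_tp bl_tp tz_tp ad_zero)

text \<open>Since \<lambda> \<ell> = \<lambda> T(\<lambda>) and z \<ell> = z T(z), the lift puts the
  zero vector at a in the base slot and \<lambda> applied to v in the vector slot.\<close>

lemma nu_el_tl:
  assumes "a \<in> Arr X" "v \<in> Arr X" "Dom X a = Dom X v" "Cod X a = U E" "Cod X v = U E"
  shows "nu_el E a v \<cdot> tl X (U E) = T_nu_el E (a \<cdot> tz X (U E)) (v \<cdot> bl E)"
  using assms dE by (simp add: nu_el_def T_nu_el_def Tad_tl bl_tl tz_tl)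

lemma nu_el_tz:
  assumes "a \<in> Arr X" "x \<in> Arr X" "Dom X a = Dom X x" "Cod X a = U E" "Cod X x = one X"
  shows "nu_el E a (x \<cdot> bz E) = a \<cdot> tz X (U E)"
  using assms dE by (simp add: nu_el_def bl_bz Tad_zero)

lemma nu_el_bl:
  assumes "x \<in> Arr X" "v \<in> Arr X" "Dom X x = Dom X v" "Cod X v = U E" "Cod X x = one X"
  shows "nu_el E (x \<cdot> bz E) v = v \<cdot> bl E"
  using assms dE by (simp add: nu_el_def bl_bz bl_bz_tz[symmetric] Tad_zero)

text \<open>The arrow of the universality axiom. There the first component is the vector and the
  second the base point, hence the exchanged projections.\<close>

definition mu :: 'a where
  "mu = nu_el E (snd (bpair X E)) (fst (bpair X E))"

lemma mu_pullback: "is_pullback X (Tm X (bq E)) (tz X (one X)) (mu, fst (bpair X E) \<cdot> bq E)"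
  using spec[OF diff_obj_axioms(9)[OF dE, unfolded is_Tpullback_def], of 0] by (simp add: mu_def nu_el_def madd_def)

text \<open>The projection \<open>tp\<close> recovers the base point; the vector is determined by
  the uniqueness half of the universality square.\<close>

lemma nu_el_inj:
  assumes av: "a \<in> Arr X" "v \<in> Arr X" "Dom X a = Dom X v" "Cod X a = U E" "Cod X v = U E"
    and bw: "b \<in> Arr X" "w \<in> Arr X" "Dom X b = Dom X w" "Cod X b = U E" "Cod X w = U E"
    and eq: "nu_el E a v = nu_el E b w"
  shows "a = b" "v = w"
proof -
  show ab: "a = b" using nu_el_tp[OF av] nu_el_tp[OF bw] eq by simp
  have vw: "Dom X w = Dom X v" using ab av bw by simp
  note P = bpair_product[OF dE]
  note [simp] = av bw vw product_tup[OF P]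
  have "tup X (bpair X E) v a = tup X (bpair X E) w b"
  proof (rule pullback_eqI[OF mu_pullback])
    show "tup X (bpair X E) v a \<cdot> snd (mu, fst (bpair X E) \<cdot> bq E) = tup X (bpair X E) w b \<cdot> snd (mu, fst (bpair X E) \<cdot> bq E)"
      by simp (rule one_eq, simp_all)
  qed (simp_all add: mu_def eq)
  then have "tup X (bpair X E) v a \<cdot> fst (bpair X E) = tup X (bpair X E) w b \<cdot> fst (bpair X E)" by simp
  then show "v = w" by simp
qed

text \<open>The existence half of universality: T of the terminal object is terminal, so the
  identity of T(E) belongs to a cone over the square and factors through \<open>mu\<close>.\<close>

lemma nu_el_ex:
  "\<exists>v \<in> Arr X. Dom X v = To X (U E) \<and> Cod X v = U E \<and> nu_el E (tp X (U E)) v = Idn X (To X (U E))"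
proof -
  let ?A = "U E"
  let ?x = "tp X ?A \<cdot> bq E" and ?c = "(mu, fst (bpair X E) \<cdot> bq E)"
  have o: "?A \<in> Obj X" by simp
  have "Idn X (To X ?A) \<cdot> Tm X (bq E) = ?x \<cdot> tz X (one X)"
    by (rule terminal_arr_eq[OF T_terminal[OF one_terminal]]) simp_all
  note h = pullback_tup[OF mu_pullback _ _ _ _ _ this, simplified]
  define h where "h = tup X ?c (Idn X (To X ?A)) ?x"
  have m: "Dom X mu = Dom X (fst (bpair X E))" by (simp add: mu_def)
  have hh: "h \<in> Arr X" "Dom X h = To X ?A" "Cod X h = Dom X (fst (bpair X E))" "h \<cdot> mu = Idn X (To X ?A)"
    using h m by (simp_all add: h_def)
  then have n: "nu_el E (h \<cdot> snd (bpair X E)) (h \<cdot> fst (bpair X E)) = Idn X (To X ?A)"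
    by (simp add: mu_def)
  have "h \<cdot> snd (bpair X E) = tp X ?A"
    using nu_el_tp[of "h \<cdot> snd (bpair X E)" "h \<cdot> fst (bpair X E)"] hh(1-3) unfolding n by simp
  then show ?thesis using n hh(1-3) by (intro bexI[of _ "h \<cdot> fst (bpair X E)"]) simp_all
qed

text \<open>The vector part \<open>T(E) \<rightarrow> E\<close> of the inverse of \<open>\<nu>\<close>; \<open>nu_el_ex\<close> makes the choice meaningful.\<close>

definition vpart :: 'a where
  "vpart = (SOME v. v \<in> Arr X \<and> Dom X v = To X (U E) \<and> Cod X v = U E \<and>
     nu_el E (tp X (U E)) v = Idn X (To X (U E)))"

lemma vpart_arr [simp]: "vpart \<in> Arr X" "Dom X vpart = To X (U E)" "Cod X vpart = U E"
  and nu_el_tp_vpart: "nu_el E (tp X (U E)) vpart = Idn X (To X (U E))"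
proof -
  have "\<exists>v. v \<in> Arr X \<and> Dom X v = To X (U E) \<and> Cod X v = U E \<and>
     nu_el E (tp X (U E)) v = Idn X (To X (U E))" using nu_el_ex by blast
  from someI_ex[OF this, folded vpart_def]
  show "vpart \<in> Arr X" "Dom X vpart = To X (U E)" "Cod X vpart = U E"
    "nu_el E (tp X (U E)) vpart = Idn X (To X (U E))" by auto
qed

lemma nu_el_elem:
  assumes "w \<in> Arr X" "Cod X w = To X (U E)"
  shows "nu_el E (w \<cdot> tp X (U E)) (w \<cdot> vpart) = w"
  using arg_cong[OF nu_el_tp_vpart, of "\<lambda>u. w \<cdot> u"] assms by simp

lemma nu_el_vpart:
  assumes "a \<in> Arr X" "v \<in> Arr X" "Dom X a = Dom X v" "Cod X a = U E" "Cod X v = U E"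
  shows "nu_el E a v \<cdot> vpart = v"
  using nu_el_elem[of "nu_el E a v"] assms by (intro nu_el_inj(2)[of a "nu_el E a v \<cdot> vpart" a v]) (simp_all add: nu_el_tp)

text \<open>\<open>nu_el_vpart\<close> at the universal pair, mapped by T and precomposed with <a,
  v>.\<close>

lemma T_nu_el_vpart:
  assumes "a \<in> Arr X" "v \<in> Arr X" "Dom X a = Dom X v" "Cod X a = To X (U E)" "Cod X v = To X (U E)"
  shows "T_nu_el E a v \<cdot> Tm X vpart = v"
proof -
  note P = bpair_product[OF dE]
  note [simp] = assms T_product_tup[OF P]
  have "Tm X (nu_el E (fst (bpair X E)) (snd (bpair X E)) \<cdot> vpart) = Tm X (snd (bpair X E))"
    by (subst nu_el_vpart) simp_all
  then have "tup X (Tcone X (bpair X E)) a v \<cdot> (T_nu_el E (Tm X (fst (bpair X E))) (Tm X (snd (bpair X E))) \<cdot> Tm X vpart)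
     = tup X (Tcone X (bpair X E)) a v \<cdot> Tm X (snd (bpair X E))" by simp
  then show ?thesis by simp
qed

text \<open>The vector part intertwines \<ell> with \<lambda>. Together with naturality of \<ell>
  this will make derivatives linear.\<close>

lemma vpart_bl:
  assumes "w \<in> Arr X" "Cod X w = To X (U E)"
  shows "w \<cdot> vpart \<cdot> bl E = w \<cdot> tl X (U E) \<cdot> Tm X vpart"
proof -
  let ?A = "U E"
  have "nu_el E (w \<cdot> tp X ?A) (w \<cdot> vpart) \<cdot> tl X ?A \<cdot> Tm X vpart = w \<cdot> vpart \<cdot> bl E"
    using assms by (simp add: nu_el_tl T_nu_el_vpart)
  then show ?thesis using assms by (simp add: nu_el_elem)
qed

text \<open>An element of \<open>T\<^sup>2(E)\<close> is a sum \<open>d \<lambda> T(\<lambda>) + b z T(\<lambda>) + c \<lambda> T(z) + a z T(z)\<close>, and the flip exchanges the two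
  middle summands.\<close>

lemma nu_el_nu_el_tc:
  assumes "a \<in> Arr X" "b \<in> Arr X" "c \<in> Arr X" "d \<in> Arr X" "Dom X a = Dom X d" "Dom X b = Dom X d" "Dom X c = Dom X d"
    "Cod X a = U E" "Cod X b = U E" "Cod X c = U E" "Cod X d = U E"
  shows "T_nu_el E (nu_el E a c) (nu_el E b d) \<cdot> tc X (U E) = T_nu_el E (nu_el E a b) (nu_el E c d)"
proof -
  let ?A = "U E" and ?l = "bl E" and ?Tl = "Tm X (bl E)" and ?z = "tz X (U E)" and ?Tz = "Tm X (tz X (U E))"
  note [simp] = assms dE
  \<comment> \<open>Additivity of \<lambda> under T, read off from the universal pair; the next
    claim does the same for z.\<close>
  have Tl: "Tad E u w \<cdot> ?Tl = TTad E (u \<cdot> ?Tl) (w \<cdot> ?Tl)" if "u \<in> Arr X" "w \<in> Arr X" "Dom X u = Dom X w" "Cod X u = To X ?A" "Cod X w = To X ?A" for u w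
  proof -
    have "Tm X (ad E (fst (bpair X E)) (snd (bpair X E)) \<cdot> bl E) = Tm X (Tad E (fst (bpair X E) \<cdot> bl E) (snd (bpair X E) \<cdot> bl E))"
      by (subst bl_ad) simp_all
    from arg_cong[OF this, of "\<lambda>k. tup X (Tcone X (bpair X E)) u w \<cdot> k"]
    show ?thesis using that T_product_tup[OF bpair_product[OF dE], of u w] by simp
  qed
  have Tz: "Tad E u w \<cdot> ?Tz = TTad E (u \<cdot> ?Tz) (w \<cdot> ?Tz)" if "u \<in> Arr X" "w \<in> Arr X" "Dom X u = Dom X w" "Cod X u = To X ?A" "Cod X w = To X ?A" for u w
  proof -
    have "Tm X (ad E (fst (bpair X E)) (snd (bpair X E)) \<cdot> ?z) = Tm X (Tad E (fst (bpair X E) \<cdot> ?z) (snd (bpair X E) \<cdot> ?z))"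
      by (subst ad_tz) simp_all
    from arg_cong[OF this, of "\<lambda>k. tup X (Tcone X (bpair X E)) u w \<cdot> k"]
    show ?thesis using that T_product_tup[OF bpair_product[OF dE], of u w] by simp
  qed
  have expand: "T_nu_el E (nu_el E a c) (nu_el E b d) = TTad E (TTad E (d \<cdot> ?l \<cdot> ?Tl) (b \<cdot> ?z \<cdot> ?Tl)) (TTad E (c \<cdot> ?l \<cdot> ?Tz) (a \<cdot> ?z \<cdot> ?Tz))"
    if "a \<in> Arr X" "b \<in> Arr X" "c \<in> Arr X" "d \<in> Arr X" "Dom X a = Dom X d" "Dom X b = Dom X d" "Dom X c = Dom X d"
    "Cod X a = ?A" "Cod X b = ?A" "Cod X c = ?A" "Cod X d = ?A" for a b c d
    using that by (simp add: T_nu_el_def nu_el_def Tl Tz)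
  \<comment> \<open>The flip on the four summands: \<ell> c = \<ell> fixes the first, naturality of
    z with T(z) c = z exchanges the middle two and fixes the last.\<close>
  have 1: "d \<cdot> ?l \<cdot> ?Tl \<cdot> tc X ?A = d \<cdot> ?l \<cdot> ?Tl"
    using bl_tl[OF dE, of d] tl_tc[of "d \<cdot> ?l" ?A] by simp
  have 2: "b \<cdot> ?z \<cdot> ?Tl \<cdot> tc X ?A = b \<cdot> ?l \<cdot> ?Tz"
    using tz_natural[of b ?l ?A] tz_T_tc[of "b \<cdot> ?l" ?A] by simp
  have 3: "c \<cdot> ?l \<cdot> ?Tz \<cdot> tc X ?A = c \<cdot> ?z \<cdot> ?Tl"
    using tz_natural[of c ?l ?A] tz_tc[of "c \<cdot> ?l" ?A] by simp
  have 4: "a \<cdot> ?z \<cdot> ?Tz \<cdot> tc X ?A = a \<cdot> ?z \<cdot> ?Tz"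
    using tz_natural[of a ?z ?A] tz_tc[of "a \<cdot> ?z" ?A] by simp
  have "T_nu_el E (nu_el E a c) (nu_el E b d) \<cdot> tc X ?A = TTad E (TTad E (d \<cdot> ?l \<cdot> ?Tl) (b \<cdot> ?l \<cdot> ?Tz)) (TTad E (c \<cdot> ?z \<cdot> ?Tl) (a \<cdot> ?z \<cdot> ?Tz))"
    by (simp add: expand TTad_tc 1 2 3 4)
  also have "\<dots> = TTad E (TTad E (d \<cdot> ?l \<cdot> ?Tl) (c \<cdot> ?z \<cdot> ?Tl)) (TTad E (b \<cdot> ?l \<cdot> ?Tz) (a \<cdot> ?z \<cdot> ?Tz))"
    by (rule TTad_interchange) simp_all
  also have "\<dots> = T_nu_el E (nu_el E a b) (nu_el E c d)"
    by (simp add: expand)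
  finally show ?thesis .
qed

end

lemma diff_obj_obj: "diff_obj E \<Longrightarrow> U E \<in> Obj X"
  using diff_obj_arr(1) Dom_obj by blast

lemmas diff_obj_simps = diff_obj_arr Cod_bq bpair_arr diff_obj_obj nu_el_arr comp_nu_el T_nu_el_arr comp_T_nu_el T_nu_el vpart_arr
  ad_arr Tad_arr TTad_arr comp_ad comp_Tad comp_TTad T_ad T_Tad

text \<open>\<lambda> is \<nu> at the zero base point, so injectivity of \<nu> makes it
  monic.\<close>

lemma bl_mono:
  assumes E: "diff_obj E" and "a \<in> Arr X" "b \<in> Arr X" "Dom X a = Dom X b" "Cod X a = U E" "Cod X b = U E"
    "a \<cdot> bl E = b \<cdot> bl E"
  shows "a = b"
proof -
  note [simp] = E diff_obj_simps[OF E]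
  have "nu_el E (b \<cdot> bq E \<cdot> bz E) a = nu_el E (b \<cdot> bq E \<cdot> bz E) b"
    using assms by (simp add: nu_el_bl)
  then show ?thesis using assms by (intro nu_el_inj(2)[OF E, of "b \<cdot> bq E \<cdot> bz E" a "b \<cdot> bq E \<cdot> bz E" b]) simp_all
qed

section \<open>Linear maps and derivatives\<close>

text \<open>Linearity of \<open>h : A \<times> F \<rightarrow> G\<close> in the second argument; \<open>c\<close> may be any product cone for \<open>A \<times> F\<close>.\<close>

definition lin :: "'a \<times> 'a \<Rightarrow> 'a bdl \<Rightarrow> 'a bdl \<Rightarrow> 'a \<Rightarrow> bool" where
  "lin c F G h \<longleftrightarrow> h \<in> Arr X \<and> Dom X h = Dom X (fst c) \<and> Cod X h = U G \<and>
     h \<cdot> bl G = tup X (Tcone X c) (fst c \<cdot> tz X (Cod X (fst c))) (snd c \<cdot> bl F) \<cdot> Tm X h"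

definition linear_map :: "'a bdl \<Rightarrow> 'a bdl \<Rightarrow> 'a \<Rightarrow> bool" where
  "linear_map F G g \<longleftrightarrow> g \<in> Arr X \<and> Dom X g = U F \<and> Cod X g = U G \<and> g \<cdot> bl G = bl F \<cdot> Tm X g"

lemma linD: "lin c F G h \<Longrightarrow> h \<in> Arr X" "lin c F G h \<Longrightarrow> Dom X h = Dom X (fst c)" "lin c F G h \<Longrightarrow> Cod X h = U G"
  by (simp_all add: lin_def)

lemma linear_mapD: "linear_map F G g \<Longrightarrow> g \<in> Arr X" "linear_map F G g \<Longrightarrow> Dom X g = U F"
  "linear_map F G g \<Longrightarrow> Cod X g = U G"
  by (simp_all add: linear_map_def)

context
  fixes A c F G h
  assumes c: "is_product X A (U F) c" and F: "diff_obj F" and G: "diff_obj G" and h: "lin c F G h"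
begin

lemma lin_bl:
  assumes "a \<in> Arr X" "e \<in> Arr X" "Dom X a = Dom X e" "Cod X a = A" "Cod X e = U F"
  shows "tup X c a e \<cdot> h \<cdot> bl G = tup X (Tcone X c) (a \<cdot> tz X A) (e \<cdot> bl F) \<cdot> Tm X h"
proof -
  note [simp] = F diff_obj_simps[OF F] G diff_obj_simps[OF G] linD[OF h] assms product_simps[OF c] product_obj[OF c]
    T_product_tup[OF c] T_product_comp_tup[OF c]
  have "tup X c a e \<cdot> (h \<cdot> bl G) = tup X c a e \<cdot> (tup X (Tcone X c) (fst c \<cdot> tz X A) (snd c \<cdot> bl F) \<cdot> Tm X h)"
    using h by (simp add: lin_def del: assoc)
  then show ?thesis by simp
qed

text \<open>The lift turns \<open>\<sigma>\<close> into the addition \<open>s\<close> of tangent vectors, which is natural, hence preserved by \<open>T(h)\<close>.\<close>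

lemma lin_ad:
  assumes "a \<in> Arr X" "e \<in> Arr X" "e' \<in> Arr X" "Dom X a = Dom X e'" "Dom X e = Dom X e'"
    "Cod X a = A" "Cod X e = U F" "Cod X e' = U F"
  shows "tup X c a (ad F e e') \<cdot> h = ad G (tup X c a e \<cdot> h) (tup X c a e' \<cdot> h)"
proof -
  let ?B = "U F" and ?M = "Dom X (fst c)" and ?D = "U G"
  note [simp] = F diff_obj_simps[OF F] G diff_obj_simps[OF G] linD[OF h] assms product_cone[OF c] product_tup[OF c] product_obj[OF c]
    T_product_tup[OF c]
  define u w where "u = tup X (Tcone X c) (a \<cdot> tz X A) (e \<cdot> bl F)"
    and "w = tup X (Tcone X c) (a \<cdot> tz X A) (e' \<cdot> bl F)"
  have uw [simp]: "u \<in> Arr X" "w \<in> Arr X" "Dom X u = Dom X e'" "Dom X w = Dom X e'" "Cod X u = To X ?M" "Cod X w = To X ?M"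
    "u \<cdot> Tm X (fst c) = a \<cdot> tz X A" "u \<cdot> Tm X (snd c) = e \<cdot> bl F" "w \<cdot> Tm X (fst c) = a \<cdot> tz X A" "w \<cdot> Tm X (snd c) = e' \<cdot> bl F"
    by (simp_all add: u_def w_def)
  have uwp: "u \<cdot> tp X ?M = w \<cdot> tp X ?M"
    using bl_ad_ts(1)[OF F, of e e'] by (simp add: u_def w_def tp_tup[OF c])
  note Q = T2_pullback[of ?M, simplified]
  note [simp] = pullback_tup(1-3)[OF Q _ _ _ _ _ uwp, simplified] pullback_cone(4-8)[OF Q]
  define s where "s = tup X (T2 X ?M) u w \<cdot> ts X ?M"
  have s [simp]: "s \<in> Arr X" "Dom X s = Dom X e'" "Cod X s = To X ?M"
    by (simp_all add: s_def)
  \<comment> \<open>The sum s is identified by its two components: naturality of the tangent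
    addition moves it past each projection, giving zero plus zero over A and the tangent sum of the
    two lifts over F.\<close>
  have "s \<cdot> Tm X (fst c) = a \<cdot> tz X A"
    unfolding s_def using uwp by (simp add: ts_natural ts_zero)
  moreover have "s \<cdot> Tm X (snd c) = ad F e e' \<cdot> bl F"
    unfolding s_def using uwp by (simp add: ts_natural bl_ad_ts(2)[OF F])
  ultimately have s': "s = tup X (Tcone X c) (a \<cdot> tz X A) (ad F e e' \<cdot> bl F)"
    by - (rule T_product_eqI[OF c], simp_all)
  have "tup X c a (ad F e e') \<cdot> h \<cdot> bl G = s \<cdot> Tm X h"
    by (simp add: lin_bl s')
  also have "\<dots> = tup X (T2 X ?D) (u \<cdot> Tm X h) (w \<cdot> Tm X h) \<cdot> ts X ?D"
    unfolding s_def using uwp by (simp add: ts_natural)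
  also have "u \<cdot> Tm X h = tup X c a e \<cdot> h \<cdot> bl G" by (simp add: lin_bl u_def)
  also have "w \<cdot> Tm X h = tup X c a e' \<cdot> h \<cdot> bl G" by (simp add: lin_bl w_def)
  also have "tup X (T2 X ?D) (tup X c a e \<cdot> h \<cdot> bl G) (tup X c a e' \<cdot> h \<cdot> bl G) \<cdot> ts X ?D
     = ad G (tup X c a e \<cdot> h) (tup X c a e' \<cdot> h) \<cdot> bl G"
    by (rule bl_ad_ts(2)[OF G]) simp_all
  finally show ?thesis by - (rule bl_mono[OF G], simp_all)
qed

text \<open>At the zero vector \<lambda> coincides with z, so the value v of h there satisfies v
  \<lambda> = v z; applying p to both sides gives v q \<zeta> = v.\<close>

lemma lin_bz:
  assumes "a \<in> Arr X" "x \<in> Arr X" "Dom X a = Dom X x" "Cod X a = A" "Cod X x = one X"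
  shows "tup X c a (x \<cdot> bz F) \<cdot> h = x \<cdot> bz G"
proof -
  let ?B = "U F" and ?M = "Dom X (fst c)" and ?D = "U G"
  note [simp] = F diff_obj_simps[OF F] G diff_obj_simps[OF G] linD[OF h] assms product_cone[OF c] product_tup[OF c] product_obj[OF c]
    T_product_tup[OF c]
  let ?v = "tup X c a (x \<cdot> bz F) \<cdot> h"
  have "?v \<cdot> bl G = tup X c a (x \<cdot> bz F) \<cdot> tz X ?M \<cdot> Tm X h"
    by (simp add: lin_bl bl_bz_tz[OF F] tz_tup[OF c])
  also have "\<dots> = ?v \<cdot> tz X ?D" by (simp add: tz_natural)
  finally have eq: "?v \<cdot> bl G = ?v \<cdot> tz X ?D" .
  have "?v = ?v \<cdot> tz X ?D \<cdot> tp X ?D" by (simp add: tz_tp)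
  also have "\<dots> = ?v \<cdot> bl G \<cdot> tp X ?D" by (simp add: eq)
  also have "\<dots> = ?v \<cdot> bq G \<cdot> bz G" by (simp add: bl_tp)
  also have "?v \<cdot> bq G = x" by (rule one_eq) simp_all
  finally show ?thesis .
qed

text \<open>\<open>lin_ad\<close> transported along T. The product C supplies the universal triple
  of a parameter and two vectors.\<close>

lemma lin_Tad:
  assumes "u \<in> Arr X" "e \<in> Arr X" "e' \<in> Arr X" "Dom X u = Dom X e'" "Dom X e = Dom X e'"
    "Cod X u = To X A" "Cod X e = To X (U F)" "Cod X e' = To X (U F)"
  shows "tup X (Tcone X c) u (Tad F e e') \<cdot> Tm X h = Tad G (tup X (Tcone X c) u e \<cdot> Tm X h) (tup X (Tcone X c) u e' \<cdot> Tm X h)"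
proof -
  note P = bpair_product[OF F]
  note [simp] = F diff_obj_simps[OF F] G diff_obj_simps[OF G] linD[OF h] assms product_cone[OF c] product_tup[OF c] product_obj[OF c]
    T_product_tup[OF c] T_product_comp_tup[OF c] T_tup[OF c] T_product_tup[OF P]
  define C where "C = prd X A (Dom X (fst (bpair X F)))"
  have C: "is_product X A (Dom X (fst (bpair X F))) C" unfolding C_def by (rule prd_product) simp_all
  note [simp] = product_cone[OF C] T_product_tup[OF C]
  let ?b = "snd C \<cdot> fst (bpair X F)" and ?b' = "snd C \<cdot> snd (bpair X F)"
  have "Tm X (tup X c (fst C) (ad F ?b ?b') \<cdot> h) = Tm X (ad G (tup X c (fst C) ?b \<cdot> h) (tup X c (fst C) ?b' \<cdot> h))"
    by (subst lin_ad) simp_all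
  from arg_cong[OF this, of "\<lambda>k. tup X (Tcone X C) u (tup X (Tcone X (bpair X F)) e e') \<cdot> k"]
  show ?thesis by simp
qed

end

context
  fixes F G g
  assumes F: "diff_obj F" and G: "diff_obj G" and g: "linear_map F G g"
begin

lemma linear_map_bl:
  assumes "x \<in> Arr X" "Cod X x = U F"
  shows "x \<cdot> g \<cdot> bl G = x \<cdot> bl F \<cdot> Tm X g"
  by (rule comp_eq_precomp) (use assms g linear_mapD[OF g] F diff_obj_simps[OF F] G diff_obj_simps[OF G] in \<open>simp_all add: linear_map_def\<close>)

text \<open>A linear map is a two-argument map that is constant in the parameter, so its additivity
  and its zero law are instances of those for \<open>lin\<close>.\<close>

lemma linear_map_lin:
  assumes c: "is_product X A (U F) c"
  shows "lin c F G (snd c \<cdot> g)"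
proof -
  note [simp] = linear_mapD[OF g] F diff_obj_simps[OF F] G diff_obj_simps[OF G] product_cone[OF c] product_obj[OF c] T_product_tup[OF c]
  show ?thesis by (simp add: lin_def linear_map_bl)
qed

lemma linear_map_ad:
  assumes "e \<in> Arr X" "e' \<in> Arr X" "Dom X e = Dom X e'" "Cod X e = U F" "Cod X e' = U F"
  shows "ad F e e' \<cdot> g = ad G (e \<cdot> g) (e' \<cdot> g)"
proof -
  note c = bpair_product[OF F]
  note [simp] = linear_mapD[OF g] F diff_obj_simps[OF F] G diff_obj_simps[OF G] product_tup[OF c] assms
  show ?thesis using lin_ad[OF c F G linear_map_lin[OF c], of e e e'] by simp
qed

lemma linear_map_Tad:
  assumes "e \<in> Arr X" "e' \<in> Arr X" "Dom X e = Dom X e'" "Cod X e = To X (U F)" "Cod X e' = To X (U F)"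
  shows "Tad F e e' \<cdot> Tm X g = Tad G (e \<cdot> Tm X g) (e' \<cdot> Tm X g)"
proof -
  note c = bpair_product[OF F]
  note [simp] = linear_mapD[OF g] F diff_obj_simps[OF F] G diff_obj_simps[OF G] T_product_tup[OF c] assms
  show ?thesis using lin_Tad[OF c F G linear_map_lin[OF c], of e e e'] by simp
qed

lemma linear_map_bz:
  assumes "x \<in> Arr X" "Cod X x = one X"
  shows "x \<cdot> bz F \<cdot> g = x \<cdot> bz G"
proof -
  note c = bpair_product[OF F]
  note [simp] = linear_mapD[OF g] F diff_obj_simps[OF F] G diff_obj_simps[OF G] product_tup[OF c] assms
  show ?thesis using lin_bz[OF c F G linear_map_lin[OF c], of "x \<cdot> bz F" x] by simp
qed

text \<open>The image under T is additive, and the map commutes with \<lambda> by linearity and with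
  z by naturality. In \<nu>-coordinates: a linear map is its own derivative.\<close>

lemma nu_el_linear_map:
  assumes "a \<in> Arr X" "v \<in> Arr X" "Dom X a = Dom X v" "Cod X a = U F" "Cod X v = U F"
  shows "nu_el F a v \<cdot> Tm X g = nu_el G (a \<cdot> g) (v \<cdot> g)"
  unfolding nu_el_def
  using assms linear_mapD[OF g] by (simp add: F diff_obj_simps[OF F] G diff_obj_simps[OF G] linear_map_Tad linear_map_bl tz_natural)

end

text \<open>The vector part of T(f) in the coordinates given by \<nu>. The cone is a parameter
  because both the pullback cone of the dual fibration and the chosen product cone occur.\<close>

definition Der :: "'a \<times> 'a \<Rightarrow> 'a bdl \<Rightarrow> 'a bdl \<Rightarrow> 'a \<Rightarrow> 'a" where
  "Der c E F f = nu_el E (fst c) (snd c) \<cdot> Tm X f \<cdot> vpart F"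

context
  fixes E F f
  assumes E: "diff_obj E" and F: "diff_obj F" and f: "f \<in> Arr X" "Dom X f = U E" "Cod X f = U F"
begin

lemmas Der_simps = E diff_obj_simps[OF E] F diff_obj_simps[OF F] f

lemma nu_el_Tm:
  assumes "a \<in> Arr X" "v \<in> Arr X" "Dom X a = Dom X v" "Cod X a = U E" "Cod X v = U E"
  shows "nu_el E a v \<cdot> Tm X f = nu_el F (a \<cdot> f) (nu_el E a v \<cdot> Tm X f \<cdot> vpart F)"
  using nu_el_elem[OF F, of "nu_el E a v \<cdot> Tm X f"] assms by (simp add: Der_simps tp_natural nu_el_tp[OF E])

lemma Der_arr:
  assumes c: "is_product X (U E) (U E) c"
  shows "Der c E F f \<in> Arr X" "Dom X (Der c E F f) = Dom X (fst c)" "Cod X (Der c E F f) = U F"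
  using product_cone[OF c] by (simp_all add: Der_simps Der_def)

lemma Der_elem:
  assumes c: "is_product X (U E) (U E) c"
    and "a \<in> Arr X" "v \<in> Arr X" "Dom X a = Dom X v" "Cod X a = U E" "Cod X v = U E"
  shows "tup X c a v \<cdot> Der c E F f = nu_el E a v \<cdot> Tm X f \<cdot> vpart F"
  using product_cone[OF c] product_tup[OF c] assms by (simp add: Der_simps Der_def)

text \<open>T(f) commutes with \<ell> by naturality; \<open>nu_el_tl\<close> and
  \<open>vpart_bl\<close> translate \<ell> into the lifts of E and F.\<close>

lemma Der_lin:
  assumes c: "is_product X (U E) (U E) c"
  shows "lin c E F (Der c E F f)"
proof -
  note [simp] = Der_simps Der_arr[OF c] product_cone[OF c] T_product_tup[OF c]
  let ?n = "nu_el E (fst c) (snd c)"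
  let ?z = "tup X (Tcone X c) (fst c \<cdot> tz X (U E)) (snd c \<cdot> bl E)"
  have "?z \<cdot> Tm X (Der c E F f) = ?n \<cdot> tl X (U E) \<cdot> Tm X (Tm X f) \<cdot> Tm X (vpart F)"
    by (simp add: Der_def nu_el_tl[OF E])
  also have "\<dots> = ?n \<cdot> Tm X f \<cdot> vpart F \<cdot> bl F"
    by (simp add: tl_natural vpart_bl)
  finally show ?thesis using c by (simp add: lin_def) (simp add: Der_def)
qed

text \<open>\<open>nu_el_Tm\<close> at the universal pair, mapped by T; this brings in the second
  derivative.\<close>

lemma T_nu_el_Tm:
  assumes c: "is_product X (U E) (U E) c"
    and "x \<in> Arr X" "y \<in> Arr X" "Dom X x = Dom X y" "Cod X x = To X (U E)" "Cod X y = To X (U E)"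
  shows "T_nu_el E x y \<cdot> Tm X (Tm X f) = T_nu_el F (x \<cdot> Tm X f) (tup X (Tcone X c) x y \<cdot> Tm X (Der c E F f))"
proof -
  note [simp] = Der_simps Der_arr[OF c] product_cone[OF c] T_product_tup[OF c] assms(2-)
  have "Tm X (nu_el E (fst c) (snd c) \<cdot> Tm X f) = Tm X (nu_el F (fst c \<cdot> f) (Der c E F f))"
    by (subst nu_el_Tm) (simp_all add: Der_def)
  from arg_cong[OF this, of "\<lambda>k. tup X (Tcone X c) x y \<cdot> k"]
  show ?thesis using c by simp
qed

text \<open>Symmetry of second derivatives. In \<nu>-coordinates the flip exchanges the two
  first-order entries, and T(T(f)) commutes with the flip, so the second-order parts on both sides
  must agree.\<close>

lemma Der_Der_swap:
  assumes P: "diff_obj P" and p: "is_product X (U E) (U E) p" "Dom X (fst p) = U P"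
    and p01: "linear_map P E (fst p)" "linear_map P E (snd p)"
    and [simp]: "a \<in> Arr X" "b \<in> Arr X" "c \<in> Arr X" "d \<in> Arr X" "Dom X a = Dom X d" "Dom X b = Dom X d" "Dom X c = Dom X d"
      "Cod X a = U E" "Cod X b = U E" "Cod X c = U E" "Cod X d = U E"
  shows "nu_el P (tup X p a b) (tup X p c d) \<cdot> Tm X (Der p E F f) \<cdot> vpart F
    = nu_el P (tup X p a c) (tup X p b d) \<cdot> Tm X (Der p E F f) \<cdot> vpart F"
proof -
  let ?A = "U E" and ?D = "Der p E F f"
  note [simp] = Der_simps P diff_obj_simps[OF P] product_cone(1,2,4-)[OF p(1)] product_cone(3)[OF p(1), unfolded p(2)] p(2)
    product_tup[OF p(1), unfolded p(2)] T_product_tup[OF p(1)] Der_arr[OF p(1), unfolded p(2)]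
  \<comment> \<open>\<delta> is the second derivative at (a, b) in direction (c, d) and \<epsilon>
    the first derivative; together with the value of f they are the coordinates of T(T(f)).\<close>
  define \<delta> where "\<delta> a b c d = nu_el P (tup X p a b) (tup X p c d) \<cdot> Tm X ?D \<cdot> vpart F" for a b c d
  define \<epsilon> where "\<epsilon> a b = nu_el E a b \<cdot> Tm X f \<cdot> vpart F" for a b
  have key: "T_nu_el E (nu_el E a c) (nu_el E b d) \<cdot> Tm X (Tm X f)
     = T_nu_el F (nu_el F (a \<cdot> f) (\<epsilon> a c)) (nu_el F (\<epsilon> a b) (\<delta> a b c d))"
    if [simp]: "a \<in> Arr X" "b \<in> Arr X" "c \<in> Arr X" "d \<in> Arr X" "Dom X a = Dom X d" "Dom X b = Dom X d" "Dom X c = Dom X d"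
      "Cod X a = U E" "Cod X b = U E" "Cod X c = U E" "Cod X d = U E" for a b c d
  proof -
    \<comment> \<open>The projections of P are linear, so \<nu> on P is componentwise.\<close>
    have "tup X (Tcone X p) (nu_el E a c) (nu_el E b d) = nu_el P (tup X p a b) (tup X p c d)"
      by (rule T_product_eqI[OF p(1)]) (simp_all add: nu_el_linear_map[OF P E p01(1)] nu_el_linear_map[OF P E p01(2)])
    moreover have "nu_el P (tup X p a b) (tup X p c d) \<cdot> Tm X ?D = nu_el F (\<epsilon> a b) (\<delta> a b c d)"
      using nu_el_elem[OF F, of "nu_el P (tup X p a b) (tup X p c d) \<cdot> Tm X ?D"]
      by (simp add: \<delta>_def \<epsilon>_def tp_natural nu_el_tp[OF P] Der_elem[OF p(1)])
    moreover have "nu_el E a c \<cdot> Tm X f = nu_el F (a \<cdot> f) (\<epsilon> a c)"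
      unfolding \<epsilon>_def by (rule nu_el_Tm) simp_all
    ultimately show ?thesis by (simp add: T_nu_el_Tm[OF p(1)])
  qed
  have [simp]: "\<epsilon> a b \<in> Arr X" "\<epsilon> a c \<in> Arr X" "Dom X (\<epsilon> a b) = Dom X d" "Dom X (\<epsilon> a c) = Dom X d"
     "Cod X (\<epsilon> a b) = U F" "Cod X (\<epsilon> a c) = U F"
     "\<delta> a b c d \<in> Arr X" "\<delta> a c b d \<in> Arr X" "Dom X (\<delta> a b c d) = Dom X d" "Dom X (\<delta> a c b d) = Dom X d"
     "Cod X (\<delta> a b c d) = U F" "Cod X (\<delta> a c b d) = U F"
    by (simp_all add: \<epsilon>_def \<delta>_def)
  \<comment> \<open>Flip the coordinates in F, move the flip through T(T(f)) by naturality, and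
    carry it out in E as the exchange of b and c.\<close>
  have "T_nu_el F (nu_el F (a \<cdot> f) (\<epsilon> a b)) (nu_el F (\<epsilon> a c) (\<delta> a b c d))
      = T_nu_el F (nu_el F (a \<cdot> f) (\<epsilon> a c)) (nu_el F (\<epsilon> a b) (\<delta> a b c d)) \<cdot> tc X (U F)"
    by (simp add: nu_el_nu_el_tc)
  also have "\<dots> = T_nu_el E (nu_el E a c) (nu_el E b d) \<cdot> tc X ?A \<cdot> Tm X (Tm X f)"
    by (simp add: key[symmetric] tc_natural)
  also have "\<dots> = T_nu_el E (nu_el E a b) (nu_el E c d) \<cdot> Tm X (Tm X f)"
    by (simp add: nu_el_nu_el_tc)
  also have "\<dots> = T_nu_el F (nu_el F (a \<cdot> f) (\<epsilon> a b)) (nu_el F (\<epsilon> a c) (\<delta> a c b d))"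
    by (rule key) simp_all
  finally have eq: "T_nu_el F (nu_el F (a \<cdot> f) (\<epsilon> a b)) (nu_el F (\<epsilon> a c) (\<delta> a b c d))
     = T_nu_el F (nu_el F (a \<cdot> f) (\<epsilon> a b)) (nu_el F (\<epsilon> a c) (\<delta> a c b d))" .
  \<comment> \<open>The vector part under T strips the outer coordinates, injectivity of \<nu> the
    inner ones.\<close>
  have "nu_el F (\<epsilon> a c) (\<delta> a b c d) = nu_el F (\<epsilon> a c) (\<delta> a c b d)"
    using arg_cong[OF eq, of "\<lambda>k. k \<cdot> Tm X (vpart F)"] by (simp add: T_nu_el_vpart)
  then have "\<delta> a b c d = \<delta> a c b d"
    by - (rule nu_el_inj(2)[OF F, of "\<epsilon> a c" _ "\<epsilon> a c"], simp_all)
  then show ?thesis by (simp add: \<delta>_def)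
qed

end

lemma nu_el_linear_map_vpart:
  assumes "diff_obj E" "diff_obj F" "linear_map E F g"
    and "a \<in> Arr X" "v \<in> Arr X" "Dom X a = Dom X v" "Cod X a = U E" "Cod X v = U E"
  shows "nu_el E a v \<cdot> Tm X g \<cdot> vpart F = v \<cdot> g"
proof -
  note [simp] = assms(1,2,4-) diff_obj_simps[OF assms(1)] diff_obj_simps[OF assms(2)] linear_mapD[OF assms(3)]
  show ?thesis by (simp add: nu_el_linear_map[OF assms(1-3)] nu_el_vpart)
qed

text \<open>A map linear in its second argument is its own partial derivative. In direction (0, d)
  the tangent vector is the pair of z at a and \<nu>(b, d), the latter a sum on which T(h) is
  additive: d \<lambda> contributes \<lambda> of h(a, d) and b z contributes z at h(a, b), so the
  vector part is h(a, d).\<close>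

lemma lin_nu_el_vpart:
  assumes E: "diff_obj E" and F: "diff_obj F" and G: "diff_obj G" and P: "diff_obj P"
    and p: "is_product X (U E) (U F) p" "Dom X (fst p) = U P"
    and p01: "linear_map P E (fst p)" "linear_map P F (snd p)"
    and h: "lin p F G h"
    and [simp]: "a \<in> Arr X" "b \<in> Arr X" "x \<in> Arr X" "d \<in> Arr X" "Dom X a = Dom X d" "Dom X b = Dom X d" "Dom X x = Dom X d"
      "Cod X a = U E" "Cod X b = U F" "Cod X x = one X" "Cod X d = U F"
  shows "nu_el P (tup X p a b) (tup X p (x \<cdot> bz E) d) \<cdot> Tm X h \<cdot> vpart G = tup X p a d \<cdot> h"
proof -
  note [simp] = P diff_obj_simps[OF P] E diff_obj_simps[OF E] F diff_obj_simps[OF F] G diff_obj_simps[OF G]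
    product_cone(1,2,4-)[OF p(1)] product_cone(3)[OF p(1), unfolded p(2)] p(2)
    product_tup[OF p(1), unfolded p(2)] T_product_tup[OF p(1)] linD[OF h, unfolded p(2)]
  have "nu_el P (tup X p a b) (tup X p (x \<cdot> bz E) d) = tup X (Tcone X p) (a \<cdot> tz X (U E)) (nu_el F b d)"
    by (rule T_product_eqI[OF p(1)]) (simp_all add: nu_el_linear_map[OF P E p01(1)] nu_el_linear_map[OF P F p01(2)] nu_el_tz)
  then have "nu_el P (tup X p a b) (tup X p (x \<cdot> bz E) d) \<cdot> Tm X h
     = Tad G (tup X (Tcone X p) (a \<cdot> tz X (U E)) (d \<cdot> bl F) \<cdot> Tm X h)
         (tup X (Tcone X p) (a \<cdot> tz X (U E)) (b \<cdot> tz X (U F)) \<cdot> Tm X h)"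
    by (simp add: nu_el_def[of F] lin_Tad[OF p(1) F G h])
  also have "\<dots> = nu_el G (tup X p a b \<cdot> h) (tup X p a d \<cdot> h)"
    unfolding nu_el_def using tz_tup[OF p(1), of a b] tz_natural[of "tup X p a b" h "U P"]
    by (simp add: lin_bl[OF p(1) F G h])
  finally show ?thesis by (simp add: nu_el_vpart)
qed

section \<open>Trivial bundles and the tangent bundle of a differential object\<close>

lemma pbcone_product:
  assumes "diff_obj E" "t \<in> Arr X" "Cod X t = one X"
  shows "is_pullback X t (bq E) (pbcone X t E)" "is_product X (Dom X t) (U E) (pbcone X t E)"
proof -
  note [simp] = assms(1) diff_obj_simps[OF assms(1)] assms(2,3)
  have "is_pullback X t (bq E) (prd X (Dom X t) (U E))"
    by (rule product_is_pullback[OF prd_product one_terminal]) simp_all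
  then show *: "is_pullback X t (bq E) (pbcone X t E)" unfolding pbcone_def by (rule pb_is_pullback)
  show "is_product X (Dom X t) (U E) (pbcone X t E)"
    by (rule pullback_over_terminal[OF *]) (simp add: one_terminal)
qed

lemma pullback_bundle_sel [simp]:
  "bq (pullback_bundle X f E) = fst (pbcone X f E)"
  "bl (pullback_bundle X f E) = tup X (Tcone X (pbcone X f E)) (fst (pbcone X f E) \<cdot> tz X (Dom X f)) (snd (pbcone X f E) \<cdot> bl E)"
  by (simp_all add: pullback_bundle_def Let_def)

lemma tangent_bundle_sel [simp]:
  "bq (tangent_bundle X A) = tp X A" "bl (tangent_bundle X A) = tl X A"
  by (simp_all add: tangent_bundle_def)

text \<open>The passage from the fibration to arrows of two arguments: over a terminal object
  compatibility with the projections is automatic, and the lift of the pullback bundle is z x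
  \<lambda>.\<close>

lemma linear_morphism_lin:
  assumes "diff_obj E" "diff_obj F" "t \<in> Arr X" "Cod X t = one X"
  shows "linear_morphism X (pullback_bundle X t E) F t h \<longleftrightarrow> lin (pbcone X t E) E F h"
proof -
  note [simp] = assms(1) diff_obj_simps[OF assms(1)] assms(2) diff_obj_simps[OF assms(2)] assms(3,4) product_cone[OF pbcone_product(2)[OF assms(1,3,4)]]
  show ?thesis
    by (auto simp: linear_morphism_def lin_def tot_def bas_def intro: one_eq)
qed

lemma linear_over_linear_map:
  assumes "diff_obj E" "diff_obj F"
  shows "linear_over X E F g \<longleftrightarrow> linear_map E F g"
proof -
  note [simp] = assms(1) diff_obj_simps[OF assms(1)] assms(2) diff_obj_simps[OF assms(2)]
  show ?thesis
    by (auto simp: linear_morphism_def linear_over_def linear_map_def tot_def bas_def intro: one_eq)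
qed

lemma nu_nu_el:
  assumes "diff_obj E"
  shows "nu X E = nu_el E (fst (pbcone X (bq E) E)) (snd (pbcone X (bq E) E))"
  by (simp add: nu_def nu_el_def madd_def Let_def tot_def)

context
  fixes E c assumes E: "diff_obj E" and cdef: "c = pbcone X (bq E) E"
begin

lemma nu_cone: "is_product X (U E) (U E) c"
  unfolding cdef by (rule pbcone_product(2)[OF E]) (simp_all add: E diff_obj_simps[OF E])

lemmas nu_simps = E diff_obj_simps[OF E] product_cone[OF nu_cone]

lemma nu_linear: "linear_over X (pullback_bundle X (bq E) E) (tangent_bundle X (U E)) (nu X E)"
  using nu_el_tl[OF E, of "fst c" "snd c"] T_product_tup[OF nu_cone]
  by (simp add: nu_simps linear_over_def linear_morphism_def nu_nu_el[OF E] cdef[symmetric] tot_def bas_def nu_el_tp)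

text \<open>The inverse of \<nu> pairs the base point with the vector part. Its linearity consists
  of \<ell> T(p) = p z and of \<open>vpart_bl\<close> at the identity.\<close>

lemma nu_inverse_linear: "linear_over X (tangent_bundle X (U E)) (pullback_bundle X (bq E) E) (tup X c (tp X (U E)) (vpart E))"
proof -
  let ?A = "U E" and ?i = "tup X c (tp X (U E)) (vpart E)"
  note [simp] = nu_simps product_tup[OF nu_cone] product_comp_tup[OF nu_cone] T_product_tup[OF nu_cone] T_product_comp_tup[OF nu_cone]
  have "tl X ?A \<cdot> Tm X (tp X ?A) = tp X ?A \<cdot> tz X ?A" using tangent_obj[of ?A] by simp
  moreover have "vpart E \<cdot> bl E = tl X ?A \<cdot> Tm X (vpart E)"
    using vpart_bl[OF E, of "Idn X (To X ?A)"] by simp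
  ultimately show ?thesis
    by (simp add: linear_over_def linear_morphism_def cdef[symmetric] tot_def bas_def T_tup[OF nu_cone])
qed

lemma nu_inverse_nu:
  "tup X c (tp X (U E)) (vpart E) \<cdot> nu X E = Idn X (To X (U E))"
  "nu X E \<cdot> tup X c (tp X (U E)) (vpart E) = Idn X (Dom X (fst c))"
  using product_tup[OF nu_cone] product_comp_tup[OF nu_cone] nu_el_tp_vpart[OF E]
  by (simp_all add: nu_simps nu_nu_el[OF E] cdef[symmetric] nu_el_tp nu_el_vpart product_tup_id[OF nu_cone])

end

lemma linear_morphism_T:
  assumes "f \<in> Arr X"
  shows "linear_morphism X (tangent_bundle X (Dom X f)) (tangent_bundle X (Cod X f)) f (Tm X f)"
  using assms tangent_arr[OF assms] by (simp add: linear_morphism_def tot_def bas_def)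

end

section \<open>The functor to the dual fibration\<close>

locale rev_ctx = tangent_ctx X for X :: "('o, 'a, 'm) tangent_cat_scheme" (structure) +
  fixes \<D> :: "'a bdl set" and V :: "'a involution"
  assumes crtc: "cartesian_reverse_tangent_category X \<D> V"
begin

lemma reverse_tangent: "system_of_bundles X \<D>" "linear_involution X \<D> V"
  using crtc by (simp_all add: cartesian_reverse_tangent_category_def reverse_tangent_category_def)

lemma bundle_axiom: "E \<in> \<D> \<Longrightarrow> differential_bundle X E"
  and tangent_bundle_mem: "A \<in> Obj X \<Longrightarrow> tangent_bundle X A \<in> \<D>"
  and pullback_bundle_mem: "\<lbrakk>E \<in> \<D>; f \<in> Arr X; Cod X f = Cod X (bq E)\<rbrakk> \<Longrightarrow> pullback_bundle X f E \<in> \<D>"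
  and pullback_bundle_ex: "\<lbrakk>E \<in> \<D>; f \<in> Arr X; Cod X f = Cod X (bq E)\<rbrakk> \<Longrightarrow> pullback_bundle_exists X f E"
  using reverse_tangent(1) by (simp_all add: system_of_bundles_def bas_def)

lemma bundle_diff_obj: "E \<in> \<D> \<Longrightarrow> Cod X (bq E) = one X \<Longrightarrow> diff_obj E"
  using bundle_axiom by (simp add: diff_obj_def)

lemma bundle_arr:
  assumes "E \<in> \<D>"
  shows "bq E \<in> Arr X" "bl E \<in> Arr X" "Dom X (bl E) = U E" "Cod X (bl E) = To X (U E)"
    "U E \<in> Obj X" "Cod X (bq E) \<in> Obj X" "bl E \<cdot> Tm X (bq E) = bq E \<cdot> tz X (Cod X (bq E))"
  using bundle_axiom[OF assms]
  by (simp_all add: differential_bundle_def comm_monoid_over_def Let_def tot_def bas_def)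

lemma pbcone_pullback:
  assumes "E \<in> \<D>" "f \<in> Arr X" "Cod X f = Cod X (bq E)"
  shows "is_pullback X f (bq E) (pbcone X f E)"
proof -
  obtain c where "is_Tpullback X f (bq E) c"
    using pullback_bundle_ex[OF assms] nfold_one_pullback[OF bundle_arr(1)[OF assms(1)]]
    unfolding pullback_bundle_exists_def by blast
  from spec[OF this[unfolded is_Tpullback_def], of 0] have "is_pullback X f (bq E) c" by simp
  then show ?thesis unfolding pbcone_def by (rule pb_is_pullback)
qed

lemma star_functor: "is_functor (DBun X \<D>) (DBun_dual X \<D>) (Star V) (StarM V)"
  and star_bas: "E \<in> \<D> \<Longrightarrow> Cod X (bq (Star V E)) = Cod X (bq E)"
  and star_base: "m \<in> Arr (DBun X \<D>) \<Longrightarrow> base (StarM V m) = base m"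
  and star_cartesian: "is_cartesian_arrow (DBun X \<D>) X (bas X) base m \<Longrightarrow>
          is_cartesian_arrow (DBun_dual X \<D>) X (bas X) base (StarM V m)"
  and iota_mor: "E \<in> \<D> \<Longrightarrow> Iota V E \<in> Hom (DBun X \<D>) E (Star V (Star V E))"
  and iota_base: "E \<in> \<D> \<Longrightarrow> base (Iota V E) = Idn X (Cod X (bq E))"
  and iota_natural: "m \<in> Arr (DBun X \<D>) \<Longrightarrow>
     m \<cdot>\<^bsub>DBun X \<D>\<^esub> Iota V (bcod m) = Iota V (bdom m) \<cdot>\<^bsub>DBun X \<D>\<^esub> double_dual X V m"
  using reverse_tangent(2) unfolding linear_involution_def bas_def by (blast | simp)+

lemma star_mem: "E \<in> \<D> \<Longrightarrow> Star V E \<in> \<D>"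
  using star_functor by (simp add: is_functor_def DBun_def DBun_dual_def)

definition star_map :: "'a bdl \<Rightarrow> 'a bdl \<Rightarrow> 'a \<Rightarrow> 'a \<Rightarrow> 'a" where
  "star_map E F f g = total (StarM V \<lparr>bdom = E, bcod = F, base = f, total = g\<rparr>)"

lemma mor_DBun:
  "\<lparr>bdom = E, bcod = F, base = f, total = g\<rparr> \<in> Arr (DBun X \<D>) \<longleftrightarrow> E \<in> \<D> \<and> F \<in> \<D> \<and> linear_morphism X E F f g"
  by (simp add: DBun_def)

lemma linear_morphismD:
  assumes "linear_morphism X E F f g"
  shows "f \<in> Arr X" "Dom X f = Cod X (bq E)" "Cod X f = Cod X (bq F)"
    "g \<in> Arr X" "Dom X g = U E" "Cod X g = U F" "g \<cdot> bq F = bq E \<cdot> f" "g \<cdot> bl F = bl E \<cdot> Tm X g"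
  using assms by (simp_all add: linear_morphism_def tot_def bas_def)

lemma linear_morphism_comp:
  assumes D: "E \<in> \<D>" "F \<in> \<D>" "G \<in> \<D>" and fg: "linear_morphism X E F f g" and hk: "linear_morphism X F G h k"
  shows "linear_morphism X E G (f \<cdot> h) (g \<cdot> k)"
proof -
  note [simp] = bundle_arr(1-6)[OF D(1)] bundle_arr(1-6)[OF D(2)] bundle_arr(1-6)[OF D(3)]
    linear_morphismD(1-6)[OF fg] linear_morphismD(1-6)[OF hk]
  have "g \<cdot> k \<cdot> bq G = g \<cdot> bq F \<cdot> h"
    by (rule comp_eq_precomp[OF linear_morphismD(7)[OF hk]]) simp_all
  also have "\<dots> = bq E \<cdot> f \<cdot> h" by (simp add: linear_morphismD(7)[OF fg])
  finally have 1: "g \<cdot> k \<cdot> bq G = bq E \<cdot> f \<cdot> h" .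
  have "g \<cdot> k \<cdot> bl G = g \<cdot> bl F \<cdot> Tm X k"
    by (rule comp_eq_precomp[OF linear_morphismD(8)[OF hk]]) simp_all
  also have "\<dots> = bl E \<cdot> Tm X g \<cdot> Tm X k" by (simp add: linear_morphismD(8)[OF fg])
  finally have "g \<cdot> k \<cdot> bl G = bl E \<cdot> Tm X g \<cdot> Tm X k" .
  with 1 show ?thesis by (simp add: linear_morphism_def tot_def bas_def)
qed

lemma linear_over_alt:
  "linear_over X E F g \<longleftrightarrow> Cod X (bq E) = Cod X (bq F) \<and> linear_morphism X E F (Idn X (Cod X (bq E))) g"
  by (simp add: linear_over_def bas_def)

lemma linear_over_comp:
  assumes "E \<in> \<D>" "F \<in> \<D>" "G \<in> \<D>" "linear_over X E F g" "linear_over X F G k"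
  shows "linear_over X E G (g \<cdot> k)"
proof -
  have [simp]: "Cod X (bq G) \<in> Obj X" by (rule bundle_arr(6)[OF assms(3)])
  have e: "Cod X (bq E) = Cod X (bq F)" "Cod X (bq F) = Cod X (bq G)"
    and m: "linear_morphism X E F (Idn X (Cod X (bq E))) g" "linear_morphism X F G (Idn X (Cod X (bq F))) k"
    using assms(4,5) unfolding linear_over_alt by blast+
  show ?thesis
    using linear_morphism_comp[OF assms(1-3) m] unfolding linear_over_alt e by simp
qed

lemma linear_over_Idn: "E \<in> \<D> \<Longrightarrow> linear_over X E E (Idn X (U E))"
  using bundle_arr[of E] by (simp add: linear_over_def linear_morphism_def tot_def bas_def)

lemma linear_over_inverse:
  assumes D: "E \<in> \<D>" "F \<in> \<D>" and g: "linear_over X E F g" and p: "inverse_pair X g k"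
  shows "linear_over X F E k"
proof -
  have g': "linear_morphism X E F (Idn X (Cod X (bq E))) g" "Cod X (bq F) = Cod X (bq E)"
    using g unfolding linear_over_alt by (blast, simp)
  note [simp] = bundle_arr(1-6)[OF D(1)] bundle_arr(1-4)[OF D(2)] linear_morphismD(1-6)[OF g'(1)] g'(2)
  have k [simp]: "k \<in> Arr X" "Dom X k = U F" "Cod X k = U E" and
    gk: "g \<cdot> k = Idn X (U E)" and kg: "k \<cdot> g = Idn X (U F)"
    using p by (simp_all add: inverse_pair_def)
  have [simp]: "U F \<in> Obj X" by (rule bundle_arr(5)[OF D(2)])
  have "k \<cdot> bq E = k \<cdot> (g \<cdot> bq F)" using linear_morphismD(7)[OF g'(1)] by simp
  also have "\<dots> = bq F" by (simp add: kg)
  finally have 1: "k \<cdot> bq E = bq F" .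
  have Tgk: "Tm X g \<cdot> Tm X k = Idn X (To X (U E))"
    using arg_cong[OF gk, of "Tm X"] by simp
  have "bl F \<cdot> Tm X k = k \<cdot> g \<cdot> bl F \<cdot> Tm X k" by (simp add: kg)
  also have "\<dots> = k \<cdot> (g \<cdot> bl F) \<cdot> Tm X k" by simp
  also have "\<dots> = k \<cdot> bl E \<cdot> (Tm X g \<cdot> Tm X k)" unfolding linear_morphismD(8)[OF g'(1)] by simp
  also have "\<dots> = k \<cdot> bl E" unfolding Tgk by simp
  finally show ?thesis using 1 by (simp add: linear_over_alt linear_morphism_def tot_def bas_def)
qed

lemma star_mor:
  assumes "E \<in> \<D>" "F \<in> \<D>" "linear_morphism X E F f g"
  shows "StarM V \<lparr>bdom = E, bcod = F, base = f, total = g\<rparr> = \<lparr>bdom = Star V E, bcod = Star V F, base = f, total = star_map E F f g\<rparr>"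
    "linear_over X (pullback_bundle X f (Star V F)) (Star V E) (star_map E F f g)"
proof -
  let ?m = "\<lparr>bdom = E, bcod = F, base = f, total = g\<rparr>"
  have m: "?m \<in> Arr (DBun X \<D>)" using assms by (simp add: mor_DBun)
  have "StarM V ?m \<in> Hom (DBun_dual X \<D>) (Star V E) (Star V F)"
    using star_functor m by (simp add: is_functor_def DBun_def)
  moreover have b: "base (StarM V ?m) = f" using star_base[OF m] by simp
  ultimately show "linear_over X (pullback_bundle X f (Star V F)) (Star V E) (star_map E F f g)"
    "StarM V ?m = \<lparr>bdom = Star V E, bcod = Star V F, base = f, total = star_map E F f g\<rparr>"
    by (auto simp: DBun_dual_def star_map_def)
qed

context
  fixes E F f g assumes D: "E \<in> \<D>" "F \<in> \<D>" and fg: "linear_morphism X E F f g"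
begin

lemma star_pullback: "is_pullback X f (bq (Star V F)) (pbcone X f (Star V F))"
  by (rule pbcone_pullback) (use D star_mem star_bas linear_morphismD[OF fg] in simp_all)

lemma star_map_arr: "star_map E F f g \<in> Arr X" "Dom X (star_map E F f g) = Dom X (fst (pbcone X f (Star V F)))"
  "Cod X (star_map E F f g) = U (Star V E)" "star_map E F f g \<cdot> bq (Star V E) = fst (pbcone X f (Star V F))"
  using star_mor(2)[OF D fg] pullback_cone[OF star_pullback] linear_morphismD(1-3)[OF fg]
  by (simp_all add: linear_over_def linear_morphism_def tot_def bas_def)

lemma star_el_arr:
  assumes "a \<in> Arr X" "w \<in> Arr X" "Dom X a = Dom X w" "Cod X a = Dom X f" "Cod X w = U (Star V F)"
    "a \<cdot> f = w \<cdot> bq (Star V F)"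
  shows "tup X (pbcone X f (Star V F)) a w \<cdot> star_map E F f g \<in> Arr X"
    "Dom X (tup X (pbcone X f (Star V F)) a w \<cdot> star_map E F f g) = Dom X w"
    "Cod X (tup X (pbcone X f (Star V F)) a w \<cdot> star_map E F f g) = U (Star V E)"
    "tup X (pbcone X f (Star V F)) a w \<cdot> star_map E F f g \<cdot> bq (Star V E) = a"
proof -
  note T = pullback_tup[OF star_pullback assms]
  show "tup X (pbcone X f (Star V F)) a w \<cdot> star_map E F f g \<in> Arr X"
    "Dom X (tup X (pbcone X f (Star V F)) a w \<cdot> star_map E F f g) = Dom X w"
    "Cod X (tup X (pbcone X f (Star V F)) a w \<cdot> star_map E F f g) = U (Star V E)"
    using T star_map_arr(1-3) by simp_all
  have "tup X (pbcone X f (Star V F)) a w \<cdot> (star_map E F f g \<cdot> bq (Star V E)) = a"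
    unfolding star_map_arr(4) using T by simp
  then show "tup X (pbcone X f (Star V F)) a w \<cdot> star_map E F f g \<cdot> bq (Star V E) = a"
    using T star_map_arr(1-3) bundle_arr(1)[OF star_mem[OF D(1)]] by simp
qed

end

text \<open>Functoriality of \<open>(-)\<^sup>*\<close> on elements: \<open>(g k)\<^sup>*(a, w) = g\<^sup>*(a, k\<^sup>*(a f, w))\<close>.\<close>

lemma star_el_comp:
  assumes D: "E \<in> \<D>" "F \<in> \<D>" "G \<in> \<D>" and fg: "linear_morphism X E F f g" and hk: "linear_morphism X F G h k"
    and aw: "a \<in> Arr X" "w \<in> Arr X" "Dom X a = Dom X w" "Cod X a = Dom X f" "Cod X w = U (Star V G)"
    "a \<cdot> f \<cdot> h = w \<cdot> bq (Star V G)"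
  shows "tup X (pbcone X (f \<cdot> h) (Star V G)) a w \<cdot> star_map E G (f \<cdot> h) (g \<cdot> k)
    = tup X (pbcone X f (Star V F)) a (tup X (pbcone X h (Star V G)) (a \<cdot> f) w \<cdot> star_map F G h k) \<cdot> star_map E F f g"
proof -
  let ?m = "\<lparr>bdom = E, bcod = F, base = f, total = g\<rparr>" and ?n = "\<lparr>bdom = F, bcod = G, base = h, total = k\<rparr>"
  let ?c = "pbcone X (f \<cdot> h) (Star V G)" and ?cf = "pbcone X f (Star V F)" and ?ch = "pbcone X h (Star V G)"
  note fghk = linear_morphism_comp[OF D fg hk]
  \<comment> \<open>In the functor law, composition in the dual fibration already is the nested
    pairing; it remains to evaluate it at <a, w>.\<close>
  have "StarM V (?m \<cdot>\<^bsub>DBun X \<D>\<^esub> ?n) = StarM V ?m \<cdot>\<^bsub>DBun_dual X \<D>\<^esub> StarM V ?n"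
    by (rule star_functor[unfolded is_functor_def, THEN conjunct2, THEN conjunct2, THEN conjunct2,
        THEN bspec, THEN bspec, THEN mp]) (use D fg hk in \<open>simp_all add: DBun_def\<close>)
  then have "star_map E G (f \<cdot> h) (g \<cdot> k)
    = tup X ?cf (fst ?c) (tup X ?ch (fst ?c \<cdot> f) (snd ?c) \<cdot> star_map F G h k) \<cdot> star_map E F f g"
    unfolding star_mor(1)[OF D(1,2) fg] star_mor(1)[OF D(2,3) hk]
    by (simp add: DBun_def DBun_dual_def Let_def star_map_def)
  note star_map = this
  note P = star_pullback[OF D(1,3) fghk] and Pf = star_pullback[OF D(1,2) fg] and Ph = star_pullback[OF D(2,3) hk]
  note [simp] = linear_morphismD(1,2,4,5,6)[OF fg] linear_morphismD(1,2,4,5,6)[OF hk] linear_morphismD(3)[OF fg]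
    pullback_cone(4-6)[OF P] pullback_cone(8)[OF P] pullback_cone(7)[OF P]
    pullback_cone(4-6)[OF Pf] pullback_cone(7,8)[OF Pf] pullback_cone(4-6)[OF Ph] pullback_cone(7,8)[OF Ph]
    star_map_arr(1-3)[OF D(1,2) fg] star_map_arr(1-3)[OF D(2,3) hk] aw(1-5) bundle_arr(1)[OF star_mem[OF D(2)]]
    bundle_arr(1)[OF star_mem[OF D(3)]]
  have 1: "fst ?c \<cdot> f \<cdot> h = snd ?c \<cdot> bq (Star V G)" using pullback_cone(9)[OF P] by simp
  note S = star_el_arr[OF D(2,3) hk _ _ _ _ _ 1, simplified]
  have 2: "fst ?c \<cdot> f = tup X ?ch (fst ?c \<cdot> f) (snd ?c) \<cdot> star_map F G h k \<cdot> bq (Star V F)" using S(4) by simp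
  have 3: "a \<cdot> (f \<cdot> h) = w \<cdot> bq (Star V G)" using aw by simp
  note Q = pullback_tup[OF P _ _ _ _ _ 3, simplified]
  note [simp] = Q S(1-3)
  show ?thesis unfolding star_map
    using pullback_tup[OF Pf _ _ _ _ _ 2, simplified] pullback_comp_tup[OF Pf _ _ _ _ _ 2, simplified]
      pullback_tup[OF Ph _ _ _ _ _ 1, simplified] pullback_comp_tup[OF Ph _ _ _ _ _ 1, simplified]
    by simp
qed

lemma star_map_Idn:
  assumes "E \<in> \<D>"
  shows "star_map E E (Idn X (Cod X (bq E))) (Idn X (U E)) = snd (pbcone X (Idn X (Cod X (bq E))) (Star V E))"
proof -
  have "StarM V (Idn (DBun X \<D>) E) = Idn (DBun_dual X \<D>) (Star V E)"
    using star_functor assms by (simp add: is_functor_def DBun_def)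
  then show ?thesis using star_bas[OF assms] by (simp add: DBun_def DBun_dual_def star_map_def tot_def bas_def)
qed

text \<open>Pullbacks being chosen, pulling back along an identity gives only an isomorphic object,
  and this isomorphism sits in front of every fibre dual. The last claim is there because the lift
  of a pullback bundle is a pairing into the T-image of the cone.\<close>

lemma pullback_Idn_iso:
  assumes P: "is_pullback X (Idn X A) q c" and A: "A \<in> Obj X"
  shows "tup X c q (Idn X (Dom X q)) \<in> Arr X" "Dom X (tup X c q (Idn X (Dom X q))) = Dom X q"
    "Cod X (tup X c q (Idn X (Dom X q))) = Dom X (fst c)"
    "tup X c q (Idn X (Dom X q)) \<cdot> snd c = Idn X (Dom X q)" "tup X c q (Idn X (Dom X q)) \<cdot> fst c = q"
    "snd c \<cdot> tup X c q (Idn X (Dom X q)) = Idn X (Dom X (fst c))" "snd c \<cdot> q = fst c"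
    "is_pullback X (Idn X (To X A)) (Tm X q) (Tcone X c)"
proof -
  note C = pullback_cone[OF P]
  have q [simp]: "q \<in> Arr X" "Cod X q = A" using C A by simp_all
  note [simp] = C(4-8) A
  show sq: "snd c \<cdot> q = fst c" using C(9) by simp
  have e: "q \<cdot> Idn X A = Idn X (Dom X q) \<cdot> q" by simp
  note T = pullback_tup[OF P _ _ _ _ _ e, simplified]
  show i: "tup X c q (Idn X (Dom X q)) \<in> Arr X" "Dom X (tup X c q (Idn X (Dom X q))) = Dom X q"
    "Cod X (tup X c q (Idn X (Dom X q))) = Dom X (fst c)"
    "tup X c q (Idn X (Dom X q)) \<cdot> snd c = Idn X (Dom X q)" "tup X c q (Idn X (Dom X q)) \<cdot> fst c = q"
    by (simp_all add: T)
  show j: "snd c \<cdot> tup X c q (Idn X (Dom X q)) = Idn X (Dom X (fst c))"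
    using pullback_comp_tup[OF P _ _ _ _ _ e, of "snd c"] pullback_tup_eta[OF P, of "Idn X (Dom X (fst c))"] sq by simp
  let ?i = "tup X c q (Idn X (Dom X q))"
  have Ti: "Tm X ?i \<cdot> Tm X (snd c) = Idn X (To X (Dom X q))" "Tm X (snd c) \<cdot> Tm X ?i = Idn X (To X (Dom X (fst c)))"
    using arg_cong[OF i(4), of "Tm X"] arg_cong[OF j, of "Tm X"] i(1-3) by simp_all
  have Tsq: "Tm X (fst c) = Tm X (snd c) \<cdot> Tm X q" using arg_cong[OF sq, of "Tm X"] by simp
  show "is_pullback X (Idn X (To X A)) (Tm X q) (Tcone X c)"
    unfolding is_pullback_def
  proof (intro conjI allI ballI impI)
    show "fst (Tcone X c) \<cdot> Idn X (To X A) = snd (Tcone X c) \<cdot> Tm X q" using Tsq by simp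
    fix Y a b assume "a \<in> Hom X Y (Dom X (Idn X (To X A)))" "b \<in> Hom X Y (Dom X (Tm X q))"
      and e: "a \<cdot> Idn X (To X A) = b \<cdot> Tm X q"
    then have ab: "a \<in> Arr X" "b \<in> Arr X" "Dom X a = Dom X b" "Cod X a = To X A" "Cod X b = To X (Dom X q)" "a = b \<cdot> Tm X q"
      by simp_all
    have "b \<cdot> Tm X ?i \<cdot> Tm X (snd c) = b"
      using ab(2,5) i(1-3) Ti(1) assoc[of b "Tm X ?i" "Tm X (snd c)"] by (simp del: assoc)
    then have "mediates X (Tcone X c) a b (b \<cdot> Tm X ?i)"
      using ab i(1-3) by (simp add: mediates_def apex_def Tsq)
    moreover have "h = b \<cdot> Tm X ?i" if "mediates X (Tcone X c) a b h" for h
    proof -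
      from that have "h \<in> Arr X" "Cod X h = To X (Dom X (fst c))" "h \<cdot> Tm X (snd c) = b"
        by (auto simp: mediates_def apex_def)
      then show ?thesis using Ti(2) assoc[of h "Tm X (snd c)" "Tm X ?i"] i(1-3) by (simp del: assoc)
    qed
    ultimately show "\<exists>!h. mediates X (Tcone X c) a b h" by blast
  qed (simp_all add: apex_def)
qed

context
  fixes Z A assumes Z: "Z \<in> \<D>" and A: "A = Cod X (bq Z)"
begin

lemma id_pullback: "is_pullback X (Idn X A) (bq Z) (pbcone X (Idn X A) Z)"
  by (rule pbcone_pullback) (use Z A bundle_arr[OF Z] in simp_all)

lemma id_pullback_mem: "pullback_bundle X (Idn X A) Z \<in> \<D>"
  by (rule pullback_bundle_mem) (use Z A bundle_arr[OF Z] in simp_all)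

lemma id_pullback_linear:
  "linear_over X Z (pullback_bundle X (Idn X A) Z) (tup X (pbcone X (Idn X A) Z) (bq Z) (Idn X (U Z)))"
  "linear_over X (pullback_bundle X (Idn X A) Z) Z (snd (pbcone X (Idn X A) Z))"
proof -
  let ?c = "pbcone X (Idn X A) Z"
  note P = id_pullback
  have [simp]: "A \<in> Obj X" using A bundle_arr[OF Z] by simp
  note I = pullback_Idn_iso[OF P, simplified]
  note [simp] = bundle_arr(1-5)[OF Z] A[symmetric] pullback_cone(4-6,8)[OF P]
  have [simp]: "Cod X (fst ?c) = A" using pullback_cone(7)[OF P] by simp
  have e: "fst ?c \<cdot> tz X A \<cdot> Idn X (To X A) = snd ?c \<cdot> bl Z \<cdot> Tm X (bq Z)"
    using bundle_arr(7)[OF Z] I(7) assoc[of "snd ?c" "bl Z" "Tm X (bq Z)"] assoc[of "snd ?c" "bq Z" "tz X A"]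
    by (simp del: assoc)
  note T = pullback_tup[OF I(8) _ _ _ _ _ e, simplified]
  have "snd ?c \<cdot> bl Z = bl (pullback_bundle X (Idn X A) Z) \<cdot> Tm X (snd ?c)"
    using T by simp
  then show s: "linear_over X (pullback_bundle X (Idn X A) Z) Z (snd (pbcone X (Idn X A) Z))"
    using I(7) by (simp add: linear_over_def linear_morphism_def tot_def bas_def)
  show "linear_over X Z (pullback_bundle X (Idn X A) Z) (tup X (pbcone X (Idn X A) Z) (bq Z) (Idn X (U Z)))"
    by (rule linear_over_inverse[OF id_pullback_mem Z s]) (use I in \<open>simp add: inverse_pair_def\<close>)
qed

end

end

lemma Ex1_eq: "\<exists>!x. P x \<Longrightarrow> P a \<Longrightarrow> P b \<Longrightarrow> a = b"
  by blast

context rev_ctx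
begin

section \<open>Differential objects in the system and duals on the fibres\<close>

definition sys_obj :: "'a bdl \<Rightarrow> bool" where
  "sys_obj E \<longleftrightarrow> E \<in> \<D> \<and> Cod X (bq E) = one X"

lemma sys_obj_mem: "sys_obj E \<Longrightarrow> E \<in> \<D>"
  and sys_obj_diff_obj: "sys_obj E \<Longrightarrow> diff_obj E"
  and sys_obj_star: "sys_obj E \<Longrightarrow> sys_obj (Star V E)"
  by (simp_all add: sys_obj_def bundle_diff_obj star_mem star_bas)

lemma sys_obj_star_diff_obj: "sys_obj E \<Longrightarrow> diff_obj (Star V E)"
  by (simp add: sys_obj_star sys_obj_diff_obj)

abbreviation fd :: "'a bdl \<Rightarrow> 'a bdl \<Rightarrow> 'a \<Rightarrow> 'a" where
  "fd \<equiv> fib_dual X V"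

context
  fixes E F g assumes D: "E \<in> \<D>" "F \<in> \<D>" and g: "linear_over X E F g"
begin

lemma vert_linear: "linear_morphism X E F (Idn X (Cod X (bq F))) g" "Cod X (bq E) = Cod X (bq F)"
  using g unfolding linear_over_alt by auto

lemma fib_dual_star_map: "fd E F g =
  tup X (pbcone X (Idn X (Cod X (bq F))) (Star V F)) (bq (Star V F)) (Idn X (U (Star V F)))
    \<cdot> star_map E F (Idn X (Cod X (bq F))) g"
  by (simp add: fib_dual_def vert_def star_map_def tot_def bas_def vert_linear(2))

lemma fib_dual_pullback:
  "is_pullback X (Idn X (Cod X (bq F))) (bq (Star V F)) (pbcone X (Idn X (Cod X (bq F))) (Star V F))"
  by (rule id_pullback[OF star_mem[OF D(2)]]) (simp add: star_bas D)

lemmas fib_dual_iso = pullback_Idn_iso[OF fib_dual_pullback bundle_arr(6)[OF D(2)]]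
lemmas fib_dual_star_map_arr = star_map_arr[OF D vert_linear(1)]

lemma fib_dual_arr:
  "fd E F g \<in> Arr X" "Dom X (fd E F g) = U (Star V F)"
  "Cod X (fd E F g) = U (Star V E)"
  using fib_dual_iso(1-3) fib_dual_star_map_arr(1-3) by (simp_all add: fib_dual_star_map)

text \<open>The canonical isomorphism inside \<open>fib_dual\<close> sends w to <w q, w>, so fibre
  duals become instances of \<open>star_map\<close> at pairs.\<close>

lemma fib_dual_elem:
  assumes "w \<in> Arr X" "Cod X w = U (Star V F)"
  shows "w \<cdot> fd E F g =
    tup X (pbcone X (Idn X (Cod X (bq F))) (Star V F)) (w \<cdot> bq (Star V F)) w \<cdot> star_map E F (Idn X (Cod X (bq F))) g"
proof -
  note b = bundle_arr[OF star_mem[OF D(2)]]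
  have e: "bq (Star V F) \<cdot> Idn X (Cod X (bq F)) = Idn X (U (Star V F)) \<cdot> bq (Star V F)"
    using b star_bas[OF D(2)] by simp
  note [simp] = fib_dual_iso(1-3) fib_dual_star_map_arr(1-3) b(1-6) assms star_bas[OF D(2)] bundle_arr(6)[OF D(2)]
    pullback_cone(4-8)[OF fib_dual_pullback] pullback_comp_tup[OF fib_dual_pullback _ _ _ _ _ e]
  show ?thesis by (simp add: fib_dual_star_map)
qed

lemma fib_dual_linear: "linear_over X (Star V F) (Star V E) (fd E F g)"
proof -
  have e: "Cod X (bq F) = Cod X (bq (Star V F))" by (simp add: star_bas D)
  show ?thesis unfolding fib_dual_star_map
    using star_mor(2)[OF D vert_linear(1)] id_pullback_linear(1)[OF star_mem[OF D(2)] e]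
      id_pullback_mem[OF star_mem[OF D(2)] e] D star_mem
    by (blast intro: linear_over_comp)
qed

lemma fib_dual_bq: "fd E F g \<cdot> bq (Star V E) = bq (Star V F)"
  using fib_dual_linear bundle_arr(1)[OF star_mem[OF D(2)]] unfolding linear_over_alt
  by (auto dest: linear_morphismD(7))

end

text \<open>Contravariance is \<open>star_el_comp\<close> over identities; the composite base arrow
  is an identity followed by itself.\<close>

lemma fib_dual_comp:
  assumes D: "E \<in> \<D>" "F \<in> \<D>" "G \<in> \<D>" and g: "linear_over X E F g" and k: "linear_over X F G k"
  shows "fd E G (g \<cdot> k) = fd F G k \<cdot> fd E F g"
proof -
  let ?A = "Cod X (bq G)" and ?q = "bq (Star V G)" and ?i = "Idn X (U (Star V G))"
  note gk = linear_over_comp[OF D g k]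
  have e: "Cod X (bq F) = ?A" by (rule vert_linear(2)[OF D(2,3) k])
  note b = bundle_arr[OF star_mem[OF D(3)]]
  note [simp] = b(1-6) star_bas[OF D(3)] e bundle_arr(6)[OF D(3)]
  have "fd F G k \<cdot> fd E F g
    = tup X (pbcone X (Idn X ?A) (Star V F)) (fd F G k \<cdot> bq (Star V F)) (fd F G k) \<cdot> star_map E F (Idn X ?A) g"
    using fib_dual_elem[OF D(1,2) g, of "fd F G k"] fib_dual_arr[OF D(2,3) k] by simp
  also have "\<dots> = tup X (pbcone X (Idn X ?A) (Star V F)) ?q (tup X (pbcone X (Idn X ?A) (Star V G)) (?q \<cdot> Idn X ?A) ?i \<cdot> star_map F G (Idn X ?A) k)
     \<cdot> star_map E F (Idn X ?A) g"
    by (simp add: fib_dual_bq[OF D(2,3) k]) (simp add: fib_dual_star_map[OF D(2,3) k])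
  also have "\<dots> = tup X (pbcone X (Idn X ?A \<cdot> Idn X ?A) (Star V G)) ?q ?i \<cdot> star_map E G (Idn X ?A \<cdot> Idn X ?A) (g \<cdot> k)"
    by (rule star_el_comp[OF D, symmetric]) (use vert_linear[OF D(1,2) g] vert_linear[OF D(2,3) k] in simp_all)
  also have "\<dots> = fd E G (g \<cdot> k)"
    by (simp add: fib_dual_star_map[OF D(1,3) gk])
  finally show ?thesis ..
qed

lemma fib_dual_Idn:
  assumes "E \<in> \<D>"
  shows "fd E E (Idn X (U E)) = Idn X (U (Star V E))"
  using fib_dual_iso[OF assms assms linear_over_Idn[OF assms]]
  by (simp add: fib_dual_star_map[OF assms assms linear_over_Idn[OF assms]] star_map_Idn[OF assms])

section \<open>Duals of Cartesian lifts\<close>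

context
  fixes t E assumes t: "t \<in> Arr X" "Cod X t = one X" and E: "sys_obj E"
begin

lemmas lift_product = pbcone_product(2)[OF sys_obj_diff_obj[OF E] t]
  and star_lift_product = pbcone_product(2)[OF sys_obj_star_diff_obj[OF E] t]

lemma lift_mem: "pullback_bundle X t E \<in> \<D>" "pullback_bundle X t (Star V E) \<in> \<D>"
  using pullback_bundle_mem[of _ t] t E sys_obj_star[OF E] by (simp_all add: sys_obj_def)

lemma lift_bas: "Cod X (bq (Star V (pullback_bundle X t E))) = Dom X t"
  using star_bas[OF lift_mem(1)] product_cone[OF lift_product] by simp

lemma lift_linear: "linear_morphism X (pullback_bundle X t E) E t (snd (pbcone X t E))"
proof -
  note [simp] = sys_obj_diff_obj[OF E] diff_obj_simps[OF sys_obj_diff_obj[OF E]] product_cone[OF lift_product] t Dom_obj[OF t(1)]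
  show ?thesis unfolding linear_morphism_lin[OF sys_obj_diff_obj[OF E] sys_obj_diff_obj[OF E] t]
    by (simp add: lin_def T_product_tup[OF lift_product])
qed

text \<open>The arrow that \<open>dual_pullback\<close> inverts by definition, from the trivial
  bundle on the dual of E to the dual of the trivial bundle on E. Its invertibility is
  \<open>dual_pullback_inverse\<close>.\<close>

definition lift_dual :: 'a where "lift_dual = star_map (pullback_bundle X t E) E t (snd (pbcone X t E))"

lemma star_cart_lift: "StarM V (cart_lift X t E) =
  \<lparr>bdom = Star V (pullback_bundle X t E), bcod = Star V E, base = t, total = lift_dual\<rparr>"
  using star_mor(1)[OF lift_mem(1) sys_obj_mem[OF E] lift_linear] by (simp add: cart_lift_def lift_dual_def)

text \<open>The involution preserves Cartesian arrows, so this is the source of the invertibility of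
  \<open>lift_dual\<close>. Since the pullback is a product, the required factorization is the
  pairing of q h with g.\<close>

lemma cart_lift_cartesian: "is_cartesian_arrow (DBun X \<D>) X (bas X) base (cart_lift X t E)"
  unfolding is_cartesian_arrow_def
proof (intro conjI ballI impI)
  let ?c = "pbcone X t E"
  note [simp] = sys_obj_diff_obj[OF E] diff_obj_simps[OF sys_obj_diff_obj[OF E]] product_cone[OF lift_product] t Dom_obj[OF t(1)]
  show "cart_lift X t E \<in> Arr (DBun X \<D>)"
    using lift_mem(1) sys_obj_mem[OF E] lift_linear by (simp add: cart_lift_def DBun_def)
  fix Y \<psi> h
  assume Y: "Y \<in> Obj (DBun X \<D>)" and \<psi>: "\<psi> \<in> Hom (DBun X \<D>) Y (Cod (DBun X \<D>) (cart_lift X t E))"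
    and h: "h \<in> Hom X (bas X Y) (bas X (Dom (DBun X \<D>) (cart_lift X t E)))"
    and ht: "h \<cdot> base (cart_lift X t E) = base \<psi>"
  have Y': "Y \<in> \<D>" using Y by (simp add: DBun_def)
  have h' [simp]: "h \<in> Arr X" "Dom X h = Cod X (bq Y)" "Cod X h = Dom X t"
    using h by (simp_all add: bas_def DBun_def cart_lift_def)
  define g where "g = total \<psi>"
  have \<psi>': "\<psi> = \<lparr>bdom = Y, bcod = E, base = h \<cdot> t, total = g\<rparr>"
    using \<psi> ht by (simp add: DBun_def cart_lift_def g_def)
  have g: "linear_morphism X Y E (h \<cdot> t) g"
    using \<psi> unfolding \<psi>' by (simp add: DBun_def)
  note [simp] = linear_morphismD(4-6)[OF g] bundle_arr(1-6)[OF Y']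
  note [simp] = product_tup[OF lift_product] T_product_tup[OF lift_product] product_comp_tup[OF lift_product] T_product_comp_tup[OF lift_product]
  let ?u = "tup X ?c (bq Y \<cdot> h) g"
  have "bl Y \<cdot> Tm X (bq Y) \<cdot> Tm X h = bq Y \<cdot> h \<cdot> tz X (Dom X t)"
    by (simp add: bundle_arr(7)[OF Y'] tz_natural)
  then have u: "linear_morphism X Y (pullback_bundle X t E) h ?u"
    using linear_morphismD(8)[OF g] by (simp add: linear_morphism_def tot_def bas_def T_tup[OF lift_product])
  let ?\<chi> = "\<lparr>bdom = Y, bcod = pullback_bundle X t E, base = h, total = ?u\<rparr>"
  show "\<exists>!\<chi>. \<chi> \<in> Hom (DBun X \<D>) Y (Dom (DBun X \<D>) (cart_lift X t E)) \<and> base \<chi> = h \<and>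
      \<chi> \<cdot>\<^bsub>DBun X \<D>\<^esub> cart_lift X t E = \<psi>"
  proof (intro ex1I[of _ ?\<chi>])
    show "?\<chi> \<in> Hom (DBun X \<D>) Y (Dom (DBun X \<D>) (cart_lift X t E)) \<and> base ?\<chi> = h \<and>
      ?\<chi> \<cdot>\<^bsub>DBun X \<D>\<^esub> cart_lift X t E = \<psi>"
      using u Y' lift_mem(1) by (simp add: \<psi>' DBun_def cart_lift_def)
    fix \<chi> assume \<chi>: "\<chi> \<in> Hom (DBun X \<D>) Y (Dom (DBun X \<D>) (cart_lift X t E)) \<and> base \<chi> = h \<and>
      \<chi> \<cdot>\<^bsub>DBun X \<D>\<^esub> cart_lift X t E = \<psi>"
    define v where "v = total \<chi>"
    have \<chi>': "\<chi> = \<lparr>bdom = Y, bcod = pullback_bundle X t E, base = h, total = v\<rparr>"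
      using \<chi> by (simp add: DBun_def cart_lift_def v_def)
    have v: "linear_morphism X Y (pullback_bundle X t E) h v" "v \<cdot> snd ?c = g"
      using \<chi> unfolding \<chi>' \<psi>' by (simp_all add: DBun_def cart_lift_def)
    have "v = ?u"
      by (rule product_eqI[OF lift_product]) (use v linear_morphismD[OF v(1)] in simp_all)
    then show "\<chi> = ?\<chi>" by (simp add: \<chi>')
  qed
qed

lemma lift_dual_arr: "lift_dual \<in> Arr X" "Dom X lift_dual = Dom X (fst (pbcone X t (Star V E)))"
  "Cod X lift_dual = U (Star V (pullback_bundle X t E))"
  "lift_dual \<cdot> bq (Star V (pullback_bundle X t E)) = fst (pbcone X t (Star V E))"
  unfolding lift_dual_def by (rule star_map_arr[OF lift_mem(1) sys_obj_mem[OF E] lift_linear])+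

lemma lift_dual_linear: "linear_over X (pullback_bundle X t (Star V E)) (Star V (pullback_bundle X t E)) lift_dual"
  unfolding lift_dual_def by (rule star_mor(2)[OF lift_mem(1) sys_obj_mem[OF E] lift_linear])

text \<open>The dual of the Cartesian lift is Cartesian, and the arrow \<open>(t, 1)\<close> of the dual fibration lies over the same \<open>t\<close>:
  factoring it through the former gives a one-sided inverse, uniqueness of factorizations the other side.\<close>

lemma dual_pullback_inverse: "inverse_pair X lift_dual (dual_pullback X V t E)"
proof -
  let ?W = "pullback_bundle X t (Star V E)" and ?Z = "Star V (pullback_bundle X t E)" and ?A = "Dom X t"
  let ?c = "pbcone X t (Star V E)" and ?i = "Idn X (Dom X t)"
  let ?\<phi> = "\<lparr>bdom = ?Z, bcod = Star V E, base = t, total = lift_dual\<rparr>"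
  let ?\<psi> = "\<lparr>bdom = ?W, bcod = Star V E, base = t, total = Idn X (Dom X (fst ?c))\<rparr>"
  note ES = sys_obj_star[OF E]
  note ZD = star_mem[OF lift_mem(1)]
  note [simp] = sys_obj_diff_obj[OF ES] diff_obj_simps[OF sys_obj_diff_obj[OF ES]] product_simps[OF star_lift_product] t Dom_obj[OF t(1)]
    lift_bas lift_dual_arr bundle_arr(1)[OF ZD] product_obj[OF star_lift_product]
  have cart: "is_cartesian_arrow (DBun_dual X \<D>) X (bas X) base ?\<phi>"
    using star_cartesian[OF cart_lift_cartesian] by (simp add: star_cart_lift)
  note uni = cart[unfolded is_cartesian_arrow_def, THEN conjunct2, THEN bspec, THEN bspec, THEN bspec, THEN mp]
  have id_W: "linear_over X ?W ?W (Idn X (Dom X (fst ?c)))"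
    using linear_over_Idn[OF lift_mem(2)] by simp
  have "\<exists>!\<chi>. \<chi> \<in> Hom (DBun_dual X \<D>) ?W (Dom (DBun_dual X \<D>) ?\<phi>) \<and> base \<chi> = ?i \<and> \<chi> \<cdot>\<^bsub>DBun_dual X \<D>\<^esub> ?\<phi> = ?\<psi>"
    by (rule uni) (use id_W lift_mem(2) sys_obj_mem[OF ES] in \<open>simp_all add: DBun_dual_def bas_def\<close>)
  moreover have "Dom (DBun_dual X \<D>) ?\<phi> = ?Z" by (simp add: DBun_dual_def)
  ultimately obtain \<chi> where \<chi>: "\<chi> \<in> Hom (DBun_dual X \<D>) ?W ?Z" "base \<chi> = ?i" "\<chi> \<cdot>\<^bsub>DBun_dual X \<D>\<^esub> ?\<phi> = ?\<psi>"
    unfolding Ex1_def by metis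
  define u where "u = total \<chi>"
  have \<chi>': "\<chi> = \<lparr>bdom = ?W, bcod = ?Z, base = ?i, total = u\<rparr>"
    using \<chi> by (simp add: DBun_dual_def u_def)
  have ul: "linear_over X (pullback_bundle X ?i ?Z) ?W u"
    using \<chi>(1) unfolding \<chi>' by (simp add: DBun_dual_def bas_def)
  have ueq: "tup X (pbcone X ?i ?Z) (fst ?c) lift_dual \<cdot> u = Idn X (Dom X (fst ?c))"
    using \<chi>(3) unfolding \<chi>' by (simp add: DBun_dual_def)
  \<comment> \<open>Removing the pullback along the identity from u gives the candidate
    inverse.\<close>
  define k' where "k' = tup X (pbcone X ?i ?Z) (bq ?Z) (Idn X (U ?Z)) \<cdot> u"
  have e: "?A = Cod X (bq ?Z)" by simp
  note IP = id_pullback[OF ZD e]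
  note I = pullback_Idn_iso[OF IP, simplified]
  note IL = id_pullback_linear[OF ZD e] and IM = id_pullback_mem[OF ZD e]
  have k'l: "linear_over X ?Z ?W k'"
    unfolding k'_def by (rule linear_over_comp[OF ZD IM lift_mem(2) IL(1) ul])
  then have k' [simp]: "k' \<in> Arr X" "Dom X k' = U ?Z" "Cod X k' = Dom X (fst ?c)"
    by (auto simp: linear_over_def linear_morphism_def tot_def)
  have u [simp]: "u \<in> Arr X" "Dom X u = Dom X (fst (pbcone X ?i ?Z))" "Cod X u = Dom X (fst ?c)"
    using ul by (auto simp: linear_over_def linear_morphism_def tot_def)
  have e2: "bq ?Z \<cdot> ?i = Idn X (U ?Z) \<cdot> bq ?Z" by simp
  have e3: "fst ?c \<cdot> ?i = lift_dual \<cdot> bq ?Z" by simp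
  note [simp] = I(1-3) pullback_cone(4-8)[OF IP] bundle_arr(5)[OF ZD]
  have lift_dual': "lift_dual \<cdot> k' = Idn X (Dom X (fst ?c))"
    unfolding k'_def using ueq pullback_comp_tup[OF IP _ _ _ _ _ e2, of lift_dual] by simp
  \<comment> \<open>Two vertical endomorphisms: the identity of the dual fibration, and the one
    built from k' followed by \<open>lift_dual\<close>. Both factor the dual of the lift through
    itself, so uniqueness equates them.\<close>
  let ?\<chi>1 = "\<lparr>bdom = ?Z, bcod = ?Z, base = ?i, total = snd (pbcone X ?i ?Z)\<rparr>"
  let ?\<chi>2 = "\<lparr>bdom = ?Z, bcod = ?Z, base = ?i, total = snd (pbcone X ?i ?Z) \<cdot> (k' \<cdot> lift_dual)\<rparr>"
  have l2: "linear_over X (pullback_bundle X ?i ?Z) ?Z (snd (pbcone X ?i ?Z) \<cdot> (k' \<cdot> lift_dual))"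
    by (rule linear_over_comp[OF IM ZD ZD IL(2) linear_over_comp[OF ZD lift_mem(2) ZD k'l lift_dual_linear]])
  have ex: "\<exists>!\<chi>. \<chi> \<in> Hom (DBun_dual X \<D>) ?Z (Dom (DBun_dual X \<D>) ?\<phi>) \<and> base \<chi> = ?i \<and> \<chi> \<cdot>\<^bsub>DBun_dual X \<D>\<^esub> ?\<phi> = ?\<phi>"
    by (rule uni) (use lift_dual_linear ZD sys_obj_mem[OF ES] in \<open>simp_all add: DBun_dual_def bas_def\<close>)
  have comp: "\<lparr>bdom = ?Z, bcod = ?Z, base = ?i, total = v\<rparr> \<cdot>\<^bsub>DBun_dual X \<D>\<^esub> ?\<phi>
      = \<lparr>bdom = ?Z, bcod = Star V E, base = t, total = tup X (pbcone X ?i ?Z) (fst ?c) lift_dual \<cdot> v\<rparr>" for v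
    by (simp add: DBun_dual_def)
  have hom: "\<lparr>bdom = ?Z, bcod = ?Z, base = ?i, total = v\<rparr> \<in> Hom (DBun_dual X \<D>) ?Z (Dom (DBun_dual X \<D>) ?\<phi>)"
    if "linear_over X (pullback_bundle X ?i ?Z) ?Z v" for v
    using that ZD by (simp add: DBun_dual_def bas_def)
  have "tup X (pbcone X ?i ?Z) (fst ?c) lift_dual \<cdot> snd (pbcone X ?i ?Z) = lift_dual"
    using pullback_tup[OF IP _ _ _ _ _ e3] by simp
  then have chi1: "?\<chi>1 \<in> Hom (DBun_dual X \<D>) ?Z (Dom (DBun_dual X \<D>) ?\<phi>) \<and> base ?\<chi>1 = ?i \<and> ?\<chi>1 \<cdot>\<^bsub>DBun_dual X \<D>\<^esub> ?\<phi> = ?\<phi>"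
    unfolding comp using hom[OF IL(2)] by simp
  have e4: "tup X (pbcone X ?i ?Z) (fst ?c) lift_dual \<cdot> (snd (pbcone X ?i ?Z) \<cdot> (k' \<cdot> lift_dual)) = lift_dual"
    using pullback_tup[OF IP _ _ _ _ _ e3] lift_dual' by simp
  have chi2: "?\<chi>2 \<in> Hom (DBun_dual X \<D>) ?Z (Dom (DBun_dual X \<D>) ?\<phi>) \<and> base ?\<chi>2 = ?i \<and> ?\<chi>2 \<cdot>\<^bsub>DBun_dual X \<D>\<^esub> ?\<phi> = ?\<phi>"
    unfolding comp e4 by (intro conjI hom[OF l2] bmor.select_convs refl)
  define P where "P \<chi> \<longleftrightarrow> \<chi> \<in> Hom (DBun_dual X \<D>) ?Z (Dom (DBun_dual X \<D>) ?\<phi>) \<and> base \<chi> = ?i \<and>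
    \<chi> \<cdot>\<^bsub>DBun_dual X \<D>\<^esub> ?\<phi> = ?\<phi>" for \<chi>
  have "\<exists>!\<chi>. P \<chi>" unfolding P_def by (rule ex)
  moreover have "P ?\<chi>1" unfolding P_def by (rule chi1)
  moreover have "P ?\<chi>2" unfolding P_def by (rule chi2)
  ultimately have "?\<chi>1 = ?\<chi>2" by (rule Ex1_eq)
  then have "total ?\<chi>1 = total ?\<chi>2" by (rule arg_cong)
  then have s: "snd (pbcone X ?i ?Z) = snd (pbcone X ?i ?Z) \<cdot> (k' \<cdot> lift_dual)"
    unfolding bmor.select_convs .
  let ?j = "tup X (pbcone X ?i ?Z) (bq ?Z) (Idn X (U ?Z))"
  have "?j \<cdot> snd (pbcone X ?i ?Z) = ?j \<cdot> (snd (pbcone X ?i ?Z) \<cdot> (k' \<cdot> lift_dual))"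
    using s by (rule arg_cong)
  also have "\<dots> = ?j \<cdot> snd (pbcone X ?i ?Z) \<cdot> (k' \<cdot> lift_dual)" by simp
  finally have "k' \<cdot> lift_dual = Idn X (U ?Z)" unfolding I(4) by simp
  with lift_dual' have p: "inverse_pair X lift_dual k'" by (simp add: inverse_pair_def)
  then show ?thesis using inv_arr_eq[OF p] by (simp add: dual_pullback_def star_cart_lift)
qed

lemma dual_pullback_arr:
  "dual_pullback X V t E \<in> Arr X" "Dom X (dual_pullback X V t E) = U (Star V (pullback_bundle X t E))"
  "Cod X (dual_pullback X V t E) = Dom X (fst (pbcone X t (Star V E)))"
  "lift_dual \<cdot> dual_pullback X V t E = Idn X (Dom X (fst (pbcone X t (Star V E))))"
  "dual_pullback X V t E \<cdot> lift_dual = Idn X (U (Star V (pullback_bundle X t E)))"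
  using dual_pullback_inverse by (simp_all add: inverse_pair_def lift_dual_arr)

lemma dual_pullback_linear:
  "linear_over X (Star V (pullback_bundle X t E)) (pullback_bundle X t (Star V E)) (dual_pullback X V t E)"
  by (rule linear_over_inverse[OF lift_mem(2) star_mem[OF lift_mem(1)] lift_dual_linear dual_pullback_inverse])

lemma dual_pullback_fst: "dual_pullback X V t E \<cdot> fst (pbcone X t (Star V E)) = bq (Star V (pullback_bundle X t E))"
  using dual_pullback_linear bundle_arr(1)[OF star_mem[OF lift_mem(1)]] unfolding linear_over_alt
  by (auto dest: linear_morphismD(7))

end

section \<open>Transposition\<close>

text \<open>The transpose \<open>h\<^sup>\<dagger> : A \<times> F\<^sup>* \<rightarrow> E\<^sup>*\<close> of \<open>h : A \<times> E \<rightarrow> F\<close>, obtained by dualizing the arrow \<open>(t, h)\<close>, which lies over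
  \<open>t : A \<rightarrow> 1\<close>.\<close>

definition dag :: "'a \<Rightarrow> 'a bdl \<Rightarrow> 'a bdl \<Rightarrow> 'a \<Rightarrow> 'a" where
  "dag t E F h = star_map (pullback_bundle X t E) F t h \<cdot> dual_pullback X V t E \<cdot> snd (pbcone X t (Star V E))"

context
  fixes t E F h assumes t: "t \<in> Arr X" "Cod X t = one X" and E: "sys_obj E" and F: "sys_obj F" and h: "lin (pbcone X t E) E F h"
begin

lemma lin_mor: "linear_morphism X (pullback_bundle X t E) F t h"
  using h linear_morphism_lin[OF sys_obj_diff_obj[OF E] sys_obj_diff_obj[OF F] t] by simp

lemmas lin_star_map_arr = star_map_arr[OF lift_mem(1)[OF t E] sys_obj_mem[OF F] lin_mor]

lemma dag_arr: "dag t E F h \<in> Arr X" "Dom X (dag t E F h) = Dom X (fst (pbcone X t (Star V F)))"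
  "Cod X (dag t E F h) = U (Star V E)"
  using lin_star_map_arr dual_pullback_arr[OF t E] product_cone[OF star_lift_product[OF t E]]
  by (simp_all add: dag_def)

lemma dag_lin: "lin (pbcone X t (Star V F)) (Star V F) (Star V E) (dag t E F h)"
proof -
  let ?W = "pullback_bundle X t (Star V E)" and ?U = "pullback_bundle X t (Star V F)"
  note M = lift_mem(2)[OF t F] star_mem[OF lift_mem(1)[OF t E]] lift_mem(2)[OF t E]
  have "linear_over X ?U ?W (star_map (pullback_bundle X t E) F t h \<cdot> dual_pullback X V t E)"
    by (rule linear_over_comp[OF M star_mor(2)[OF lift_mem(1)[OF t E] sys_obj_mem[OF F] lin_mor] dual_pullback_linear[OF t E]])
  then have "linear_morphism X ?U ?W (Idn X (Cod X (bq ?W))) (star_map (pullback_bundle X t E) F t h \<cdot> dual_pullback X V t E)"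
    by (rule vert_linear(1)[OF M(1,3)])
  from linear_morphism_comp[OF M(1,3) sys_obj_mem[OF sys_obj_star[OF E]] this lift_linear[OF t sys_obj_star[OF E]]]
  show ?thesis
    using linear_morphism_lin[OF sys_obj_star_diff_obj[OF F] sys_obj_star_diff_obj[OF E] t] t product_cone[OF star_lift_product[OF t E]]
    by (simp add: dag_def)
qed

text \<open>\<open>lift_dual\<close> cancels \<open>dual_pullback\<close>, so the raw dual of (t, h)
  is the transpose viewed inside the dual of A x E. Identities between transposes are proved there,
  where functoriality applies, and brought back by \<open>lift_dual_inj\<close>.\<close>

lemma dag_lift_dual:
  assumes "a \<in> Arr X" "w \<in> Arr X" "Dom X a = Dom X w" "Cod X a = Dom X t" "Cod X w = U (Star V F)"
  shows "tup X (pbcone X t (Star V F)) a w \<cdot> star_map (pullback_bundle X t E) F t h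
    = tup X (pbcone X t (Star V E)) a (tup X (pbcone X t (Star V F)) a w \<cdot> dag t E F h) \<cdot> lift_dual t E"
proof -
  note [simp] = t Dom_obj[OF t(1)] assms product_cone[OF star_lift_product[OF t E]] product_cone[OF star_lift_product[OF t F]]
    product_tup[OF star_lift_product[OF t E]] product_tup[OF star_lift_product[OF t F]] lin_star_map_arr(1-3) dag_arr
    dual_pullback_arr(1-3)[OF t E] lift_dual_arr(1-3)[OF t E] bundle_arr(1,5)[OF star_mem[OF lift_mem(1)[OF t E]]]
  let ?K = "dual_pullback X V t E"
  let ?s = "tup X (pbcone X t (Star V F)) a w \<cdot> star_map (pullback_bundle X t E) F t h"
  have "?s \<cdot> ?K \<cdot> fst (pbcone X t (Star V E)) = tup X (pbcone X t (Star V F)) a w \<cdot> (star_map (pullback_bundle X t E) F t h \<cdot> (?K \<cdot> fst (pbcone X t (Star V E))))"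
    by simp
  also have "\<dots> = a" unfolding dual_pullback_fst[OF t E] lin_star_map_arr(4) by simp
  finally have "?s \<cdot> ?K = tup X (pbcone X t (Star V E)) a (tup X (pbcone X t (Star V F)) a w \<cdot> dag t E F h)"
    by - (rule product_eqI[OF star_lift_product[OF t E]], simp_all add: dag_def)
  then have "tup X (pbcone X t (Star V E)) a (tup X (pbcone X t (Star V F)) a w \<cdot> dag t E F h) \<cdot> lift_dual t E = ?s \<cdot> ?K \<cdot> lift_dual t E"
    by simp
  also have "\<dots> = ?s \<cdot> (?K \<cdot> lift_dual t E)" by simp
  also have "\<dots> = ?s" unfolding dual_pullback_arr(5)[OF t E] by simp
  finally show ?thesis ..
qed

end

lemma lift_dual_inj:
  assumes t: "t \<in> Arr X" "Cod X t = one X" and E: "sys_obj E"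
    and aw: "a \<in> Arr X" "Cod X a = Dom X t" "w \<in> Arr X" "Dom X a = Dom X w" "Cod X w = U (Star V E)"
      "w' \<in> Arr X" "Dom X w' = Dom X w" "Cod X w' = U (Star V E)"
    and eq: "tup X (pbcone X t (Star V E)) a w \<cdot> lift_dual t E = tup X (pbcone X t (Star V E)) a w' \<cdot> lift_dual t E"
  shows "w = w'"
proof -
  note [simp] = aw product_cone[OF star_lift_product[OF t E]] product_tup[OF star_lift_product[OF t E]]
    dual_pullback_arr(1-3)[OF t E] lift_dual_arr(1-3)[OF t E]
  have K: "x \<cdot> lift_dual t E \<cdot> dual_pullback X V t E = x" if "x \<in> Arr X" "Cod X x = Dom X (fst (pbcone X t (Star V E)))" for x
    using that dual_pullback_arr(4)[OF t E] assoc[of x "lift_dual t E" "dual_pullback X V t E"] by (simp del: assoc)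
  let ?t = "tup X (pbcone X t (Star V E)) a"
  have "w = ?t w \<cdot> snd (pbcone X t (Star V E))" by simp
  also have "?t w = ?t w \<cdot> lift_dual t E \<cdot> dual_pullback X V t E" by (rule K[symmetric]) simp_all
  also have "?t w \<cdot> lift_dual t E = ?t w' \<cdot> lift_dual t E" by (rule eq)
  also have "?t w' \<cdot> lift_dual t E \<cdot> dual_pullback X V t E = ?t w'" by (rule K) simp_all
  also have "?t w' \<cdot> snd (pbcone X t (Star V E)) = w'" by simp
  finally show ?thesis .
qed

text \<open>Let n be the bundle map over f sending (a, e') to (a f, e(a, e')). Then e is n followed
  by the projection and H is n followed by h. Functoriality applied to both factorizations produces
  the same dual of n, and comparing them gives the formula.\<close>

lemma dag_comp:
  assumes t: "t \<in> Arr X" "Cod X t = one X" and t': "t' \<in> Arr X" "Cod X t' = one X"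
    and E': "sys_obj E'" and E: "sys_obj E" and F: "sys_obj F"
    and f: "f \<in> Arr X" "Dom X f = Dom X t'" "Cod X f = Dom X t"
    and e: "lin (pbcone X t' E') E' E e" and h: "lin (pbcone X t E) E F h"
    and H: "H = tup X (pbcone X t E) (fst (pbcone X t' E') \<cdot> f) e \<cdot> h"
    and aw: "a \<in> Arr X" "w \<in> Arr X" "Dom X a = Dom X w" "Cod X a = Dom X t'" "Cod X w = U (Star V F)"
  shows "lin (pbcone X t' E') E' F H"
    "tup X (pbcone X t' (Star V F)) a w \<cdot> dag t' E' F H
      = tup X (pbcone X t' (Star V E)) a (tup X (pbcone X t (Star V F)) (a \<cdot> f) w \<cdot> dag t E F h) \<cdot> dag t' E' E e"
proof -
  let ?c = "pbcone X t' E'" and ?d = "pbcone X t E"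
  let ?n = "tup X ?d (fst ?c \<cdot> f) e"
  note [simp] = sys_obj_diff_obj[OF E] diff_obj_simps[OF sys_obj_diff_obj[OF E]] sys_obj_diff_obj[OF E'] diff_obj_simps[OF sys_obj_diff_obj[OF E']]
    sys_obj_diff_obj[OF F] diff_obj_simps[OF sys_obj_diff_obj[OF F]] t t' f aw Dom_obj[OF t(1)] Dom_obj[OF t'(1)] linD[OF e] linD[OF h]
    diff_obj_simps[OF sys_obj_star_diff_obj[OF E]] diff_obj_simps[OF sys_obj_star_diff_obj[OF F]]
    product_cone[OF lift_product[OF t E]] product_cone[OF lift_product[OF t' E']] product_tup[OF lift_product[OF t E]]
    product_comp_tup[OF lift_product[OF t E]] product_tup[OF lift_product[OF t' E']] product_comp_tup[OF lift_product[OF t' E']]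
    T_product_tup[OF lift_product[OF t E]] T_product_comp_tup[OF lift_product[OF t E]]
    T_product_tup[OF lift_product[OF t' E']] T_product_comp_tup[OF lift_product[OF t' E']] T_tup[OF lift_product[OF t E]]
  \<comment> \<open>The chosen cones depend on the base arrow; equality of t' with f t makes the
    cones on both sides literally the same.\<close>
  have tt: "t' = f \<cdot> t" by (rule one_eq) simp_all
  have "e \<cdot> bl E = tup X (Tcone X ?c) (fst ?c \<cdot> tz X (Dom X t')) (snd ?c \<cdot> bl E') \<cdot> Tm X e"
    using e by (simp add: lin_def)
  then have n: "linear_morphism X (pullback_bundle X t' E') (pullback_bundle X t E) f ?n"
    by (simp add: linear_morphism_def tot_def bas_def tz_natural)
  note hm = lin_mor[OF t E F h] and em = lin_mor[OF t' E' E e] and lm = lift_linear[OF t E]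
  note DE' = lift_mem(1)[OF t' E'] and DE = lift_mem(1)[OF t E] and E1 = sys_obj_mem[OF E] and F1 = sys_obj_mem[OF F]
  have "linear_morphism X (pullback_bundle X t' E') F t' H"
    using linear_morphism_comp[OF DE' DE F1 n hm] by (simp add: H tt[symmetric])
  then show Hl: "lin (pbcone X t' E') E' F H"
    using linear_morphism_lin[OF sys_obj_diff_obj[OF E'] sys_obj_diff_obj[OF F] t'] by simp
  note [simp] = product_cone[OF star_lift_product[OF t F]] product_cone[OF star_lift_product[OF t' F]] product_cone[OF star_lift_product[OF t' E]]
    product_tup[OF star_lift_product[OF t F]] product_tup[OF star_lift_product[OF t' F]] product_tup[OF star_lift_product[OF t' E]]
    dag_arr[OF t E F h] dag_arr[OF t' E' E e] dag_arr[OF t' E' F Hl]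
  let ?w = "tup X (pbcone X t (Star V F)) (a \<cdot> f) w \<cdot> dag t E F h"
  have q1: "a \<cdot> f \<cdot> t = ?w \<cdot> bq (Star V E)" and q2: "a \<cdot> f \<cdot> t = w \<cdot> bq (Star V F)"
    by (rule one_eq; simp)+
  have "tup X (pbcone X t' (Star V E')) a (tup X (pbcone X t' (Star V E)) a ?w \<cdot> dag t' E' E e) \<cdot> lift_dual t' E'
     = tup X (pbcone X t' (Star V E)) a ?w \<cdot> star_map (pullback_bundle X t' E') E t' e"
    by (rule dag_lift_dual[OF t' E' E e, symmetric]) simp_all
  also have "\<dots> = tup X (pbcone X (f \<cdot> t) (Star V E)) a ?w \<cdot> star_map (pullback_bundle X t' E') E (f \<cdot> t) (?n \<cdot> snd ?d)"
    by (simp add: tt[symmetric])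
  also have "\<dots> = tup X (pbcone X f (Star V (pullback_bundle X t E))) a (tup X (pbcone X t (Star V E)) (a \<cdot> f) ?w \<cdot> lift_dual t E)
      \<cdot> star_map (pullback_bundle X t' E') (pullback_bundle X t E) f ?n"
    unfolding lift_dual_def[OF t E] by (rule star_el_comp[OF DE' DE E1 n lm]) (use q1 in simp_all)
  also have "tup X (pbcone X t (Star V E)) (a \<cdot> f) ?w \<cdot> lift_dual t E = tup X (pbcone X t (Star V F)) (a \<cdot> f) w \<cdot> star_map (pullback_bundle X t E) F t h"
    by (rule dag_lift_dual[OF t E F h, symmetric]) simp_all
  also have "tup X (pbcone X f (Star V (pullback_bundle X t E))) a (tup X (pbcone X t (Star V F)) (a \<cdot> f) w \<cdot> star_map (pullback_bundle X t E) F t h)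
      \<cdot> star_map (pullback_bundle X t' E') (pullback_bundle X t E) f ?n
     = tup X (pbcone X (f \<cdot> t) (Star V F)) a w \<cdot> star_map (pullback_bundle X t' E') F (f \<cdot> t) (?n \<cdot> h)"
    by (rule star_el_comp[OF DE' DE F1 n hm, symmetric]) (use q2 in simp_all)
  also have "\<dots> = tup X (pbcone X t' (Star V F)) a w \<cdot> star_map (pullback_bundle X t' E') F t' H"
    by (simp add: tt[symmetric] H)
  also have "\<dots> = tup X (pbcone X t' (Star V E')) a (tup X (pbcone X t' (Star V F)) a w \<cdot> dag t' E' F H) \<cdot> lift_dual t' E'"
    by (rule dag_lift_dual[OF t' E' F Hl]) simp_all
  finally show "tup X (pbcone X t' (Star V F)) a w \<cdot> dag t' E' F H
      = tup X (pbcone X t' (Star V E)) a ?w \<cdot> dag t' E' E e"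
    by (rule lift_dual_inj[OF t' E', symmetric, rotated -1]) simp_all
qed

lemma fib_dual_linear_map:
  assumes "sys_obj E" "sys_obj F" "linear_map E F g"
  shows "linear_map (Star V F) (Star V E) (fd E F g)"
  using assms fib_dual_linear[of E F g] sys_obj_star_diff_obj
  by (simp add: sys_obj_mem sys_obj_diff_obj linear_over_linear_map)

text \<open>The projection followed by g is a composite of bundle maps over t and over the identity
  of the terminal object; the dual of the second one is the fibre dual of g.\<close>

lemma dag_linear_map:
  assumes t: "t \<in> Arr X" "Cod X t = one X" and E: "sys_obj E" and F: "sys_obj F" and g: "linear_map E F g"
    and aw: "a \<in> Arr X" "w \<in> Arr X" "Dom X a = Dom X w" "Cod X a = Dom X t" "Cod X w = U (Star V F)"
  shows "tup X (pbcone X t (Star V F)) a w \<cdot> dag t E F (snd (pbcone X t E) \<cdot> g) = w \<cdot> fd E F g"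
proof -
  let ?c = "pbcone X t E"
  have go: "linear_over X E F g" using g linear_over_linear_map[OF sys_obj_diff_obj[OF E] sys_obj_diff_obj[OF F]] by simp
  note l = linear_map_lin[OF sys_obj_diff_obj[OF E] sys_obj_diff_obj[OF F] g lift_product[OF t E]]
  note M = lift_mem(1)[OF t E] sys_obj_mem[OF E] sys_obj_mem[OF F]
  have c1: "Cod X (bq F) = one X" using F by (simp add: sys_obj_def)
  note v = vert_linear(1)[OF M(2,3) go, unfolded c1]
  note [simp] = sys_obj_star_diff_obj[OF E] sys_obj_star_diff_obj[OF F]  diff_obj_simps[OF sys_obj_star_diff_obj[OF E]] diff_obj_simps[OF sys_obj_star_diff_obj[OF F]] t aw
    product_cone[OF star_lift_product[OF t F]] product_tup[OF star_lift_product[OF t F]] dag_arr[OF t E F l]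
    fib_dual_arr[OF M(2,3) go]
  have q: "a \<cdot> t \<cdot> Idn X (one X) = w \<cdot> bq (Star V F)" "w \<cdot> bq (Star V F) = a \<cdot> t" by (rule one_eq; simp)+
  have "tup X (pbcone X t (Star V E)) a (tup X (pbcone X t (Star V F)) a w \<cdot> dag t E F (snd ?c \<cdot> g)) \<cdot> lift_dual t E
     = tup X (pbcone X t (Star V F)) a w \<cdot> star_map (pullback_bundle X t E) F t (snd ?c \<cdot> g)"
    by (rule dag_lift_dual[OF t E F l, symmetric]) simp_all
  also have "\<dots> = tup X (pbcone X (t \<cdot> Idn X (one X)) (Star V F)) a w \<cdot> star_map (pullback_bundle X t E) F (t \<cdot> Idn X (one X)) (snd ?c \<cdot> g)"
    by simp
  also have "\<dots> = tup X (pbcone X t (Star V E)) a (tup X (pbcone X (Idn X (one X)) (Star V F)) (a \<cdot> t) w \<cdot> star_map E F (Idn X (one X)) g)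
     \<cdot> star_map (pullback_bundle X t E) E t (snd ?c)"
    by (rule star_el_comp[OF M lift_linear[OF t E] v]) (use q in simp_all)
  also have "\<dots> = tup X (pbcone X t (Star V E)) a (w \<cdot> fd E F g) \<cdot> lift_dual t E"
    using fib_dual_elem[OF M(2,3) go, of w] by (simp add: lift_dual_def[OF t E] c1 q)
  finally show ?thesis by (rule lift_dual_inj[OF t E, rotated -1]) simp_all
qed

section \<open>Transposing twice\<close>

abbreviation iota_map :: "'a bdl \<Rightarrow> 'a" where "iota_map E \<equiv> total (Iota V E)"

lemma iota_map_mor:
  assumes "E \<in> \<D>"
  shows "linear_morphism X E (Star V (Star V E)) (Idn X (Cod X (bq E))) (iota_map E)"
  using iota_mor[OF assms] iota_base[OF assms] by (auto simp: DBun_def)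

lemma dag_Idn:
  assumes t: "t \<in> Arr X" "Cod X t = one X" and E: "sys_obj E"
  shows "dag t E E (snd (pbcone X t E)) = snd (pbcone X t (Star V E))"
proof -
  let ?c = "pbcone X t (Star V E)"
  note [simp] = sys_obj_diff_obj[OF E] diff_obj_simps[OF sys_obj_diff_obj[OF E]] t product_cone[OF lift_product[OF t E]]
    diff_obj_simps[OF sys_obj_star_diff_obj[OF E]] product_simps[OF star_lift_product[OF t E]] product_obj[OF star_lift_product[OF t E]]
    T_Idn[OF diff_obj_obj[OF sys_obj_diff_obj[OF E]]]
  have g: "linear_map E E (Idn X (U E))" by (simp add: linear_map_def)
  note l = linear_map_lin[OF sys_obj_diff_obj[OF E] sys_obj_diff_obj[OF E] g lift_product[OF t E]]
  show ?thesis
    using dag_linear_map[OF t E E g, of "fst ?c" "snd ?c"] dag_arr[OF t E E l] fib_dual_Idn[OF sys_obj_mem[OF E]] by simp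
qed

text \<open>Naturality of \<iota> at (t, h), with the double dual rewritten until the transpose of
  the transpose appears. The factors in front of it depend on t and E only, which
  \<open>dag_dag\<close> exploits.\<close>

lemma double_dag:
  assumes t: "t \<in> Arr X" "Cod X t = one X" and E: "sys_obj E" and F: "sys_obj F" and h: "lin (pbcone X t E) E F h"
  shows "h \<cdot> iota_map F = iota_map (pullback_bundle X t E) \<cdot>
     fd (pullback_bundle X t (Star V E)) (Star V (pullback_bundle X t E)) (lift_dual t E) \<cdot>
     dual_pullback X V t (Star V E) \<cdot> dag t (Star V F) (Star V E) (dag t E F h)"
proof -
  let ?U = "pullback_bundle X t E" and ?Z = "Star V (pullback_bundle X t E)"
  let ?WE = "pullback_bundle X t (Star V E)" and ?WF = "pullback_bundle X t (Star V F)"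
  let ?i = "Idn X (Dom X t)" and ?m = "\<lparr>bdom = pullback_bundle X t E, bcod = F, base = t, total = h\<rparr>"
  note ES = sys_obj_star[OF E] and FS = sys_obj_star[OF F]
  note dl = dag_lin[OF t E F h] and da = dag_arr[OF t E F h]
  note M = lift_mem(1)[OF t E] lift_mem(2)[OF t E] lift_mem(2)[OF t F]
  note ZD = star_mem[OF M(1)]
  note hm = lin_mor[OF t E F h]
  define v where "v = tup X (pbcone X t (Star V E)) (fst (pbcone X t (Star V F))) (dag t E F h)"
  note [simp] = t Dom_obj[OF t(1)] diff_obj_simps[OF sys_obj_star_diff_obj[OF E]] diff_obj_simps[OF sys_obj_star_diff_obj[OF F]]
    product_cone[OF star_lift_product[OF t E]] product_cone[OF star_lift_product[OF t F]]
    product_tup[OF star_lift_product[OF t E]] product_tup[OF star_lift_product[OF t F]]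
    product_tup_id[OF star_lift_product[OF t F]] da product_obj[OF star_lift_product[OF t F]] product_obj[OF star_lift_product[OF t E]]
    lift_dual_arr(1-3)[OF t E] dual_pullback_arr(1-3)[OF t E] lin_star_map_arr(1-3)[OF t E F h]
  have v [simp]: "v \<in> Arr X" "Dom X v = Dom X (fst (pbcone X t (Star V F)))" "Cod X v = Dom X (fst (pbcone X t (Star V E)))"
    "v \<cdot> snd (pbcone X t (Star V E)) = dag t E F h"
    by (simp_all add: v_def)
  \<comment> \<open>The dual of (t, h) is a vertical map v, pairing the base with the transpose,
    followed by \<open>lift_dual\<close>.\<close>
  have stv: "star_map ?U F t h = v \<cdot> lift_dual t E"
    using dag_lift_dual[OF t E F h, of "fst (pbcone X t (Star V F))" "snd (pbcone X t (Star V F))"] by (simp add: v_def)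
  have "v = v \<cdot> (lift_dual t E \<cdot> dual_pullback X V t E)"
    unfolding dual_pullback_arr(4)[OF t E] by simp
  also have "\<dots> = star_map ?U F t h \<cdot> dual_pullback X V t E" by (simp add: stv)
  also have "linear_over X ?WF ?WE \<dots>"
    by (rule linear_over_comp[OF M(3) ZD M(2) star_mor(2)[OF M(1) sys_obj_mem[OF F] hm] dual_pullback_linear[OF t E]])
  finally have vl: "linear_over X ?WF ?WE v" .
  note fv = fib_dual_arr[OF M(3) M(2) vl] and fk = fib_dual_arr[OF M(2) ZD lift_dual_linear[OF t E]]
  have c: "fd ?WF ?Z (star_map ?U F t h) = fd ?WE ?Z (lift_dual t E) \<cdot> fd ?WF ?WE v"
    unfolding stv by (rule fib_dual_comp[OF M(3) M(2) ZD vl lift_dual_linear[OF t E]])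
  note dla = lin_star_map_arr[OF t FS ES dl]
  \<comment> \<open>The transpose is v followed by the projection to the dual of E, so its own dual
    passes through the fibre dual of v.\<close>
  have e: "star_map ?WF (Star V E) t (dag t E F h) = lift_dual t (Star V E) \<cdot> fd ?WF ?WE v"
  proof -
    let ?c = "pbcone X t (Star V (Star V E))"
    have cb: "Cod X (bq ?WE) = Dom X t" by simp
    note [simp] = product_cone[OF star_lift_product[OF t ES]] product_tup_id[OF star_lift_product[OF t ES]]
      lift_dual_arr[OF t ES] dla(1-3) product_obj[OF star_lift_product[OF t ES]] diff_obj_simps[OF sys_obj_star_diff_obj[OF ES]]
    have q: "fst ?c \<cdot> ?i \<cdot> t = snd ?c \<cdot> bq (Star V (Star V E))" by (rule one_eq) simp_all
    have "star_map ?WF (Star V E) t (dag t E F h) = tup X (pbcone X (?i \<cdot> t) (Star V (Star V E))) (fst ?c) (snd ?c)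
        \<cdot> star_map ?WF (Star V E) (?i \<cdot> t) (v \<cdot> snd (pbcone X t (Star V E)))"
      by simp
    also have "\<dots> = tup X (pbcone X ?i (Star V ?WE)) (fst ?c) (tup X ?c (fst ?c \<cdot> ?i) (snd ?c) \<cdot> star_map ?WE (Star V E) t (snd (pbcone X t (Star V E))))
       \<cdot> star_map ?WF ?WE ?i v"
      by (rule star_el_comp[OF M(3) M(2) sys_obj_mem[OF ES] _ lift_linear[OF t ES]])
        (use vert_linear(1)[OF M(3) M(2) vl] q in simp_all)
    also have "\<dots> = tup X (pbcone X ?i (Star V ?WE)) (lift_dual t (Star V E) \<cdot> bq (Star V ?WE)) (lift_dual t (Star V E)) \<cdot> star_map ?WF ?WE ?i v"
      by (simp add: lift_dual_def[OF t ES, symmetric])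
    also have "\<dots> = lift_dual t (Star V E) \<cdot> fd ?WF ?WE v"
      using fib_dual_elem[OF M(3) M(2) vl, of "lift_dual t (Star V E)"] unfolding cb by simp
    finally show ?thesis .
  qed
  note [simp] = product_cone[OF star_lift_product[OF t FS]] product_cone[OF star_lift_product[OF t ES]]
    lift_dual_arr(1-3)[OF t ES] dual_pullback_arr(1-3)[OF t ES] dual_pullback_arr(1-3)[OF t FS] fv fk linear_morphismD(4-6)[OF iota_map_mor[OF M(1)]]
    product_cone[OF lift_product[OF t E]]
  have f: "dual_pullback X V t (Star V E) \<cdot> dag t (Star V F) (Star V E) (dag t E F h)
      = fd ?WF ?WE v \<cdot> dual_pullback X V t (Star V F) \<cdot> snd (pbcone X t (Star V (Star V F)))"
  proof -
    have "dual_pullback X V t (Star V E) \<cdot> dag t (Star V F) (Star V E) (dag t E F h)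
       = (dual_pullback X V t (Star V E) \<cdot> lift_dual t (Star V E)) \<cdot> fd ?WF ?WE v \<cdot> dual_pullback X V t (Star V F) \<cdot> snd (pbcone X t (Star V (Star V F)))"
      unfolding dag_def[of t "Star V F" "Star V E"] e by simp
    then show ?thesis unfolding dual_pullback_arr(5)[OF t ES] by simp
  qed
  have "?m \<cdot>\<^bsub>DBun X \<D>\<^esub> Iota V (bcod ?m) = Iota V (bdom ?m) \<cdot>\<^bsub>DBun X \<D>\<^esub> double_dual X V ?m"
    by (rule iota_natural) (use M(1) sys_obj_mem[OF F] hm in \<open>simp add: mor_DBun\<close>)
  then have "h \<cdot> iota_map F = iota_map ?U \<cdot> (fd ?WF ?Z (star_map ?U F t h) \<cdot> dual_pullback X V t (Star V F) \<cdot> snd (pbcone X t (Star V (Star V F))))"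
    by (simp add: DBun_def double_dual_def Let_def star_map_def)
  also have "\<dots> = iota_map ?U \<cdot> fd ?WE ?Z (lift_dual t E) \<cdot> (fd ?WF ?WE v \<cdot> dual_pullback X V t (Star V F) \<cdot> snd (pbcone X t (Star V (Star V F))))"
    unfolding c by simp
  also have "\<dots> = iota_map ?U \<cdot> fd ?WE ?Z (lift_dual t E) \<cdot> (dual_pullback X V t (Star V E) \<cdot> dag t (Star V F) (Star V E) (dag t E F h))"
    unfolding f by (simp del: assoc)
  also have "\<dots> = iota_map ?U \<cdot> fd ?WE ?Z (lift_dual t E) \<cdot> dual_pullback X V t (Star V E) \<cdot> dag t (Star V F) (Star V E) (dag t E F h)"
    using dag_arr[OF t FS ES dl] by simp
  finally show ?thesis .
qed

text \<open>The common prefix J of \<open>double_dag\<close> is computed by a special case: the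
  projection to E has a projection as transpose, so the E-component of J is \<iota>. Its other
  component is the parameter, because every factor of J lies over an identity.\<close>

lemma dag_dag:
  assumes t: "t \<in> Arr X" "Cod X t = one X" and E: "sys_obj E" and F: "sys_obj F" and h: "lin (pbcone X t E) E F h"
    and aw: "a \<in> Arr X" "e \<in> Arr X" "Dom X a = Dom X e" "Cod X a = Dom X t" "Cod X e = U E"
  shows "tup X (pbcone X t E) a e \<cdot> h \<cdot> iota_map F
    = tup X (pbcone X t (Star V (Star V E))) a (e \<cdot> iota_map E) \<cdot> dag t (Star V F) (Star V E) (dag t E F h)"
proof -
  let ?U = "pullback_bundle X t E" and ?Z = "Star V (pullback_bundle X t E)" and ?WE = "pullback_bundle X t (Star V E)"
  note ES = sys_obj_star[OF E] and FS = sys_obj_star[OF F]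
  note M = lift_mem(1)[OF t E] lift_mem(2)[OF t E]
  note ZD = star_mem[OF M(1)]
  note fk = fib_dual_arr[OF M(2) ZD lift_dual_linear[OF t E]]
  define J where "J = iota_map ?U \<cdot> fd ?WE ?Z (lift_dual t E) \<cdot> dual_pullback X V t (Star V E)"
  note dd = dag_arr[OF t FS ES dag_lin[OF t E F h]]
  note [simp] = t aw Dom_obj[OF t(1)] sys_obj_diff_obj[OF E] sys_obj_diff_obj[OF F] diff_obj_simps[OF sys_obj_diff_obj[OF E]] diff_obj_simps[OF sys_obj_diff_obj[OF F]]
    linD[OF h] product_cone[OF lift_product[OF t E]] product_tup[OF lift_product[OF t E]]
    product_comp_tup[OF lift_product[OF t E]]
    product_cone[OF star_lift_product[OF t ES]] product_tup[OF star_lift_product[OF t ES]] product_comp_tup[OF star_lift_product[OF t ES]]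
    dual_pullback_arr(1-3)[OF t ES] fk lift_dual_arr(1-3)[OF t E] linear_morphismD(4-6)[OF iota_map_mor[OF M(1)]]
    linear_morphismD(4-6)[OF iota_map_mor[OF sys_obj_mem[OF E]]] linear_morphismD(4-6)[OF iota_map_mor[OF sys_obj_mem[OF F]]]
    diff_obj_simps[OF sys_obj_star_diff_obj[OF ES]] dd
  have J [simp]: "J \<in> Arr X" "Dom X J = Dom X (fst (pbcone X t E))" "Cod X J = Dom X (fst (pbcone X t (Star V (Star V E))))"
    by (simp_all add: J_def)
  have sl: "lin (pbcone X t E) E E (snd (pbcone X t E))"
    using lift_linear[OF t E] linear_morphism_lin[OF sys_obj_diff_obj[OF E] sys_obj_diff_obj[OF E] t] by simp
  have 1: "J \<cdot> snd (pbcone X t (Star V (Star V E))) = snd (pbcone X t E) \<cdot> iota_map E"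
    using double_dag[OF t E E sl] by (simp add: J_def dag_Idn[OF t E] dag_Idn[OF t ES])
  have 2: "J \<cdot> fst (pbcone X t (Star V (Star V E))) = fst (pbcone X t E)"
  proof -
    note b = bundle_arr(1)[OF star_mem[OF ZD]] bundle_arr(1)[OF star_mem[OF M(2)]]
    have "J \<cdot> fst (pbcone X t (Star V (Star V E)))
       = iota_map ?U \<cdot> (fd ?WE ?Z (lift_dual t E) \<cdot> (dual_pullback X V t (Star V E) \<cdot> fst (pbcone X t (Star V (Star V E)))))"
      by (simp add: J_def)
    also have "\<dots> = iota_map ?U \<cdot> bq (Star V ?Z)"
      unfolding dual_pullback_fst[OF t ES] fib_dual_bq[OF M(2) ZD lift_dual_linear[OF t E]] ..
    also have "\<dots> = fst (pbcone X t E)" using linear_morphismD(7)[OF iota_map_mor[OF M(1)]] by simp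
    finally show ?thesis .
  qed
  have eq: "tup X (pbcone X t E) a e \<cdot> J = tup X (pbcone X t (Star V (Star V E))) a (e \<cdot> iota_map E)"
  proof (rule product_eqI[OF star_lift_product[OF t ES]])
    have "tup X (pbcone X t E) a e \<cdot> (J \<cdot> fst (pbcone X t (Star V (Star V E)))) = a" unfolding 2 by simp
    then show "tup X (pbcone X t E) a e \<cdot> J \<cdot> fst (pbcone X t (Star V (Star V E)))
        = tup X (pbcone X t (Star V (Star V E))) a (e \<cdot> iota_map E) \<cdot> fst (pbcone X t (Star V (Star V E)))" by simp
    have "tup X (pbcone X t E) a e \<cdot> (J \<cdot> snd (pbcone X t (Star V (Star V E)))) = e \<cdot> iota_map E" unfolding 1 by simp
    then show "tup X (pbcone X t E) a e \<cdot> J \<cdot> snd (pbcone X t (Star V (Star V E)))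
        = tup X (pbcone X t (Star V (Star V E))) a (e \<cdot> iota_map E) \<cdot> snd (pbcone X t (Star V (Star V E)))" by simp
  qed simp_all
  have "tup X (pbcone X t E) a e \<cdot> (h \<cdot> iota_map F) = tup X (pbcone X t E) a e \<cdot> (J \<cdot> dag t (Star V F) (Star V E) (dag t E F h))"
    using double_dag[OF t E F h] by (simp add: J_def)
  also have "\<dots> = tup X (pbcone X t E) a e \<cdot> J \<cdot> dag t (Star V F) (Star V E) (dag t E F h)" by simp
  finally show ?thesis unfolding eq by simp
qed

lemma iota_map_linear_map: "sys_obj E \<Longrightarrow> linear_map E (Star V (Star V E)) (iota_map E)"
  using iota_map_mor[of E] by (simp add: sys_obj_def linear_morphism_def linear_map_def tot_def)

text \<open>A linear map is regarded as parametrized by E itself, and \<open>dag_dag\<close> is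
  evaluated at the pair of identities.\<close>

lemma iota_map_natural:
  assumes E: "sys_obj E" and F: "sys_obj F" and g: "linear_map E F g"
  shows "g \<cdot> iota_map F = iota_map E \<cdot> fd (Star V F) (Star V E) (fd E F g)"
proof -
  let ?t = "bq E"
  note [simp] = sys_obj_diff_obj[OF E] sys_obj_diff_obj[OF F] diff_obj_simps[OF sys_obj_diff_obj[OF E]] diff_obj_simps[OF sys_obj_diff_obj[OF F]] linear_mapD[OF g]
    linear_mapD[OF iota_map_linear_map[OF E]] linear_mapD[OF iota_map_linear_map[OF F]]
  have t: "?t \<in> Arr X" "Cod X ?t = one X" by simp_all
  note ES = sys_obj_star[OF E] and FS = sys_obj_star[OF F]
  note gl = linear_map_lin[OF sys_obj_diff_obj[OF E] sys_obj_diff_obj[OF F] g lift_product[OF t E]]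
  note fg = fib_dual_linear_map[OF E F g]
  note [simp] = linear_mapD[OF fg] product_cone[OF star_lift_product[OF t E]] product_cone[OF star_lift_product[OF t F]]
    product_tup[OF lift_product[OF t E]] product_cone[OF lift_product[OF t E]] dag_arr[OF t E F gl]
  have "dag ?t E F (snd (pbcone X ?t E) \<cdot> g) = snd (pbcone X ?t (Star V F)) \<cdot> fd E F g"
    using dag_linear_map[OF t E F g, of "fst (pbcone X ?t (Star V F))" "snd (pbcone X ?t (Star V F))"]
      product_tup_id[OF star_lift_product[OF t F]] product_obj[OF star_lift_product[OF t F]] by simp
  then show ?thesis
    using dag_dag[OF t E F gl, of "Idn X (U E)" "Idn X (U E)"]
      dag_linear_map[OF t FS ES fg, of "Idn X (U E)" "iota_map E"] by simp
qed

section \<open>Biproducts\<close>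

definition biprod :: "'a bdl \<Rightarrow> 'a bdl \<Rightarrow> 'a bdl \<Rightarrow> 'a \<times> 'a \<Rightarrow> 'a \<times> 'a \<Rightarrow> bool" where
  "biprod E F P p i \<longleftrightarrow> fibre_biproduct X \<D> E F P p i \<and> Cod X (bq E) = one X"

lemma biprodD:
  assumes "biprod E F P p i"
  shows "sys_obj E" "sys_obj F" "sys_obj P" "linear_map P E (fst p)" "linear_map P F (snd p)" "linear_map E P (fst i)" "linear_map F P (snd i)"
    "is_product X (U E) (U F) p" "Dom X (fst p) = U P"
    "fst i \<cdot> fst p = Idn X (U E)" "fst i \<cdot> snd p = bq E \<cdot> bz F"
    "snd i \<cdot> fst p = bq F \<cdot> bz E" "snd i \<cdot> snd p = Idn X (U F)"
proof -
  have b: "fibre_biproduct X \<D> E F P p i" and e: "Cod X (bq E) = one X" using assms by (simp_all add: biprod_def)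
  have P: "Cod X (bq P) = Cod X (bq E)" "Cod X (bq P) = Cod X (bq F)"
    using b unfolding fibre_biproduct_def linear_over_alt by blast+
  show o: "sys_obj E" "sys_obj F" "sys_obj P"
    using b e P unfolding fibre_biproduct_def sys_obj_def by simp_all
  note d = sys_obj_diff_obj[OF o(1)] sys_obj_diff_obj[OF o(2)] sys_obj_diff_obj[OF o(3)]
  show l: "linear_map P E (fst p)" "linear_map P F (snd p)" "linear_map E P (fst i)" "linear_map F P (snd i)"
    using b d unfolding fibre_biproduct_def by (simp_all add: linear_over_linear_map)
  have pb: "is_pullback X (bq E) (bq F) p" using b by (simp add: fibre_biproduct_def)
  show "is_product X (U E) (U F) p"
    by (rule pullback_over_terminal[OF pb]) (simp add: e one_terminal)
  show "Dom X (fst p) = U P" using linear_mapD(2)[OF l(1)] .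
  show "fst i \<cdot> fst p = Idn X (U E)" "fst i \<cdot> snd p = bq E \<cdot> bz F"
    "snd i \<cdot> fst p = bq F \<cdot> bz E" "snd i \<cdot> snd p = Idn X (U F)"
    using b by (simp_all add: fibre_biproduct_def tot_def)
qed

text \<open>The involution is contravariant on fibres, so duals of injections serve as projections
  and duals of projections as injections.\<close>

lemma biprod_star:
  assumes "biprod E F P p i"
  shows "biprod (Star V E) (Star V F) (Star V P)
          (fd E P (fst i), fd F P (snd i)) (fd P E (fst p), fd P F (snd p))"
proof -
  have "preserves_biproducts X \<D> V"
    using crtc by (simp add: cartesian_reverse_tangent_category_def)
  moreover have b: "fibre_biproduct X \<D> E F P p i" and "E \<in> \<D>" "Cod X (bq E) = one X"
    using assms by (simp_all add: biprod_def fibre_biproduct_def)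
  ultimately show ?thesis unfolding biprod_def preserves_biproducts_def by (simp only: star_bas)
qed

text \<open>The biproduct decomposition of the identity, checked against the two projections, which
  are additive.\<close>

lemma biprod_split:
  assumes b: "biprod E F P p i" and x: "x \<in> Arr X" "Cod X x = U P"
  shows "ad P (x \<cdot> fst p \<cdot> fst i) (x \<cdot> snd p \<cdot> snd i) = x"
proof -
  note B = biprodD[OF b]
  note d = sys_obj_diff_obj[OF B(1)] sys_obj_diff_obj[OF B(2)] sys_obj_diff_obj[OF B(3)]
  note [simp] = x d diff_obj_simps[OF d(1)] diff_obj_simps[OF d(2)] diff_obj_simps[OF d(3)]
    linear_mapD[OF B(4)] linear_mapD[OF B(5)] linear_mapD[OF B(6)] linear_mapD[OF B(7)]
  have c: "y \<cdot> fst i \<cdot> fst p = y" "y \<cdot> fst i \<cdot> snd p = y \<cdot> bq E \<cdot> bz F" if "y \<in> Arr X" "Cod X y = U E" for y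
    using that B(10,11) assoc[of y "fst i" "fst p"] assoc[of y "fst i" "snd p"] assoc[of y "bq E" "bz F"] by (simp_all del: assoc)
  have c': "y \<cdot> snd i \<cdot> snd p = y" "y \<cdot> snd i \<cdot> fst p = y \<cdot> bq F \<cdot> bz E" if "y \<in> Arr X" "Cod X y = U F" for y
    using that B(12,13) assoc[of y "snd i" "fst p"] assoc[of y "snd i" "snd p"] assoc[of y "bq F" "bz E"] by (simp_all del: assoc)
  show ?thesis
    by (rule product_eqI[OF B(8)])
     (simp_all add: linear_map_ad[OF d(3) d(1) B(4)] linear_map_ad[OF d(3) d(2) B(5)] c c' ad_zero)
qed

text \<open>The zero map is the first injection followed by the second projection, and the dual
  diagram is again a biproduct.\<close>

lemma fib_dual_zero:
  assumes b: "biprod E F P p i"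
  shows "fd E F (bq E \<cdot> bz F) = bq (Star V F) \<cdot> bz (Star V E)"
proof -
  note B = biprodD[OF b]
  have lo: "linear_over X E P (fst i)" "linear_over X P F (snd p)"
    using b by (simp_all add: biprod_def fibre_biproduct_def)
  have "fd E F (fst i \<cdot> snd p) = fd P F (snd p) \<cdot> fd E P (fst i)"
    by (rule fib_dual_comp) (use B lo sys_obj_mem in simp_all)
  then show ?thesis using biprodD(12)[OF biprod_star[OF b]] B(11) by simp
qed

text \<open>\<open>dag_comp\<close> with an identity on the base and a second map that is constant
  in the parameter.\<close>

lemma dag_post:
  assumes t: "t \<in> Arr X" "Cod X t = one X" and E: "sys_obj E" and F: "sys_obj F" and G: "sys_obj G"
    and h: "lin (pbcone X t E) E F h" and g: "linear_map F G g"
    and aw: "a \<in> Arr X" "w \<in> Arr X" "Dom X a = Dom X w" "Cod X a = Dom X t" "Cod X w = U (Star V G)"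
  shows "lin (pbcone X t E) E G (h \<cdot> g)"
    "tup X (pbcone X t (Star V G)) a w \<cdot> dag t E G (h \<cdot> g) = tup X (pbcone X t (Star V F)) a (w \<cdot> fd F G g) \<cdot> dag t E F h"
proof -
  note [simp] = t aw Dom_obj[OF t(1)] linD[OF h] linear_mapD[OF g] product_cone[OF lift_product[OF t E]] product_cone[OF lift_product[OF t F]]
    product_tup[OF lift_product[OF t F]]
  note gl = linear_map_lin[OF sys_obj_diff_obj[OF F] sys_obj_diff_obj[OF G] g lift_product[OF t F]]
  have H: "h \<cdot> g = tup X (pbcone X t F) (fst (pbcone X t E) \<cdot> Idn X (Dom X t)) h \<cdot> (snd (pbcone X t F) \<cdot> g)" by simp
  note c = dag_comp[OF t t E F G _ _ _ h gl H aw]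
  show "lin (pbcone X t E) E G (h \<cdot> g)" by (rule c(1)) simp_all
  show "tup X (pbcone X t (Star V G)) a w \<cdot> dag t E G (h \<cdot> g) = tup X (pbcone X t (Star V F)) a (w \<cdot> fd F G g) \<cdot> dag t E F h"
    using c(2) dag_linear_map[OF t F G g, of a w] by simp
qed

lemma dag_pre:
  assumes t: "t \<in> Arr X" "Cod X t = one X" and E: "sys_obj E" and F: "sys_obj F" and G: "sys_obj G"
    and h: "lin (pbcone X t F) F G h" and g: "linear_map E F g"
    and H: "H = tup X (pbcone X t F) (fst (pbcone X t E)) (snd (pbcone X t E) \<cdot> g) \<cdot> h"
    and aw: "a \<in> Arr X" "w \<in> Arr X" "Dom X a = Dom X w" "Cod X a = Dom X t" "Cod X w = U (Star V G)"
  shows "lin (pbcone X t E) E G H"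
    "tup X (pbcone X t (Star V G)) a w \<cdot> dag t E G H = tup X (pbcone X t (Star V G)) a w \<cdot> dag t F G h \<cdot> fd E F g"
proof -
  note [simp] = t aw Dom_obj[OF t(1)] linD[OF h] linear_mapD[OF g] product_cone[OF lift_product[OF t E]] product_cone[OF lift_product[OF t F]]
    product_tup[OF lift_product[OF t F]] dag_arr[OF t F G h] product_cone[OF star_lift_product[OF t G]]
    product_tup[OF star_lift_product[OF t G]]
  note gl = linear_map_lin[OF sys_obj_diff_obj[OF E] sys_obj_diff_obj[OF F] g lift_product[OF t E]]
  have H': "H = tup X (pbcone X t F) (fst (pbcone X t E) \<cdot> Idn X (Dom X t)) (snd (pbcone X t E) \<cdot> g) \<cdot> h" by (simp add: H)
  note c = dag_comp[OF t t E F G _ _ _ gl h H' aw]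
  show "lin (pbcone X t E) E G H" by (rule c(1)) simp_all
  show "tup X (pbcone X t (Star V G)) a w \<cdot> dag t E G H = tup X (pbcone X t (Star V G)) a w \<cdot> dag t F G h \<cdot> fd E F g"
    using c(2) dag_linear_map[OF t E F g, of a "tup X (pbcone X t (Star V G)) a w \<cdot> dag t F G h"] by simp
qed

text \<open>An element of the dual of P splits as a sum along the dual biproduct. The transpose is
  additive in it, and \<open>dag_post\<close> turns each summand into the transpose of a component
  of h.\<close>

lemma dag_biprod:
  assumes t: "t \<in> Arr X" "Cod X t = one X" and E: "sys_obj E" and b: "biprod F G P p i"
    and h: "lin (pbcone X t E) E P h"
    and aw: "a \<in> Arr X" "w \<in> Arr X" "Dom X a = Dom X w" "Cod X a = Dom X t" "Cod X w = U (Star V P)"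
  shows "tup X (pbcone X t (Star V P)) a w \<cdot> dag t E P h = ad (Star V E)
    (tup X (pbcone X t (Star V F)) a (w \<cdot> fd F P (fst i)) \<cdot> dag t E F (h \<cdot> fst p))
    (tup X (pbcone X t (Star V G)) a (w \<cdot> fd G P (snd i)) \<cdot> dag t E G (h \<cdot> snd p))"
proof -
  note B = biprodD[OF b] and B' = biprodD[OF biprod_star[OF b], simplified]
  note d = sys_obj_diff_obj[OF B'(3)] sys_obj_star_diff_obj[OF E]
  note [simp] = aw linear_mapD[OF B'(4)] linear_mapD[OF B'(5)] linear_mapD[OF B'(6)] linear_mapD[OF B'(7)]
  have "ad (Star V P) (w \<cdot> fd F P (fst i) \<cdot> fd P F (fst p))
      (w \<cdot> fd G P (snd i) \<cdot> fd P G (snd p)) = w"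
    using biprod_split[OF biprod_star[OF b], of w] by simp
  then have "tup X (pbcone X t (Star V P)) a w \<cdot> dag t E P h
     = tup X (pbcone X t (Star V P)) a (ad (Star V P) (w \<cdot> fd F P (fst i) \<cdot> fd P F (fst p))
      (w \<cdot> fd G P (snd i) \<cdot> fd P G (snd p))) \<cdot> dag t E P h" by simp
  also have "\<dots> = ad (Star V E)
      (tup X (pbcone X t (Star V P)) a (w \<cdot> fd F P (fst i) \<cdot> fd P F (fst p)) \<cdot> dag t E P h)
      (tup X (pbcone X t (Star V P)) a (w \<cdot> fd G P (snd i) \<cdot> fd P G (snd p)) \<cdot> dag t E P h)"
    by (rule lin_ad[OF star_lift_product[OF t B(3)] d dag_lin[OF t E B(3) h]]) simp_all
  finally show ?thesis
    using dag_post(2)[OF t E B(3) B(1) h B(4), of a "w \<cdot> fd F P (fst i)"]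
      dag_post(2)[OF t E B(3) B(2) h B(5), of a "w \<cdot> fd G P (snd i)"] by simp
qed

section \<open>Self-dual objects\<close>

abbreviation obj :: "'a sdobj \<Rightarrow> 'o" where
  "obj S \<equiv> U (sbun S)"

definition self_dual :: "'a sdobj \<Rightarrow> bool" where
  "self_dual S \<longleftrightarrow> linear_self_duality X \<D> V S \<and> symmetric_duality X V S"

abbreviation du :: "'a sdobj \<Rightarrow> 'a" where "du S \<equiv> sdual S"
abbreviation ud :: "'a sdobj \<Rightarrow> 'a" where "ud S \<equiv> inv_arr X (sdual S)"

context
  fixes S assumes S: "self_dual S"
begin

lemma self_dual_sys_obj: "sys_obj (sbun S)"
  using S by (simp add: self_dual_def linear_self_duality_def sys_obj_def bas_def)

lemma du_linear_map: "linear_map (sbun S) (Star V (sbun S)) (du S)"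
  using S by (simp add: self_dual_def linear_self_duality_def DBun_def vert_def linear_morphism_def linear_map_def tot_def)

text \<open>The hypothesis provides an inverse in the category of bundles; its total part is linear
  and is the inverse in X that \<open>inv_arr\<close> selects.\<close>

lemma ud_facts:
  "linear_map (Star V (sbun S)) (sbun S) (ud S)" "du S \<cdot> ud S = Idn X (obj S)"
  "ud S \<cdot> du S = Idn X (U (Star V (sbun S)))"
proof -
  obtain m where m: "inverse_pair (DBun X \<D>) (vert X (sbun S) (Star V (sbun S)) (du S)) m"
    using S by (auto simp: self_dual_def linear_self_duality_def is_iso_def)
  define g where "g = total m"
  have g: "linear_morphism X (Star V (sbun S)) (sbun S) (base m) g" "du S \<cdot> g = Idn X (obj S)"
    "g \<cdot> du S = Idn X (U (Star V (sbun S)))"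
    using m by (auto simp: inverse_pair_def DBun_def vert_def g_def tot_def)
  have p: "inverse_pair X (du S) g"
    using g linear_morphismD[OF g(1)] linear_mapD[OF du_linear_map] by (simp add: inverse_pair_def)
  have "linear_map (Star V (sbun S)) (sbun S) g"
    using g(1) by (simp add: linear_morphism_def linear_map_def tot_def)
  then show "linear_map (Star V (sbun S)) (sbun S) (ud S)" "du S \<cdot> ud S = Idn X (obj S)"
    "ud S \<cdot> du S = Idn X (U (Star V (sbun S)))"
    using g(2,3) inv_arr_eq[OF p] by simp_all
qed

lemmas self_dual_simps = sys_obj_diff_obj[OF self_dual_sys_obj] sys_obj_star_diff_obj[OF self_dual_sys_obj] diff_obj_simps[OF sys_obj_diff_obj[OF self_dual_sys_obj]]
  diff_obj_simps[OF sys_obj_star_diff_obj[OF self_dual_sys_obj]] linear_mapD[OF du_linear_map] linear_mapD[OF ud_facts(1)]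

lemma du_ud: "\<lbrakk>x \<in> Arr X; Cod X x = obj S\<rbrakk> \<Longrightarrow> x \<cdot> du S \<cdot> ud S = x"
  using ud_facts(2) assoc[of x "du S" "ud S"] by (simp add: self_dual_simps del: assoc)

lemma ud_du: "\<lbrakk>x \<in> Arr X; Cod X x = U (Star V (sbun S))\<rbrakk> \<Longrightarrow> x \<cdot> ud S \<cdot> du S = x"
  using ud_facts(3) assoc[of x "ud S" "du S"] by (simp add: self_dual_simps del: assoc)

lemma iota_map_fib_du: "iota_map (sbun S) \<cdot> fd (sbun S) (Star V (sbun S)) (du S) = du S"
  using S by (simp add: self_dual_def symmetric_duality_def)

lemma du_linear_over: "linear_over X (sbun S) (Star V (sbun S)) (du S)"
  and ud_linear_over: "linear_over X (Star V (sbun S)) (sbun S) (ud S)"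
  using du_linear_map ud_facts(1) linear_over_linear_map self_dual_simps by simp_all

text \<open>Symmetry says that \<iota> followed by the dual of \<open>du\<close> is
  \<open>du\<close>; the dual of \<open>ud\<close> cancels the dual of \<open>du\<close>, so it can
  be moved to the other side.\<close>

lemma fib_du_fib_ud:
  assumes "x \<in> Arr X" "Cod X x = obj S"
  shows "x \<cdot> du S \<cdot> fd (Star V (sbun S)) (sbun S) (ud S) = x \<cdot> iota_map (sbun S)"
proof -
  let ?E = "sbun S" and ?fu = "fd (Star V (sbun S)) (sbun S) (ud S)" and ?fd = "fd (sbun S) (Star V (sbun S)) (du S)"
  note M = sys_obj_mem[OF self_dual_sys_obj] star_mem[OF sys_obj_mem[OF self_dual_sys_obj]]
  note [simp] = self_dual_simps linear_mapD[OF fib_dual_linear_map[OF self_dual_sys_obj sys_obj_star[OF self_dual_sys_obj] du_linear_map]]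
    linear_mapD[OF fib_dual_linear_map[OF sys_obj_star[OF self_dual_sys_obj] self_dual_sys_obj ud_facts(1)]] linear_mapD[OF iota_map_linear_map[OF self_dual_sys_obj]] assms
    diff_obj_simps[OF sys_obj_star_diff_obj[OF sys_obj_star[OF self_dual_sys_obj]]]
  have 1: "?fd \<cdot> ?fu = Idn X (U (Star V (Star V ?E)))"
    using fib_dual_comp[OF M(2) M(1) M(2) ud_linear_over du_linear_over] fib_dual_Idn[OF M(2)] ud_facts(3) by simp
  have "x \<cdot> du S \<cdot> ?fu = x \<cdot> (iota_map ?E \<cdot> ?fd) \<cdot> ?fu" unfolding iota_map_fib_du ..
  also have "\<dots> = x \<cdot> iota_map ?E \<cdot> (?fd \<cdot> ?fu)" by simp
  also have "\<dots> = x \<cdot> iota_map ?E" unfolding 1 by simp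
  finally show ?thesis .
qed

end

text \<open>Conjugation by the dualities makes transposition an involution. Symmetry is used at both
  ends: it creates the \<iota> at the source that \<open>dag_dag\<close> expects, and absorbs the
  one that \<open>dag_dag\<close> leaves at the target.\<close>

lemma self_dual_transpose:
  assumes t: "t \<in> Arr X" "Cod X t = one X" and S: "self_dual S" and S': "self_dual S'"
    and h: "lin (pbcone X t (sbun S)) (sbun S) (sbun S') h"
    and H: "H = tup X (pbcone X t (Star V (sbun S'))) (fst (pbcone X t (sbun S'))) (snd (pbcone X t (sbun S')) \<cdot> du S')
       \<cdot> dag t (sbun S) (sbun S') h \<cdot> ud S"
    and ae: "a \<in> Arr X" "e \<in> Arr X" "Dom X a = Dom X e" "Cod X a = Dom X t" "Cod X e = obj S"
  shows "lin (pbcone X t (sbun S')) (sbun S') (sbun S) H"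
    "tup X (pbcone X t (Star V (sbun S))) a (e \<cdot> du S) \<cdot> dag t (sbun S') (sbun S) H \<cdot> ud S' = tup X (pbcone X t (sbun S)) a e \<cdot> h"
proof -
  let ?E = "sbun S" and ?F = "sbun S'"
  note E = self_dual_sys_obj[OF S] and F = self_dual_sys_obj[OF S']
  note ES = sys_obj_star[OF E] and FS = sys_obj_star[OF F]
  note dl = dag_lin[OF t E F h]
  define H1 where "H1 = dag t ?E ?F h \<cdot> ud S"
  have H': "H = tup X (pbcone X t (Star V ?F)) (fst (pbcone X t ?F)) (snd (pbcone X t ?F) \<cdot> du S') \<cdot> H1"
    using dag_arr[OF t E F h] self_dual_simps[OF S] self_dual_simps[OF S'] t product_cone[OF lift_product[OF t F]] product_tup[OF lift_product[OF t FS]]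
    by (simp add: H H1_def)
  note [simp] = self_dual_simps[OF S] self_dual_simps[OF S'] t ae Dom_obj[OF t(1)] linD[OF h]
    product_tup[OF lift_product[OF t E]] product_cone[OF lift_product[OF t E]]
    diff_obj_simps[OF sys_obj_star_diff_obj[OF ES]] diff_obj_simps[OF sys_obj_star_diff_obj[OF FS]]
    linear_mapD[OF iota_map_linear_map[OF E]] linear_mapD[OF iota_map_linear_map[OF F]]
    linear_mapD[OF fib_dual_linear_map[OF F FS du_linear_map[OF S']]] linear_mapD[OF fib_dual_linear_map[OF ES E ud_facts(1)[OF S]]]
  note p1 = dag_post[OF t FS ES E dl ud_facts(1)[OF S], folded H1_def]
  have l1: "lin (pbcone X t (Star V ?F)) (Star V ?F) ?E H1" by (rule p1(1)[of a "e \<cdot> du S"]) simp_all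
  note p2 = dag_pre[OF t F FS E l1 du_linear_map[OF S'] H']
  show "lin (pbcone X t ?F) ?F ?E H" by (rule p2(1)[of a "e \<cdot> du S"]) simp_all
  have "tup X (pbcone X t (Star V ?E)) a (e \<cdot> du S) \<cdot> dag t ?F ?E H
    = tup X (pbcone X t (Star V ?E)) a (e \<cdot> du S) \<cdot> dag t (Star V ?F) ?E H1 \<cdot> fd ?F (Star V ?F) (du S')"
    by (rule p2(2)) simp_all
  also have "tup X (pbcone X t (Star V ?E)) a (e \<cdot> du S) \<cdot> dag t (Star V ?F) ?E H1
    = tup X (pbcone X t (Star V (Star V ?E))) a (e \<cdot> iota_map ?E) \<cdot> dag t (Star V ?F) (Star V ?E) (dag t ?E ?F h)"
    using p1(2)[of a "e \<cdot> du S"] fib_du_fib_ud[OF S, of e] by simp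
  also have "\<dots> = tup X (pbcone X t ?E) a e \<cdot> h \<cdot> iota_map ?F"
    by (rule dag_dag[OF t E F h, symmetric]) simp_all
  also have "tup X (pbcone X t ?E) a e \<cdot> h \<cdot> iota_map ?F \<cdot> fd ?F (Star V ?F) (du S')
      = tup X (pbcone X t ?E) a e \<cdot> h \<cdot> (iota_map ?F \<cdot> fd ?F (Star V ?F) (du S'))" by simp
  also have "\<dots> = tup X (pbcone X t ?E) a e \<cdot> h \<cdot> du S'" unfolding iota_map_fib_du[OF S'] ..
  finally show "tup X (pbcone X t (Star V ?E)) a (e \<cdot> du S) \<cdot> dag t ?F ?E H \<cdot> ud S' = tup X (pbcone X t ?E) a e \<cdot> h"
    by (simp add: du_ud[OF S'])
qed

text \<open>\<open>R[f](a, y)\<close> at generalized elements \<open>a\<close> and \<open>y\<close>.\<close>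

definition rev_el :: "'a sdobj \<Rightarrow> 'a sdobj \<Rightarrow> 'a \<Rightarrow> 'a \<Rightarrow> 'a \<Rightarrow> 'a" where
  "rev_el S S' f a y = tup X (pbcone X (bq (sbun S)) (Star V (sbun S'))) a (y \<cdot> du S')
     \<cdot> dag (bq (sbun S)) (sbun S) (sbun S') (Der (pbcone X (bq (sbun S)) (sbun S)) (sbun S) (sbun S') f) \<cdot> ud S"

lemma bq_to_one: "sys_obj E \<Longrightarrow> bq E \<in> Arr X" "sys_obj E \<Longrightarrow> Cod X (bq E) = one X"
  using bundle_arr(1) by (simp_all add: sys_obj_def)

lemma self_lift_product: "sys_obj E \<Longrightarrow> is_product X (U E) (U E) (pbcone X (bq E) E)"
  using lift_product[OF bq_to_one] by blast

context
  fixes S S' f assumes S: "self_dual S" and S': "self_dual S'" and f: "f \<in> Arr X" "Dom X f = obj S" "Cod X f = obj S'"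
begin

lemma Der_self_lin: "lin (pbcone X (bq (sbun S)) (sbun S)) (sbun S) (sbun S') (Der (pbcone X (bq (sbun S)) (sbun S)) (sbun S) (sbun S') f)"
  by (rule Der_lin[OF sys_obj_diff_obj[OF self_dual_sys_obj[OF S]] sys_obj_diff_obj[OF self_dual_sys_obj[OF S']] f self_lift_product[OF self_dual_sys_obj[OF S]]])

lemmas dD_arr = dag_arr[OF bq_to_one[OF self_dual_sys_obj[OF S]] self_dual_sys_obj[OF S] self_dual_sys_obj[OF S'] Der_self_lin]
  and dD_lin = dag_lin[OF bq_to_one[OF self_dual_sys_obj[OF S]] self_dual_sys_obj[OF S] self_dual_sys_obj[OF S'] Der_self_lin]
  and dD_product = star_lift_product[OF bq_to_one[OF self_dual_sys_obj[OF S]] self_dual_sys_obj[OF S']]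

lemma rev_el_arr:
  assumes "a \<in> Arr X" "y \<in> Arr X" "Dom X a = Dom X y" "Cod X a = obj S" "Cod X y = obj S'"
  shows "rev_el S S' f a y \<in> Arr X" "Dom X (rev_el S S' f a y) = Dom X y" "Cod X (rev_el S S' f a y) = obj S"
  using assms by (simp_all add: product_tup[OF dD_product] dD_arr self_dual_simps[OF S] self_dual_simps[OF S'] rev_el_def)

lemma comp_rev_el:
  assumes "x \<in> Arr X" "Cod X x = Dom X y" "a \<in> Arr X" "y \<in> Arr X" "Dom X a = Dom X y" "Cod X a = obj S" "Cod X y = obj S'"
  shows "x \<cdot> rev_el S S' f a y = rev_el S S' f (x \<cdot> a) (x \<cdot> y)"
  using assms by (simp add: product_tup[OF dD_product] product_comp_tup[OF dD_product] dD_arr self_dual_simps[OF S] self_dual_simps[OF S'] rev_el_def)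

lemma rev_el_ad:
  assumes "a \<in> Arr X" "y \<in> Arr X" "y' \<in> Arr X" "Dom X a = Dom X y'" "Dom X y = Dom X y'"
    "Cod X a = obj S" "Cod X y = obj S'" "Cod X y' = obj S'"
  shows "rev_el S S' f a (ad (sbun S') y y') = ad (sbun S) (rev_el S S' f a y) (rev_el S S' f a y')"
proof -
  note [simp] = assms self_dual_simps[OF S] self_dual_simps[OF S'] product_tup[OF dD_product] dD_arr
  show ?thesis
    by (simp add: rev_el_def linear_map_ad[OF _ _ du_linear_map[OF S']] linear_map_ad[OF _ _ ud_facts(1)[OF S]] lin_ad[OF dD_product _ _ dD_lin])
qed

lemma rev_el_bz:
  assumes "a \<in> Arr X" "x \<in> Arr X" "Dom X a = Dom X x" "Cod X a = obj S" "Cod X x = one X"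
  shows "rev_el S S' f a (x \<cdot> bz (sbun S')) = x \<cdot> bz (sbun S)"
proof -
  note [simp] = assms self_dual_simps[OF S] self_dual_simps[OF S'] product_tup[OF dD_product] dD_arr
  show ?thesis
    by (simp add: rev_el_def linear_map_bz[OF _ _ du_linear_map[OF S']] linear_map_bz[OF _ _ ud_facts(1)[OF S]] lin_bz[OF dD_product _ _ dD_lin])
qed

text \<open>The duality, the transpose and the inverse duality each commute with the lifts. This is
  the linearity behind RD.6.\<close>

lemma rev_el_lin:
  assumes c: "is_product X (obj S) (obj S') c"
  shows "lin c (sbun S') (sbun S) (rev_el S S' f (fst c) (snd c))"
proof -
  let ?d = "pbcone X (bq (sbun S)) (Star V (sbun S'))" and ?D = "dag (bq (sbun S)) (sbun S) (sbun S') (Der (pbcone X (bq (sbun S)) (sbun S)) (sbun S) (sbun S') f)"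
  note [simp] = self_dual_simps[OF S] self_dual_simps[OF S'] product_tup[OF dD_product] dD_arr T_product_tup[OF dD_product] product_cone[OF dD_product] product_cone[OF c] T_product_tup[OF c]
    T_product_comp_tup[OF dD_product] T_tup[OF dD_product]
  let ?u = "tup X ?d (fst c) (snd c \<cdot> du S')"
  have "rev_el S S' f (fst c) (snd c) \<cdot> bl (sbun S) = ?u \<cdot> ?D \<cdot> bl (Star V (sbun S)) \<cdot> Tm X (ud S)"
    by (simp add: rev_el_def linear_map_bl[OF _ _ ud_facts(1)[OF S]])
  also have "?u \<cdot> ?D \<cdot> bl (Star V (sbun S)) = tup X (Tcone X ?d) (fst c \<cdot> tz X (obj S)) (snd c \<cdot> du S' \<cdot> bl (Star V (sbun S'))) \<cdot> Tm X ?D"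
    by (rule lin_bl[OF dD_product _ _ dD_lin]) simp_all
  also have "snd c \<cdot> du S' \<cdot> bl (Star V (sbun S')) = snd c \<cdot> bl (sbun S') \<cdot> Tm X (du S')"
    by (rule linear_map_bl[OF _ _ du_linear_map[OF S']]) simp_all
  finally show ?thesis using rev_el_arr[of "fst c" "snd c"] by (simp add: lin_def) (simp add: rev_el_def)
qed

end

text \<open>The derivative of a linear map is the map itself at the vector, so its transpose is the
  fibre dual and the base point disappears.\<close>

lemma rev_el_linear_map:
  assumes S: "self_dual S" and S': "self_dual S'" and g: "linear_map (sbun S) (sbun S') g"
    and "a \<in> Arr X" "y \<in> Arr X" "Dom X a = Dom X y" "Cod X a = obj S" "Cod X y = obj S'"
  shows "rev_el S S' g a y = y \<cdot> du S' \<cdot> fd (sbun S) (sbun S') g \<cdot> ud S"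
proof -
  let ?c = "pbcone X (bq (sbun S)) (sbun S)"
  note P = self_lift_product[OF self_dual_sys_obj[OF S]]
  note [simp] = self_dual_simps[OF S] self_dual_simps[OF S'] product_cone[OF P] linear_mapD[OF g] assms(4-)
  have "Der ?c (sbun S) (sbun S') g = snd ?c \<cdot> g"
    unfolding Der_def by (rule nu_el_linear_map_vpart[OF _ _ g]) simp_all
  then show ?thesis
    using dag_linear_map[OF bq_to_one[OF self_dual_sys_obj[OF S]] self_dual_sys_obj[OF S] self_dual_sys_obj[OF S'] g, of a "y \<cdot> du S'"] by (simp add: rev_el_def)
qed

lemma rev_el_comp:
  assumes S: "self_dual S" and S': "self_dual S'" and S'': "self_dual S''"
    and f: "f \<in> Arr X" "Dom X f = obj S" "Cod X f = obj S'"
    and g: "g \<in> Arr X" "Dom X g = obj S'" "Cod X g = obj S''"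
    and ay: "a \<in> Arr X" "y \<in> Arr X" "Dom X a = Dom X y" "Cod X a = obj S" "Cod X y = obj S''"
  shows "rev_el S S'' (f \<cdot> g) a y = rev_el S S' f a (rev_el S' S'' g (a \<cdot> f) y)"
proof -
  let ?E = "sbun S" and ?F = "sbun S'" and ?G = "sbun S''"
  let ?c = "pbcone X (bq (sbun S)) (sbun S)" and ?d = "pbcone X (bq (sbun S')) (sbun S')"
  note E = self_dual_sys_obj[OF S] and F = self_dual_sys_obj[OF S'] and G = self_dual_sys_obj[OF S'']
  note P = self_lift_product[OF E] and Q = self_lift_product[OF F]
  note dF = Der_arr[OF sys_obj_diff_obj[OF E] sys_obj_diff_obj[OF F] f P] and dG = Der_arr[OF sys_obj_diff_obj[OF F] sys_obj_diff_obj[OF G] g Q]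
  note [simp] = self_dual_simps[OF S] self_dual_simps[OF S'] self_dual_simps[OF S''] product_cone[OF P] product_tup[OF Q] f g ay dF dG
  \<comment> \<open>The chain rule for \<open>Der\<close>, in the form that \<open>dag_comp\<close>
    consumes.\<close>
  have H: "Der ?c ?E ?G (f \<cdot> g) = tup X ?d (fst ?c \<cdot> f) (Der ?c ?E ?F f) \<cdot> Der ?d ?F ?G g"
  proof -
    have "tup X ?d (fst ?c \<cdot> f) (Der ?c ?E ?F f) \<cdot> Der ?d ?F ?G g = nu_el ?F (fst ?c \<cdot> f) (Der ?c ?E ?F f) \<cdot> Tm X g \<cdot> vpart ?G"
      by (rule Der_elem[OF _ _ g Q]) simp_all
    also have "nu_el ?F (fst ?c \<cdot> f) (Der ?c ?E ?F f) = nu_el ?E (fst ?c) (snd ?c) \<cdot> Tm X f"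
      unfolding Der_def by (rule nu_el_Tm[OF _ _ f, symmetric]) simp_all
    finally show ?thesis by (simp add: Der_def)
  qed
  note dg = dD_arr[OF S' S'' g] and Pg = product_tup[OF dD_product[OF S' S'' g]]
  show ?thesis
    using dag_comp(2)[OF bq_to_one[OF F] bq_to_one[OF E] E F G _ _ _ Der_self_lin[OF S S' f] Der_self_lin[OF S' S'' g] H, of a "y \<cdot> du S''"]
    by (simp add: rev_el_def ud_du[OF S'] dg Pg)
qed

section \<open>Products compatible with the dualities\<close>

definition sd_prod :: "'a sdobj \<Rightarrow> 'a sdobj \<Rightarrow> 'a sdobj \<Rightarrow> 'a \<times> 'a \<Rightarrow> 'a \<times> 'a \<Rightarrow> bool" where
  "sd_prod S S' P p i \<longleftrightarrow> self_dual S \<and> self_dual S' \<and> self_dual P \<and> biprod (sbun S) (sbun S') (sbun P) p i \<and>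
     du P \<cdot> fd (sbun S) (sbun P) (fst i) = fst p \<cdot> du S \<and>
     du P \<cdot> fd (sbun S') (sbun P) (snd i) = snd p \<cdot> du S'"

context
  fixes S S' P p i assumes sp: "sd_prod S S' P p i"
begin

lemma sd_prodD: "self_dual S" "self_dual S'" "self_dual P" "biprod (sbun S) (sbun S') (sbun P) p i"
  using sp by (simp_all add: sd_prod_def)

lemmas sd_prod_biprod = biprodD[OF sd_prodD(4)] and sd_prod_star = biprodD[OF biprod_star[OF sd_prodD(4)], simplified]

lemmas sd_prod_simps = self_dual_simps[OF sd_prodD(1)] self_dual_simps[OF sd_prodD(2)] self_dual_simps[OF sd_prodD(3)]
  linear_mapD[OF sd_prod_biprod(4)] linear_mapD[OF sd_prod_biprod(5)] linear_mapD[OF sd_prod_biprod(6)] linear_mapD[OF sd_prod_biprod(7)]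
  linear_mapD[OF sd_prod_star(4)] linear_mapD[OF sd_prod_star(5)] linear_mapD[OF sd_prod_star(6)] linear_mapD[OF sd_prod_star(7)]

lemma inj_proj:
  assumes "x \<in> Arr X"
  shows "Cod X x = obj S \<Longrightarrow> x \<cdot> fst i \<cdot> fst p = x"
    "Cod X x = obj S \<Longrightarrow> x \<cdot> fst i \<cdot> snd p = x \<cdot> bq (sbun S) \<cdot> bz (sbun S')"
    "Cod X x = obj S' \<Longrightarrow> x \<cdot> snd i \<cdot> fst p = x \<cdot> bq (sbun S') \<cdot> bz (sbun S)"
    "Cod X x = obj S' \<Longrightarrow> x \<cdot> snd i \<cdot> snd p = x"
  using assms
  by (simp_all add: sd_prod_simps comp_eq_precomp1[OF sd_prod_biprod(10)] comp_eq_precomp1[OF sd_prod_biprod(11)]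
    comp_eq_precomp1[OF sd_prod_biprod(12)] comp_eq_precomp1[OF sd_prod_biprod(13)])

lemma du_inj:
  assumes "x \<in> Arr X" "Cod X x = obj P"
  shows "x \<cdot> du P \<cdot> fd (sbun S) (sbun P) (fst i) = x \<cdot> fst p \<cdot> du S"
    "x \<cdot> du P \<cdot> fd (sbun S') (sbun P) (snd i) = x \<cdot> snd p \<cdot> du S'"
  using assms by - (rule comp_eq_precomp; simp add: sd_prod_simps sp[unfolded sd_prod_def])+

text \<open>\<open>du_inj\<close> conjugated by the inverse dualities.\<close>

lemma ud_proj:
  assumes "x \<in> Arr X" "Cod X x = U (Star V (sbun P))"
  shows "x \<cdot> ud P \<cdot> fst p = x \<cdot> fd (sbun S) (sbun P) (fst i) \<cdot> ud S"
    "x \<cdot> ud P \<cdot> snd p = x \<cdot> fd (sbun S') (sbun P) (snd i) \<cdot> ud S'"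
proof -
  note [simp] = sd_prod_simps assms
  have "x \<cdot> ud P \<cdot> fst p = x \<cdot> ud P \<cdot> fst p \<cdot> du S \<cdot> ud S" by (simp add: du_ud[OF sd_prodD(1)])
  then show "x \<cdot> ud P \<cdot> fst p = x \<cdot> fd (sbun S) (sbun P) (fst i) \<cdot> ud S"
    using du_inj(1)[of "x \<cdot> ud P"] by (simp add: ud_du[OF sd_prodD(3)])
  have "x \<cdot> ud P \<cdot> snd p = x \<cdot> ud P \<cdot> snd p \<cdot> du S' \<cdot> ud S'" by (simp add: du_ud[OF sd_prodD(2)])
  then show "x \<cdot> ud P \<cdot> snd p = x \<cdot> fd (sbun S') (sbun P) (snd i) \<cdot> ud S'"
    using du_inj(2)[of "x \<cdot> ud P"] by (simp add: ud_du[OF sd_prodD(3)])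
qed

lemma proj_linear_over: "linear_over X (sbun S) (sbun P) (fst i)" "linear_over X (sbun S') (sbun P) (snd i)"
  "linear_over X (sbun P) (sbun S) (fst p)" "linear_over X (sbun P) (sbun S') (snd p)"
  using sd_prodD(4) by (simp_all add: biprod_def fibre_biproduct_def)

text \<open>Under the dualities the dual of a projection is an injection. Both sides are tested
  against the projections of P, which \<open>ud_proj\<close> turns into duals of injections. This is
  the content of RD.3 for projections.\<close>

lemma du_proj:
  assumes "x \<in> Arr X"
  shows "Cod X x = obj S \<Longrightarrow> x \<cdot> du S \<cdot> fd (sbun P) (sbun S) (fst p) \<cdot> ud P = x \<cdot> fst i"
    "Cod X x = obj S' \<Longrightarrow> x \<cdot> du S' \<cdot> fd (sbun P) (sbun S') (snd p) \<cdot> ud P = x \<cdot> snd i"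
proof -
  note [simp] = sd_prod_simps assms
  have c: "y \<cdot> fd (sbun P) (sbun S) (fst p) \<cdot> fd (sbun S) (sbun P) (fst i) = y"
    "y \<cdot> fd (sbun P) (sbun S) (fst p) \<cdot> fd (sbun S') (sbun P) (snd i) = y \<cdot> bq (Star V (sbun S)) \<cdot> bz (Star V (sbun S'))"
    if "y \<in> Arr X" "Cod X y = U (Star V (sbun S))" for y
    using that by (simp_all add: comp_eq_precomp1[OF sd_prod_star(10)] comp_eq_precomp1[OF sd_prod_star(11)])
  have c': "y \<cdot> fd (sbun P) (sbun S') (snd p) \<cdot> fd (sbun S') (sbun P) (snd i) = y"
    "y \<cdot> fd (sbun P) (sbun S') (snd p) \<cdot> fd (sbun S) (sbun P) (fst i) = y \<cdot> bq (Star V (sbun S')) \<cdot> bz (Star V (sbun S))"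
    if "y \<in> Arr X" "Cod X y = U (Star V (sbun S'))" for y
    using that by (simp_all add: comp_eq_precomp1[OF sd_prod_star(13)] comp_eq_precomp1[OF sd_prod_star(12)])
  {
    assume [simp]: "Cod X x = obj S"
    have "x \<cdot> du S \<cdot> bq (Star V (sbun S)) = x \<cdot> bq (sbun S)" by (rule one_eq) simp_all
    then show "x \<cdot> du S \<cdot> fd (sbun P) (sbun S) (fst p) \<cdot> ud P = x \<cdot> fst i"
      by - (rule product_eqI[OF sd_prod_biprod(8)], simp_all add: ud_proj c inj_proj du_ud[OF sd_prodD(1)] linear_map_bz[OF _ _ ud_facts(1)[OF sd_prodD(2)]])
  }
  {
    assume [simp]: "Cod X x = obj S'"
    have "x \<cdot> du S' \<cdot> bq (Star V (sbun S')) = x \<cdot> bq (sbun S')" by (rule one_eq) simp_all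
    then show "x \<cdot> du S' \<cdot> fd (sbun P) (sbun S') (snd p) \<cdot> ud P = x \<cdot> snd i"
      by - (rule product_eqI[OF sd_prod_biprod(8)], simp_all add: ud_proj c' inj_proj du_ud[OF sd_prodD(2)] linear_map_bz[OF _ _ ud_facts(1)[OF sd_prodD(1)]])
  }
qed

lemma rev_el_proj:
  assumes "x \<in> Arr X" "y \<in> Arr X" "Dom X x = Dom X y" "Cod X x = obj P"
  shows "Cod X y = obj S \<Longrightarrow> rev_el P S (fst p) x y = y \<cdot> fst i"
   "Cod X y = obj S' \<Longrightarrow> rev_el P S' (snd p) x y = y \<cdot> snd i"
  using assms rev_el_linear_map[OF sd_prodD(3,1) sd_prod_biprod(4), of x y] rev_el_linear_map[OF sd_prodD(3,2) sd_prod_biprod(5), of x y]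
  by (simp_all add: du_proj)

text \<open>The projections are linear, so the components of the derivative of k are the derivatives
  of its components. \<open>dag_biprod\<close> splits the transpose accordingly, and compatibility
  of the dualities with the product moves the splitting to y.\<close>

lemma rev_el_pair:
  assumes R: "self_dual R" and k: "k \<in> Arr X" "Dom X k = obj R" "Cod X k = obj P"
    and ay: "a \<in> Arr X" "y \<in> Arr X" "Dom X a = Dom X y" "Cod X a = obj R" "Cod X y = obj P"
  shows "rev_el R P k a y = ad (sbun R) (rev_el R S (k \<cdot> fst p) a (y \<cdot> fst p)) (rev_el R S' (k \<cdot> snd p) a (y \<cdot> snd p))"
proof -
  let ?c = "pbcone X (bq (sbun R)) (sbun R)"
  note Q = self_lift_product[OF self_dual_sys_obj[OF R]]
  note [simp] = sd_prod_simps self_dual_simps[OF R] k ay product_cone[OF Q]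
  let ?D = "Der ?c (sbun R) (sbun P) k"
  have n: "nu_el (sbun R) (fst ?c) (snd ?c) \<cdot> Tm X k = nu_el (sbun P) (fst ?c \<cdot> k) ?D"
    unfolding Der_def by (rule nu_el_Tm) simp_all
  have dk [simp]: "?D \<in> Arr X" "Dom X ?D = Dom X (fst ?c)" "Cod X ?D = obj P"
    by (rule Der_arr[OF _ _ k Q]; simp)+
  have "Der ?c (sbun R) (sbun S) (k \<cdot> fst p) = nu_el (sbun P) (fst ?c \<cdot> k) ?D \<cdot> Tm X (fst p) \<cdot> vpart (sbun S)"
    unfolding n[symmetric] by (simp add: Der_def)
  also have "\<dots> = ?D \<cdot> fst p" by (rule nu_el_linear_map_vpart[OF _ _ sd_prod_biprod(4)]) simp_all
  finally have 1: "Der ?c (sbun R) (sbun S) (k \<cdot> fst p) = ?D \<cdot> fst p" .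
  have "Der ?c (sbun R) (sbun S') (k \<cdot> snd p) = nu_el (sbun P) (fst ?c \<cdot> k) ?D \<cdot> Tm X (snd p) \<cdot> vpart (sbun S')"
    unfolding n[symmetric] by (simp add: Der_def)
  also have "\<dots> = ?D \<cdot> snd p" by (rule nu_el_linear_map_vpart[OF _ _ sd_prod_biprod(5)]) simp_all
  finally have 2: "Der ?c (sbun R) (sbun S') (k \<cdot> snd p) = ?D \<cdot> snd p" .
  note kp = rev_el_arr[OF R sd_prodD(1), of "k \<cdot> fst p"] rev_el_arr[OF R sd_prodD(2), of "k \<cdot> snd p"]
  have dags: "tup X (pbcone X (bq (sbun R)) (Star V (sbun S))) a (y \<cdot> fst p \<cdot> du S) \<cdot> dag (bq (sbun R)) (sbun R) (sbun S) (?D \<cdot> fst p) \<in> Arr X"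
    "Dom X (tup X (pbcone X (bq (sbun R)) (Star V (sbun S))) a (y \<cdot> fst p \<cdot> du S) \<cdot> dag (bq (sbun R)) (sbun R) (sbun S) (?D \<cdot> fst p)) = Dom X y"
    "Cod X (tup X (pbcone X (bq (sbun R)) (Star V (sbun S))) a (y \<cdot> fst p \<cdot> du S) \<cdot> dag (bq (sbun R)) (sbun R) (sbun S) (?D \<cdot> fst p)) = U (Star V (sbun R))"
    "tup X (pbcone X (bq (sbun R)) (Star V (sbun S'))) a (y \<cdot> snd p \<cdot> du S') \<cdot> dag (bq (sbun R)) (sbun R) (sbun S') (?D \<cdot> snd p) \<in> Arr X"
    "Dom X (tup X (pbcone X (bq (sbun R)) (Star V (sbun S'))) a (y \<cdot> snd p \<cdot> du S') \<cdot> dag (bq (sbun R)) (sbun R) (sbun S') (?D \<cdot> snd p)) = Dom X y"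
    "Cod X (tup X (pbcone X (bq (sbun R)) (Star V (sbun S'))) a (y \<cdot> snd p \<cdot> du S') \<cdot> dag (bq (sbun R)) (sbun R) (sbun S') (?D \<cdot> snd p)) = U (Star V (sbun R))"
    using dD_arr[OF R sd_prodD(1), of "k \<cdot> fst p"] dD_arr[OF R sd_prodD(2), of "k \<cdot> snd p"]
      product_tup[OF dD_product[OF R sd_prodD(1), of "k \<cdot> fst p"]] product_tup[OF dD_product[OF R sd_prodD(2), of "k \<cdot> snd p"]]
    by (simp_all add: 1 2)
  show ?thesis
    using dag_biprod[OF bq_to_one[OF self_dual_sys_obj[OF R]] self_dual_sys_obj[OF R] sd_prodD(4) Der_self_lin[OF R sd_prodD(3) k], of a "y \<cdot> du P"]
    by (simp add: rev_el_def 1 2 du_inj linear_map_ad[OF _ _ ud_facts(1)[OF R]] dags)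
qed

text \<open>The zero map is linear, and its fibre dual is again zero by the biproduct through which
  it factors.\<close>

lemma rev_el_zero:
  assumes "a \<in> Arr X" "y \<in> Arr X" "Dom X a = Dom X y" "Cod X a = obj S" "Cod X y = obj S'"
  shows "rev_el S S' (bq (sbun S) \<cdot> bz (sbun S')) a y = y \<cdot> bq (sbun S') \<cdot> bz (sbun S)"
proof -
  let ?E = "sbun S" and ?F = "sbun S'"
  note [simp] = sd_prod_simps assms
  have "bq ?E \<cdot> bz ?F \<cdot> bl ?F = bl ?E \<cdot> Tm X (bq ?E) \<cdot> Tm X (bz ?F)"
    using bundle_arr(7)[OF sys_obj_mem[OF sd_prod_biprod(1)]] by (simp add: bl_bz)
  then have l: "linear_map ?E ?F (bq ?E \<cdot> bz ?F)" by (simp add: linear_map_def)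
  have q: "y \<cdot> du S' \<cdot> bq (Star V ?F) = y \<cdot> bq ?F" by (rule one_eq) simp_all
  show ?thesis
    using q by (simp add: rev_el_linear_map[OF sd_prodD(1,2) l] fib_dual_zero[OF sd_prodD(4)] linear_map_bz[OF _ _ ud_facts(1)[OF sd_prodD(1)]])
qed

end

text \<open>\<open>f + g = \<langle>f, g\<rangle> \<sigma>\<close>, and the transpose of \<open>\<sigma>\<close> is the diagonal.\<close>

lemma rev_el_add:
  assumes sp: "sd_prod S' S' P p i" and S: "self_dual S"
    and f: "f \<in> Arr X" "Dom X f = obj S" "Cod X f = obj S'"
    and g: "g \<in> Arr X" "Dom X g = obj S" "Cod X g = obj S'"
    and ay: "a \<in> Arr X" "y \<in> Arr X" "Dom X a = Dom X y" "Cod X a = obj S" "Cod X y = obj S'"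
  shows "rev_el S S' (ad (sbun S') f g) a y = ad (sbun S) (rev_el S S' f a y) (rev_el S S' g a y)"
proof -
  let ?F = "sbun S'" and ?P = "sbun P"
  note B = sd_prod_biprod[OF sp] and B' = sd_prod_star[OF sp] and D = sd_prodD[OF sp]
  define s where "s = ad ?F (fst p) (snd p)"
  define k where "k = tup X p f g"
  note [simp] = sd_prod_simps[OF sp] self_dual_simps[OF S] f g ay product_tup[OF B(8)]
  have s [simp]: "s \<in> Arr X" "Dom X s = U ?P" "Cod X s = U ?F" by (simp_all add: s_def)
  have k [simp]: "k \<in> Arr X" "Dom X k = obj S" "Cod X k = U ?P" "k \<cdot> fst p = f" "k \<cdot> snd p = g"
    by (simp_all add: k_def)
  have ks: "k \<cdot> s = ad ?F f g" by (simp add: s_def)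
  have "s \<cdot> bl ?F = bl ?P \<cdot> Tm X s"
    using B(4,5) by (simp add: s_def bl_ad linear_map_def)
  then have sl: "linear_map ?P ?F s" by (simp add: linear_map_def)
  then have slo: "linear_over X ?P ?F s" by (simp add: linear_over_linear_map)
  have is0: "fst i \<cdot> s = Idn X (U ?F)" "snd i \<cdot> s = Idn X (U ?F)"
    using B(10-13) by (simp_all add: s_def ad_zero)
  define u where "u = rev_el P S' s (a \<cdot> k) y"
  have u: "u = y \<cdot> du S' \<cdot> fd ?P ?F s \<cdot> ud P"
    unfolding u_def by (rule rev_el_linear_map[OF D(3,1) sl]) simp_all
  note fl = linear_mapD[OF fib_dual_linear_map[OF B(3) B(1) sl]]
  have [simp]: "u \<in> Arr X" "Dom X u = Dom X y" "Cod X u = U ?P" using fl by (simp_all add: u)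
  note M = sys_obj_mem[OF B(1)] sys_obj_mem[OF B(3)]
  \<comment> \<open>Each injection followed by s is an identity; dually, the dual of s followed by
    the dual of either injection is an identity, so the dual of s is a diagonal.\<close>
  have c: "w \<cdot> fd ?P ?F s \<cdot> fd ?F ?P (fst i) = w" "w \<cdot> fd ?P ?F s \<cdot> fd ?F ?P (snd i) = w"
    if w: "w \<in> Arr X" "Cod X w = U (Star V ?F)" for w
  proof -
    have "fd ?P ?F s \<cdot> fd ?F ?P (fst i) = Idn X (U (Star V ?F))"
      "fd ?P ?F s \<cdot> fd ?F ?P (snd i) = Idn X (U (Star V ?F))"
      using fib_dual_comp[OF M(1,2,1) proj_linear_over(1)[OF sp] slo] fib_dual_comp[OF M(1,2,1) proj_linear_over(2)[OF sp] slo]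
        fib_dual_Idn[OF M(1)] is0 by simp_all
    then show "w \<cdot> fd ?P ?F s \<cdot> fd ?F ?P (fst i) = w" "w \<cdot> fd ?P ?F s \<cdot> fd ?F ?P (snd i) = w"
      using w fl comp_eq_precomp1[of "fd ?P ?F s" "fd ?F ?P (fst i)" _ w]
        comp_eq_precomp1[of "fd ?P ?F s" "fd ?F ?P (snd i)" _ w] by simp_all
  qed
  have u0: "u \<cdot> fst p = y" "u \<cdot> snd p = y"
    using fl by (simp_all add: u ud_proj[OF sp] c du_ud[OF D(1)])
  have "rev_el S S' (ad ?F f g) a y = rev_el S P k a u"
    using rev_el_comp[OF S D(3) D(1) k(1-3) s ay] by (simp add: ks u_def)
  also have "\<dots> = ad (sbun S) (rev_el S S' f a y) (rev_el S S' g a y)"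
    using rev_el_pair[OF sp S k(1-3), of a u] by (simp add: u0)
  finally show ?thesis .
qed

text \<open>The reverse derivative \<open>r\<close> of \<open>f\<close> is its own partial derivative in the second argument, so that transposing this partial
  derivative recovers the derivative of \<open>f\<close>.\<close>

lemma rev_el_rev_el:
  assumes sp: "sd_prod S S' P p i"
    and f: "f \<in> Arr X" "Dom X f = obj S" "Cod X f = obj S'"
    and r: "r = rev_el S S' f (fst p) (snd p)"
    and av: "a \<in> Arr X" "v \<in> Arr X" "Dom X a = Dom X v" "Cod X a = obj S" "Cod X v = obj S"
  shows "rev_el P S r (tup X p a (a \<cdot> bq (sbun S) \<cdot> bz (sbun S'))) v \<cdot> snd p = nu_el (sbun S) a v \<cdot> Tm X f \<cdot> vpart (sbun S')"
proof -
  let ?E = "sbun S" and ?F = "sbun S'" and ?P = "sbun P"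
  note B = sd_prod_biprod[OF sp] and D = sd_prodD[OF sp]
  note tE = bq_to_one[OF B(1)] and tP = bq_to_one[OF B(3)]
  let ?cE = "pbcone X (bq ?E) ?E" and ?cP = "pbcone X (bq ?P) ?P" and ?cF = "pbcone X (bq ?E) ?F"
  note [simp] = sd_prod_simps[OF sp] f av product_tup[OF B(8)] product_comp_tup[OF B(8)] B(9)
    product_cone[OF lift_product[OF tE B(2)]] product_tup[OF lift_product[OF tE B(2)]] product_comp_tup[OF lift_product[OF tE B(2)]]
    product_cone[OF self_lift_product[OF B(3)]] product_tup[OF self_lift_product[OF B(3)]]
    product_comp_tup[OF self_lift_product[OF B(3)]]
    product_tup[OF self_lift_product[OF B(1)]]
  have ra [simp]: "r \<in> Arr X" "Dom X r = U ?P" "Cod X r = U ?E"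
    using rev_el_arr[OF D(1,2) f, of "fst p" "snd p"] by (simp_all add: r)
  have rl: "lin p ?F ?E r" unfolding r by (rule rev_el_lin[OF D(1,2) f B(8)])
  \<comment> \<open>This sends a to (a, 0), the point at which the forward derivative evaluates the
    second reverse derivative.\<close>
  define s where "s = tup X p (Idn X (U ?E)) (bq ?E \<cdot> bz ?F)"
  have s [simp]: "s \<in> Arr X" "Dom X s = U ?E" "Cod X s = U ?P"
    "\<And>x. x \<in> Arr X \<Longrightarrow> Cod X x = U ?E \<Longrightarrow> x \<cdot> s = tup X p x (x \<cdot> bq ?E \<cdot> bz ?F)"
    by (simp_all add: s_def)
  let ?h = "Der ?cP ?P ?E r" and ?e = "snd ?cF \<cdot> snd i"
  note hl = Der_self_lin[OF D(3,1) ra]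
  note el = linear_map_lin[OF sys_obj_diff_obj[OF B(2)] sys_obj_diff_obj[OF B(3)] B(7) lift_product[OF tE B(2)]]
  \<comment> \<open>The partial derivative of r in its second argument at (a, 0), as a map linear in
    the direction.\<close>
  define H where "H = tup X ?cP (fst ?cF \<cdot> s) ?e \<cdot> ?h"
  note [simp] = Der_arr[OF sys_obj_diff_obj[OF B(3)] sys_obj_diff_obj[OF B(1)] ra self_lift_product[OF B(3)]]
  \<comment> \<open>The transpose of the derivative of f conjugated by the dualities, that is, r on
    the pullback cone.\<close>
  define H' where "H' = tup X (pbcone X (bq ?E) (Star V ?F)) (fst ?cF) (snd ?cF \<cdot> du S')
       \<cdot> dag (bq ?E) ?E ?F (Der ?cE ?E ?F f) \<cdot> ud S"
  have HH': "H = H'"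
  proof -
    have i1: "snd ?cF \<cdot> snd i = tup X p (fst ?cF \<cdot> bq ?E \<cdot> bz ?E) (snd ?cF)"
    proof (rule product_eqI[OF B(8)])
      have "snd ?cF \<cdot> bq ?F = fst ?cF \<cdot> bq ?E" by (rule one_eq) simp_all
      then show "snd ?cF \<cdot> snd i \<cdot> fst p = tup X p (fst ?cF \<cdot> bq ?E \<cdot> bz ?E) (snd ?cF) \<cdot> fst p"
        by (simp add: inj_proj[OF sp])
    qed (simp_all add: inj_proj[OF sp])
    have "H = nu_el ?P (fst ?cF \<cdot> s) ?e \<cdot> Tm X r \<cdot> vpart ?E"
      unfolding H_def by (rule Der_elem[OF _ _ ra self_lift_product[OF B(3)]]) simp_all
    also have "\<dots> = nu_el ?P (tup X p (fst ?cF) (fst ?cF \<cdot> bq ?E \<cdot> bz ?F)) (tup X p (fst ?cF \<cdot> bq ?E \<cdot> bz ?E) (snd ?cF)) \<cdot> Tm X r \<cdot> vpart ?E"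
      by (simp add: i1)
    also have "\<dots> = tup X p (fst ?cF) (snd ?cF) \<cdot> r"
      by (rule lin_nu_el_vpart[OF _ _ _ _ B(8,9,4,5) rl]) simp_all
    also have "\<dots> = rev_el S S' f (fst ?cF) (snd ?cF)"
      unfolding r using comp_rev_el[OF D(1,2) f, of "tup X p (fst ?cF) (snd ?cF)" "snd p" "fst p"] by simp
    finally show ?thesis by (simp add: rev_el_def H'_def)
  qed
  \<comment> \<open>Transposing H is transposing the derivative of f a second time, which returns
    it.\<close>
  have tt: "tup X (pbcone X (bq ?E) (Star V ?E)) a (v \<cdot> du S) \<cdot> dag (bq ?E) ?F ?E H \<cdot> ud S'
     = tup X ?cE a v \<cdot> Der ?cE ?E ?F f"
    unfolding HH' by (rule self_dual_transpose(2)[OF tE D(1,2) Der_self_lin[OF D(1,2) f] H'_def]) simp_all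
  \<comment> \<open>The same transpose by \<open>dag_comp\<close>: the full transpose of the
    derivative of r, followed by the dual of the second injection, which the dualities will turn
    into the second projection.\<close>
  have "tup X (pbcone X (bq ?E) (Star V ?E)) a (v \<cdot> du S) \<cdot> dag (bq ?E) ?F ?E H
     = tup X (pbcone X (bq ?E) (Star V ?P)) a (tup X (pbcone X (bq ?P) (Star V ?E)) (a \<cdot> s) (v \<cdot> du S) \<cdot> dag (bq ?P) ?P ?E ?h) \<cdot> dag (bq ?E) ?F ?P ?e"
    by (rule dag_comp(2)[OF tP tE B(2) B(3) B(1) _ _ _ el hl H_def]) simp_all
  also have "\<dots> = tup X (pbcone X (bq ?P) (Star V ?E)) (a \<cdot> s) (v \<cdot> du S) \<cdot> dag (bq ?P) ?P ?E ?h \<cdot> fd ?F ?P (snd i)"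
    using dD_arr[OF D(3,1) ra] product_tup[OF dD_product[OF D(3,1) ra]]
    by - (rule dag_linear_map[OF tE B(2) B(3) B(7)], simp_all)
  finally have "tup X (pbcone X (bq ?P) (Star V ?E)) (a \<cdot> s) (v \<cdot> du S) \<cdot> dag (bq ?P) ?P ?E ?h \<cdot> fd ?F ?P (snd i) \<cdot> ud S'
     = tup X ?cE a v \<cdot> Der ?cE ?E ?F f" using tt by simp
  moreover have "tup X ?cE a v \<cdot> Der ?cE ?E ?F f = nu_el ?E a v \<cdot> Tm X f \<cdot> vpart ?F"
    by (rule Der_elem[OF _ _ f self_lift_product[OF B(1)]]) simp_all
  ultimately show ?thesis
    using ud_proj(2)[OF sp, of "tup X (pbcone X (bq ?P) (Star V ?E)) (a \<cdot> s) (v \<cdot> du S) \<cdot> dag (bq ?P) ?P ?E ?h"]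
      dD_arr[OF D(3,1) ra] product_tup[OF dD_product[OF D(3,1) ra]]
    by (simp add: rev_el_def)
qed

section \<open>The cotangent isomorphism\<close>

text \<open>Every factor of the isomorphism has a known inverse, so the \<open>inv_arr\<close> in
  \<open>cotangent_pullback_iso\<close> can be replaced by an explicit composite.\<close>

lemma cotangent_iso_inverse:
  assumes S: "self_dual S" and d: "is_product X (obj S) (obj S) (xcone pr S S)"
  shows "inverse_pair X (cotangent_iso X V pr S)
    (tup X (pbcone X (bq (sbun S)) (Star V (sbun S))) (fst (xcone pr S S)) (snd (xcone pr S S) \<cdot> du S) \<cdot> lift_dual (bq (sbun S)) (sbun S)
     \<cdot> fd (tangent_bundle X (obj S)) (pullback_bundle X (bq (sbun S)) (sbun S))
         (tup X (pbcone X (bq (sbun S)) (sbun S)) (tp X (obj S)) (vpart (sbun S))))"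
    "cotangent_iso X V pr S \<cdot> snd (xcone pr S S) =
       fd (pullback_bundle X (bq (sbun S)) (sbun S)) (tangent_bundle X (obj S)) (nu X (sbun S))
        \<cdot> dual_pullback X V (bq (sbun S)) (sbun S) \<cdot> snd (pbcone X (bq (sbun S)) (Star V (sbun S))) \<cdot> ud S"
proof -
  let ?E = "sbun S" and ?t = "bq (sbun S)" and ?T = "tangent_bundle X (obj S)"
  let ?U = "pullback_bundle X (bq (sbun S)) (sbun S)" and ?d = "xcone pr S S" and ?c = "pbcone X (bq (sbun S)) (Star V (sbun S))"
  note E = self_dual_sys_obj[OF S] and t = bq_to_one[OF self_dual_sys_obj[OF S]]
  note TD = tangent_bundle_mem[OF diff_obj_obj[OF sys_obj_diff_obj[OF E]]] and UD = lift_mem(1)[OF t E]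
  note nl = nu_linear[OF sys_obj_diff_obj[OF E] refl] and nil = nu_inverse_linear[OF sys_obj_diff_obj[OF E] refl]
    and ni = nu_inverse_nu[OF sys_obj_diff_obj[OF E] refl]
  let ?\<Phi> = "fd ?U ?T (nu X ?E)" and ?ni = "tup X (pbcone X ?t ?E) (tp X (Dom X ?t)) (vpart ?E)"
  let ?\<Psi> = "fd ?T ?U ?ni"
  note fa = fib_dual_arr[OF UD TD nl] and ga = fib_dual_arr[OF TD UD nil]
  have 1: "?\<Phi> \<cdot> ?\<Psi> = Idn X (U (Star V ?T))"
    using fib_dual_comp[OF TD UD TD nil nl] fib_dual_Idn[OF TD] ni(1) by (simp add: diff_obj_obj[OF sys_obj_diff_obj[OF E]])
  have 2: "?\<Psi> \<cdot> ?\<Phi> = Idn X (U (Star V ?U))"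
    using fib_dual_comp[OF UD TD UD nl nil] fib_dual_Idn[OF UD] ni(2) by simp
  note [simp] = self_dual_simps[OF S] fa ga lift_dual_arr(1-3)[OF t E] dual_pullback_arr(1-3)[OF t E] product_simps[OF d]
    product_cone[OF star_lift_product[OF t E]] product_tup[OF star_lift_product[OF t E]] product_comp_tup[OF star_lift_product[OF t E]]
    product_obj[OF d] product_obj[OF star_lift_product[OF t E]] bundle_arr(5)[OF star_mem[OF TD]]
  define k where "k = tup X ?d (fst ?c) (snd ?c \<cdot> ud S)"
  define k' where "k' = tup X ?c (fst ?d) (snd ?d \<cdot> du S)"
  have k [simp]: "k \<in> Arr X" "Dom X k = Dom X (fst ?c)" "Cod X k = Dom X (fst ?d)"
     "k' \<in> Arr X" "Dom X k' = Dom X (fst ?d)" "Cod X k' = Dom X (fst ?c)" by (simp_all add: k_def k'_def)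
  have lift_dual': "k \<cdot> k' = Idn X (Dom X (fst ?c))" "k' \<cdot> k = Idn X (Dom X (fst ?d))"
    by (simp_all add: k_def k'_def ud_du[OF S] du_ud[OF S] product_tup_id[OF star_lift_product[OF t E]])
  have co: "cotangent_iso X V pr S = ?\<Phi> \<cdot> dual_pullback X V ?t ?E \<cdot> k"
    by (simp add: cotangent_iso_def Let_def k_def tot_def)
  then show "cotangent_iso X V pr S \<cdot> snd ?d = ?\<Phi> \<cdot> dual_pullback X V ?t ?E \<cdot> snd ?c \<cdot> ud S"
    using assoc[of "?\<Phi> \<cdot> dual_pullback X V ?t ?E" k "snd ?d"] by (simp del: assoc) (simp add: k_def)
  have i1: "(?\<Phi> \<cdot> dual_pullback X V ?t ?E \<cdot> k) \<cdot> (k' \<cdot> lift_dual ?t ?E \<cdot> ?\<Psi>) = Idn X (U (Star V ?T))"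
  proof -
    have "(?\<Phi> \<cdot> dual_pullback X V ?t ?E \<cdot> k) \<cdot> (k' \<cdot> lift_dual ?t ?E \<cdot> ?\<Psi>) = ?\<Phi> \<cdot> dual_pullback X V ?t ?E \<cdot> (k \<cdot> k') \<cdot> lift_dual ?t ?E \<cdot> ?\<Psi>" by simp
    also have "\<dots> = ?\<Phi> \<cdot> (dual_pullback X V ?t ?E \<cdot> lift_dual ?t ?E) \<cdot> ?\<Psi>" unfolding lift_dual'(1) by simp
    also have "\<dots> = ?\<Phi> \<cdot> ?\<Psi>" unfolding dual_pullback_arr(5)[OF t E] by simp
    finally show ?thesis by (simp only: 1)
  qed
  have i2: "(k' \<cdot> lift_dual ?t ?E \<cdot> ?\<Psi>) \<cdot> (?\<Phi> \<cdot> dual_pullback X V ?t ?E \<cdot> k) = Idn X (Dom X (fst ?d))"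
  proof -
    have "(k' \<cdot> lift_dual ?t ?E \<cdot> ?\<Psi>) \<cdot> (?\<Phi> \<cdot> dual_pullback X V ?t ?E \<cdot> k) = k' \<cdot> lift_dual ?t ?E \<cdot> (?\<Psi> \<cdot> ?\<Phi>) \<cdot> dual_pullback X V ?t ?E \<cdot> k" by simp
    also have "\<dots> = k' \<cdot> (lift_dual ?t ?E \<cdot> dual_pullback X V ?t ?E) \<cdot> k" unfolding 2 by simp
    also have "\<dots> = k' \<cdot> k" unfolding dual_pullback_arr(4)[OF t E] by simp
    finally show ?thesis by (simp only: lift_dual')
  qed
  have "inverse_pair X (?\<Phi> \<cdot> dual_pullback X V ?t ?E \<cdot> k) (k' \<cdot> lift_dual ?t ?E \<cdot> ?\<Psi>)"
    unfolding inverse_pair_def using i1 i2 by (simp del: assoc)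
  then show "inverse_pair X (cotangent_iso X V pr S) (tup X ?c (fst ?d) (snd ?d \<cdot> du S) \<cdot> lift_dual ?t ?E \<cdot> ?\<Psi>)"
    unfolding co k'_def .
qed

text \<open>The duals in the definition of R merge by functoriality: those of the inverse of \<nu>
  on B, of T(f) and of \<nu> on A combine to the dual of \<nu> T(f) followed by the vector part,
  which is the derivative. What remains is its transpose between the dualities.\<close>

lemma rev_deriv_rev_el:
  assumes S: "self_dual S" and S': "self_dual S'" and f: "f \<in> Arr X" "Dom X f = obj S" "Cod X f = obj S'"
    and c: "is_product X (obj S) (obj S') (xcone pr S S')"
    and d: "is_product X (obj S) (obj S) (xcone pr S S)"
    and d': "is_product X (obj S') (obj S') (xcone pr S' S')"
  shows "sarr (rev_deriv X V pr \<lparr>sdom = S, scod = S', sarr = f\<rparr>) = rev_el S S' f (fst (xcone pr S S')) (snd (xcone pr S S'))"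
proof -
  let ?E = "sbun S" and ?F = "sbun S'" and ?c = "xcone pr S S'" and ?d = "xcone pr S S" and ?d' = "xcone pr S' S'"
  let ?A = "obj S" and ?B = "obj S'"
  let ?TA = "tangent_bundle X (obj S)" and ?TB = "tangent_bundle X (obj S')"
  let ?UE = "pullback_bundle X (bq ?E) ?E" and ?UF = "pullback_bundle X (bq ?F) ?F"
  note E = self_dual_sys_obj[OF S] and F = self_dual_sys_obj[OF S']
  note tE = bq_to_one[OF E] and tF = bq_to_one[OF F]
  note TAD = tangent_bundle_mem[OF diff_obj_obj[OF sys_obj_diff_obj[OF E]]] and TBD = tangent_bundle_mem[OF diff_obj_obj[OF sys_obj_diff_obj[OF F]]]
    and UED = lift_mem(1)[OF tE E] and UFD = lift_mem(1)[OF tF F]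
  let ?ni = "tup X (pbcone X (bq ?F) ?F) (tp X ?B) (vpart ?F)"
  note nl = nu_linear[OF sys_obj_diff_obj[OF E] refl] and nil = nu_inverse_linear[OF sys_obj_diff_obj[OF F] refl]
  let ?\<Phi> = "fd ?UE ?TA (nu X ?E)" and ?\<Psi> = "fd ?TB ?UF ?ni"
  note fa = fib_dual_arr[OF UED TAD nl] and ga = fib_dual_arr[OF TBD UFD nil]
  note Tf = linear_morphism_T[OF f(1), unfolded f(2,3)]
  note cF = star_lift_product[OF tF F] and cEF = star_lift_product[OF tE F]
  note [simp] = self_dual_simps[OF S] self_dual_simps[OF S'] f fa ga product_cone[OF c] product_cone[OF d] product_cone[OF d']
    product_tup[OF d'] product_comp_tup[OF d'] product_cone[OF cF] product_tup[OF cF] product_comp_tup[OF cF]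
    product_cone[OF cEF] product_tup[OF cEF]
    lift_dual_arr(1-3)[OF tE E] lift_dual_arr(1-3)[OF tF F] dual_pullback_arr(1-3)[OF tE E] linear_mapD
  let ?a = "fst ?c" and ?w = "snd ?c \<cdot> du S'"
  let ?kw = "tup X (pbcone X (bq ?F) (Star V ?F)) (?a \<cdot> f) ?w \<cdot> lift_dual (bq ?F) ?F"
  have kwb: "?kw \<cdot> bq (Star V ?UF) = ?a \<cdot> f"
  proof -
    have "tup X (pbcone X (bq ?F) (Star V ?F)) (?a \<cdot> f) ?w \<cdot> (lift_dual (bq ?F) ?F \<cdot> bq (Star V ?UF)) = ?a \<cdot> f"
      unfolding lift_dual_arr(4)[OF tF F] by simp
    then show ?thesis using bundle_arr(1)[OF star_mem[OF UFD]] by simp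
  qed
  have psib: "?kw \<cdot> ?\<Psi> \<cdot> bq (Star V ?TB) = ?a \<cdot> f"
    using comp_eq_precomp1[OF fib_dual_bq[OF TBD UFD nil], of ?kw] bundle_arr(1)[OF star_mem[OF TBD]] kwb by simp
  \<comment> \<open>The element of the cotangent bundle of B over a f that corresponds to the second
    component of the product cone.\<close>
  define z where "z = ?kw \<cdot> ?\<Psi>"
  have z [simp]: "z \<in> Arr X" "Dom X z = Dom X (fst ?c)" "Cod X z = U (Star V ?TB)"
    by (simp_all add: z_def)
  have pq: "?a \<cdot> f = z \<cdot> bq (Star V ?TB)" unfolding z_def by (rule psib[symmetric])
  let ?x = "tup X (pbcone X f (Star V ?TB)) ?a z \<cdot> star_map ?TA ?TB f (Tm X f)"
  have xx: "?x \<in> Arr X" "Dom X ?x = Dom X z" "Cod X ?x = U (Star V ?TA)" "?x \<cdot> bq (Star V ?TA) = ?a"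
    by (rule star_el_arr[OF TAD TBD Tf _ _ _ _ _ pq]; simp)+
  define x where "x = ?x"
  have x [simp]: "x \<in> Arr X" "Dom X x = Dom X (fst ?c)" "Cod X x = U (Star V ?TA)" "x \<cdot> bq (Star V ?TA) = ?a"
    using xx by (simp_all only: x_def z)
  have inv: "inv_arr X (cotangent_iso X V pr S') = tup X (pbcone X (bq ?F) (Star V ?F)) (fst ?d') (snd ?d' \<cdot> du S') \<cdot> lift_dual (bq ?F) ?F \<cdot> ?\<Psi>"
    by (rule inv_arr_eq[OF cotangent_iso_inverse(1)[OF S' d']])
  have cpi: "cotangent_pullback_iso X V pr \<lparr>sdom = S, scod = S', sarr = f\<rparr> = tup X (pbcone X f (Star V ?TB)) ?a z"
    by (simp add: cotangent_pullback_iso_def Let_def stot_def tot_def cotangent_bundle_def inv z_def)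
  have cm: "cotangent_map X V f = star_map ?TA ?TB f (Tm X f)"
    by (simp add: cotangent_map_def star_map_def)
  let ?D = "Der (pbcone X (bq ?E) ?E) ?E ?F f"
  note Dl = Der_self_lin[OF S S' f]
  have e1: "x \<cdot> ?\<Phi>
     = tup X (pbcone X (bq ?E) (Star V ?F)) ?a ?w \<cdot> star_map ?UE ?F (bq ?E) ?D"
  proof -
    have iA: "Cod X (bq ?TA) = ?A" and iB: "Cod X (bq ?UF) = ?B" and iC: "Cod X (bq ?TB) = ?B"
      using product_cone[OF lift_product[OF tF F]] by simp_all
    have oA [simp]: "?A \<in> Obj X" "?B \<in> Obj X" by simp_all
    note vA = vert_linear(1)[OF UED TAD nl, unfolded iA]
      and vB = vert_linear(1)[OF TBD UFD nil, unfolded iB]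
    note cl = lift_linear[OF tF F]
    have q1: "?a \<cdot> f \<cdot> bq ?F = ?w \<cdot> bq (Star V ?F)" by (rule one_eq) simp_all
    have b: "Cod X (bq ?F) = one X" by simp
    \<comment> \<open>z is the dual of the vector part on B, evaluated at the base point a
      f.\<close>
    have s1: "z = tup X (pbcone X (bq ?F) (Star V ?F)) (?a \<cdot> f) ?w \<cdot> star_map ?TB ?F (bq ?F) (?ni \<cdot> snd (pbcone X (bq ?F) ?F))"
    proof -
      have "tup X (pbcone X (Idn X ?B \<cdot> bq ?F) (Star V ?F)) (?a \<cdot> f) ?w \<cdot> star_map ?TB ?F (Idn X ?B \<cdot> bq ?F) (?ni \<cdot> snd (pbcone X (bq ?F) ?F))
        = tup X (pbcone X (Idn X ?B) (Star V ?UF)) (?a \<cdot> f) (tup X (pbcone X (bq ?F) (Star V ?F)) (?a \<cdot> f \<cdot> Idn X ?B) ?w \<cdot> lift_dual (bq ?F) ?F) \<cdot> star_map ?TB ?UF (Idn X ?B) ?ni"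
        unfolding lift_dual_def[OF tF F]
        by (rule star_el_comp[OF TBD UFD sys_obj_mem[OF F] vB cl]) (use q1 in simp_all)
      then show ?thesis using fib_dual_elem[OF TBD UFD nil, of ?kw] kwb iB by (simp add: z_def)
    qed
    let ?g = "?ni \<cdot> snd (pbcone X (bq ?F) ?F)"
    have g: "?g = vpart ?F" using product_tup[OF lift_product[OF tF F]] by simp
    note lg = linear_morphism_comp[OF TBD UFD sys_obj_mem[OF F] vB cl]
    then have lg: "linear_morphism X ?TB ?F (bq ?F) ?g" by simp
    have tf: "f \<cdot> bq ?F = bq ?E" by (rule one_eq) simp_all
    have q2: "?a \<cdot> bq ?E = ?w \<cdot> bq (Star V ?F)" by (rule one_eq) simp_all
    \<comment> \<open>After the dual of T(f), x is the dual of T(f) followed by the vector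
      part.\<close>
    have s2: "x = tup X (pbcone X (bq ?E) (Star V ?F)) ?a ?w \<cdot> star_map ?TA ?F (bq ?E) (Tm X f \<cdot> ?g)"
      using star_el_comp[OF TAD TBD sys_obj_mem[OF F] Tf lg, of ?a ?w] q1 by (simp add: tf s1[symmetric] x_def)
    note lTg = linear_morphism_comp[OF TAD TBD sys_obj_mem[OF F] Tf lg, unfolded tf]
    \<comment> \<open>\<nu> followed by that composite is the derivative, so one more use of
      functoriality, over the identity of A, completes the merging.\<close>
    have D: "?D = nu X ?E \<cdot> (Tm X f \<cdot> ?g)"
      using product_cone[OF lift_product[OF tE E]] unfolding g by (simp add: Der_def nu_nu_el)
    have "tup X (pbcone X (Idn X ?A \<cdot> bq ?E) (Star V ?F)) ?a ?w \<cdot> star_map ?UE ?F (Idn X ?A \<cdot> bq ?E) (nu X ?E \<cdot> (Tm X f \<cdot> ?g))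
      = tup X (pbcone X (Idn X ?A) (Star V ?TA)) ?a (tup X (pbcone X (bq ?E) (Star V ?F)) (?a \<cdot> Idn X ?A) ?w \<cdot> star_map ?TA ?F (bq ?E) (Tm X f \<cdot> ?g)) \<cdot> star_map ?UE ?TA (Idn X ?A) (nu X ?E)"
      by (rule star_el_comp[OF UED TAD sys_obj_mem[OF F] vA lTg]) (use q2 in simp_all)
    also have "\<dots> = tup X (pbcone X (Idn X ?A) (Star V ?TA)) (x \<cdot> bq (Star V ?TA)) x \<cdot> star_map ?UE ?TA (Idn X ?A) (nu X ?E)"
      by (simp add: s2[symmetric])
    also have "\<dots> = x \<cdot> ?\<Phi>"
      using fib_dual_elem[OF UED TAD nl, of x] unfolding iA by simp
    finally show ?thesis unfolding D by simp
  qed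
  let ?y = "tup X (pbcone X (bq ?E) (Star V ?F)) ?a ?w \<cdot> dag (bq ?E) ?E ?F ?D"
  have e2: "tup X (pbcone X (bq ?E) (Star V ?F)) ?a ?w \<cdot> star_map ?UE ?F (bq ?E) ?D = tup X (pbcone X (bq ?E) (Star V ?E)) ?a ?y \<cdot> lift_dual (bq ?E) ?E"
    by (rule dag_lift_dual[OF tE E F Dl]) simp_all
  note da = dD_arr[OF S S' f]
  note cE = star_lift_product[OF tE E]
  have ty: "tup X (pbcone X (bq ?E) (Star V ?E)) ?a ?y \<in> Arr X" "Dom X (tup X (pbcone X (bq ?E) (Star V ?E)) ?a ?y) = Dom X (fst ?c)"
    "Cod X (tup X (pbcone X (bq ?E) (Star V ?E)) ?a ?y) = Dom X (fst (pbcone X (bq ?E) (Star V ?E)))"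
    "tup X (pbcone X (bq ?E) (Star V ?E)) ?a ?y \<cdot> snd (pbcone X (bq ?E) (Star V ?E)) = ?y"
    using da by (simp_all add: product_tup[OF cE])
  have coa: "cotangent_iso X V pr S \<in> Arr X" "Dom X (cotangent_iso X V pr S) = U (Star V ?TA)" "Cod X (cotangent_iso X V pr S) = Dom X (fst ?d)"
    using product_tup[OF d] product_cone[OF cE] by (simp_all add: cotangent_iso_def Let_def tot_def)
  have "sarr (rev_deriv X V pr \<lparr>sdom = S, scod = S', sarr = f\<rparr>)
     = x \<cdot> cotangent_iso X V pr S \<cdot> snd ?d"
    unfolding x_def by (simp add: rev_deriv_def cpi cm)
  also have "\<dots> = x \<cdot> (cotangent_iso X V pr S \<cdot> snd ?d)"
    using coa by simp
  also have "\<dots> = (x \<cdot> ?\<Phi>) \<cdot> dual_pullback X V (bq ?E) ?E \<cdot> snd (pbcone X (bq ?E) (Star V ?E)) \<cdot> ud S"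
    unfolding cotangent_iso_inverse(2)[OF S d] using product_cone[OF cE] by simp
  also have "\<dots> = tup X (pbcone X (bq ?E) (Star V ?E)) ?a ?y \<cdot> (lift_dual (bq ?E) ?E \<cdot> dual_pullback X V (bq ?E) ?E) \<cdot> snd (pbcone X (bq ?E) (Star V ?E)) \<cdot> ud S"
    unfolding e1 e2 using ty product_cone[OF cE] by simp
  also have "\<dots> = ?y \<cdot> ud S"
    unfolding dual_pullback_arr(4)[OF tE E] using ty by simp
  finally show ?thesis by (simp add: rev_el_def)
qed

section \<open>Existence of products\<close>

lemma self_dualI:
  assumes E: "sys_obj E" and u: "linear_map E (Star V E) u" and v: "linear_map (Star V E) E v"
    and uv: "u \<cdot> v = Idn X (U E)" "v \<cdot> u = Idn X (U (Star V E))"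
    and sym: "iota_map E \<cdot> fd E (Star V E) u = u"
  shows "self_dual \<lparr>sbun = E, sdual = u\<rparr>"
proof -
  note M = sys_obj_mem[OF E] star_mem[OF sys_obj_mem[OF E]]
  note d = sys_obj_diff_obj[OF E] sys_obj_star_diff_obj[OF E]
  note [simp] = d diff_obj_simps[OF d(1)] diff_obj_simps[OF d(2)] M
  have lu: "linear_morphism X E (Star V E) (Idn X (one X)) u" and lv: "linear_morphism X (Star V E) E (Idn X (one X)) v"
    using u v linear_over_linear_map[OF d] linear_over_linear_map[OF d(2,1)] by (simp_all add: linear_over_alt)
  have "inverse_pair (DBun X \<D>) (vert X E (Star V E) u) (vert X (Star V E) E v)"
    using lu lv uv by (simp add: inverse_pair_def DBun_def vert_def bas_def tot_def)
  then have "is_iso (DBun X \<D>) (vert X E (Star V E) u)" unfolding is_iso_def by blast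
  then show ?thesis
    using lu sym by (simp add: self_dual_def linear_self_duality_def symmetric_duality_def DBun_def vert_def bas_def)
qed

text \<open>T(1) is terminal, so the tangent bundle of 1 is a zero object of its fibre; preservation
  of the empty biproduct makes the dual terminal too. All conditions then hold by uniqueness of
  arrows.\<close>

lemma terminal_self_dual: "\<exists>I. self_dual I \<and> is_terminal X (obj I)"
proof -
  let ?Z = "tangent_bundle X (one X)"
  have Z: "sys_obj ?Z" using tangent_bundle_mem[OF one_obj] by (simp add: sys_obj_def)
  note d = sys_obj_diff_obj[OF Z] sys_obj_star_diff_obj[OF Z]
  note t0 = T_terminal[OF one_terminal]
  have "inverse_pair X (bq ?Z) (tz X (one X))"
    using terminal_arr_eq[OF t0, of "tp X (one X) \<cdot> tz X (one X)" "Idn X (To X (one X))"]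
      terminal_arr_eq[OF one_terminal, of "tz X (one X) \<cdot> tp X (one X)" "Idn X (one X)"] by (simp add: inverse_pair_def)
  then have "fibre_zero X \<D> ?Z" using Z by (auto simp: fibre_zero_def is_iso_def sys_obj_def)
  then have "fibre_zero X \<D> (Star V ?Z)"
    using crtc by (simp add: cartesian_reverse_tangent_category_def preserves_biproducts_def)
  then obtain k where k: "inverse_pair X (bq (Star V ?Z)) k" by (auto simp: fibre_zero_def is_iso_def)
  note [simp] = d diff_obj_simps[OF d(2)] diff_obj_simps[OF d(1), simplified]
  have k' [simp]: "k \<in> Arr X" "Dom X k = one X" "Cod X k = U (Star V ?Z)"
    and kid: "bq (Star V ?Z) \<cdot> k = Idn X (U (Star V ?Z))"
    using k by (simp_all add: inverse_pair_def)
  let ?B = "U (Star V ?Z)"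
  have tB: "is_terminal X ?B"
    unfolding is_terminal_def
  proof (intro conjI ballI)
    fix A assume "A \<in> Obj X"
    then obtain u where u: "u \<in> Hom X A (one X)" using one_terminal unfolding is_terminal_def by blast
    show "\<exists>!f. f \<in> Hom X A ?B"
    proof (intro ex1I[of _ "u \<cdot> k"])
      show "u \<cdot> k \<in> Hom X A ?B" using u by simp
      fix f assume f: "f \<in> Hom X A ?B"
      have "f = f \<cdot> (bq (Star V ?Z) \<cdot> k)" unfolding kid using f by simp
      also have "\<dots> = f \<cdot> bq (Star V ?Z) \<cdot> k" using f by simp
      also have "f \<cdot> bq (Star V ?Z) = u" by (rule one_eq) (use u f in simp_all)
      finally show "f = u \<cdot> k" .
    qed
  qed simp
  let ?u = "tp X (one X) \<cdot> k" and ?v = "bq (Star V ?Z) \<cdot> tz X (one X)"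
  have "self_dual \<lparr>sbun = ?Z, sdual = ?u\<rparr>"
  proof (rule self_dualI[OF Z])
    show "linear_map ?Z (Star V ?Z) ?u"
      using terminal_arr_eq[OF T_terminal[OF tB], of "?u \<cdot> bl (Star V ?Z)" "bl ?Z \<cdot> Tm X ?u"] by (simp add: linear_map_def)
    then have ul: "linear_map ?Z (Star V ?Z) ?u" .
    show "linear_map (Star V ?Z) ?Z ?v"
      using terminal_arr_eq[OF T_terminal[OF t0], of "?v \<cdot> bl ?Z" "bl (Star V ?Z) \<cdot> Tm X ?v"] by (simp add: linear_map_def)
    show "?u \<cdot> ?v = Idn X (U ?Z)" by (rule terminal_arr_eq[OF t0]) simp_all
    show "?v \<cdot> ?u = Idn X ?B" by (rule terminal_arr_eq[OF tB]) simp_all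
    show "iota_map ?Z \<cdot> fd ?Z (Star V ?Z) ?u = ?u"
      using linear_mapD[OF iota_map_linear_map[OF Z]] linear_mapD[OF fib_dual_linear_map[OF Z sys_obj_star[OF Z] ul]]
      by - (rule terminal_arr_eq[OF tB], simp_all)
  qed
  then show ?thesis using t0 by (intro exI[of _ "\<lparr>sbun = ?Z, sdual = ?u\<rparr>"]) simp
qed

text \<open>The system is closed under product bundles, but the product of two bundles over 1 lies
  over 1 x 1. Pulling it back along the diagonal brings it to the fibre over 1 and changes the total
  space only by a terminal factor.\<close>

lemma biprod_exists:
  assumes E: "sys_obj E" and F: "sys_obj F"
  shows "\<exists>P p i. biprod E F P p i"
proof -
  note d = sys_obj_diff_obj[OF E] sys_obj_diff_obj[OF F]
  let ?A = "U E" and ?B = "U F"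
  note [simp] = d diff_obj_simps[OF d(1)] diff_obj_simps[OF d(2)]
  define c where "c = prd X ?A ?B"
  define b where "b = prd X (one X) (one X)"
  have c: "is_product X ?A ?B c" unfolding c_def by (rule prd_product) simp_all
  have b: "is_product X (one X) (one X) b" unfolding b_def by (rule prd_product) simp_all
  note [simp] = product_cone[OF c] product_tup[OF c] T_product_tup[OF c] product_cone[OF b] product_tup[OF b] product_obj[OF b]
  have tb: "is_terminal X (Dom X (fst b))"
    unfolding is_terminal_def
  proof (intro conjI ballI)
    fix Y assume "Y \<in> Obj X"
    then obtain u where u: "u \<in> Hom X Y (one X)" using one_terminal unfolding is_terminal_def by blast
    show "\<exists>!f. f \<in> Hom X Y (Dom X (fst b))"
    proof (intro ex1I[of _ "tup X b u u"])
      show "tup X b u u \<in> Hom X Y (Dom X (fst b))" using u by simp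
      fix f assume f: "f \<in> Hom X Y (Dom X (fst b))"
      show "f = tup X b u u"
        by (rule product_eqI[OF b]) (use u f in \<open>simp_all add: one_eq\<close>)
    qed
  qed simp
  define G where "G = product_bundle X E F"
  have G: "G \<in> \<D>" using crtc sys_obj_mem[OF E] sys_obj_mem[OF F]
    unfolding G_def cartesian_reverse_tangent_category_def by blast
  have Gq: "bq G = tup X b (fst c \<cdot> bq E) (snd c \<cdot> bq F)"
    and Gl: "bl G = tup X (Tcone X c) (fst c \<cdot> bl E) (snd c \<cdot> bl F)"
    by (simp_all add: G_def product_bundle_def Let_def tot_def bas_def c_def b_def)
  \<comment> \<open>The diagonal of 1, along which the product bundle is pulled back.\<close>
  define \<delta> where "\<delta> = tup X b (Idn X (one X)) (Idn X (one X))"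
  have \<delta> [simp]: "\<delta> \<in> Arr X" "Dom X \<delta> = one X" "Cod X \<delta> = Dom X (fst b)" by (simp_all add: \<delta>_def)
  have Gb: "Cod X (bq G) = Dom X (fst b)" "U G = Dom X (fst c)" "bq G \<in> Arr X" by (simp_all add: Gq)
  define Q where "Q = pullback_bundle X \<delta> G"
  define e where "e = pbcone X \<delta> G"
  have Q: "Q \<in> \<D>" unfolding Q_def by (rule pullback_bundle_mem[OF G]) (simp_all add: Gb)
  have "is_pullback X \<delta> (bq G) e" unfolding e_def by (rule pbcone_pullback[OF G]) (simp_all add: Gb)
  from pullback_over_terminal[OF this] tb have e: "is_product X (one X) (Dom X (fst c)) e" by (simp add: Gb)
  note [simp] = product_cone[OF e] product_tup[OF e] T_product_tup[OF e] T_product_comp_tup[OF c]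
  have Qq: "bq Q = fst e" and Ql: "bl Q = tup X (Tcone X e) (fst e \<cdot> tz X (one X)) (snd e \<cdot> bl G)"
    by (simp_all add: Q_def e_def)
  have Qo: "sys_obj Q" using Q by (simp add: sys_obj_def Qq)
  note dQ = sys_obj_diff_obj[OF Qo]
  note [simp] = dQ diff_obj_simps[OF dQ, unfolded Qq]
  \<comment> \<open>The total space of Q is a product of 1 with A x B; \<open>snd e\<close> drops
    the terminal factor.\<close>
  define p where "p = (snd e \<cdot> fst c, snd e \<cdot> snd c)"
  have p [simp]: "fst p = snd e \<cdot> fst c" "snd p = snd e \<cdot> snd c" by (simp_all add: p_def)
  have P: "is_product X ?A ?B p"
  proof (rule is_productI)
    fix x y assume xy: "x \<in> Arr X" "y \<in> Arr X" "Dom X x = Dom X y" "Cod X x = ?A" "Cod X y = ?B"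
    then show "\<exists>h\<in>Arr X. Dom X h = Dom X y \<and> Cod X h = Dom X (fst p) \<and> h \<cdot> fst p = x \<and> h \<cdot> snd p = y"
      by (intro bexI[of _ "tup X e (x \<cdot> bq E) (tup X c x y)"]) simp_all
  next
    fix h k assume hk: "h \<in> Arr X" "k \<in> Arr X" "Dom X h = Dom X k" "Cod X h = Dom X (fst p)" "Cod X k = Dom X (fst p)"
      "h \<cdot> fst p = k \<cdot> fst p" "h \<cdot> snd p = k \<cdot> snd p"
    have "h \<cdot> snd e = k \<cdot> snd e" by (rule product_eqI[OF c]) (use hk in simp_all)
    moreover have "h \<cdot> fst e = k \<cdot> fst e" by (rule one_eq) (use hk in simp_all)
    ultimately show "h = k" using hk by - (rule product_eqI[OF e], simp_all)
  qed simp_all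
  have l0: "linear_map Q E (fst p)" and l1: "linear_map Q F (snd p)"
    by (simp_all add: linear_map_def Qq Ql Gl)
  note Pt = product_tup[OF P, simplified]
  have z: "bq E \<cdot> bz F \<cdot> bl F = bl E \<cdot> Tm X (bq E) \<cdot> Tm X (bz F)" "bq F \<cdot> bz E \<cdot> bl E = bl F \<cdot> Tm X (bq F) \<cdot> Tm X (bz E)"
    using bundle_arr(7)[OF sys_obj_mem[OF E]] bundle_arr(7)[OF sys_obj_mem[OF F]] by (simp_all add: bl_bz)
  define i where "i = (tup X p (Idn X ?A) (bq E \<cdot> bz F), tup X p (bq F \<cdot> bz E) (Idn X ?B))"
  note TPt = T_product_tup[OF P]
  have Dp: "Dom X (fst p) = Dom X (fst e)" by simp
  have ia: "fst i \<in> Arr X" "Dom X (fst i) = ?A" "Cod X (fst i) = U Q" "snd i \<in> Arr X" "Dom X (snd i) = ?B" "Cod X (snd i) = U Q"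
    "fst i \<cdot> fst p = Idn X ?A" "fst i \<cdot> snd p = bq E \<cdot> bz F" "snd i \<cdot> fst p = bq F \<cdot> bz E" "snd i \<cdot> snd p = Idn X ?B"
    using product_tup[OF P, of "Idn X ?A" "bq E \<cdot> bz F"] product_tup[OF P, of "bq F \<cdot> bz E" "Idn X ?B"]
    by (simp_all add: i_def Qq Dp del: p)
  have Tp: "Tm X (fst i) \<cdot> Tm X (fst p) = Idn X (To X ?A)" "Tm X (fst i) \<cdot> Tm X (snd p) = Tm X (bq E) \<cdot> Tm X (bz F)"
    "Tm X (snd i) \<cdot> Tm X (fst p) = Tm X (bq F) \<cdot> Tm X (bz E)" "Tm X (snd i) \<cdot> Tm X (snd p) = Idn X (To X ?B)"
    using arg_cong[OF ia(7), of "Tm X"] arg_cong[OF ia(8), of "Tm X"] arg_cong[OF ia(9), of "Tm X"] arg_cong[OF ia(10), of "Tm X"] ia(1-6) linear_mapD[OF l0] linear_mapD[OF l1]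
    by (simp_all del: p)
  note L = linear_mapD[OF l0] linear_mapD[OF l1]
  note dQs = dQ diff_obj_simps[OF dQ]
  have i0: "linear_map E Q (fst i)"
  proof -
    have "fst i \<cdot> bl Q = bl E \<cdot> Tm X (fst i)"
    proof (rule T_product_eqI[OF P])
      show "fst i \<cdot> bl Q \<cdot> Tm X (fst p) = bl E \<cdot> Tm X (fst i) \<cdot> Tm X (fst p)"
        using linear_map_bl[OF dQ d(1) l0, of "fst i"] comp_eq_precomp1[OF Tp(1), of "bl E"] ia L dQs by (simp del: p)
      show "fst i \<cdot> bl Q \<cdot> Tm X (snd p) = bl E \<cdot> Tm X (fst i) \<cdot> Tm X (snd p)"
        using linear_map_bl[OF dQ d(2) l1, of "fst i"] comp_eq_precomp1[OF Tp(2), of "bl E"] ia L dQs z by (simp del: p)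
    qed (use ia L dQs in \<open>simp_all del: p\<close>)
    then show ?thesis using ia by (simp add: linear_map_def)
  qed
  have i1: "linear_map F Q (snd i)"
  proof -
    have "snd i \<cdot> bl Q = bl F \<cdot> Tm X (snd i)"
    proof (rule T_product_eqI[OF P])
      show "snd i \<cdot> bl Q \<cdot> Tm X (snd p) = bl F \<cdot> Tm X (snd i) \<cdot> Tm X (snd p)"
        using linear_map_bl[OF dQ d(2) l1, of "snd i"] comp_eq_precomp1[OF Tp(4), of "bl F"] ia L dQs by (simp del: p)
      show "snd i \<cdot> bl Q \<cdot> Tm X (fst p) = bl F \<cdot> Tm X (snd i) \<cdot> Tm X (fst p)"
        using linear_map_bl[OF dQ d(1) l0, of "snd i"] comp_eq_precomp1[OF Tp(3), of "bl F"] ia L dQs z by (simp del: p)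
    qed (use ia L dQs in \<open>simp_all del: p\<close>)
    then show ?thesis using ia by (simp add: linear_map_def)
  qed
  have "is_pullback X (bq E) (bq F) p" by (rule product_is_pullback[OF P one_terminal]) simp_all
  then have "fibre_biproduct X \<D> E F Q p i"
    using Q sys_obj_mem[OF E] sys_obj_mem[OF F] i0 i1 l0 l1 ia(7-10)
    unfolding fibre_biproduct_def tot_def by (simp add: linear_over_linear_map d dQ del: p)
  then have "biprod E F Q p i" by (simp add: biprod_def)
  then show ?thesis by blast
qed

text \<open>The product duality is determined by its composites with the duals of the injections,
  which are the projections of the dual biproduct; its inverse is built likewise from the inverse
  dualities. The remaining task is to show that this duality is symmetric.\<close>

lemma sd_prod_exists:
  assumes S: "self_dual S" and S': "self_dual S'"
  shows "\<exists>P p i. sd_prod S S' P p i"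
proof -
  let ?E = "sbun S" and ?F = "sbun S'"
  note E = self_dual_sys_obj[OF S] and F = self_dual_sys_obj[OF S']
  obtain Q p i where b: "biprod ?E ?F Q p i" using biprod_exists[OF E F] by blast
  note B = biprodD[OF b] and B' = biprodD[OF biprod_star[OF b], simplified]
  note dQ = sys_obj_diff_obj[OF B(3)] sys_obj_star_diff_obj[OF B(3)]
  let ?i0 = "fd ?E Q (fst i)" and ?i1 = "fd ?F Q (snd i)" and ?p0 = "fd Q ?E (fst p)" and ?p1 = "fd Q ?F (snd p)"
  let ?ps = "(fd ?E Q (fst i), fd ?F Q (snd i))"
  note [simp] = self_dual_simps[OF S] self_dual_simps[OF S'] dQ diff_obj_simps[OF dQ(1)] diff_obj_simps[OF dQ(2)]
    linear_mapD[OF B(4)] linear_mapD[OF B(5)] linear_mapD[OF B(6)] linear_mapD[OF B(7)]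
    linear_mapD[OF B'(4)] linear_mapD[OF B'(5)] linear_mapD[OF B'(6)] linear_mapD[OF B'(7)]
  note [simp] = product_tup[OF B(8)] product_tup[OF B'(8), simplified] T_product_tup[OF B(8)] T_product_tup[OF B'(8), simplified]
  define u where "u = tup X ?ps (fst p \<cdot> du S) (snd p \<cdot> du S')"
  define v where "v = tup X p (?i0 \<cdot> ud S) (?i1 \<cdot> ud S')"
  have u [simp]: "u \<in> Arr X" "Dom X u = U Q" "Cod X u = U (Star V Q)"
    "u \<cdot> ?i0 = fst p \<cdot> du S" "u \<cdot> ?i1 = snd p \<cdot> du S'" by (simp_all add: u_def)
  have v [simp]: "v \<in> Arr X" "Dom X v = U (Star V Q)" "Cod X v = U Q"
    "v \<cdot> fst p = ?i0 \<cdot> ud S" "v \<cdot> snd p = ?i1 \<cdot> ud S'" by (simp_all add: v_def)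
  have uv: "u \<cdot> v = Idn X (U Q)"
  proof (rule product_eqI[OF B(8)])
    have "u \<cdot> (v \<cdot> fst p) = fst p" by (simp only: v) (simp add: du_ud[OF S])
    then show "u \<cdot> v \<cdot> fst p = Idn X (U Q) \<cdot> fst p" by (simp del: v(4,5))
    have "u \<cdot> (v \<cdot> snd p) = snd p" by (simp only: v) (simp add: du_ud[OF S'])
    then show "u \<cdot> v \<cdot> snd p = Idn X (U Q) \<cdot> snd p" by (simp del: v(4,5))
  qed simp_all
  have vu: "v \<cdot> u = Idn X (U (Star V Q))"
  proof (rule product_eqI[OF B'(8)])
    have "v \<cdot> (u \<cdot> ?i0) = ?i0" by (simp only: u) (simp add: ud_du[OF S])
    then show "v \<cdot> u \<cdot> fst ?ps = Idn X (U (Star V Q)) \<cdot> fst ?ps" by (simp del: u(4,5))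
    have "v \<cdot> (u \<cdot> ?i1) = ?i1" by (simp only: u) (simp add: ud_du[OF S'])
    then show "v \<cdot> u \<cdot> snd ?ps = Idn X (U (Star V Q)) \<cdot> snd ?ps" by (simp del: u(4,5))
  qed simp_all
  have Tu: "Tm X u \<cdot> Tm X ?i0 = Tm X (fst p) \<cdot> Tm X (du S)" "Tm X u \<cdot> Tm X ?i1 = Tm X (snd p) \<cdot> Tm X (du S')"
    using arg_cong[OF u(4), of "Tm X"] arg_cong[OF u(5), of "Tm X"] by (simp_all del: u(4,5))
  have Tv: "Tm X v \<cdot> Tm X (fst p) = Tm X ?i0 \<cdot> Tm X (ud S)" "Tm X v \<cdot> Tm X (snd p) = Tm X ?i1 \<cdot> Tm X (ud S')"
    using arg_cong[OF v(4), of "Tm X"] arg_cong[OF v(5), of "Tm X"] by (simp_all del: v(4,5))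
  have eqs: "fst p \<cdot> bl ?E = bl Q \<cdot> Tm X (fst p)" "snd p \<cdot> bl ?F = bl Q \<cdot> Tm X (snd p)"
    "?i0 \<cdot> bl (Star V ?E) = bl (Star V Q) \<cdot> Tm X ?i0" "?i1 \<cdot> bl (Star V ?F) = bl (Star V Q) \<cdot> Tm X ?i1"
    using B(4,5) B'(4,5) by (simp_all add: linear_map_def)
  have "u \<cdot> bl (Star V Q) = bl Q \<cdot> Tm X u"
  proof (rule T_product_eqI[OF B'(8)])
    have "u \<cdot> bl (Star V Q) \<cdot> Tm X ?i0 = bl Q \<cdot> (Tm X u \<cdot> Tm X ?i0)"
      unfolding Tu using linear_map_bl[OF dQ(2) _ B'(4), of u] linear_map_bl[OF _ _ du_linear_map[OF S], of "fst p"] by (simp add: eqs)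
    then show "u \<cdot> bl (Star V Q) \<cdot> Tm X (fst ?ps) = bl Q \<cdot> Tm X u \<cdot> Tm X (fst ?ps)" by simp
    have "u \<cdot> bl (Star V Q) \<cdot> Tm X ?i1 = bl Q \<cdot> (Tm X u \<cdot> Tm X ?i1)"
      unfolding Tu using linear_map_bl[OF dQ(2) _ B'(5), of u] linear_map_bl[OF _ _ du_linear_map[OF S'], of "snd p"] by (simp add: eqs)
    then show "u \<cdot> bl (Star V Q) \<cdot> Tm X (snd ?ps) = bl Q \<cdot> Tm X u \<cdot> Tm X (snd ?ps)" by simp
  qed simp_all
  then have ul: "linear_map Q (Star V Q) u" by (simp add: linear_map_def)
  have "v \<cdot> bl Q = bl (Star V Q) \<cdot> Tm X v"
  proof (rule T_product_eqI[OF B(8)])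
    have "v \<cdot> bl Q \<cdot> Tm X (fst p) = bl (Star V Q) \<cdot> (Tm X v \<cdot> Tm X (fst p))"
      unfolding Tv using linear_map_bl[OF dQ(1) _ B(4), of v] linear_map_bl[OF _ _ ud_facts(1)[OF S], of ?i0] by (simp add: eqs)
    then show "v \<cdot> bl Q \<cdot> Tm X (fst p) = bl (Star V Q) \<cdot> Tm X v \<cdot> Tm X (fst p)" by simp
    have "v \<cdot> bl Q \<cdot> Tm X (snd p) = bl (Star V Q) \<cdot> (Tm X v \<cdot> Tm X (snd p))"
      unfolding Tv using linear_map_bl[OF dQ(1) _ B(5), of v] linear_map_bl[OF _ _ ud_facts(1)[OF S'], of ?i1] by (simp add: eqs)
    then show "v \<cdot> bl Q \<cdot> Tm X (snd p) = bl (Star V Q) \<cdot> Tm X v \<cdot> Tm X (snd p)" by simp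
  qed simp_all
  then have vl: "linear_map (Star V Q) Q v" by (simp add: linear_map_def)
  \<comment> \<open>On the first summand the product duality is the duality of S followed by the
    dual of the first projection; symmetry is reduced to this equation and its companion.\<close>
  have i0u: "fst i \<cdot> u = du S \<cdot> ?p0"
  proof (rule product_eqI[OF B'(8)])
    have "du S \<cdot> bq (Star V ?E) = bq ?E" by (rule one_eq) simp_all
    then have "du S \<cdot> (?p0 \<cdot> ?i1) = bq ?E \<cdot> bz (Star V ?F)" unfolding B'(11) by simp
    moreover have "fst i \<cdot> (u \<cdot> ?i1) = bq ?E \<cdot> bz (Star V ?F)"
      unfolding u using B(11) linear_map_bz[OF _ _ du_linear_map[OF S'], of "bq ?E"] by simp
    ultimately show "fst i \<cdot> u \<cdot> snd ?ps = du S \<cdot> ?p0 \<cdot> snd ?ps" by (simp del: u(4,5))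
    have "du S \<cdot> (?p0 \<cdot> ?i0) = du S" unfolding B'(10) by simp
    moreover have "fst i \<cdot> (u \<cdot> ?i0) = du S" unfolding u using B(10) by simp
    ultimately show "fst i \<cdot> u \<cdot> fst ?ps = du S \<cdot> ?p0 \<cdot> fst ?ps" by (simp del: u(4,5))
  qed simp_all
  have i1u: "snd i \<cdot> u = du S' \<cdot> ?p1"
  proof (rule product_eqI[OF B'(8)])
    have "du S' \<cdot> bq (Star V ?F) = bq ?F" by (rule one_eq) simp_all
    then have "du S' \<cdot> (?p1 \<cdot> ?i0) = bq ?F \<cdot> bz (Star V ?E)" unfolding B'(12) by simp
    moreover have "snd i \<cdot> (u \<cdot> ?i0) = bq ?F \<cdot> bz (Star V ?E)"
      unfolding u using B(12) linear_map_bz[OF _ _ du_linear_map[OF S], of "bq ?F"] by simp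
    ultimately show "snd i \<cdot> u \<cdot> fst ?ps = du S' \<cdot> ?p1 \<cdot> fst ?ps" by (simp del: u(4,5))
    have "du S' \<cdot> (?p1 \<cdot> ?i1) = du S'" unfolding B'(13) by simp
    moreover have "snd i \<cdot> (u \<cdot> ?i1) = du S'" unfolding u using B(13) by simp
    ultimately show "snd i \<cdot> u \<cdot> snd ?ps = du S' \<cdot> ?p1 \<cdot> snd ?ps" by (simp del: u(4,5))
  qed simp_all
  have QS: "sys_obj (Star V Q)" by (rule sys_obj_star[OF B(3)])
  have over: "linear_over X K L g" if "linear_map K L g" "sys_obj K" "sys_obj L" for K L g
    using that by (simp add: linear_over_linear_map sys_obj_diff_obj)
  note fu = fib_dual_linear_map[OF B(3) QS ul] and ioQ = iota_map_linear_map[OF B(3)]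
  note [simp] = linear_mapD[OF fu] linear_mapD[OF ioQ] linear_mapD[OF iota_map_linear_map[OF E]] linear_mapD[OF iota_map_linear_map[OF F]]
    linear_mapD[OF fib_dual_linear_map[OF E sys_obj_star[OF E] du_linear_map[OF S]]] linear_mapD[OF fib_dual_linear_map[OF F sys_obj_star[OF F] du_linear_map[OF S']]]
    linear_mapD[OF fib_dual_linear_map[OF sys_obj_star[OF E] QS B'(6)]] linear_mapD[OF fib_dual_linear_map[OF sys_obj_star[OF F] QS B'(7)]]
  note M = sys_obj_mem[OF E] sys_obj_mem[OF F] sys_obj_mem[OF B(3)] sys_obj_mem[OF QS] sys_obj_mem[OF sys_obj_star[OF E]] sys_obj_mem[OF sys_obj_star[OF F]]
  \<comment> \<open>Tested against each projection of the dual: \<open>i0u\<close> and functoriality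
    rewrite the dual of u, naturality of \<iota> at the projection of Q replaces \<iota> on Q by
    \<iota> on the factor, and symmetry of the given dualities concludes.\<close>
  have sym: "iota_map Q \<cdot> fd Q (Star V Q) u = u"
  proof (rule product_eqI[OF B'(8)])
    have "fd Q (Star V Q) u \<cdot> ?i0 = fd ?E (Star V Q) (du S \<cdot> ?p0)"
      using fib_dual_comp[OF M(1,3,4) over[OF B(6) E B(3)] over[OF ul B(3) QS]] i0u by simp
    also have "\<dots> = fd (Star V ?E) (Star V Q) ?p0 \<cdot> fd ?E (Star V ?E) (du S)"
      by (rule fib_dual_comp[OF M(1,5,4) over[OF du_linear_map[OF S] E sys_obj_star[OF E]] over[OF B'(6) sys_obj_star[OF E] QS]])
    finally have "iota_map Q \<cdot> (fd Q (Star V Q) u \<cdot> ?i0) = (iota_map Q \<cdot> fd (Star V ?E) (Star V Q) ?p0) \<cdot> fd ?E (Star V ?E) (du S)" by simp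
    also have "\<dots> = fst p \<cdot> (iota_map ?E \<cdot> fd ?E (Star V ?E) (du S))"
      unfolding iota_map_natural[OF B(3) E B(4), symmetric] by simp
    also have "\<dots> = u \<cdot> ?i0" unfolding iota_map_fib_du[OF S] by simp
    finally show "iota_map Q \<cdot> fd Q (Star V Q) u \<cdot> fst ?ps = u \<cdot> fst ?ps" by (simp del: u(4,5))
    have "fd Q (Star V Q) u \<cdot> ?i1 = fd ?F (Star V Q) (du S' \<cdot> ?p1)"
      using fib_dual_comp[OF M(2,3,4) over[OF B(7) F B(3)] over[OF ul B(3) QS]] i1u by simp
    also have "\<dots> = fd (Star V ?F) (Star V Q) ?p1 \<cdot> fd ?F (Star V ?F) (du S')"
      by (rule fib_dual_comp[OF M(2,6,4) over[OF du_linear_map[OF S'] F sys_obj_star[OF F]] over[OF B'(7) sys_obj_star[OF F] QS]])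
    finally have "iota_map Q \<cdot> (fd Q (Star V Q) u \<cdot> ?i1) = (iota_map Q \<cdot> fd (Star V ?F) (Star V Q) ?p1) \<cdot> fd ?F (Star V ?F) (du S')" by simp
    also have "\<dots> = snd p \<cdot> (iota_map ?F \<cdot> fd ?F (Star V ?F) (du S'))"
      unfolding iota_map_natural[OF B(3) F B(5), symmetric] by simp
    also have "\<dots> = u \<cdot> ?i1" unfolding iota_map_fib_du[OF S'] by simp
    finally show "iota_map Q \<cdot> fd Q (Star V Q) u \<cdot> snd ?ps = u \<cdot> snd ?ps" by (simp del: u(4,5))
  qed simp_all
  have "self_dual \<lparr>sbun = Q, sdual = u\<rparr>" by (rule self_dualI[OF B(3) ul vl uv vu sym])
  then have "sd_prod S S' \<lparr>sbun = Q, sdual = u\<rparr> p i" using S S' b by (simp add: sd_prod_def)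
  then show ?thesis by blast
qed

end

section \<open>The reverse differential structure\<close>

abbreviation sd_mor :: "'a sdobj \<Rightarrow> 'a sdobj \<Rightarrow> 'a \<Rightarrow> 'a sdmor" where
  "sd_mor S S' f \<equiv> \<lparr>sdom = S, scod = S', sarr = f\<rparr>"

context rev_ctx
begin

abbreviation DO :: "('a sdobj, 'a sdmor) cat" where "DO \<equiv> DOsd X \<D> V"

lemma DO_sel [simp]:
  "S \<in> Obj DO \<longleftrightarrow> self_dual S"
  "m \<in> Arr DO \<longleftrightarrow> self_dual (sdom m) \<and> self_dual (scod m) \<and> sarr m \<in> Arr X \<and> Dom X (sarr m) = obj (sdom m) \<and> Cod X (sarr m) = obj (scod m)"
  "Dom DO = sdom" "Cod DO = scod"
  "m \<cdot>\<^bsub>DO\<^esub> n = sd_mor (sdom m) (scod n) (sarr m \<cdot> sarr n)"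
  "Idn DO S = sd_mor S S (Idn X (obj S))"
  by (auto simp: DOsd_def self_dual_def stot_def tot_def)

lemma sd_add_mor: "sd_add X (sd_mor A B f) (sd_mor A B g) = sd_mor A B (ad (sbun B) f g)"
  by (simp add: sd_add_def madd_def)

lemma Hom_DO:
  assumes "m \<in> Hom DO A B"
  obtains f where "m = sd_mor A B f" "f \<in> Arr X" "Dom X f = obj A" "Cod X f = obj B"
  using assms by (intro that[of "sarr m"]) auto

lemma self_dual_obj: "self_dual S \<Longrightarrow> obj S \<in> Obj X"
  using diff_obj_obj[OF sys_obj_diff_obj[OF self_dual_sys_obj]] .

lemma category_DO: "category DO"
  unfolding category_def by (auto simp: self_dual_obj)

text \<open>Unpacks a product cone into arrows of X, the form in which the results on
  \<open>sd_prod\<close> apply.\<close>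

lemma sd_product_iff:
  assumes "self_dual S" "self_dual S'"
  shows "sd_product X \<D> V S S' c \<longleftrightarrow> (\<exists>P p i. sd_prod S S' P p i \<and> c = (sd_mor P S (fst p), sd_mor P S' (snd p)))"
proof
  assume "sd_product X \<D> V S S' c"
  then obtain P i where P: "self_dual P" "fst c \<in> Hom DO P S" "snd c \<in> Hom DO P S'"
    and i: "fibre_biproduct X \<D> (sbun S) (sbun S') (sbun P) (sarr (fst c), sarr (snd c)) i"
      "sdual P \<cdot> fd (sbun S) (sbun P) (fst i) = sarr (fst c) \<cdot> sdual S"
      "sdual P \<cdot> fd (sbun S') (sbun P) (snd i) = sarr (snd c) \<cdot> sdual S'"
    unfolding sd_product_def by auto
  let ?p = "(sarr (fst c), sarr (snd c))"
  have "sd_prod S S' P ?p i"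
    using assms P(1) i self_dual_sys_obj[OF assms(1)] by (simp add: sd_prod_def biprod_def sys_obj_def)
  moreover have "c = (sd_mor P S (fst ?p), sd_mor P S' (snd ?p))"
    using P(2,3) by (auto simp: prod_eq_iff)
  ultimately show "\<exists>P p i. sd_prod S S' P p i \<and> c = (sd_mor P S (fst p), sd_mor P S' (snd p))" by blast
next
  assume "\<exists>P p i. sd_prod S S' P p i \<and> c = (sd_mor P S (fst p), sd_mor P S' (snd p))"
  then obtain P p i where P: "sd_prod S S' P p i" and c: "c = (sd_mor P S (fst p), sd_mor P S' (snd p))" by blast
  have "fibre_biproduct X \<D> (sbun S) (sbun S') (sbun P) p i"
    using sd_prodD(4)[OF P] by (simp add: biprod_def)
  moreover have "fst c \<in> Hom DO P S" "snd c \<in> Hom DO P S'"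
    using sd_prodD(1-3)[OF P] by (simp_all add: c sd_prod_simps[OF P])
  ultimately show "sd_product X \<D> V S S' c"
    using P unfolding sd_product_def sd_prod_def
    by (intro bexI[of _ P] conjI exI[of _ i]) (simp_all add: c)
qed

text \<open>Every arrow of X between total spaces is a map here, so terminality is inherited from
  the total space.\<close>

lemma terminal_DO: "\<lbrakk>self_dual I; is_terminal X (obj I)\<rbrakk> \<Longrightarrow> is_terminal DO I"
  unfolding is_terminal_def[of DO]
proof (intro conjI ballI)
  fix A assume I: "self_dual I" "is_terminal X (obj I)" and "A \<in> Obj DO"
  then have A: "self_dual A" by simp
  obtain u where u: "u \<in> Hom X (obj A) (obj I)"
    using I(2) self_dual_obj[OF A] unfolding is_terminal_def by blast
  show "\<exists>!f. f \<in> Hom DO A I"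
  proof (intro ex1I[of _ "sd_mor A I u"])
    show "sd_mor A I u \<in> Hom DO A I" using u I A by simp
    fix m assume "m \<in> Hom DO A I"
    then obtain f where "m = sd_mor A I f" "f \<in> Arr X" "Dom X f = obj A" "Cod X f = obj I" by (rule Hom_DO)
    then show "m = sd_mor A I u" using terminal_arr_eq[OF I(2), of f u] u by simp
  qed
qed simp

lemma product_structure_exists: "\<exists>I pr. sd_product_structure X \<D> V I pr"
proof -
  obtain I where I: "self_dual I" "is_terminal X (obj I)" using terminal_self_dual by blast
  have "\<exists>c. sd_product X \<D> V S S' c" if "self_dual S" "self_dual S'" for S S'
    using sd_prod_exists[OF that] sd_product_iff[OF that] by blast
  then have "sd_product X \<D> V S S' (SOME c. sd_product X \<D> V S S' c)" if "self_dual S" "self_dual S'" for S S'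
    using that by (meson someI_ex)
  then have "sd_product_structure X \<D> V I (\<lambda>S S'. SOME c. sd_product X \<D> V S S' c)"
    unfolding sd_product_structure_def using terminal_DO[OF I] by simp
  then show ?thesis by blast
qed

end

section \<open>An arbitrary product structure on the self-dual objects\<close>

locale sd_ctx = rev_ctx X \<D> V for X :: "('o, 'a, 'm) tangent_cat_scheme" (structure) and \<D> V +
  fixes I :: "'a sdobj" and pr :: "'a sdobj \<Rightarrow> 'a sdobj \<Rightarrow> 'a sdmor \<times> 'a sdmor"
  assumes ps: "sd_product_structure X \<D> V I pr"
begin

definition Pr :: "'a sdobj \<Rightarrow> 'a sdobj \<Rightarrow> 'a sdobj" where "Pr S S' = sdom (fst (pr S S'))"
abbreviation pc :: "'a sdobj \<Rightarrow> 'a sdobj \<Rightarrow> 'a \<times> 'a" where "pc S S' \<equiv> xcone pr S S'"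

lemma I_self_dual: "self_dual I" and I_terminal: "is_terminal DO I"
  using ps by (simp_all add: sd_product_structure_def is_terminal_def)

context
  fixes S S' assumes S: "self_dual S" and S': "self_dual S'"
begin

lemma Pr_sd_prod: "\<exists>i. sd_prod S S' (Pr S S') (pc S S') i"
  and pr_mor: "pr S S' = (sd_mor (Pr S S') S (fst (pc S S')), sd_mor (Pr S S') S' (snd (pc S S')))"
proof -
  have "sd_product X \<D> V S S' (pr S S')" using ps S S' by (simp add: sd_product_structure_def)
  then obtain P p i where *: "sd_prod S S' P p i" "pr S S' = (sd_mor P S (fst p), sd_mor P S' (snd p))"
    using sd_product_iff[OF S S'] by blast
  have "Pr S S' = P" "pc S S' = p" by (simp_all add: Pr_def xcone_def *(2))
  then show "\<exists>i. sd_prod S S' (Pr S S') (pc S S') i"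
    "pr S S' = (sd_mor (Pr S S') S (fst (pc S S')), sd_mor (Pr S S') S' (snd (pc S S')))"
    using * by blast+
qed

definition injs :: "'a \<times> 'a" where "injs = (SOME i. sd_prod S S' (Pr S S') (pc S S') i)"

lemma injs_sd_prod: "sd_prod S S' (Pr S S') (pc S S') injs"
  unfolding injs_def by (rule someI_ex[OF Pr_sd_prod])

lemmas Pr_self_dual = sd_prodD(3)[OF injs_sd_prod]
  and pc_biprod = sd_prod_biprod[OF injs_sd_prod]

lemma pc_product: "is_product X (obj S) (obj S') (pc S S')" and Dom_pc: "Dom X (fst (pc S S')) = obj (Pr S S')"
  using pc_biprod(8,9) .

lemma pc_arr: "fst (pc S S') \<in> Arr X" "snd (pc S S') \<in> Arr X" "Dom X (fst (pc S S')) = obj (Pr S S')" "Dom X (snd (pc S S')) = obj (Pr S S')"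
  "Cod X (fst (pc S S')) = obj S" "Cod X (snd (pc S S')) = obj S'"
  using linear_mapD[OF pc_biprod(4)] linear_mapD[OF pc_biprod(5)] by simp_all

lemmas pc_tup = product_tup[OF pc_product, unfolded Dom_pc]
  and pc_comp_tup = product_comp_tup[OF pc_product]
  and pc_eqI = product_eqI[OF pc_product, unfolded Dom_pc]

lemma pc_eta: "\<lbrakk>x \<in> Arr X; Cod X x = obj (Pr S S')\<rbrakk> \<Longrightarrow> tup X (pc S S') (x \<cdot> fst (pc S S')) (x \<cdot> snd (pc S S')) = x"
  "tup X (pc S S') (fst (pc S S')) (snd (pc S S')) = Idn X (obj (Pr S S'))"
  using product_tup_eta[OF pc_product] product_tup_id[OF pc_product] Dom_pc by simp_all

text \<open>The injections come from an existence statement, but their components pin them down as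
  <1, 0> and <0, 1>, the form that RD.3 mentions.\<close>

lemma injs_eq:
  "fst injs = tup X (pc S S') (Idn X (obj S)) (bq (sbun S) \<cdot> bz (sbun S'))"
  "snd injs = tup X (pc S S') (bq (sbun S') \<cdot> bz (sbun S)) (Idn X (obj S'))"
proof -
  note [simp] = self_dual_simps[OF S] self_dual_simps[OF S'] pc_tup linear_mapD[OF pc_biprod(6)] linear_mapD[OF pc_biprod(7)] pc_biprod(10-13)
  show "fst injs = tup X (pc S S') (Idn X (obj S)) (bq (sbun S) \<cdot> bz (sbun S'))"
    by (rule pc_eqI) simp_all
  show "snd injs = tup X (pc S S') (bq (sbun S') \<cdot> bz (sbun S)) (Idn X (obj S'))"
    by (rule pc_eqI) simp_all
qed

lemmas pc_simps = S S' Pr_self_dual pc_arr pc_tup pc_comp_tup pc_eta self_dual_simps[OF S] self_dual_simps[OF S'] self_dual_simps[OF Pr_self_dual]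

lemma DO_product: "is_product DO S S' (pr S S')"
  unfolding is_product_def
proof (intro conjI allI ballI)
  show "fst (pr S S') \<in> Hom DO (apex DO (pr S S')) S" "snd (pr S S') \<in> Hom DO (apex DO (pr S S')) S'"
    by (simp_all add: apex_def pr_mor pc_simps)
  fix Y a b assume "a \<in> Hom DO Y S" and "b \<in> Hom DO Y S'"
  then obtain f g where a: "a = sd_mor Y S f" "f \<in> Arr X" "Dom X f = obj Y" "Cod X f = obj S"
    and b: "b = sd_mor Y S' g" "g \<in> Arr X" "Dom X g = obj Y" "Cod X g = obj S'" by (metis Hom_DO)
  have Y: "self_dual Y" using \<open>a \<in> Hom DO Y S\<close> by auto
  show "\<exists>!h. mediates DO (pr S S') a b h"
  proof (intro ex1I[of _ "sd_mor Y (Pr S S') (tup X (pc S S') f g)"])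
    show "mediates DO (pr S S') a b (sd_mor Y (Pr S S') (tup X (pc S S') f g))"
      using a b Y by (simp add: mediates_def apex_def pr_mor pc_simps)
    fix h assume h: "mediates DO (pr S S') a b h"
    then have "h \<in> Hom DO Y (Pr S S')" using a by (auto simp: mediates_def apex_def pr_mor)
    then obtain k where k: "h = sd_mor Y (Pr S S') k" "k \<in> Arr X" "Dom X k = obj Y" "Cod X k = obj (Pr S S')" by (rule Hom_DO)
    have "k = tup X (pc S S') f g"
      by (rule pc_eqI) (use h k a b in \<open>simp_all add: mediates_def pr_mor pc_simps\<close>)
    then show "h = sd_mor Y (Pr S S') (tup X (pc S S') f g)" by (simp add: k)
  qed
qed

lemma DO_tup:
  assumes "self_dual Y" "f \<in> Arr X" "Dom X f = obj Y" "Cod X f = obj S" "g \<in> Arr X" "Dom X g = obj Y" "Cod X g = obj S'"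
  shows "tup DO (pr S S') (sd_mor Y S f) (sd_mor Y S' g) = sd_mor Y (Pr S S') (tup X (pc S S') f g)"
  unfolding tup_def[of DO]
proof (rule the1_equality)
  show "\<exists>!h. mediates DO (pr S S') (sd_mor Y S f) (sd_mor Y S' g) h"
    using DO_product assms S S' unfolding is_product_def by simp
  show "mediates DO (pr S S') (sd_mor Y S f) (sd_mor Y S' g) (sd_mor Y (Pr S S') (tup X (pc S S') f g))"
    using assms by (simp add: mediates_def apex_def pr_mor pc_simps)
qed

lemma prod_obj_DO: "prod_obj DO pr S S' = Pr S S'"
  and pi0_DO: "pi0 pr S S' = sd_mor (Pr S S') S (fst (pc S S'))"
  and pi1_DO: "pi1 pr S S' = sd_mor (Pr S S') S' (snd (pc S S'))"
  by (simp_all add: prod_obj_def apex_def pr_mor pi0_def pi1_def)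

end

lemma pairing_DO:
  assumes "self_dual Y" "self_dual S" "self_dual S'" "f \<in> Arr X" "Dom X f = obj Y" "Cod X f = obj S" "g \<in> Arr X" "Dom X g = obj Y" "Cod X g = obj S'"
  shows "pairing DO pr (sd_mor Y S f) (sd_mor Y S' g) = sd_mor Y (Pr S S') (tup X (pc S S') f g)"
  using assms by (simp add: pairing_def DO_tup)

lemma cross_DO:
  assumes "self_dual A" "self_dual A'" "self_dual B" "self_dual B'"
    "f \<in> Arr X" "Dom X f = obj A" "Cod X f = obj A'" "g \<in> Arr X" "Dom X g = obj B" "Cod X g = obj B'"
  shows "cross DO pr (sd_mor A A' f) (sd_mor B B' g) = sd_mor (Pr A B) (Pr A' B') (tup X (pc A' B') (fst (pc A B) \<cdot> f) (snd (pc A B) \<cdot> g))"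
  using assms by (simp add: cross_def pi0_DO pi1_DO pairing_DO pc_arr Pr_self_dual)

section \<open>The reverse and forward derivatives of the structure\<close>

abbreviation RR :: "'a sdmor \<Rightarrow> 'a sdmor" where "RR \<equiv> rev_deriv X V pr"
abbreviation rr :: "'a sdobj \<Rightarrow> 'a sdobj \<Rightarrow> 'a \<Rightarrow> 'a" where "rr S S' f \<equiv> rev_el S S' f (fst (pc S S')) (snd (pc S S'))"
abbreviation ze :: "'a sdobj \<Rightarrow> 'a sdobj \<Rightarrow> 'a" where "ze S S' \<equiv> bq (sbun S) \<cdot> bz (sbun S')"

context
  fixes A B f assumes A: "self_dual A" and B: "self_dual B" and f: "f \<in> Arr X" "Dom X f = obj A" "Cod X f = obj B"
begin

lemma RR_mor: "RR (sd_mor A B f) = sd_mor (Pr A B) A (rr A B f)"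
  using rev_deriv_rev_el[OF A B f pc_product[OF A B] pc_product[OF A A] pc_product[OF B B]]
  by (simp add: rev_deriv_def Pr_def)

lemma rr_arr: "rr A B f \<in> Arr X" "Dom X (rr A B f) = obj (Pr A B)" "Cod X (rr A B f) = obj A"
  using rev_el_arr[OF A B f] pc_arr[OF A B] by simp_all

lemma rr_elem:
  assumes "a \<in> Arr X" "y \<in> Arr X" "Dom X a = Dom X y" "Cod X a = obj A" "Cod X y = obj B"
  shows "tup X (pc A B) a y \<cdot> rr A B f = rev_el A B f a y"
  using assms comp_rev_el[OF A B f, of "tup X (pc A B) a y" "snd (pc A B)" "fst (pc A B)"] pc_arr[OF A B]
  by (simp add: pc_tup[OF A B])

end

text \<open>The map <1, 0> x 1 supplies exactly the point (a, 0) and the direction of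
  \<open>rev_el_rev_el\<close>. The derivative built from R thus agrees with the one from the
  tangent functor, and RD.6 and RD.7 become statements about \<open>Der\<close>.\<close>

lemma fwd_DO:
  assumes A: "self_dual A" and B: "self_dual B" and f: "f \<in> Arr X" "Dom X f = obj A" "Cod X f = obj B"
  shows "fwd_deriv DO pr (sd_zero X) RR (sd_mor A B f) = sd_mor (Pr A A) B (Der (pc A A) (sbun A) (sbun B) f)"
proof -
  let ?P = "Pr A B" and ?z = "tup X (pc A B) (Idn X (obj A)) (ze A B)"
  note P = Pr_self_dual[OF A B] and AA = pc_simps[OF A A] and AB = pc_simps[OF A B]
  note r = rr_arr[OF A B f]
  note [simp] = AA AB f r pc_simps[OF P A]
  let ?r = "rr A B f"
  have "tup X (pc ?P A) (fst (pc A A) \<cdot> ?z) (snd (pc A A)) \<cdot> rr ?P A ?r \<cdot> snd (pc A B)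
     = rev_el ?P A ?r (tup X (pc A B) (fst (pc A A)) (fst (pc A A) \<cdot> bq (sbun A) \<cdot> bz (sbun B))) (snd (pc A A)) \<cdot> snd (pc A B)"
    using rr_elem[OF P A r, of "fst (pc A A) \<cdot> ?z" "snd (pc A A)"] by simp
  also have "\<dots> = Der (pc A A) (sbun A) (sbun B) f"
    unfolding Der_def by (rule rev_el_rev_el[OF injs_sd_prod[OF A B] f refl]) simp_all
  finally have e: "tup X (pc ?P A) (fst (pc A A) \<cdot> ?z) (snd (pc A A)) \<cdot> rr ?P A ?r \<cdot> snd (pc A B) = Der (pc A A) (sbun A) (sbun B) f" .
  have "fwd_deriv DO pr (sd_zero X) RR (sd_mor A B f) =
     sd_mor (Pr A A) B (tup X (pc ?P A) (fst (pc A A) \<cdot> ?z) (snd (pc A A) \<cdot> Idn X (obj A)) \<cdot> rr ?P A ?r \<cdot> snd (pc A B))"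
    using A B P by (simp add: fwd_deriv_def Let_def sd_zero_def pairing_DO cross_DO RR_mor[OF A B f] RR_mor[OF P A r] pi1_DO)
  then show ?thesis using e by simp
qed

lemma left_additive: "cartesian_left_additive_category DO I pr (sd_add X) (sd_zero X)"
  unfolding cartesian_left_additive_category_def
proof (intro conjI ballI)
  show "category DO" by (rule category_DO)
  show "is_terminal DO I" by (rule I_terminal)
  show "is_product DO A B (pr A B)" if "A \<in> Obj DO" "B \<in> Obj DO" for A B
    using that by (simp add: DO_product)
next
  fix A B assume "A \<in> Obj DO" "B \<in> Obj DO"
  then have A: "self_dual A" and B: "self_dual B" by simp_all
  note [simp] = A B self_dual_simps[OF A] self_dual_simps[OF B]
  show "sd_zero X A B \<in> Hom DO A B" by (simp add: sd_zero_def)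
  fix m assume "m \<in> Hom DO A B"
  then obtain f where m: "m = sd_mor A B f" and f [simp]: "f \<in> Arr X" "Dom X f = obj A" "Cod X f = obj B" by (rule Hom_DO)
  show "sd_add X (sd_zero X A B) m = m" by (simp add: m sd_zero_def sd_add_mor ad_zero)
  fix n assume "n \<in> Hom DO A B"
  then obtain g where n: "n = sd_mor A B g" and g [simp]: "g \<in> Arr X" "Dom X g = obj A" "Cod X g = obj B" by (rule Hom_DO)
  show "sd_add X m n \<in> Hom DO A B" by (simp add: m n sd_add_mor)
  show "sd_add X m n = sd_add X n m" using ad_comm[of "sbun B" f g] by (simp add: m n sd_add_mor)
  fix l assume "l \<in> Hom DO A B"
  then obtain h where l: "l = sd_mor A B h" and h [simp]: "h \<in> Arr X" "Dom X h = obj A" "Cod X h = obj B" by (rule Hom_DO)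
  show "sd_add X (sd_add X m n) l = sd_add X m (sd_add X n l)" by (simp add: m n l sd_add_mor ad_assoc)
next
  fix Y A B m assume "Y \<in> Obj DO" "A \<in> Obj DO" "B \<in> Obj DO" "m \<in> Hom DO Y A"
  then have Y: "self_dual Y" and A: "self_dual A" and B: "self_dual B" by simp_all
  obtain f where m: "m = sd_mor Y A f" and f [simp]: "f \<in> Arr X" "Dom X f = obj Y" "Cod X f = obj A"
    using \<open>m \<in> Hom DO Y A\<close> by (rule Hom_DO)
  note [simp] = Y A B self_dual_simps[OF Y] self_dual_simps[OF A] self_dual_simps[OF B]
  have "f \<cdot> bq (sbun A) = bq (sbun Y)" by (rule one_eq) simp_all
  then show "m \<cdot>\<^bsub>DO\<^esub> sd_zero X A B = sd_zero X Y B" by (simp add: m sd_zero_def)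
  fix n l assume "n \<in> Hom DO A B" "l \<in> Hom DO A B"
  obtain g where n: "n = sd_mor A B g" and g [simp]: "g \<in> Arr X" "Dom X g = obj A" "Cod X g = obj B"
    using \<open>n \<in> Hom DO A B\<close> by (rule Hom_DO)
  obtain h where l: "l = sd_mor A B h" and h [simp]: "h \<in> Arr X" "Dom X h = obj A" "Cod X h = obj B"
    using \<open>l \<in> Hom DO A B\<close> by (rule Hom_DO)
  show "m \<cdot>\<^bsub>DO\<^esub> sd_add X n l = sd_add X (m \<cdot>\<^bsub>DO\<^esub> n) (m \<cdot>\<^bsub>DO\<^esub> l)"
    by (simp add: m n l sd_add_mor)
next
  fix Y A B assume "Y \<in> Obj DO" "A \<in> Obj DO" "B \<in> Obj DO"
  then have Y: "self_dual Y" and A: "self_dual A" and B: "self_dual B" by simp_all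
  note [simp] = self_dual_simps[OF Y] pc_simps[OF A B]
  \<comment> \<open>The projections are linear maps, and linear maps preserve sums and
    zeros.\<close>
  note l = pc_biprod(4,5)[OF A B]
  have 1: "(sd_add X m n) \<cdot>\<^bsub>DO\<^esub> sd_mor (Pr A B) A (fst (pc A B)) = sd_add X (m \<cdot>\<^bsub>DO\<^esub> sd_mor (Pr A B) A (fst (pc A B))) (n \<cdot>\<^bsub>DO\<^esub> sd_mor (Pr A B) A (fst (pc A B)))
     \<and> (sd_add X m n) \<cdot>\<^bsub>DO\<^esub> sd_mor (Pr A B) B (snd (pc A B)) = sd_add X (m \<cdot>\<^bsub>DO\<^esub> sd_mor (Pr A B) B (snd (pc A B))) (n \<cdot>\<^bsub>DO\<^esub> sd_mor (Pr A B) B (snd (pc A B)))"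
    if mn: "m \<in> Hom DO Y (Pr A B)" "n \<in> Hom DO Y (Pr A B)" for m n
  proof -
    obtain f where m: "m = sd_mor Y (Pr A B) f" and f [simp]: "f \<in> Arr X" "Dom X f = obj Y" "Cod X f = obj (Pr A B)"
      using mn(1) by (rule Hom_DO)
    obtain g where n: "n = sd_mor Y (Pr A B) g" and g [simp]: "g \<in> Arr X" "Dom X g = obj Y" "Cod X g = obj (Pr A B)"
      using mn(2) by (rule Hom_DO)
    show ?thesis by (simp add: m n sd_add_mor linear_map_ad[OF _ _ l(1)] linear_map_ad[OF _ _ l(2)])
  qed
  have 2: "bq (sbun Y) \<cdot> bz (sbun (Pr A B)) \<cdot> fst (pc A B) = bq (sbun Y) \<cdot> bz (sbun A)"
    "bq (sbun Y) \<cdot> bz (sbun (Pr A B)) \<cdot> snd (pc A B) = bq (sbun Y) \<cdot> bz (sbun B)"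
    by (rule linear_map_bz[OF _ _ l(1)] linear_map_bz[OF _ _ l(2)]; simp)+
  show "let c = pr A B; P = apex DO c in
        sd_zero X Y P \<cdot>\<^bsub>DO\<^esub> fst c = sd_zero X Y A \<and> sd_zero X Y P \<cdot>\<^bsub>DO\<^esub> snd c = sd_zero X Y B \<and>
        (\<forall>f \<in> Hom DO Y P. \<forall>g \<in> Hom DO Y P.
           (sd_add X f g) \<cdot>\<^bsub>DO\<^esub> fst c = sd_add X (f \<cdot>\<^bsub>DO\<^esub> fst c) (g \<cdot>\<^bsub>DO\<^esub> fst c) \<and> (sd_add X f g) \<cdot>\<^bsub>DO\<^esub> snd c = sd_add X (f \<cdot>\<^bsub>DO\<^esub> snd c) (g \<cdot>\<^bsub>DO\<^esub> snd c))"
  proof -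
    have "apex DO (pr A B) = Pr A B" "fst (pr A B) = sd_mor (Pr A B) A (fst (pc A B))" "snd (pr A B) = sd_mor (Pr A B) B (snd (pc A B))"
      using pr_mor[OF A B] by (simp_all add: apex_def)
    then show ?thesis unfolding Let_def using 1 2 by (simp add: sd_zero_def del: in_Hom)
  qed
qed

lemma RR_zero:
  assumes A: "self_dual A" and B: "self_dual B"
  shows "RR (sd_zero X A B) = sd_zero X (Pr A B) A"
proof -
  note [simp] = pc_simps[OF A B]
  have "snd (pc A B) \<cdot> bq (sbun B) = bq (sbun (Pr A B))" by (rule one_eq) simp_all
  then show ?thesis
    by (simp add: sd_zero_def RR_mor rev_el_zero[OF injs_sd_prod[OF A B]])
qed

lemma rev_el_Idn:
  assumes A: "self_dual A" and "a \<in> Arr X" "y \<in> Arr X" "Dom X a = Dom X y" "Cod X a = obj A" "Cod X y = obj A"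
  shows "rev_el A A (Idn X (obj A)) a y = y"
proof -
  note [simp] = self_dual_simps[OF A] assms(2-)
  have "linear_map (sbun A) (sbun A) (Idn X (obj A))" by (simp add: linear_map_def)
  from rev_el_linear_map[OF A A this, of a y] show ?thesis
    by (simp add: fib_dual_Idn[OF sys_obj_mem[OF self_dual_sys_obj[OF A]]] du_ud[OF A])
qed

lemma reverse_differential: "cartesian_reverse_differential_category DO I pr (sd_add X) (sd_zero X) RR"
  unfolding cartesian_reverse_differential_category_def
proof (intro conjI ballI)
  show "cartesian_left_additive_category DO I pr (sd_add X) (sd_zero X)" by (rule left_additive)
next
  fix A B m assume "A \<in> Obj DO" "B \<in> Obj DO" and m: "m \<in> Hom DO A B"
  then have A: "self_dual A" and B: "self_dual B" by simp_all
  obtain f where f: "m = sd_mor A B f" "f \<in> Arr X" "Dom X f = obj A" "Cod X f = obj B" using m by (rule Hom_DO)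
  show "RR m \<in> Hom DO (prod_obj DO pr A B) A"
    using rr_arr[OF A B f(2-)] by (simp add: f(1) RR_mor[OF A B f(2-)] prod_obj_DO A B Pr_self_dual)
next
  \<comment> \<open>RD.1: the zero map is handled through the product of A and B, sums through that
    of B with itself.\<close>
  fix A B assume "A \<in> Obj DO" "B \<in> Obj DO"
  then have A: "self_dual A" and B: "self_dual B" by simp_all
  show "RR (sd_zero X A B) = sd_zero X (prod_obj DO pr A B) A" by (simp add: RR_zero prod_obj_DO A B)
  fix m n assume m: "m \<in> Hom DO A B" and n: "n \<in> Hom DO A B"
  obtain f where f: "m = sd_mor A B f" "f \<in> Arr X" "Dom X f = obj A" "Cod X f = obj B" using m by (rule Hom_DO)
  obtain g where g: "n = sd_mor A B g" "g \<in> Arr X" "Dom X g = obj A" "Cod X g = obj B" using n by (rule Hom_DO)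
  note [simp] = f g pc_simps[OF A B]
  show "RR (sd_add X m n) = sd_add X (RR m) (RR n)"
    by (simp add: sd_add_mor RR_mor rev_el_add[OF injs_sd_prod[OF B B]])
next
  \<comment> \<open>RD.2: the transpose is linear in its second argument, hence additive and
    zero-preserving there.\<close>
  fix Y A B m k assume "Y \<in> Obj DO" "A \<in> Obj DO" "B \<in> Obj DO" and m: "m \<in> Hom DO A B" and k: "k \<in> Hom DO Y A"
  then have Y: "self_dual Y" and A: "self_dual A" and B: "self_dual B" by simp_all
  obtain f where f: "m = sd_mor A B f" "f \<in> Arr X" "Dom X f = obj A" "Cod X f = obj B" using m by (rule Hom_DO)
  obtain a where a: "k = sd_mor Y A a" "a \<in> Arr X" "Dom X a = obj Y" "Cod X a = obj A" using k by (rule Hom_DO)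
  note [simp] = f a pc_simps[OF A B] Y self_dual_simps[OF Y] rr_arr[OF A B f(2-)]
  note re = rr_elem[OF A B f(2-)] and ra = rev_el_arr[OF A B f(2-)]
  show "pairing DO pr k (sd_zero X Y B) \<cdot>\<^bsub>DO\<^esub> RR m = sd_zero X Y A"
    by (simp add: sd_zero_def pairing_DO RR_mor re rev_el_bz)
  fix b d assume b: "b \<in> Hom DO Y B" and d: "d \<in> Hom DO Y B"
  obtain y where y: "b = sd_mor Y B y" "y \<in> Arr X" "Dom X y = obj Y" "Cod X y = obj B" using b by (rule Hom_DO)
  obtain w where w: "d = sd_mor Y B w" "w \<in> Arr X" "Dom X w = obj Y" "Cod X w = obj B" using d by (rule Hom_DO)
  note [simp] = y w
  show "pairing DO pr k (sd_add X b d) \<cdot>\<^bsub>DO\<^esub> RR m = sd_add X (pairing DO pr k b \<cdot>\<^bsub>DO\<^esub> RR m) (pairing DO pr k d \<cdot>\<^bsub>DO\<^esub> RR m)"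
    by (simp add: sd_add_mor pairing_DO RR_mor re rev_el_ad)
next
  fix A assume "A \<in> Obj DO"
  then have A: "self_dual A" by simp
  note [simp] = pc_simps[OF A A]
  show "RR (Idn DO A) = pi1 pr A A" by (simp add: RR_mor rev_el_Idn pi1_DO)
next
  \<comment> \<open>RD.3 for projections: the reverse derivatives are the injections, which
    \<open>injs_eq\<close> writes as the pairs in the axiom.\<close>
  fix A B assume "A \<in> Obj DO" "B \<in> Obj DO"
  then have A: "self_dual A" and B: "self_dual B" by simp_all
  note P = Pr_self_dual[OF A B]
  note [simp] = pc_simps[OF A B] pc_simps[OF P A] pc_simps[OF P B]
  note i = rev_el_proj[OF injs_sd_prod[OF A B], unfolded injs_eq[OF A B]]
  show "RR (pi0 pr A B) = pi1 pr (prod_obj DO pr A B) A \<cdot>\<^bsub>DO\<^esub> pairing DO pr (Idn DO A) (sd_zero X A B)"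
    by (simp add: pi0_DO pi1_DO prod_obj_DO RR_mor pairing_DO sd_zero_def i)
  show "RR (pi1 pr A B) = pi1 pr (prod_obj DO pr A B) B \<cdot>\<^bsub>DO\<^esub> pairing DO pr (sd_zero X B A) (Idn DO B)"
    by (simp add: pi0_DO pi1_DO prod_obj_DO RR_mor pairing_DO sd_zero_def i)
next
  \<comment> \<open>RD.4 for pairings is \<open>rev_el_pair\<close> at the chosen product of B and
    D.\<close>
  fix A B D m n assume "A \<in> Obj DO" "B \<in> Obj DO" "D \<in> Obj DO" and m: "m \<in> Hom DO A B" and n: "n \<in> Hom DO A D"
  then have A: "self_dual A" and B: "self_dual B" and D: "self_dual D" by simp_all
  obtain f where f: "m = sd_mor A B f" "f \<in> Arr X" "Dom X f = obj A" "Cod X f = obj B" using m by (rule Hom_DO)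
  obtain g where g: "n = sd_mor A D g" "g \<in> Arr X" "Dom X g = obj A" "Cod X g = obj D" using n by (rule Hom_DO)
  note Q = Pr_self_dual[OF B D]
  note [simp] = f g pc_simps[OF A B] pc_simps[OF A D] pc_simps[OF B D] pc_simps[OF A Q] rr_arr[OF A B f(2-)] rr_arr[OF A D g(2-)]
  show "RR (pairing DO pr m n) = sd_add X (cross DO pr (Idn DO A) (pi0 pr B D) \<cdot>\<^bsub>DO\<^esub> RR m) (cross DO pr (Idn DO A) (pi1 pr B D) \<cdot>\<^bsub>DO\<^esub> RR n)"
    by (simp add: pairing_DO RR_mor cross_DO pi0_DO pi1_DO sd_add_mor rr_elem[OF A B f(2-)] rr_elem[OF A D g(2-)] rev_el_pair[OF injs_sd_prod[OF B D] A])
next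
  \<comment> \<open>RD.4 for the terminal object: uniqueness turns t into a zero map.\<close>
  fix A t assume "A \<in> Obj DO" and t: "t \<in> Hom DO A I"
  then have A: "self_dual A" by simp
  have z: "sd_zero X A I \<in> Hom DO A I" using self_dual_simps[OF A] self_dual_simps[OF I_self_dual] A I_self_dual by (simp add: sd_zero_def)
  have "\<exists>!f. f \<in> Hom DO A I" using I_terminal \<open>A \<in> Obj DO\<close> unfolding is_terminal_def by blast
  then have "t = sd_zero X A I" using t z by (rule Ex1_eq)
  then show "RR t = sd_zero X (prod_obj DO pr A I) A" by (simp add: RR_zero prod_obj_DO A I_self_dual)
next
  \<comment> \<open>RD.5: contravariance of transposition, applied to the chain rule.\<close>
  fix A B D m n assume "A \<in> Obj DO" "B \<in> Obj DO" "D \<in> Obj DO" and m: "m \<in> Hom DO A B" and n: "n \<in> Hom DO B D"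
  then have A: "self_dual A" and B: "self_dual B" and D: "self_dual D" by simp_all
  obtain f where f: "m = sd_mor A B f" "f \<in> Arr X" "Dom X f = obj A" "Cod X f = obj B" using m by (rule Hom_DO)
  obtain g where g: "n = sd_mor B D g" "g \<in> Arr X" "Dom X g = obj B" "Cod X g = obj D" using n by (rule Hom_DO)
  note [simp] = f g pc_simps[OF A B] pc_simps[OF A D] pc_simps[OF B D] rr_arr[OF A B f(2-)] rr_arr[OF B D g(2-)]
    rev_el_arr[OF B D g(2-)]
  show "RR (m \<cdot>\<^bsub>DO\<^esub> n) = pairing DO pr (pi0 pr A D) (cross DO pr m (Idn DO D) \<cdot>\<^bsub>DO\<^esub> RR n) \<cdot>\<^bsub>DO\<^esub> RR m"
    by (simp add: pairing_DO RR_mor cross_DO pi0_DO rr_elem[OF A B f(2-)] rr_elem[OF B D g(2-)] rev_el_comp)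
next
  \<comment> \<open>RD.6: R[f] is linear in its second argument, so its derivative in a direction
    (0, y) is R[f] at y with the same base point.\<close>
  fix A B m assume "A \<in> Obj DO" "B \<in> Obj DO" and m: "m \<in> Hom DO A B"
  then have A: "self_dual A" and B: "self_dual B" by simp_all
  obtain f where f: "m = sd_mor A B f" "f \<in> Arr X" "Dom X f = obj A" "Cod X f = obj B" using m by (rule Hom_DO)
  note P = Pr_self_dual[OF A B] and Q = Pr_self_dual[OF B B]
  note r = rr_arr[OF A B f(2-)]
  note [simp] = f pc_simps[OF A B] pc_simps[OF B B] pc_simps[OF A Q] pc_simps[OF P P] r
    Der_arr[OF self_dual_simps(1)[OF P] self_dual_simps(1)[OF A] r pc_product[OF P P], unfolded Dom_pc[OF P P]]
  note b = pc_biprod[OF A B]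
  have l: "lin (pc A B) (sbun B) (sbun A) (rr A B f)" by (rule rev_el_lin[OF A B f(2-) b(8)])
  let ?x = "tup X (pc A B) (fst (pc A (Pr B B))) (snd (pc A (Pr B B)) \<cdot> fst (pc B B))"
  let ?y = "tup X (pc A B) (fst (pc A (Pr B B)) \<cdot> bq (sbun A) \<cdot> bz (sbun A)) (snd (pc A (Pr B B)) \<cdot> snd (pc B B))"
  have "tup X (pc (Pr A B) (Pr A B)) ?x ?y \<cdot> Der (pc (Pr A B) (Pr A B)) (sbun (Pr A B)) (sbun A) (rr A B f)
     = nu_el (sbun (Pr A B)) ?x ?y \<cdot> Tm X (rr A B f) \<cdot> vpart (sbun A)"
    by (rule Der_elem[OF _ _ r pc_product[OF P P]]) simp_all
  also have "\<dots> = tup X (pc A B) (fst (pc A (Pr B B))) (snd (pc A (Pr B B)) \<cdot> snd (pc B B)) \<cdot> rr A B f"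
    by (rule lin_nu_el_vpart[OF _ _ _ _ b(8,9,4,5) l]) simp_all
  finally show "pairing DO pr (cross DO pr (Idn DO A) (pi0 pr B B)) (cross DO pr (sd_zero X A A) (pi1 pr B B)) \<cdot>\<^bsub>DO\<^esub>
      fwd_deriv DO pr (sd_zero X) RR (RR m) = cross DO pr (Idn DO A) (pi1 pr B B) \<cdot>\<^bsub>DO\<^esub> RR m"
    by (simp add: RR_mor fwd_DO cross_DO pairing_DO pi0_DO pi1_DO sd_zero_def)
next
  \<comment> \<open>RD.7: the exchange map permutes the four coordinates exactly as in
    \<open>Der_Der_swap\<close>.\<close>
  fix A B m assume "A \<in> Obj DO" "B \<in> Obj DO" and m: "m \<in> Hom DO A B"
  then have A: "self_dual A" and B: "self_dual B" by simp_all
  obtain f where f: "m = sd_mor A B f" "f \<in> Arr X" "Dom X f = obj A" "Cod X f = obj B" using m by (rule Hom_DO)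
  note P = Pr_self_dual[OF A A]
  note d = self_dual_simps(1)[OF A] self_dual_simps(1)[OF B] self_dual_simps(1)[OF P]
  note b = pc_biprod[OF A A]
  note D = Der_arr[OF d(1,2) f(2-) pc_product[OF A A], unfolded Dom_pc[OF A A]]
  let ?P = "Pr A A" and ?p = "pc A A" and ?q = "pc (Pr A A) (Pr A A)" and ?D = "Der (pc A A) (sbun A) (sbun B) f"
  note [simp] = f pc_simps[OF A A] pc_simps[OF P P] self_dual_simps[OF B] B D
    Der_arr[OF d(3,2) D pc_product[OF P P], unfolded Dom_pc[OF P P]]
  let ?x = "tup X ?p (fst ?q \<cdot> fst ?p) (snd ?q \<cdot> fst ?p)" and ?y = "tup X ?p (fst ?q \<cdot> snd ?p) (snd ?q \<cdot> snd ?p)"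
  have "tup X ?q ?x ?y \<cdot> Der ?q (sbun ?P) (sbun B) ?D = nu_el (sbun ?P) ?x ?y \<cdot> Tm X ?D \<cdot> vpart (sbun B)"
    by (rule Der_elem[OF d(3,2) D pc_product[OF P P]]) simp_all
  also have "\<dots> = nu_el (sbun ?P) (tup X ?p (fst ?q \<cdot> fst ?p) (fst ?q \<cdot> snd ?p)) (tup X ?p (snd ?q \<cdot> fst ?p) (snd ?q \<cdot> snd ?p)) \<cdot> Tm X ?D \<cdot> vpart (sbun B)"
    by (rule Der_Der_swap[OF d(1,2) f(2-) d(3) b(8,9,4,5)]) simp_all
  also have "\<dots> = Der ?q (sbun ?P) (sbun B) ?D" by (simp add: Der_def[of ?q])
  finally show "pairing DO pr (cross DO pr (pi0 pr A A) (pi0 pr A A)) (cross DO pr (pi1 pr A A) (pi1 pr A A)) \<cdot>\<^bsub>DO\<^esub>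
      fwd_deriv DO pr (sd_zero X) RR (fwd_deriv DO pr (sd_zero X) RR m) = fwd_deriv DO pr (sd_zero X) RR (fwd_deriv DO pr (sd_zero X) RR m)"
    by (simp add: fwd_DO cross_DO pairing_DO pi0_DO pi1_DO)
qed

end

theorem proposition42:
  fixes X :: "('o, 'a) tangent_cat"
    and \<D> :: "'a bdl set"
    and V :: "'a involution"
  assumes "cartesian_reverse_tangent_category X \<D> V"
  shows "(\<exists>I pr. sd_product_structure X \<D> V I pr) \<and>
    (\<forall>I pr. sd_product_structure X \<D> V I pr \<longrightarrow>
       cartesian_reverse_differential_category (DOsd X \<D> V) I pr (sd_add X) (sd_zero X)
         (rev_deriv X V pr))"
proof -
  have c: "cartesian_tangent_category X"
    using assms by (simp add: cartesian_reverse_tangent_category_def)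
  then have "category X" by (simp add: cartesian_tangent_category_def tangent_category_def)
  with c assms interpret rev_ctx X \<D> V by unfold_locales
  show ?thesis
  proof (intro conjI allI impI)
    show "\<exists>I pr. sd_product_structure X \<D> V I pr" by (rule product_structure_exists)
    fix I pr assume "sd_product_structure X \<D> V I pr"
    then interpret sd_ctx X \<D> V I pr by unfold_locales
    show "cartesian_reverse_differential_category (DOsd X \<D> V) I pr (sd_add X) (sd_zero X) (rev_deriv X V pr)"
      by (rule reverse_differential)
  qed
qed

end
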